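(* Let $A$ be a QF ring and $\mathcal{C}$ a non-zero $A$-coring such that ${}_A\mathcal{C}$ and $\mathcal{C}_A$ are projective, $\mathcal{C}^{\ast}$ is right Artinian and ${}^{\ast}\mathcal{C}$ is left Artinian. Then the following statements (where in each of (1)–(7) both the right-hand version and the left-hand version in parentheses are meant, all of them being equivalent) are equivalent: (1) $\mathcal{C}^{\ast}$ (or ${}^{\ast}\mathcal{C}$) is prime; (2) $\mathcal{C}_{\mathcal{C}^{\ast}}$ (or ${}_{{}^{\ast}\mathcal{C}}\mathcal{C}$) is diprime; (3) $\mathcal{C}_{\mathcal{C}^{\ast}}$ (or ${}_{{}^{\ast}\mathcal{C}}\mathcal{C}$) is prime; (4) $\mathcal{C}^{\ast}$ (or ${}^{\ast}\mathcal{C}$) is simple Artinian; (5) $\mathcal{C}_{\mathcal{C}^{\ast}}$ (or ${}_{{}^{\ast}\mathcal{C}}\mathcal{C}$) is strongly prime; (6) $\mathcal{C}^{r}$ (or $\mathcal{C}^{l}$) is fully coprime; (7) $\mathcal{C}$ has no non-trivial fully invariant right (left) $\mathcal{C}$-coideals; (8) $\mathcal{C}$ is simple (as a $({}^{\ast}\mathcal{C},\mathcal{C}^{\ast})$-bimodule).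
   Context: $R$ is a commutative ring with $1\neq 0$ and $A$ is a unital $R$-algebra; QF means quasi-Frobenius. An $A$-coring is a coalgebra $(\mathcal{C},\Delta,\varepsilon)$ in the monoidal category of $(A,A)$-bimodules. $\mathcal{C}^r$ and $\mathcal{C}^l$ denote $\mathcal{C}$ as a right, respectively left, $\mathcal{C}$-comodule via $\Delta$. Right (left) $\mathcal{C}$-coideals are the right (left) subcomodules of $\mathcal{C}$. Dual rings: $\mathcal{C}^{\ast}=\mathrm{Hom}_{-A}(\mathcal{C},A)$ (right $A$-linear maps) with product $(f\ast^r g)(c)=\sum g(f(c_1)c_2)$, and ${}^{\ast}\mathcal{C}=\mathrm{Hom}_{A-}(\mathcal{C},A)$ (left $A$-linear maps) with product $(f\ast^l g)(c)=\sum f(c_1g(c_2))$, both with unit $\varepsilon$. $\mathcal{C}$ is a $({}^{\ast}\mathcal{C},\mathcal{C}^{\ast})$-bimodule via $f\rightharpoonup c=\sum c_1f(c_2)$ and $c\leftharpoonup g=\sum g(c_1)c_2$. For a ring $T$, a non-zero $T$-module $M$ is: prime if $\mathrm{ann}_T(K)=\mathrm{ann}_T(M)$ for every non-zero submodule $K$; diprime if for every submodule $0\neq K\subsetneq M$ one has $\mathrm{ann}_T(K)=\mathrm{ann}_T(M)$ or $\mathrm{ann}_T(M/K)=\mathrm{ann}_T(M)$; strongly prime if $M\in\sigma[K]$ for every non-zero submodule $K\subseteq M$, where $\sigma[K]$ is the class of submodules of $K$-generated modules. A right (left) subcomodule of $\mathcal{C}$ is fully invariant if it is stable under all right (left) $\mathcal{C}$-colinear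 endomorphisms of $\mathcal{C}$; non-trivial means different from $0$ and $\mathcal{C}$. For right (left) subcomodules $X,Y$ of $\mathcal{C}$ the internal coproduct $(X:Y)$ is $\bigcap f^{-1}(Y)$ over all right (left) colinear endomorphisms $f$ of $\mathcal{C}$ with $f(X)=0$. $\mathcal{C}^r$ ($\mathcal{C}^l$) is fully coprime if for all fully invariant right (left) subcomodules $X,Y\subseteq\mathcal{C}$ with $\mathcal{C}=(X:Y)$ one has $X=\mathcal{C}$ or $Y=\mathcal{C}$. *)

theory Defs
  imports
    "HOL-Algebra.Module"
    "HOL-Algebra.Ideal_Product"
    "HOL-Algebra.Generated_Groups"
    "HOL-Algebra.Free_Abelian_Groups"
begin

section \<open>Modules over noncommutative rings\<close>

text \<open>
  The library's locale for modules requires a commutative ring of scalars, so modules over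
  arbitrary unital rings are introduced here; records, submodules, ideals and additive cosets
  are those of the library.  A right module over \<open>T\<close> is a left module over \<open>opposite T\<close>, with
  \<open>t \<odot> x\<close> standing for the product \<open>x t\<close>.

  The record type of modules extends the one of rings.  Its fields for multiplication and unit
  have no meaning for a module and are left undefined.
\<close>

definition opposite :: "('t, 'x) ring_scheme \<Rightarrow> ('t, 'x) ring_scheme"
  where "opposite T = T\<lparr>mult := \<lambda>x y. y \<otimes>\<^bsub>T\<^esub> x\<rparr>"

locale left_module = T?: ring T + M?: abelian_group M
  for T (structure) and M :: "('t, 'm, 'y) module_scheme" (structure) +
  assumes lsmult_closed:
      "\<lbrakk>a \<in> carrier T; x \<in> carrier M\<rbrakk> \<Longrightarrow> a \<odot>\<^bsub>M\<^esub> x \<in> carrier M"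
    and lsmult_l_distr:
      "\<lbrakk>a \<in> carrier T; b \<in> carrier T; x \<in> carrier M\<rbrakk>
        \<Longrightarrow> (a \<oplus>\<^bsub>T\<^esub> b) \<odot>\<^bsub>M\<^esub> x = a \<odot>\<^bsub>M\<^esub> x \<oplus>\<^bsub>M\<^esub> b \<odot>\<^bsub>M\<^esub> x"
    and lsmult_r_distr:
      "\<lbrakk>a \<in> carrier T; x \<in> carrier M; y \<in> carrier M\<rbrakk>
        \<Longrightarrow> a \<odot>\<^bsub>M\<^esub> (x \<oplus>\<^bsub>M\<^esub> y) = a \<odot>\<^bsub>M\<^esub> x \<oplus>\<^bsub>M\<^esub> a \<odot>\<^bsub>M\<^esub> y"
    and lsmult_assoc:
      "\<lbrakk>a \<in> carrier T; b \<in> carrier T; x \<in> carrier M\<rbrakk>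
        \<Longrightarrow> (a \<otimes>\<^bsub>T\<^esub> b) \<odot>\<^bsub>M\<^esub> x = a \<odot>\<^bsub>M\<^esub> (b \<odot>\<^bsub>M\<^esub> x)"
    and lsmult_one:
      "x \<in> carrier M \<Longrightarrow> \<one>\<^bsub>T\<^esub> \<odot>\<^bsub>M\<^esub> x = x"

definition mod_hom ::
    "('t, 'x) ring_scheme \<Rightarrow> ('t, 'm, 'y) module_scheme \<Rightarrow> ('t, 'n, 'z) module_scheme
      \<Rightarrow> ('m \<Rightarrow> 'n) set"
  where "mod_hom T M N =
    {f \<in> hom (add_monoid M) (add_monoid N).
       \<forall>t\<in>carrier T. \<forall>x\<in>carrier M. f (t \<odot>\<^bsub>M\<^esub> x) = t \<odot>\<^bsub>N\<^esub> f x}"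

definition quotient_module :: "('t, 'm, 'y) module_scheme \<Rightarrow> 'm set \<Rightarrow> ('t, 'm set) module"
  where "quotient_module M K =
    \<lparr>carrier = a_rcosets\<^bsub>M\<^esub> K, mult = undefined, one = undefined,
     ring.zero = K, add = set_add M,
     smult = \<lambda>t X. K <+>\<^bsub>M\<^esub> (\<lambda>x. t \<odot>\<^bsub>M\<^esub> x) ` X\<rparr>"

definition direct_sum :: "('t, 'm, 'y) module_scheme \<Rightarrow> 'i set \<Rightarrow> ('t, 'i \<Rightarrow> 'm) module"
  where "direct_sum M I =
    \<lparr>carrier = {f \<in> I \<rightarrow>\<^sub>E carrier M. finite {i \<in> I. f i \<noteq> \<zero>\<^bsub>M\<^esub>}},
     mult = undefined, one = undefined,
     ring.zero = \<lambda>i\<in>I. \<zero>\<^bsub>M\<^esub>,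
     add = \<lambda>f g. \<lambda>i\<in>I. f i \<oplus>\<^bsub>M\<^esub> g i,
     smult = \<lambda>t f. \<lambda>i\<in>I. t \<odot>\<^bsub>M\<^esub> f i\<rparr>"

definition annihilator :: "('t, 'x) ring_scheme \<Rightarrow> ('t, 'm, 'y) module_scheme \<Rightarrow> 't set"
  where "annihilator T M = {t \<in> carrier T. \<forall>x\<in>carrier M. t \<odot>\<^bsub>M\<^esub> x = \<zero>\<^bsub>M\<^esub>}"

definition artinian_module :: "('t, 'x) ring_scheme \<Rightarrow> ('t, 'm, 'y) module_scheme \<Rightarrow> bool"
  where "artinian_module T M \<longleftrightarrow>
    (\<forall>N :: nat \<Rightarrow> 'm set.
       (\<forall>i. submodule (N i) T M \<and> N (Suc i) \<subseteq> N i) \<longrightarrow> (\<exists>n. \<forall>i\<ge>n. N i = N n))"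

text \<open>
  HOL does not allow quantification over modules of all types.  The test modules of
  \<open>injective_module\<close> have their elements in the type of the ring: Baer's criterion needs only
  the regular module and its submodules.  Those of \<open>projective_module\<close> include the free module
  with basis \<open>P\<close> and \<open>P\<close> itself, which is enough to make \<open>P\<close> a direct summand of a free module.
\<close>

definition injective_module :: "('t, 'x) ring_scheme \<Rightarrow> ('t, 'm, 'y) module_scheme \<Rightarrow> bool"
  where "injective_module T Q \<longleftrightarrow>
    left_module T Q \<and>
    (\<forall>(N :: ('t, 't) module) L. left_module T N \<longrightarrow> submodule L T N \<longrightarrow>
       (\<forall>f\<in>mod_hom T (N\<lparr>carrier := L\<rparr>) Q. \<exists>g\<in>mod_hom T N Q. \<forall>x\<in>L. g x = f x))"

definition projective_module :: "('t, 'x) ring_scheme \<Rightarrow> ('t, 'm, 'y) module_scheme \<Rightarrow> bool"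
  where "projective_module T P \<longleftrightarrow>
    left_module T P \<and>
    (\<forall>(N :: ('t, 'm \<Rightarrow> 't) module) (L :: ('t, 'm) module).
       left_module T N \<longrightarrow> left_module T L \<longrightarrow>
       (\<forall>g\<in>mod_hom T N L. g ` carrier N = carrier L \<longrightarrow>
          (\<forall>f\<in>mod_hom T P L. \<exists>h\<in>mod_hom T P N. \<forall>x\<in>carrier P. g (h x) = f x)))"

text \<open>
  \<open>generates T K N\<close>: the module \<open>N\<close> is an epimorphic image of a direct sum of copies of \<open>K\<close>.
  An index set contained in \<open>N \<times> \<nat>\<close> always suffices, because each element of \<open>N\<close> lies in the
  sum of finitely many images of \<open>K\<close>.

  \<open>subgenerates T K M\<close>: \<open>M \<in> \<sigma>[K]\<close>, that is, \<open>M\<close> embeds in a \<open>K\<close>-generated module \<open>N\<close>.  For the same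
  reason \<open>N\<close> may be taken as a quotient of a direct sum of copies of \<open>K\<close> indexed by \<open>M \<times> \<nat>\<close>, and
  the type of \<open>N\<close> is chosen to contain these quotients.
\<close>

definition generates ::
    "('t, 'x) ring_scheme \<Rightarrow> ('t, 'k, 'y) module_scheme \<Rightarrow> ('t, 'n, 'z) module_scheme \<Rightarrow> bool"
  where "generates T K N \<longleftrightarrow>
    (\<exists>I :: ('n \<times> nat) set. \<exists>h\<in>mod_hom T (direct_sum K I) N.
       h ` carrier (direct_sum K I) = carrier N)"

definition subgenerates ::
    "('t, 'x) ring_scheme \<Rightarrow> ('t, 'k, 'y) module_scheme \<Rightarrow> ('t, 'm, 'z) module_scheme \<Rightarrow> bool"
  where "subgenerates T K M \<longleftrightarrow>
    (\<exists>N :: ('t, ('m \<times> nat \<Rightarrow> 'k) set) module.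
       left_module T N \<and> generates T K N \<and> (\<exists>i\<in>mod_hom T M N. inj_on i (carrier M)))"

definition prime_module :: "('t, 'x) ring_scheme \<Rightarrow> ('t, 'm, 'y) module_scheme \<Rightarrow> bool"
  where "prime_module T M \<longleftrightarrow>
    carrier M \<noteq> {\<zero>\<^bsub>M\<^esub>} \<and>
    (\<forall>K. submodule K T M \<longrightarrow> K \<noteq> {\<zero>\<^bsub>M\<^esub>} \<longrightarrow>
       annihilator T (M\<lparr>carrier := K\<rparr>) = annihilator T M)"

definition diprime_module :: "('t, 'x) ring_scheme \<Rightarrow> ('t, 'm, 'y) module_scheme \<Rightarrow> bool"
  where "diprime_module T M \<longleftrightarrow>
    carrier M \<noteq> {\<zero>\<^bsub>M\<^esub>} \<and>
    (\<forall>K. submodule K T M \<longrightarrow> K \<noteq> {\<zero>\<^bsub>M\<^esub>} \<longrightarrow> K \<noteq> carrier M \<longrightarrow>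
       annihilator T (M\<lparr>carrier := K\<rparr>) = annihilator T M \<or>
       annihilator T (quotient_module M K) = annihilator T M)"

definition strongly_prime_module :: "('t, 'x) ring_scheme \<Rightarrow> ('t, 'm, 'y) module_scheme \<Rightarrow> bool"
  where "strongly_prime_module T M \<longleftrightarrow>
    carrier M \<noteq> {\<zero>\<^bsub>M\<^esub>} \<and>
    (\<forall>K. submodule K T M \<longrightarrow> K \<noteq> {\<zero>\<^bsub>M\<^esub>} \<longrightarrow> subgenerates T (M\<lparr>carrier := K\<rparr>) M)"


section \<open>Bimodules and rings\<close>

record ('a, 'm) bimodule = "('a, 'm) module" +
  rsmult :: "'m \<Rightarrow> 'a \<Rightarrow> 'm"

definition right_mod :: "('a, 'm, 'y) bimodule_scheme \<Rightarrow> ('a, 'm, 'y) bimodule_scheme"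
  where "right_mod M = M\<lparr>smult := \<lambda>a x. rsmult M x a\<rparr>"

definition bimodule :: "('a, 'x) ring_scheme \<Rightarrow> ('a, 'm, 'y) bimodule_scheme \<Rightarrow> bool"
  where "bimodule A M \<longleftrightarrow>
    left_module A M \<and> left_module (opposite A) (right_mod M) \<and>
    (\<forall>a\<in>carrier A. \<forall>b\<in>carrier A. \<forall>x\<in>carrier M.
       rsmult M (a \<odot>\<^bsub>M\<^esub> x) b = a \<odot>\<^bsub>M\<^esub> rsmult M x b)"

definition bimodule_hom ::
    "('a, 'x) ring_scheme \<Rightarrow> ('a, 'm, 'y) bimodule_scheme \<Rightarrow> ('a, 'n, 'z) bimodule_scheme
      \<Rightarrow> ('m \<Rightarrow> 'n) set"
  where "bimodule_hom A M N =
    mod_hom A M N \<inter> mod_hom (opposite A) (right_mod M) (right_mod N)"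

definition regular :: "('a, 'x) ring_scheme \<Rightarrow> ('a, 'a) bimodule"
  where "regular T =
    \<lparr>carrier = carrier T, mult = undefined, one = undefined,
     ring.zero = \<zero>\<^bsub>T\<^esub>, add = add T, smult = mult T, rsmult = mult T\<rparr>"

definition left_artinian :: "('t, 'x) ring_scheme \<Rightarrow> bool"
  where "left_artinian T \<longleftrightarrow> artinian_module T (regular T)"

definition right_artinian :: "('t, 'x) ring_scheme \<Rightarrow> bool"
  where "right_artinian T \<longleftrightarrow> artinian_module (opposite T) (right_mod (regular T))"

definition quasi_frobenius :: "('t, 'x) ring_scheme \<Rightarrow> bool"
  where "quasi_frobenius T \<longleftrightarrow>
    ring T \<and> left_artinian T \<and> right_artinian T \<and>
    injective_module T (regular T) \<and>
    injective_module (opposite T) (right_mod (regular T))"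

definition prime_ring :: "('t, 'x) ring_scheme \<Rightarrow> bool"
  where "prime_ring T \<longleftrightarrow>
    ring T \<and> carrier T \<noteq> {\<zero>\<^bsub>T\<^esub>} \<and>
    (\<forall>I J. ideal I T \<longrightarrow> ideal J T \<longrightarrow> ideal_prod T I J = {\<zero>\<^bsub>T\<^esub>} \<longrightarrow>
       I = {\<zero>\<^bsub>T\<^esub>} \<or> J = {\<zero>\<^bsub>T\<^esub>})"

definition simple_artinian_ring :: "('t, 'x) ring_scheme \<Rightarrow> bool"
  where "simple_artinian_ring T \<longleftrightarrow>
    ring T \<and> carrier T \<noteq> {\<zero>\<^bsub>T\<^esub>} \<and>
    (\<forall>I. ideal I T \<longrightarrow> I = {\<zero>\<^bsub>T\<^esub>} \<or> I = carrier T) \<and>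
    left_artinian T \<and> right_artinian T"

definition unital_algebra :: "('r, 'x) ring_scheme \<Rightarrow> ('r, 'a, 'y) module_scheme \<Rightarrow> bool"
  where "unital_algebra R A \<longleftrightarrow>
    module R A \<and> ring A \<and>
    (\<forall>r\<in>carrier R. \<forall>x\<in>carrier A. \<forall>y\<in>carrier A.
       (r \<odot>\<^bsub>A\<^esub> x) \<otimes>\<^bsub>A\<^esub> y = r \<odot>\<^bsub>A\<^esub> (x \<otimes>\<^bsub>A\<^esub> y) \<and>
       x \<otimes>\<^bsub>A\<^esub> (r \<odot>\<^bsub>A\<^esub> y) = r \<odot>\<^bsub>A\<^esub> (x \<otimes>\<^bsub>A\<^esub> y))"

text \<open>
  A \<open>(T,S)\<close>-bimodule over two different rings is given by a left \<open>T\<close>-module \<open>L\<close> and a left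
  \<open>opposite S\<close>-module \<open>M\<close> on the same additive group.
\<close>

definition simple_bimodule ::
    "('t, 'x) ring_scheme \<Rightarrow> ('t, 'm, 'y) module_scheme
      \<Rightarrow> ('s, 'z) ring_scheme \<Rightarrow> ('s, 'm, 'w) module_scheme \<Rightarrow> bool"
  where "simple_bimodule T L S M \<longleftrightarrow>
    carrier L \<noteq> {\<zero>\<^bsub>L\<^esub>} \<and>
    (\<forall>K. submodule K T L \<longrightarrow> submodule K (opposite S) M \<longrightarrow> K = {\<zero>\<^bsub>L\<^esub>} \<or> K = carrier L)"


section \<open>Tensor products\<close>

text \<open>
  \<open>M \<otimes>\<^sub>A N\<close> is the free abelian group on the set \<open>M \<times> N\<close> modulo the usual relations; its elements
  are cosets.  The group depends only on the right action on \<open>M\<close> and the left action on \<open>N\<close>.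
  The left action of \<open>A\<close> on \<open>M \<otimes>\<^sub>A N\<close> comes from \<open>M\<close> and the right action from \<open>N\<close>; each of them
  is meaningful only if the corresponding factor is a bimodule.
\<close>

definition tensor_rel ::
    "('a, 'x) ring_scheme \<Rightarrow> ('a, 'm, 'y) bimodule_scheme \<Rightarrow> ('a, 'n, 'z) bimodule_scheme
      \<Rightarrow> ('m \<times> 'n \<Rightarrow>\<^sub>0 int) set"
  where "tensor_rel A M N = generate (free_Abelian_group (carrier M \<times> carrier N))
    ({frag_of (x \<oplus>\<^bsub>M\<^esub> x', y) - frag_of (x, y) - frag_of (x', y) | x x' y.
        x \<in> carrier M \<and> x' \<in> carrier M \<and> y \<in> carrier N} \<union>
     {frag_of (x, y \<oplus>\<^bsub>N\<^esub> y') - frag_of (x, y) - frag_of (x, y') | x y y'.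
        x \<in> carrier M \<and> y \<in> carrier N \<and> y' \<in> carrier N} \<union>
     {frag_of (rsmult M x a, y) - frag_of (x, a \<odot>\<^bsub>N\<^esub> y) | x a y.
        x \<in> carrier M \<and> a \<in> carrier A \<and> y \<in> carrier N})"

definition tensor ::
    "('a, 'x) ring_scheme \<Rightarrow> ('a, 'm, 'y) bimodule_scheme \<Rightarrow> ('a, 'n, 'z) bimodule_scheme
      \<Rightarrow> ('a, ('m \<times> 'n \<Rightarrow>\<^sub>0 int) set) bimodule"
  where "tensor A M N =
    (let F = free_Abelian_group (carrier M \<times> carrier N); U = tensor_rel A M N
     in \<lparr>carrier = rcosets\<^bsub>F\<^esub> U, mult = undefined, one = undefined,
         ring.zero = U, add = set_mult F,
         smult = \<lambda>a X. U <#>\<^bsub>F\<^esub> frag_extend (\<lambda>(x, y). frag_of (a \<odot>\<^bsub>M\<^esub> x, y)) ` X,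
         rsmult = \<lambda>X a. U <#>\<^bsub>F\<^esub> frag_extend (\<lambda>(x, y). frag_of (x, rsmult N y a)) ` X\<rparr>)"

definition pure_tensor ::
    "('a, 'x) ring_scheme \<Rightarrow> ('a, 'm, 'y) bimodule_scheme \<Rightarrow> ('a, 'n, 'z) bimodule_scheme
      \<Rightarrow> 'm \<Rightarrow> 'n \<Rightarrow> ('m \<times> 'n \<Rightarrow>\<^sub>0 int) set"
  where "pure_tensor A M N x y =
    tensor_rel A M N #>\<^bsub>free_Abelian_group (carrier M \<times> carrier N)\<^esub> frag_of (x, y)"

text \<open>
  The additive map from a tensor product to the abelian group \<open>G\<close> that sends \<open>x \<otimes> y\<close> to \<open>\<beta> x y\<close>,
  for biadditive and \<open>A\<close>-balanced \<open>\<beta>\<close>.  All representatives of the coset \<open>X\<close> then have the same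
  value, so the image below is a singleton.
\<close>

definition tensor_lift ::
    "('g, 'x) ring_scheme \<Rightarrow> ('m \<Rightarrow> 'n \<Rightarrow> 'g) \<Rightarrow> ('m \<times> 'n \<Rightarrow>\<^sub>0 int) set \<Rightarrow> 'g"
  where "tensor_lift G \<beta> X = the_elem
    ((\<lambda>p. \<Oplus>\<^bsub>G\<^esub>k\<in>Poly_Mapping.keys p. add_pow G (Poly_Mapping.lookup p k) (\<beta> (fst k) (snd k))) ` X)"

text \<open>The map \<open>f \<otimes> g\<close> with values in \<open>M \<otimes>\<^sub>A N\<close>.\<close>

definition tensor_map ::
    "('a, 'x) ring_scheme \<Rightarrow> ('a, 'm, 'y) bimodule_scheme \<Rightarrow> ('a, 'n, 'z) bimodule_scheme
      \<Rightarrow> ('p \<Rightarrow> 'm) \<Rightarrow> ('q \<Rightarrow> 'n) \<Rightarrow> ('p \<times> 'q \<Rightarrow>\<^sub>0 int) set \<Rightarrow> ('m \<times> 'n \<Rightarrow>\<^sub>0 int) set"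
  where "tensor_map A M N f g =
    tensor_lift (tensor A M N) (\<lambda>x y. pure_tensor A M N (f x) (g y))"

text \<open>The map \<open>(L \<otimes> M) \<otimes> N \<rightarrow> L \<otimes> (M \<otimes> N)\<close> that sends \<open>(x \<otimes> y) \<otimes> z\<close> to \<open>x \<otimes> (y \<otimes> z)\<close>.\<close>

definition tensor_assoc ::
    "('a, 'x) ring_scheme \<Rightarrow> ('a, 'l, 'y) bimodule_scheme \<Rightarrow> ('a, 'm, 'z) bimodule_scheme
      \<Rightarrow> ('a, 'n, 'w) bimodule_scheme
      \<Rightarrow> (('l \<times> 'm \<Rightarrow>\<^sub>0 int) set \<times> 'n \<Rightarrow>\<^sub>0 int) set \<Rightarrow> ('l \<times> ('m \<times> 'n \<Rightarrow>\<^sub>0 int) set \<Rightarrow>\<^sub>0 int) set"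
  where "tensor_assoc A L M N =
    tensor_lift (tensor A L (tensor A M N)) (\<lambda>X z.
      tensor_lift (tensor A L (tensor A M N)) (\<lambda>x y.
        pure_tensor A L (tensor A M N) x (pure_tensor A M N y z)) X)"


section \<open>Corings and comodules\<close>

record ('a, 'c) coring = "('a, 'c) bimodule" +
  comult :: "'c \<Rightarrow> ('c \<times> 'c \<Rightarrow>\<^sub>0 int) set"
  counit :: "'c \<Rightarrow> 'a"

definition coring :: "('a, 'x) ring_scheme \<Rightarrow> ('a, 'c, 'y) coring_scheme \<Rightarrow> bool"
  where "coring A C \<longleftrightarrow>
    ring A \<and> bimodule A C \<and>
    comult C \<in> bimodule_hom A C (tensor A C C) \<and>
    counit C \<in> bimodule_hom A C (regular A) \<and>
    (\<forall>c\<in>carrier C.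
       tensor_assoc A C C C (tensor_map A (tensor A C C) C (comult C) id (comult C c)) =
       tensor_map A C (tensor A C C) id (comult C) (comult C c)) \<and>
    (\<forall>c\<in>carrier C.
       tensor_lift C (\<lambda>x y. counit C x \<odot>\<^bsub>C\<^esub> y) (comult C c) = c \<and>
       tensor_lift C (\<lambda>x y. rsmult C x (counit C y)) (comult C c) = c)"

text \<open>
  A right comodule is a right \<open>A\<close>-module \<open>M\<close> with coaction \<open>\<rho>\<close>, a left comodule is a left
  \<open>A\<close>-module \<open>M\<close> with coaction \<open>\<rho>\<close>.  The opposite action in the bimodule record \<open>M\<close> is not used.
\<close>

definition right_comodule ::
    "('a, 'x) ring_scheme \<Rightarrow> ('a, 'c, 'y) coring_scheme \<Rightarrow> ('a, 'm, 'z) bimodule_scheme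
      \<Rightarrow> ('m \<Rightarrow> ('m \<times> 'c \<Rightarrow>\<^sub>0 int) set) \<Rightarrow> bool"
  where "right_comodule A C M \<rho> \<longleftrightarrow>
    left_module (opposite A) (right_mod M) \<and>
    \<rho> \<in> mod_hom (opposite A) (right_mod M) (right_mod (tensor A M C)) \<and>
    (\<forall>x\<in>carrier M.
       tensor_assoc A M C C (tensor_map A (tensor A M C) C \<rho> id (\<rho> x)) =
       tensor_map A M (tensor A C C) id (comult C) (\<rho> x)) \<and>
    (\<forall>x\<in>carrier M. tensor_lift M (\<lambda>y c. rsmult M y (counit C c)) (\<rho> x) = x)"

definition left_comodule ::
    "('a, 'x) ring_scheme \<Rightarrow> ('a, 'c, 'y) coring_scheme \<Rightarrow> ('a, 'm, 'z) bimodule_scheme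
      \<Rightarrow> ('m \<Rightarrow> ('c \<times> 'm \<Rightarrow>\<^sub>0 int) set) \<Rightarrow> bool"
  where "left_comodule A C M \<rho> \<longleftrightarrow>
    left_module A M \<and>
    \<rho> \<in> mod_hom A M (tensor A C M) \<and>
    (\<forall>x\<in>carrier M.
       tensor_assoc A C C M (tensor_map A (tensor A C C) M (comult C) id (\<rho> x)) =
       tensor_map A C (tensor A C M) id \<rho> (\<rho> x)) \<and>
    (\<forall>x\<in>carrier M. tensor_lift M (\<lambda>c y. counit C c \<odot>\<^bsub>M\<^esub> y) (\<rho> x) = x)"

definition right_colinear ::
    "('a, 'x) ring_scheme \<Rightarrow> ('a, 'c, 'y) coring_scheme
      \<Rightarrow> ('a, 'm, 'z) bimodule_scheme \<Rightarrow> ('m \<Rightarrow> ('m \<times> 'c \<Rightarrow>\<^sub>0 int) set)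
      \<Rightarrow> ('a, 'n, 'w) bimodule_scheme \<Rightarrow> ('n \<Rightarrow> ('n \<times> 'c \<Rightarrow>\<^sub>0 int) set)
      \<Rightarrow> ('m \<Rightarrow> 'n) set"
  where "right_colinear A C M \<rho> N \<tau> =
    {f \<in> mod_hom (opposite A) (right_mod M) (right_mod N).
       \<forall>x\<in>carrier M. \<tau> (f x) = tensor_map A N C f id (\<rho> x)}"

definition left_colinear ::
    "('a, 'x) ring_scheme \<Rightarrow> ('a, 'c, 'y) coring_scheme
      \<Rightarrow> ('a, 'm, 'z) bimodule_scheme \<Rightarrow> ('m \<Rightarrow> ('c \<times> 'm \<Rightarrow>\<^sub>0 int) set)
      \<Rightarrow> ('a, 'n, 'w) bimodule_scheme \<Rightarrow> ('n \<Rightarrow> ('c \<times> 'n \<Rightarrow>\<^sub>0 int) set)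
      \<Rightarrow> ('m \<Rightarrow> 'n) set"
  where "left_colinear A C M \<rho> N \<tau> =
    {f \<in> mod_hom A M N. \<forall>x\<in>carrier M. \<tau> (f x) = tensor_map A C N id f (\<rho> x)}"

text \<open>
  The coideals are the subcomodules of \<open>C\<close>: submodules carrying a coaction of their own for
  which the inclusion into \<open>C\<close> is colinear.
\<close>

definition right_coideal ::
    "('a, 'x) ring_scheme \<Rightarrow> ('a, 'c, 'y) coring_scheme \<Rightarrow> 'c set \<Rightarrow> bool"
  where "right_coideal A C K \<longleftrightarrow>
    submodule K (opposite A) (right_mod C) \<and>
    (\<exists>\<rho>. right_comodule A C (C\<lparr>carrier := K\<rparr>) \<rho> \<and>
         id \<in> right_colinear A C (C\<lparr>carrier := K\<rparr>) \<rho> C (comult C))"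

definition left_coideal ::
    "('a, 'x) ring_scheme \<Rightarrow> ('a, 'c, 'y) coring_scheme \<Rightarrow> 'c set \<Rightarrow> bool"
  where "left_coideal A C K \<longleftrightarrow>
    submodule K A C \<and>
    (\<exists>\<rho>. left_comodule A C (C\<lparr>carrier := K\<rparr>) \<rho> \<and>
         id \<in> left_colinear A C (C\<lparr>carrier := K\<rparr>) \<rho> C (comult C))"

definition right_colinear_endos ::
    "('a, 'x) ring_scheme \<Rightarrow> ('a, 'c, 'y) coring_scheme \<Rightarrow> ('c \<Rightarrow> 'c) set"
  where "right_colinear_endos A C = right_colinear A C C (comult C) C (comult C)"

definition left_colinear_endos ::
    "('a, 'x) ring_scheme \<Rightarrow> ('a, 'c, 'y) coring_scheme \<Rightarrow> ('c \<Rightarrow> 'c) set"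
  where "left_colinear_endos A C = left_colinear A C C (comult C) C (comult C)"

definition fully_invariant_right_coideal ::
    "('a, 'x) ring_scheme \<Rightarrow> ('a, 'c, 'y) coring_scheme \<Rightarrow> 'c set \<Rightarrow> bool"
  where "fully_invariant_right_coideal A C K \<longleftrightarrow>
    right_coideal A C K \<and> (\<forall>f\<in>right_colinear_endos A C. f ` K \<subseteq> K)"

definition fully_invariant_left_coideal ::
    "('a, 'x) ring_scheme \<Rightarrow> ('a, 'c, 'y) coring_scheme \<Rightarrow> 'c set \<Rightarrow> bool"
  where "fully_invariant_left_coideal A C K \<longleftrightarrow>
    left_coideal A C K \<and> (\<forall>f\<in>left_colinear_endos A C. f ` K \<subseteq> K)"

text \<open>The internal coproduct \<open>(X : Y)\<close>, with \<open>E\<close> the set of right or left colinear endomorphisms.\<close>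

definition internal_coproduct ::
    "('a, 'c, 'y) coring_scheme \<Rightarrow> ('c \<Rightarrow> 'c) set \<Rightarrow> 'c set \<Rightarrow> 'c set \<Rightarrow> 'c set"
  where "internal_coproduct C E X Y =
    {c \<in> carrier C. \<forall>f\<in>E. (\<forall>x\<in>X. f x = \<zero>\<^bsub>C\<^esub>) \<longrightarrow> f c \<in> Y}"

definition right_fully_coprime ::
    "('a, 'x) ring_scheme \<Rightarrow> ('a, 'c, 'y) coring_scheme \<Rightarrow> bool"
  where "right_fully_coprime A C \<longleftrightarrow>
    (\<forall>X Y. fully_invariant_right_coideal A C X \<longrightarrow> fully_invariant_right_coideal A C Y \<longrightarrow>
       carrier C = internal_coproduct C (right_colinear_endos A C) X Y \<longrightarrow>
       X = carrier C \<or> Y = carrier C)"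

definition left_fully_coprime ::
    "('a, 'x) ring_scheme \<Rightarrow> ('a, 'c, 'y) coring_scheme \<Rightarrow> bool"
  where "left_fully_coprime A C \<longleftrightarrow>
    (\<forall>X Y. fully_invariant_left_coideal A C X \<longrightarrow> fully_invariant_left_coideal A C Y \<longrightarrow>
       carrier C = internal_coproduct C (left_colinear_endos A C) X Y \<longrightarrow>
       X = carrier C \<or> Y = carrier C)"


section \<open>The dual rings and their actions\<close>

text \<open>
  \<open>right_dual A C\<close> is the ring of right \<open>A\<close>-linear maps \<open>C \<rightarrow> A\<close>, written \<open>C\<^sup>*\<close> in the literature,
  and \<open>left_dual A C\<close> the ring of left \<open>A\<close>-linear maps, written \<open>\<^sup>*C\<close>.  Maps are extensional, so
  that equal maps are equal elements.
\<close>

definition right_dual ::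
    "('a, 'x) ring_scheme \<Rightarrow> ('a, 'c, 'y) coring_scheme \<Rightarrow> ('c \<Rightarrow> 'a) ring"
  where "right_dual A C =
    \<lparr>carrier = mod_hom (opposite A) (right_mod C) (right_mod (regular A))
                 \<inter> extensional (carrier C),
     mult = \<lambda>f g. \<lambda>c\<in>carrier C. tensor_lift A (\<lambda>x y. g (f x \<odot>\<^bsub>C\<^esub> y)) (comult C c),
     one = restrict (counit C) (carrier C),
     ring.zero = \<lambda>c\<in>carrier C. \<zero>\<^bsub>A\<^esub>,
     add = \<lambda>f g. \<lambda>c\<in>carrier C. f c \<oplus>\<^bsub>A\<^esub> g c\<rparr>"

definition left_dual ::
    "('a, 'x) ring_scheme \<Rightarrow> ('a, 'c, 'y) coring_scheme \<Rightarrow> ('c \<Rightarrow> 'a) ring"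
  where "left_dual A C =
    \<lparr>carrier = mod_hom A C (regular A) \<inter> extensional (carrier C),
     mult = \<lambda>f g. \<lambda>c\<in>carrier C. tensor_lift A (\<lambda>x y. f (rsmult C x (g y))) (comult C c),
     one = restrict (counit C) (carrier C),
     ring.zero = \<lambda>c\<in>carrier C. \<zero>\<^bsub>A\<^esub>,
     add = \<lambda>f g. \<lambda>c\<in>carrier C. f c \<oplus>\<^bsub>A\<^esub> g c\<rparr>"

text \<open>
  \<open>C\<close> as a right module over the right dual ring (hence a module over \<open>opposite (right_dual A C)\<close>)
  and as a left module over the left dual ring.
\<close>

definition right_dual_mod :: "('a, 'c, 'y) coring_scheme \<Rightarrow> ('c \<Rightarrow> 'a, 'c) module"
  where "right_dual_mod C =
    \<lparr>carrier = carrier C, mult = undefined, one = undefined,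
     ring.zero = \<zero>\<^bsub>C\<^esub>, add = add C,
     smult = \<lambda>g c. tensor_lift C (\<lambda>x y. g x \<odot>\<^bsub>C\<^esub> y) (comult C c)\<rparr>"

definition left_dual_mod :: "('a, 'c, 'y) coring_scheme \<Rightarrow> ('c \<Rightarrow> 'a, 'c) module"
  where "left_dual_mod C =
    \<lparr>carrier = carrier C, mult = undefined, one = undefined,
     ring.zero = \<zero>\<^bsub>C\<^esub>, add = add C,
     smult = \<lambda>f c. tensor_lift C (\<lambda>x y. rsmult C x (f y)) (comult C c)\<rparr>"

end

theory Submission
  imports Defs
begin

text \<open>
  Projectivity makes the coideals exactly the submodules over the dual ring, and the colinear
  endomorphisms are the actions of the other dual ring, so the fully invariant coideals on either
  side are the subbimodules of \<open>C\<close>.  Both dual rings act faithfully.  Since \<open>A\<close> is quasi-Frobenius,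
  regular modules over \<open>A\<close> are cogenerators, so a nonzero linear map vanishes on a given
  proper subbimodule \<open>K\<close>; it annihilates \<open>K\<close> as an element of the dual ring, because \<open>K\<close> is a coideal.

  The rest is formal for two commuting faithful module structures with this property.  If \<open>C\<close> is
  simple, then every condition holds.  Conversely, each of them makes the dual ring prime or
  rules out annihilators of proper subbimodules.  A prime Artinian ring is simple, and then the
  annihilator of a proper subbimodule \<open>K\<close>, a nonzero ideal, is the whole ring, whence \<open>K = 0\<close>.
\<close>

section \<open>Modules\<close>

text \<open>Every condition is compared with one proposition, simplicity as a bimodule, which is
  symmetric in the two dual rings. The formal argument is therefore carried out for an abstract pair
  of commuting actions and instantiated twice, with the rings exchanged; the common notion of
  simplicity ties the two hands together. Two obstacles shape the rest. A coideal must carry a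
  coaction of its own with values in \<open>K \<otimes> C\<close>, so passing from stability to
  coideals requires the canonical maps from \<open>K \<otimes> C\<close> and
  \<open>K \<otimes> (C \<otimes> C)\<close> to be injective, and a dual basis of the last tensor
  factor provides this. Moreover only a one-sided chain condition is given for each dual ring, while
  simple Artinian rings satisfy both: the missing one is obtained by writing the unit as a sum of
  orthogonal idempotents, each of which generates a minimal right ideal. Elements of tensor products
  are cosets of formal sums. Computations with them are kept away from representatives by the
  universal property: additive maps are determined by pure tensors, and Sweedler sums are lifts of
  balanced maps.\<close>

lemma opposite_sel [simp]:
  "carrier (opposite T) = carrier T" "\<zero>\<^bsub>opposite T\<^esub> = \<zero>\<^bsub>T\<^esub>" "\<one>\<^bsub>opposite T\<^esub> = \<one>\<^bsub>T\<^esub>"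
  "x \<oplus>\<^bsub>opposite T\<^esub> y = x \<oplus>\<^bsub>T\<^esub> y" "x \<otimes>\<^bsub>opposite T\<^esub> y = y \<otimes>\<^bsub>T\<^esub> x" "opposite (opposite T) = T"
  by (simp_all add: opposite_def)

lemma add_monoid_opposite [simp]: "add_monoid (opposite T) = add_monoid T"
  by (simp add: opposite_def)

text \<open>Only carrier, zero and addition enter the axioms, so they pass between records that
  agree there, whatever the meaningless multiplicative fields contain.\<close>

lemma abelian_group_cong:
  assumes "abelian_group G" and "carrier H = carrier G" and "\<zero>\<^bsub>H\<^esub> = \<zero>\<^bsub>G\<^esub>" and "add H = add G"
  shows "abelian_group H"
proof -
  interpret G: abelian_group G by fact
  show ?thesis
    using G.l_neg G.add.inv_closed by (intro abelian_groupI) (auto simp: assms G.a_ac intro!: bexI[of _ "\<ominus>\<^bsub>G\<^esub> x" for x])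
qed

lemma (in abelian_group) eq_if_diff_eq_zero:
  assumes "a \<oplus> (\<ominus> b) = \<zero>" "a \<in> carrier G" "b \<in> carrier G"
  shows "a = b"
  using minus_equality[OF assms(1)] assms by simp

text \<open>Serves well-definedness: if one element is decomposed in two ways, the difference of the
  first parts lies in the subgroup that contains the second parts.\<close>

lemma (in abelian_group) diff_eq_diff:
  assumes "u \<oplus> k = u' \<oplus> k'"
    and cl: "u \<in> carrier G" "u' \<in> carrier G" "k \<in> carrier G" "k' \<in> carrier G"
  shows "u \<oplus> (\<ominus> u') = k' \<oplus> (\<ominus> k)"
proof -
  have "u \<oplus> (\<ominus> u') = u \<oplus> k \<oplus> (\<ominus> k) \<oplus> (\<ominus> u')"
    using cl by (simp add: a_assoc r_neg)
  also have "\<dots> = (u' \<oplus> (\<ominus> u')) \<oplus> (k' \<oplus> (\<ominus> k))"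
    unfolding assms(1) using cl by (simp add: a_ac)
  finally show ?thesis
    using cl by (simp add: r_neg)
qed

lemma ring_opposite:
  assumes "ring T"
  shows "ring (opposite T)"
proof -
  interpret ring T by fact
  show ?thesis
    by (rule ringI)
      (auto intro!: abelian_group_cong[OF is_abelian_group] monoidI simp: m_assoc l_distr r_distr
         opposite_def)
qed

lemma mod_hom_iff:
  "f \<in> mod_hom T M N \<longleftrightarrow>
     (\<forall>x\<in>carrier M. f x \<in> carrier N) \<and>
     (\<forall>x\<in>carrier M. \<forall>y\<in>carrier M. f (x \<oplus>\<^bsub>M\<^esub> y) = f x \<oplus>\<^bsub>N\<^esub> f y) \<and>
     (\<forall>t\<in>carrier T. \<forall>x\<in>carrier M. f (t \<odot>\<^bsub>M\<^esub> x) = t \<odot>\<^bsub>N\<^esub> f x)"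
  by (auto simp: mod_hom_def hom_def)

lemma mod_hom_closed: "\<lbrakk>f \<in> mod_hom T M N; x \<in> carrier M\<rbrakk> \<Longrightarrow> f x \<in> carrier N"
  and mod_hom_add: "\<lbrakk>f \<in> mod_hom T M N; x \<in> carrier M; y \<in> carrier M\<rbrakk>
    \<Longrightarrow> f (x \<oplus>\<^bsub>M\<^esub> y) = f x \<oplus>\<^bsub>N\<^esub> f y"
  and mod_hom_smult: "\<lbrakk>f \<in> mod_hom T M N; t \<in> carrier T; x \<in> carrier M\<rbrakk>
    \<Longrightarrow> f (t \<odot>\<^bsub>M\<^esub> x) = t \<odot>\<^bsub>N\<^esub> f x"
  by (simp_all add: mod_hom_iff)

lemma left_moduleI:
  assumes "ring T" and "abelian_group M"
    and "\<And>a x. \<lbrakk>a \<in> carrier T; x \<in> carrier M\<rbrakk> \<Longrightarrow> a \<odot>\<^bsub>M\<^esub> x \<in> carrier M"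
    and "\<And>a b x. \<lbrakk>a \<in> carrier T; b \<in> carrier T; x \<in> carrier M\<rbrakk>
        \<Longrightarrow> (a \<oplus>\<^bsub>T\<^esub> b) \<odot>\<^bsub>M\<^esub> x = a \<odot>\<^bsub>M\<^esub> x \<oplus>\<^bsub>M\<^esub> b \<odot>\<^bsub>M\<^esub> x"
    and "\<And>a x y. \<lbrakk>a \<in> carrier T; x \<in> carrier M; y \<in> carrier M\<rbrakk>
        \<Longrightarrow> a \<odot>\<^bsub>M\<^esub> (x \<oplus>\<^bsub>M\<^esub> y) = a \<odot>\<^bsub>M\<^esub> x \<oplus>\<^bsub>M\<^esub> a \<odot>\<^bsub>M\<^esub> y"
    and "\<And>a b x. \<lbrakk>a \<in> carrier T; b \<in> carrier T; x \<in> carrier M\<rbrakk>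
        \<Longrightarrow> (a \<otimes>\<^bsub>T\<^esub> b) \<odot>\<^bsub>M\<^esub> x = a \<odot>\<^bsub>M\<^esub> (b \<odot>\<^bsub>M\<^esub> x)"
    and "\<And>x. x \<in> carrier M \<Longrightarrow> \<one>\<^bsub>T\<^esub> \<odot>\<^bsub>M\<^esub> x = x"
  shows "left_module T M"
  using assms by (simp add: left_module_def left_module_axioms_def)

context left_module
begin

lemma lsmult_zero_left [simp]:
  assumes "x \<in> carrier M"
  shows "\<zero>\<^bsub>T\<^esub> \<odot>\<^bsub>M\<^esub> x = \<zero>\<^bsub>M\<^esub>"
  using lsmult_l_distr[of "\<zero>\<^bsub>T\<^esub>" "\<zero>\<^bsub>T\<^esub>" x] lsmult_closed[of "\<zero>\<^bsub>T\<^esub>" x] assms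
  by simp

lemma lsmult_zero_right [simp]:
  assumes "a \<in> carrier T"
  shows "a \<odot>\<^bsub>M\<^esub> \<zero>\<^bsub>M\<^esub> = \<zero>\<^bsub>M\<^esub>"
  using lsmult_r_distr[of a "\<zero>\<^bsub>M\<^esub>" "\<zero>\<^bsub>M\<^esub>"] lsmult_closed[of a "\<zero>\<^bsub>M\<^esub>"] assms
  by simp

lemma lsmult_minus_left:
  assumes "a \<in> carrier T" "x \<in> carrier M"
  shows "(\<ominus>\<^bsub>T\<^esub> a) \<odot>\<^bsub>M\<^esub> x = \<ominus>\<^bsub>M\<^esub> (a \<odot>\<^bsub>M\<^esub> x)"
  using assms lsmult_l_distr[of "\<ominus>\<^bsub>T\<^esub> a" a x]
  by (intro M.minus_equality[symmetric]) (simp_all add: lsmult_closed T.l_neg)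

text \<open>Closure under negatives comes with the scalars: \<open>\<ominus> x\<close> is the
  multiple of \<open>x\<close> by the negative of the unit.\<close>

lemma submodule_iff:
  "submodule H T M \<longleftrightarrow>
     H \<subseteq> carrier M \<and> \<zero>\<^bsub>M\<^esub> \<in> H \<and> (\<forall>x\<in>H. \<forall>y\<in>H. x \<oplus>\<^bsub>M\<^esub> y \<in> H) \<and>
     (\<forall>a\<in>carrier T. \<forall>x\<in>H. a \<odot>\<^bsub>M\<^esub> x \<in> H)"
    (is "_ \<longleftrightarrow> ?r")
proof
  assume H: "submodule H T M"
  then interpret submodule H T M .
  show ?r
    using subset one_closed m_closed smult_closed by simp
next
  assume r: ?r
  have "\<ominus>\<^bsub>M\<^esub> x \<in> H" if "x \<in> H" for x
  proof -
    have "x \<in> carrier M" "(\<ominus>\<^bsub>T\<^esub> \<one>\<^bsub>T\<^esub>) \<odot>\<^bsub>M\<^esub> x \<in> H"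
      using r that T.a_inv_closed[OF T.one_closed] by blast+
    then show ?thesis
      by (simp add: lsmult_minus_left lsmult_one)
  qed
  with r show "submodule H T M"
    by (auto simp: submodule_def submodule_axioms_def subgroup_def a_inv_def)
qed

lemma submodule_minus:
  assumes "submodule H T M" "x \<in> H"
  shows "\<ominus>\<^bsub>M\<^esub> x \<in> H"
  using subgroup.m_inv_closed[OF submodule.axioms(1)[OF assms(1)] assms(2)] by (simp add: a_inv_def)

lemma left_module_submodule:
  assumes "submodule H T M"
  shows "left_module T (M\<lparr>carrier := H\<rparr>)"
proof -
  note H = assms[unfolded submodule_iff]
  have HM: "\<And>x. x \<in> H \<Longrightarrow> x \<in> carrier M" using H by blast
  have "abelian_group (M\<lparr>carrier := H\<rparr>)"
  proof (rule abelian_groupI)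
    fix x y z assume "x \<in> carrier (M\<lparr>carrier := H\<rparr>)" "y \<in> carrier (M\<lparr>carrier := H\<rparr>)"
      "z \<in> carrier (M\<lparr>carrier := H\<rparr>)"
    then have "x \<in> H" "y \<in> H" "z \<in> H" by simp_all
    then show "x \<oplus>\<^bsub>M\<lparr>carrier := H\<rparr>\<^esub> y \<oplus>\<^bsub>M\<lparr>carrier := H\<rparr>\<^esub> z
        = x \<oplus>\<^bsub>M\<lparr>carrier := H\<rparr>\<^esub> (y \<oplus>\<^bsub>M\<lparr>carrier := H\<rparr>\<^esub> z)"
      by (simp add: HM M.a_assoc)
  next
    fix x assume "x \<in> carrier (M\<lparr>carrier := H\<rparr>)"
    then show "\<exists>y\<in>carrier (M\<lparr>carrier := H\<rparr>). y \<oplus>\<^bsub>M\<lparr>carrier := H\<rparr>\<^esub> x = \<zero>\<^bsub>M\<lparr>carrier := H\<rparr>\<^esub>"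
      using submodule_minus[OF assms] HM M.l_neg by fastforce
  qed (use H in \<open>simp_all add: HM M.a_comm\<close>)
  then show ?thesis
    using H by (intro left_moduleI)
      (simp_all add: HM T.ring_axioms lsmult_l_distr lsmult_r_distr lsmult_assoc lsmult_one)
qed

lemma lsmult_finsum:
  assumes "a \<in> carrier T" "finite J" "f \<in> J \<rightarrow> carrier M"
  shows "a \<odot>\<^bsub>M\<^esub> finsum M f J = finsum M (\<lambda>j. a \<odot>\<^bsub>M\<^esub> f j) J"
  using assms(2,3)
proof (induction J rule: finite_induct)
  case empty
  then show ?case using assms(1) by simp
next
  case (insert j J)
  then have "f \<in> J \<rightarrow> carrier M" "f j \<in> carrier M" by auto
  with insert assms(1) show ?case
    by (simp add: lsmult_closed lsmult_r_distr M.finsum_closed Pi_iff)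
qed

lemma mod_hom_zero:
  assumes f: "f \<in> mod_hom T M N" and "abelian_group N"
  shows "f \<zero>\<^bsub>M\<^esub> = \<zero>\<^bsub>N\<^esub>"
proof -
  interpret N: abelian_group N by fact
  have "f (\<zero>\<^bsub>M\<^esub> \<oplus>\<^bsub>M\<^esub> \<zero>\<^bsub>M\<^esub>) = f \<zero>\<^bsub>M\<^esub> \<oplus>\<^bsub>N\<^esub> f \<zero>\<^bsub>M\<^esub>" "f \<zero>\<^bsub>M\<^esub> \<in> carrier N"
    using f unfolding mod_hom_iff by (blast intro: M.zero_closed)+
  then show ?thesis
    by simp
qed

end

section \<open>Chain conditions\<close>

text \<open>Without a minimal member, dependent choice would produce a strictly descending sequence
  inside the family.\<close>

lemma artinian_module_minimal:
  assumes art: "artinian_module T M" and ne: "\<N> \<noteq> {}"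
    and sub: "\<And>N. N \<in> \<N> \<Longrightarrow> submodule N T M"
  obtains (min) N where "N \<in> \<N>" "\<And>N'. \<lbrakk>N' \<in> \<N>; N' \<subseteq> N\<rbrakk> \<Longrightarrow> N' = N"
proof (rule ccontr)
  assume neg: "\<not> thesis"
  have step: "\<exists>N'\<in>\<N>. N' \<subset> N" if "N \<in> \<N>" for N
  proof (rule ccontr)
    assume "\<not> ?thesis"
    then have "\<And>N'. \<lbrakk>N' \<in> \<N>; N' \<subseteq> N\<rbrakk> \<Longrightarrow> N' = N"
      by blast
    with that have thesis by (rule min)
    with neg show False by blast
  qed
  obtain N0 where N0: "N0 \<in> \<N>" using ne by blast
  have "\<exists>f :: nat \<Rightarrow> _. \<forall>n. f n \<in> \<N> \<and> f (Suc n) \<subset> f n"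
    by (rule dependent_nat_choice) (use step N0 in auto)
  then obtain f :: "nat \<Rightarrow> _" where f: "\<And>n. f n \<in> \<N>" "\<And>n. f (Suc n) \<subset> f n"
    by blast
  then have "\<forall>i. submodule (f i) T M \<and> f (Suc i) \<subseteq> f i"
    using sub by blast
  then have "\<exists>n. \<forall>i\<ge>n. f i = f n"
    by (rule art[unfolded artinian_module_def, THEN spec, THEN mp])
  then obtain n where "\<forall>i\<ge>n. f i = f n" ..
  then have "f (Suc n) = f n"
    by (rule allE[of _ "Suc n"]) (simp only: le_SucI order_refl simp_thms)
  with f(2)[of n] show False
    by blast
qed

section \<open>Self-injective rings\<close>

text \<open>The regular module occurs as \<open>regular T\<close> over \<open>T\<close> and as
  \<open>right_mod (regular T)\<close> over \<open>opposite T\<close>. Results about any record of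
  this shape cover both sides, and also the double opposite.\<close>

definition is_regular :: "('t, 'x) ring_scheme \<Rightarrow> ('t, 't, 'y) module_scheme \<Rightarrow> bool"
  where "is_regular T Q \<longleftrightarrow>
    carrier Q = carrier T \<and> \<zero>\<^bsub>Q\<^esub> = \<zero>\<^bsub>T\<^esub> \<and> add Q = add T \<and> smult Q = mult T"

lemma is_regular_regular: "is_regular T (regular T)"
  by (simp add: is_regular_def regular_def)

lemma is_regular_right_mod_regular: "is_regular (opposite T) (right_mod (regular T))"
  by (simp add: is_regular_def regular_def right_mod_def opposite_def)

lemma left_module_is_regular:
  assumes "ring T" "is_regular T Q"
  shows "left_module T Q"
proof -
  interpret ring T by fact
  have eq: "carrier Q = carrier T" "\<zero>\<^bsub>Q\<^esub> = \<zero>\<^bsub>T\<^esub>" "add Q = add T" "smult Q = mult T"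
    using assms(2) by (simp_all add: is_regular_def)
  show ?thesis
    by (intro left_moduleI abelian_group_cong[OF is_abelian_group])
      (simp_all add: eq ring_axioms l_distr r_distr m_assoc)
qed

text \<open>Baer's criterion: the type of the module \<open>M\<close> is arbitrary here, whereas the definition of
  injectivity only speaks about modules of the type of the ring.  Zorn's lemma is applied to the
  graphs of partial extensions.\<close>

lemma injective_module_extend:
  fixes M :: "('t, 'm, 'y) module_scheme"
  assumes inj: "injective_module T Q" and M: "left_module T M" and L: "submodule L T M"
    and f: "f \<in> mod_hom T (M\<lparr>carrier := L\<rparr>) Q"
  obtains g where "g \<in> mod_hom T M Q" "\<And>x. x \<in> L \<Longrightarrow> g x = f x"
proof -
  interpret M: left_module T M by fact
  interpret Q: left_module T Q
    using inj by (simp add: injective_module_def)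
  note fD = f[unfolded mod_hom_iff, simplified]
  \<comment> \<open>Partial extensions are encoded as relations: closed under addition and scalars,
    containing the graph of \<open>f\<close>, and relating zero only to zero. The closure conditions
    together with the last one force single-valuedness.\<close>
  define \<G> where "\<G> = {G. G \<subseteq> carrier M \<times> carrier Q \<and> (\<lambda>x. (x, f x)) ` L \<subseteq> G \<and>
    (\<forall>x y x' y'. (x, y) \<in> G \<longrightarrow> (x', y') \<in> G \<longrightarrow> (x \<oplus>\<^bsub>M\<^esub> x', y \<oplus>\<^bsub>Q\<^esub> y') \<in> G) \<and>
    (\<forall>a\<in>carrier T. \<forall>x y. (x, y) \<in> G \<longrightarrow> (a \<odot>\<^bsub>M\<^esub> x, a \<odot>\<^bsub>Q\<^esub> y) \<in> G) \<and>
    (\<forall>y. (\<zero>\<^bsub>M\<^esub>, y) \<in> G \<longrightarrow> y = \<zero>\<^bsub>Q\<^esub>)}"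
  have L': "L \<subseteq> carrier M" "\<zero>\<^bsub>M\<^esub> \<in> L"
    using L by (auto simp: M.submodule_iff)
  have f0: "f \<zero>\<^bsub>M\<^esub> = \<zero>\<^bsub>Q\<^esub>"
    using left_module.mod_hom_zero[OF M.left_module_submodule[OF L] f Q.M.abelian_group_axioms]
    by simp
  have "(\<lambda>x. (x, f x)) ` L \<in> \<G>"
    using L fD f0 unfolding \<G>_def M.submodule_iff by (auto simp: image_iff)
  then have "\<G> \<noteq> {}"
    by blast
  moreover have "\<Union> \<C> \<in> \<G>" if ne: "\<C> \<noteq> {}" and ch: "subset.chain \<G> \<C>" for \<C>
  proof -
    have C: "\<C> \<subseteq> \<G>" and tot: "\<And>X Y. X \<in> \<C> \<Longrightarrow> Y \<in> \<C> \<Longrightarrow> X \<subseteq> Y \<or> Y \<subseteq> X"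
      using ch by (auto simp: subset_chain_def)
    have add: "(x \<oplus>\<^bsub>M\<^esub> x', y \<oplus>\<^bsub>Q\<^esub> y') \<in> \<Union> \<C>" if xy: "(x, y) \<in> \<Union> \<C>" "(x', y') \<in> \<Union> \<C>" for x y x' y'
    proof -
      obtain X Y where XY: "X \<in> \<C>" "Y \<in> \<C>" "(x, y) \<in> X" "(x', y') \<in> Y"
        using xy by blast
      then obtain Z where "Z \<in> \<C>" "(x, y) \<in> Z" "(x', y') \<in> Z"
        using tot[of X Y] by blast
      then show ?thesis
        using C unfolding \<G>_def by blast
    qed
    from ne C have C1: "\<And>X. X \<in> \<C> \<Longrightarrow> X \<subseteq> carrier M \<times> carrier Q \<and> (\<lambda>x. (x, f x)) ` L \<subseteq> X \<and>
        (\<forall>a\<in>carrier T. \<forall>x y. (x, y) \<in> X \<longrightarrow> (a \<odot>\<^bsub>M\<^esub> x, a \<odot>\<^bsub>Q\<^esub> y) \<in> X) \<and>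
        (\<forall>y. (\<zero>\<^bsub>M\<^esub>, y) \<in> X \<longrightarrow> y = \<zero>\<^bsub>Q\<^esub>)"
      unfolding \<G>_def by blast
    obtain X0 where "X0 \<in> \<C>" using ne by blast
    with C1[of X0] have "(\<lambda>x. (x, f x)) ` L \<subseteq> \<Union> \<C>" by blast
    moreover have "\<Union> \<C> \<subseteq> carrier M \<times> carrier Q" using C1 by blast
    moreover have "\<forall>a\<in>carrier T. \<forall>x y. (x, y) \<in> \<Union> \<C> \<longrightarrow> (a \<odot>\<^bsub>M\<^esub> x, a \<odot>\<^bsub>Q\<^esub> y) \<in> \<Union> \<C>"
      using C1 by (meson Union_iff)
    moreover have "\<forall>y. (\<zero>\<^bsub>M\<^esub>, y) \<in> \<Union> \<C> \<longrightarrow> y = \<zero>\<^bsub>Q\<^esub>"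
      using C1 by blast
    ultimately show ?thesis
      unfolding \<G>_def using add by simp
  qed
  ultimately obtain G where G: "G \<in> \<G>" and max: "\<And>X. X \<in> \<G> \<Longrightarrow> G \<subseteq> X \<Longrightarrow> X = G"
    using subset_Zorn_nonempty[of \<G>] by metis
  have Gsub: "\<And>x y. (x, y) \<in> G \<Longrightarrow> x \<in> carrier M \<and> y \<in> carrier Q"
    and Gf: "\<And>x. x \<in> L \<Longrightarrow> (x, f x) \<in> G"
    and Gadd: "\<And>x y x' y'. (x, y) \<in> G \<Longrightarrow> (x', y') \<in> G \<Longrightarrow> (x \<oplus>\<^bsub>M\<^esub> x', y \<oplus>\<^bsub>Q\<^esub> y') \<in> G"
    and Gsm: "\<And>a x y. a \<in> carrier T \<Longrightarrow> (x, y) \<in> G \<Longrightarrow> (a \<odot>\<^bsub>M\<^esub> x, a \<odot>\<^bsub>Q\<^esub> y) \<in> G"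
    and G0: "\<And>y. (\<zero>\<^bsub>M\<^esub>, y) \<in> G \<Longrightarrow> y = \<zero>\<^bsub>Q\<^esub>"
    using G unfolding \<G>_def by blast+
  have Gminus: "(\<ominus>\<^bsub>M\<^esub> x, \<ominus>\<^bsub>Q\<^esub> y) \<in> G" if "(x, y) \<in> G" for x y
    using Gsm[of "\<ominus>\<^bsub>T\<^esub> \<one>\<^bsub>T\<^esub>" x y] Gsub[OF that] that
    by (simp add: M.lsmult_minus_left Q.lsmult_minus_left M.lsmult_one Q.lsmult_one)
  have Guniq: "y = y'" if "(x, y) \<in> G" "(x, y') \<in> G" for x y y'
  proof -
    have "(\<zero>\<^bsub>M\<^esub>, y \<oplus>\<^bsub>Q\<^esub> (\<ominus>\<^bsub>Q\<^esub> y')) \<in> G"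
      using Gadd[OF that(1) Gminus[OF that(2)]] Gsub[OF that(1)] by (simp add: M.M.r_neg)
    then have "y \<oplus>\<^bsub>Q\<^esub> (\<ominus>\<^bsub>Q\<^esub> y') = \<zero>\<^bsub>Q\<^esub>"
      by (rule G0)
    then show ?thesis
      using Gsub that Q.M.eq_if_diff_eq_zero by blast
  qed
  have dom: "\<exists>y. (x, y) \<in> G" if x: "x \<in> carrier M" for x
  proof -
    \<comment> \<open>The scalars that carry \<open>x\<close> into the domain of the maximal graph
      form a left ideal, and \<open>\<phi>\<close> is the value already prescribed at
      \<open>a x\<close>. Extending \<open>\<phi>\<close> to the whole ring produces the value
      \<open>q\<close> to be assigned to \<open>x\<close>.\<close>
    define I where "I = {a \<in> carrier T. \<exists>y. (a \<odot>\<^bsub>M\<^esub> x, y) \<in> G}"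
    define \<phi> where "\<phi> a = (THE y. (a \<odot>\<^bsub>M\<^esub> x, y) \<in> G)" for a
    have \<phi>: "\<phi> a = y" if "(a \<odot>\<^bsub>M\<^esub> x, y) \<in> G" for a y
      unfolding \<phi>_def using Guniq that by blast
    \<comment> \<open>\<open>regular T\<close> is a bimodule record, whereas injectivity tests plain
      module records; hence this copy.\<close>
    define N :: "('t, 't) module" where
      "N = \<lparr>carrier = carrier T, mult = undefined, one = undefined, ring.zero = \<zero>\<^bsub>T\<^esub>,
            add = add T, smult = mult T\<rparr>"
    have N: "left_module T N"
      by (rule left_module_is_regular) (simp_all add: M.T.ring_axioms is_regular_def N_def)
    have z: "(\<zero>\<^bsub>M\<^esub>, \<zero>\<^bsub>Q\<^esub>) \<in> G"
      using Gf[OF L'(2)] f0 by simp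
    have IN: "submodule I T N"
      unfolding left_module.submodule_iff[OF N]
    proof (intro conjI ballI)
      show "I \<subseteq> carrier N" by (auto simp: I_def N_def)
      show "\<zero>\<^bsub>N\<^esub> \<in> I" using z x by (auto simp: I_def N_def)
    next
      fix a b assume "a \<in> I" "b \<in> I"
      then obtain y y' where y: "(a \<odot>\<^bsub>M\<^esub> x, y) \<in> G" "(b \<odot>\<^bsub>M\<^esub> x, y') \<in> G"
        and ab: "a \<in> carrier T" "b \<in> carrier T"
        by (auto simp: I_def)
      show "a \<oplus>\<^bsub>N\<^esub> b \<in> I"
        using Gadd[OF y] x ab unfolding I_def N_def by (auto simp: M.lsmult_l_distr)
    next
      fix t a assume "t \<in> carrier T" "a \<in> I"
      then obtain y where y: "(a \<odot>\<^bsub>M\<^esub> x, y) \<in> G" and a: "a \<in> carrier T" "t \<in> carrier T"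
        by (auto simp: I_def)
      show "t \<odot>\<^bsub>N\<^esub> a \<in> I"
        using Gsm[OF a(2) y] x a unfolding I_def N_def by (auto simp: M.lsmult_assoc)
    qed
    have "\<phi> \<in> mod_hom T (N\<lparr>carrier := I\<rparr>) Q"
      unfolding mod_hom_iff
    proof (simp add: N_def, intro conjI ballI)
      fix a assume "a \<in> I"
      then obtain y where y: "(a \<odot>\<^bsub>M\<^esub> x, y) \<in> G" and a: "a \<in> carrier T"
        by (auto simp: I_def)
      show "\<phi> a \<in> carrier Q"
        using \<phi>[OF y] Gsub y by auto
      show "\<phi> (t \<otimes>\<^bsub>T\<^esub> a) = t \<odot>\<^bsub>Q\<^esub> \<phi> a" if t: "t \<in> carrier T" for t
        using Gsm[OF t y] t a x \<phi>[OF y] by (intro \<phi>) (simp add: M.lsmult_assoc)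
      fix b assume "b \<in> I"
      then obtain y' where y': "(b \<odot>\<^bsub>M\<^esub> x, y') \<in> G" and b: "b \<in> carrier T"
        by (auto simp: I_def)
      show "\<phi> (a \<oplus>\<^bsub>T\<^esub> b) = \<phi> a \<oplus>\<^bsub>Q\<^esub> \<phi> b"
        using Gadd[OF y y'] a b x \<phi>[OF y] \<phi>[OF y'] by (intro \<phi>) (simp add: M.lsmult_l_distr)
    qed
    then obtain h where h: "h \<in> mod_hom T N Q" "\<And>a. a \<in> I \<Longrightarrow> h a = \<phi> a"
      using inj N IN unfolding injective_module_def by blast
    define q where "q = h \<one>\<^bsub>T\<^esub>"
    have q: "q \<in> carrier Q"
      using h(1) by (simp add: q_def mod_hom_iff N_def)
    have hq: "h a = a \<odot>\<^bsub>Q\<^esub> q" if "a \<in> carrier T" for a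
    proof -
      show ?thesis
        using mod_hom_smult[OF h(1), of a "\<one>\<^bsub>T\<^esub>"] that by (simp add: q_def N_def)
    qed
    \<comment> \<open>The graph is enlarged by assigning \<open>q\<close> to \<open>x\<close>.
      Maximality then says that \<open>x\<close> was in the domain all along.\<close>
    define G' where "G' = {(a \<odot>\<^bsub>M\<^esub> x \<oplus>\<^bsub>M\<^esub> m, a \<odot>\<^bsub>Q\<^esub> q \<oplus>\<^bsub>Q\<^esub> y) | a m y. a \<in> carrier T \<and> (m, y) \<in> G}"
    have "G \<subseteq> G'"
    proof (clarify)
      fix m y assume "(m, y) \<in> G"
      then show "(m, y) \<in> G'"
        unfolding G'_def using Gsub x q
        by (intro CollectI exI[of _ "\<zero>\<^bsub>T\<^esub>"] exI[of _ m] exI[of _ y]) auto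
    qed
    moreover have "G' \<in> \<G>"
      unfolding \<G>_def
    proof (intro CollectI conjI allI impI ballI)
      show "G' \<subseteq> carrier M \<times> carrier Q"
        unfolding G'_def using Gsub x q by (auto simp: M.lsmult_closed Q.lsmult_closed)
      show "(\<lambda>x. (x, f x)) ` L \<subseteq> G'"
        using \<open>G \<subseteq> G'\<close> Gf by blast
    next
      fix u v u' v' assume "(u, v) \<in> G'" "(u', v') \<in> G'"
      then obtain a m y a' m' y' where *: "a \<in> carrier T" "a' \<in> carrier T" "(m, y) \<in> G" "(m', y') \<in> G"
        "u = a \<odot>\<^bsub>M\<^esub> x \<oplus>\<^bsub>M\<^esub> m" "v = a \<odot>\<^bsub>Q\<^esub> q \<oplus>\<^bsub>Q\<^esub> y" "u' = a' \<odot>\<^bsub>M\<^esub> x \<oplus>\<^bsub>M\<^esub> m'" "v' = a' \<odot>\<^bsub>Q\<^esub> q \<oplus>\<^bsub>Q\<^esub> y'"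
        unfolding G'_def by blast
      have "u \<oplus>\<^bsub>M\<^esub> u' = (a \<oplus>\<^bsub>T\<^esub> a') \<odot>\<^bsub>M\<^esub> x \<oplus>\<^bsub>M\<^esub> (m \<oplus>\<^bsub>M\<^esub> m')"
        using * x Gsub[OF *(3)] Gsub[OF *(4)]
        by (simp add: M.lsmult_closed M.lsmult_l_distr M.M.a_ac)
      moreover have "v \<oplus>\<^bsub>Q\<^esub> v' = (a \<oplus>\<^bsub>T\<^esub> a') \<odot>\<^bsub>Q\<^esub> q \<oplus>\<^bsub>Q\<^esub> (y \<oplus>\<^bsub>Q\<^esub> y')"
        using * q Gsub[OF *(3)] Gsub[OF *(4)]
        by (simp add: Q.lsmult_closed Q.lsmult_l_distr Q.M.a_ac)
      ultimately show "(u \<oplus>\<^bsub>M\<^esub> u', v \<oplus>\<^bsub>Q\<^esub> v') \<in> G'"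
        unfolding G'_def using * Gadd[OF *(3,4)] by blast
    next
      fix t u v assume t: "t \<in> carrier T" and "(u, v) \<in> G'"
      then obtain a m y where *: "a \<in> carrier T" "(m, y) \<in> G"
        "u = a \<odot>\<^bsub>M\<^esub> x \<oplus>\<^bsub>M\<^esub> m" "v = a \<odot>\<^bsub>Q\<^esub> q \<oplus>\<^bsub>Q\<^esub> y"
        unfolding G'_def by blast
      have "t \<odot>\<^bsub>M\<^esub> u = (t \<otimes>\<^bsub>T\<^esub> a) \<odot>\<^bsub>M\<^esub> x \<oplus>\<^bsub>M\<^esub> t \<odot>\<^bsub>M\<^esub> m"
        using * x t Gsub[OF *(2)] by (simp add: M.lsmult_closed M.lsmult_r_distr M.lsmult_assoc)
      moreover have "t \<odot>\<^bsub>Q\<^esub> v = (t \<otimes>\<^bsub>T\<^esub> a) \<odot>\<^bsub>Q\<^esub> q \<oplus>\<^bsub>Q\<^esub> t \<odot>\<^bsub>Q\<^esub> y"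
        using * q t Gsub[OF *(2)] by (simp add: Q.lsmult_closed Q.lsmult_r_distr Q.lsmult_assoc)
      ultimately show "(t \<odot>\<^bsub>M\<^esub> u, t \<odot>\<^bsub>Q\<^esub> v) \<in> G'"
        unfolding G'_def using * t Gsm[OF t *(2)] by blast
    next
      fix v assume "(\<zero>\<^bsub>M\<^esub>, v) \<in> G'"
      then obtain a m y where *: "a \<in> carrier T" "(m, y) \<in> G"
        "\<zero>\<^bsub>M\<^esub> = a \<odot>\<^bsub>M\<^esub> x \<oplus>\<^bsub>M\<^esub> m" "v = a \<odot>\<^bsub>Q\<^esub> q \<oplus>\<^bsub>Q\<^esub> y"
        unfolding G'_def by blast
      \<comment> \<open>The one point at which the choice of \<open>q\<close> matters: here
        \<open>a x\<close> already lies in the old domain, so \<open>a\<close> is in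
        \<open>I\<close>, and \<open>a q\<close> is the prescribed value
        \<open>\<phi> a\<close>.\<close>
      have "a \<odot>\<^bsub>M\<^esub> x = \<ominus>\<^bsub>M\<^esub> m"
        using * x Gsub[OF *(2)] by (intro M.M.minus_equality[symmetric]) (simp_all add: M.lsmult_closed)
      then have **: "(a \<odot>\<^bsub>M\<^esub> x, \<ominus>\<^bsub>Q\<^esub> y) \<in> G"
        using Gminus[OF *(2)] by simp
      then have "a \<in> I" "\<phi> a = \<ominus>\<^bsub>Q\<^esub> y"
        using \<phi> * by (auto simp: I_def)
      then have "a \<odot>\<^bsub>Q\<^esub> q = \<ominus>\<^bsub>Q\<^esub> y"
        using h(2)[of a] hq[of a] *(1) by simp
      then show "v = \<zero>\<^bsub>Q\<^esub>"
        using * Gsub[OF *(2)] by (simp add: Q.M.l_neg)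
    qed
    ultimately have "G' = G"
      using max by blast
    moreover have "(\<one>\<^bsub>T\<^esub> \<odot>\<^bsub>M\<^esub> x \<oplus>\<^bsub>M\<^esub> \<zero>\<^bsub>M\<^esub>, \<one>\<^bsub>T\<^esub> \<odot>\<^bsub>Q\<^esub> q \<oplus>\<^bsub>Q\<^esub> \<zero>\<^bsub>Q\<^esub>) \<in> G'"
      unfolding G'_def using z by blast
    ultimately show ?thesis
      using x by (auto simp: M.lsmult_one)
  qed
  define g where "g x = (THE y. (x, y) \<in> G)" for x
  have g: "g x = y" if "(x, y) \<in> G" for x y
    unfolding g_def using Guniq that by blast
  have gG: "(x, g x) \<in> G" if "x \<in> carrier M" for x
    using dom[OF that] g by blast
  have "g \<in> mod_hom T M Q"
    unfolding mod_hom_iff using gG Gsub Gadd Gsm by (auto intro!: g)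
  moreover have "g x = f x" if "x \<in> L" for x
    using g Gf that by blast
  ultimately show thesis ..
qed

text \<open>An extension to the whole regular module is determined by its value \<open>c\<close> at
  the unit, so homomorphisms on left ideals are right multiplications.\<close>

lemma injective_regular_extend:
  fixes T :: "('t, 'x) ring_scheme" (structure)
  assumes T: "ring T" and Q: "is_regular T Q" "injective_module T Q" and L: "submodule L T Q"
    and f: "f \<in> mod_hom T (Q\<lparr>carrier := L\<rparr>) Q"
  obtains c where "c \<in> carrier T" "\<And>b. b \<in> L \<Longrightarrow> f b = b \<otimes>\<^bsub>T\<^esub> c"
proof -
  interpret ring T by fact
  interpret Q: left_module T Q
    by (rule left_module_is_regular) fact+
  obtain g where g: "g \<in> mod_hom T Q Q" "\<And>x. x \<in> L \<Longrightarrow> g x = f x"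
    by (rule injective_module_extend[OF Q(2) Q.left_module_axioms L f]) blast
  have *: "carrier Q = carrier T" "smult Q = mult T"
    using Q(1) by (simp_all add: is_regular_def)
  show thesis
  proof
    show "g \<one> \<in> carrier T"
      using g(1) * by (simp add: mod_hom_iff)
    fix b assume "b \<in> L"
    then have "b \<in> carrier T"
      using L * by (auto simp: Q.submodule_iff)
    then have "g (b \<otimes> \<one>) = b \<otimes> g \<one>"
      using mod_hom_smult[OF g(1), of b \<one>] * by simp
    then show "f b = b \<otimes> g \<one>"
      using g(2) \<open>b \<in> L\<close> \<open>b \<in> carrier T\<close> by simp
  qed
qed

text \<open>For a finite subset \<open>F\<close> of the left ideal \<open>I\<close>, self-injectivity on the other side puts the
  double annihilator of \<open>F\<close> inside \<open>I\<close>; by the chain condition some such \<open>F\<close> has the same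
  right annihilator as \<open>I\<close>.\<close>

lemma proper_left_ideal_annihilated:
  fixes T :: "('t, 'x) ring_scheme" (structure)
  assumes T: "ring T" and Q': "is_regular (opposite T) Q'" "injective_module (opposite T) Q'"
    and art: "artinian_module (opposite T) Q'"
    and Q: "is_regular T Q" and I: "submodule I T Q" "I \<noteq> carrier T"
  obtains b where "b \<in> carrier T" "b \<noteq> \<zero>\<^bsub>T\<^esub>" "\<And>a. a \<in> I \<Longrightarrow> a \<otimes>\<^bsub>T\<^esub> b = \<zero>\<^bsub>T\<^esub>"
proof -
  interpret ring T by fact
  interpret Q: left_module T Q
    by (rule left_module_is_regular) fact+
  interpret Q': left_module "opposite T" Q'
    by (rule left_module_is_regular[OF ring_opposite]) fact+
  have eq: "carrier Q = carrier T" "smult Q = mult T" "add Q = add T" "\<zero>\<^bsub>Q\<^esub> = \<zero>"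
    "carrier Q' = carrier T" "smult Q' = (\<lambda>x y. y \<otimes> x)" "add Q' = add T" "\<zero>\<^bsub>Q'\<^esub> = \<zero>"
    using Q Q'(1) by (simp_all add: is_regular_def opposite_def)
  have IT: "I \<subseteq> carrier T" and I_add: "\<And>x y. x \<in> I \<Longrightarrow> y \<in> I \<Longrightarrow> x \<oplus> y \<in> I"
    and I_mult: "\<And>a x. a \<in> carrier T \<Longrightarrow> x \<in> I \<Longrightarrow> a \<otimes> x \<in> I" and I_0: "\<zero> \<in> I"
    using I(1) unfolding Q.submodule_iff eq by auto
  define r where "r F = {b \<in> carrier T. \<forall>x\<in>F. x \<otimes> b = \<zero>}" for F
  have r_sub: "submodule (r F) (opposite T) Q'" if "F \<subseteq> I" for F
    unfolding Q'.submodule_iff eq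
  proof (intro conjI ballI)
    have F: "\<And>x. x \<in> F \<Longrightarrow> x \<in> carrier T" using that IT by blast
    show "r F \<subseteq> carrier T" "\<zero> \<in> r F" by (auto simp: r_def F)
    show "x \<oplus> y \<in> r F" if "x \<in> r F" "y \<in> r F" for x y
      using that by (auto simp: r_def F r_distr)
    show "x \<otimes> a \<in> r F" if "x \<in> r F" "a \<in> carrier (opposite T)" for x a
      using that by (auto simp: r_def F m_assoc[symmetric])
  qed
  have double: "y \<in> I" if "finite F" "F \<subseteq> I" "y \<in> carrier T" "\<And>b. b \<in> r F \<Longrightarrow> y \<otimes> b = \<zero>" for F y
    using that
  proof (induction F arbitrary: y rule: finite_induct)
    case empty
    from empty(3)[of \<one>] have "y = \<zero>"
      using empty(2) by (simp add: r_def)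
    then show ?case by (simp add: I_0)
  next
    case (insert x F)
    have x: "x \<in> carrier T" "x \<in> I" and FI: "F \<subseteq> I"
      using insert IT by auto
    have r_carr: "b \<in> carrier T" if "b \<in> r F" for b
      using that by (simp add: r_def)
    have rF: "\<zero> \<in> r F" "\<And>a b. a \<in> r F \<Longrightarrow> b \<in> r F \<Longrightarrow> a \<oplus> b \<in> r F"
      "\<And>a t. a \<in> r F \<Longrightarrow> t \<in> carrier T \<Longrightarrow> a \<otimes> t \<in> r F"
      using r_sub[OF FI] unfolding Q'.submodule_iff eq by auto
    have rF_minus: "\<ominus> a \<in> r F" if "a \<in> r F" for a
      using rF(3)[OF that, of "\<ominus> \<one>"] r_carr[OF that] by (simp add: r_minus)
    \<comment> \<open>The rule sending \<open>x b\<close> to \<open>y b\<close> is well defined on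
      the right ideal of all \<open>x b\<close> with \<open>b\<close> in \<open>r F\<close>, because
      \<open>y\<close> kills every element of \<open>r F\<close> killed by \<open>x\<close>.
      Self-injectivity makes it left multiplication by some \<open>c\<close>; then
      \<open>y - c x\<close> kills \<open>r F\<close> and lies in \<open>I\<close> by induction, and
      so does \<open>y\<close>.\<close>
    define J where "J = (\<lambda>b. x \<otimes> b) ` r F"
    define f where "f z = y \<otimes> (SOME b. b \<in> r F \<and> z = x \<otimes> b)" for z
    have f: "f (x \<otimes> b) = y \<otimes> b" if b: "b \<in> r F" for b
    proof -
      define b' where "b' = (SOME b'. b' \<in> r F \<and> x \<otimes> b = x \<otimes> b')"
      have b': "b' \<in> r F" "x \<otimes> b = x \<otimes> b'"
        using someI[of "\<lambda>b'. b' \<in> r F \<and> x \<otimes> b = x \<otimes> b'" b] b unfolding b'_def by auto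
      have "b \<oplus> (\<ominus> b') \<in> r F"
        using rF rF_minus b b' by blast
      moreover have "x \<otimes> (b \<oplus> (\<ominus> b')) = \<zero>"
        using b b' x r_carr by (simp add: r_distr r_minus r_neg)
      ultimately have "b \<oplus> (\<ominus> b') \<in> r (insert x F)"
        by (simp add: r_def)
      then have y0: "y \<otimes> (b \<oplus> (\<ominus> b')) = \<zero>"
        by (rule insert.prems(3))
      have bc: "y \<in> carrier T" "b \<in> carrier T" "b' \<in> carrier T"
        using insert.prems(2) b b'(1) r_carr by blast+
      have "y \<otimes> b \<oplus> (\<ominus> (y \<otimes> b')) = y \<otimes> (b \<oplus> (\<ominus> b'))"
        using bc by (simp add: r_distr r_minus)
      with y0 bc have "y \<otimes> b = y \<otimes> b'"
        by - (rule eq_if_diff_eq_zero, simp_all)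
      then show ?thesis
        unfolding f_def b'_def[symmetric] by (rule sym)
    qed
    have J: "submodule J (opposite T) Q'"
      unfolding Q'.submodule_iff eq J_def
    proof (intro conjI ballI)
      show "(\<otimes>) x ` r F \<subseteq> carrier T" using x r_carr by auto
      show "\<zero> \<in> (\<otimes>) x ` r F"
        using rF(1) x by (intro image_eqI[of _ _ \<zero>]) auto
      show "u \<oplus> v \<in> (\<otimes>) x ` r F" if uv: "u \<in> (\<otimes>) x ` r F" "v \<in> (\<otimes>) x ` r F" for u v
      proof -
        obtain a b where "u = x \<otimes> a" "v = x \<otimes> b" "a \<in> r F" "b \<in> r F"
          using uv by blast
        then show ?thesis
          using rF(2) x r_carr by (intro image_eqI[of _ _ "a \<oplus> b"]) (auto simp: r_distr)
      qed
      show "u \<otimes> t \<in> (\<otimes>) x ` r F" if ut: "t \<in> carrier (opposite T)" "u \<in> (\<otimes>) x ` r F" for t u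
      proof -
        obtain a where "u = x \<otimes> a" "a \<in> r F"
          using ut by blast
        then show ?thesis
          using rF(3) x r_carr ut by (intro image_eqI[of _ _ "a \<otimes> t"]) (auto simp: m_assoc)
      qed
    qed
    have "f \<in> mod_hom (opposite T) (Q'\<lparr>carrier := J\<rparr>) Q'"
      unfolding mod_hom_iff
    proof (simp add: eq, intro conjI ballI)
      fix u assume "u \<in> J"
      then obtain a where u: "u = x \<otimes> a" "a \<in> r F" by (auto simp: J_def)
      show "f u \<in> carrier T"
        using u f insert.prems(2) r_carr by simp
      show "f (u \<otimes> t) = f u \<otimes> t" if t: "t \<in> carrier T" for t
        using f[OF rF(3)[OF u(2) t]] f[OF u(2)] u t x insert.prems(2) r_carr
        by (simp add: m_assoc)
      fix v assume "v \<in> J"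
      then obtain b where v: "v = x \<otimes> b" "b \<in> r F" by (auto simp: J_def)
      show "f (u \<oplus> v) = f u \<oplus> f v"
        using f[OF rF(2)[OF u(2) v(2)]] f[OF u(2)] f[OF v(2)] u v x insert.prems(2) r_carr
        by (simp add: r_distr)
    qed
    then obtain c where c: "c \<in> carrier T" "\<And>b. b \<in> J \<Longrightarrow> f b = c \<otimes> b"
      using injective_regular_extend[OF ring_opposite[OF T] Q' J] by auto
    have "(y \<oplus> (\<ominus> (c \<otimes> x))) \<otimes> b = \<zero>" if b: "b \<in> r F" for b
    proof -
      have "y \<otimes> b = c \<otimes> (x \<otimes> b)"
        using f[OF b] c(2)[of "x \<otimes> b"] b by (auto simp: J_def)
      then show ?thesis
        using b x c(1) insert.prems(2) r_carr by (simp add: l_distr l_minus m_assoc r_neg)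
    qed
    then have *: "y \<oplus> (\<ominus> (c \<otimes> x)) \<in> I"
      using insert.IH[OF FI] insert.prems(2) c(1) x by simp
    have "y = (y \<oplus> (\<ominus> (c \<otimes> x))) \<oplus> c \<otimes> x"
      using insert.prems(2) c(1) x by (simp add: a_assoc l_neg)
    then show "y \<in> I"
      using I_add[OF * I_mult[OF c(1) x(2)]] by simp
  qed
  obtain F where F: "finite F" "F \<subseteq> I"
    and min: "\<And>F'. \<lbrakk>finite F'; F' \<subseteq> I; r F' \<subseteq> r F\<rbrakk> \<Longrightarrow> r F' = r F"
  proof (rule artinian_module_minimal[OF art, of "{r F | F. finite F \<and> F \<subseteq> I}"])
    fix N assume N: "N \<in> {r F |F. finite F \<and> F \<subseteq> I}"
      "\<And>N'. N' \<in> {r F |F. finite F \<and> F \<subseteq> I} \<Longrightarrow> N' \<subseteq> N \<Longrightarrow> N' = N"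
    from N(1) obtain F where F: "finite F" "F \<subseteq> I" "N = r F" by blast
    show thesis
      by (rule that[OF F(1,2)], rule N(2)[unfolded F(3)]) blast+
  qed (use r_sub in auto)
  \<comment> \<open>Adding an element of \<open>I\<close> to \<open>F\<close> can only shrink
    \<open>r F\<close>, which is minimal. So all of \<open>I\<close> kills \<open>r F\<close>, while
    the unit, which is outside \<open>I\<close>, does not.\<close>
  have rI: "x \<otimes> b = \<zero>" if "x \<in> I" "b \<in> r F" for x b
  proof -
    have "r (insert x F) = r F"
      by (rule min) (use F that in \<open>auto simp: r_def\<close>)
    then show ?thesis
      using that unfolding r_def by blast
  qed
  have "\<one> \<notin> I"
    using I(2) I_mult[of _ \<one>] IT by auto
  then obtain b where "b \<in> r F" "\<one> \<otimes> b \<noteq> \<zero>"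
    using double[OF F one_closed] by blast
  then show thesis
    using that[of b] rI by (auto simp: r_def)
qed

text \<open>For \<open>x\<close> outside \<open>K\<close>, the scalars carrying \<open>x\<close>
  into \<open>K\<close> form a proper left ideal, which is annihilated by some nonzero
  \<open>b\<close> on the right. Hence \<open>a x + k \<mapsto> a b\<close> is well defined; it
  kills \<open>K\<close>, sends \<open>x\<close> to \<open>b\<close>, and extends to
  \<open>M\<close> by injectivity. One side of the quasi-Frobenius property supplies
  \<open>b\<close>, the other the extension.\<close>

lemma quasi_frobenius_cogenerates:
  assumes T: "ring T" and Q: "is_regular T Q" "injective_module T Q"
    and Q': "is_regular (opposite T) Q'" "injective_module (opposite T) Q'"
    and art: "artinian_module (opposite T) Q'"
    and M: "left_module T M" and K: "submodule K T M" "K \<noteq> carrier M"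
  obtains g where "g \<in> mod_hom T M Q" "\<And>x. x \<in> K \<Longrightarrow> g x = \<zero>\<^bsub>T\<^esub>" "\<exists>x\<in>carrier M. g x \<noteq> \<zero>\<^bsub>T\<^esub>"
proof -
  interpret M: left_module T M by fact
  interpret Q: left_module T Q
    by (rule left_module_is_regular) fact+
  have eq: "carrier Q = carrier T" "smult Q = mult T" "add Q = add T" "\<zero>\<^bsub>Q\<^esub> = \<zero>\<^bsub>T\<^esub>"
    using Q by (simp_all add: is_regular_def)
  have KM: "K \<subseteq> carrier M" "\<zero>\<^bsub>M\<^esub> \<in> K" "\<And>x y. x \<in> K \<Longrightarrow> y \<in> K \<Longrightarrow> x \<oplus>\<^bsub>M\<^esub> y \<in> K"
    "\<And>a x. a \<in> carrier T \<Longrightarrow> x \<in> K \<Longrightarrow> a \<odot>\<^bsub>M\<^esub> x \<in> K"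
    using K(1) unfolding M.submodule_iff by auto
  obtain x where x: "x \<in> carrier M" "x \<notin> K"
    using K(2) KM by blast
  define I where "I = {a \<in> carrier T. a \<odot>\<^bsub>M\<^esub> x \<in> K}"
  have "submodule I T Q"
    unfolding Q.submodule_iff eq I_def using x KM
    by (auto simp: M.lsmult_l_distr M.lsmult_assoc)
  moreover have "I \<noteq> carrier T"
    using x M.T.one_closed unfolding I_def by (metis (lifting) M.lsmult_one mem_Collect_eq)
  ultimately obtain b where b: "b \<in> carrier T" "b \<noteq> \<zero>\<^bsub>T\<^esub>" "\<And>a. a \<in> I \<Longrightarrow> a \<otimes>\<^bsub>T\<^esub> b = \<zero>\<^bsub>T\<^esub>"
    by (rule proper_left_ideal_annihilated[OF T Q' art Q(1)]) blast
  define L where "L = {a \<odot>\<^bsub>M\<^esub> x \<oplus>\<^bsub>M\<^esub> k | a k. a \<in> carrier T \<and> k \<in> K}"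
  define f where "f z = (SOME a. a \<in> carrier T \<and> (\<exists>k\<in>K. z = a \<odot>\<^bsub>M\<^esub> x \<oplus>\<^bsub>M\<^esub> k)) \<otimes>\<^bsub>T\<^esub> b" for z
  have f: "f (a \<odot>\<^bsub>M\<^esub> x \<oplus>\<^bsub>M\<^esub> k) = a \<otimes>\<^bsub>T\<^esub> b" if a: "a \<in> carrier T" and k: "k \<in> K" for a k
  proof -
    let ?P = "\<lambda>a'. a' \<in> carrier T \<and> (\<exists>k'\<in>K. a \<odot>\<^bsub>M\<^esub> x \<oplus>\<^bsub>M\<^esub> k = a' \<odot>\<^bsub>M\<^esub> x \<oplus>\<^bsub>M\<^esub> k')"
    define a' where "a' = (SOME a'. ?P a')"
    have "?P a'"
      unfolding a'_def by (rule someI[of _ a]) (use a k in blast)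
    then obtain k' where k': "a' \<in> carrier T" "k' \<in> K"
      "a \<odot>\<^bsub>M\<^esub> x \<oplus>\<^bsub>M\<^esub> k = a' \<odot>\<^bsub>M\<^esub> x \<oplus>\<^bsub>M\<^esub> k'" by blast
    have cl: "a \<odot>\<^bsub>M\<^esub> x \<in> carrier M" "a' \<odot>\<^bsub>M\<^esub> x \<in> carrier M" "k \<in> carrier M" "k' \<in> carrier M"
      using a k k' x KM(1) by (auto simp: M.lsmult_closed)
    have "a \<odot>\<^bsub>M\<^esub> x \<oplus>\<^bsub>M\<^esub> (\<ominus>\<^bsub>M\<^esub> (a' \<odot>\<^bsub>M\<^esub> x)) = k' \<oplus>\<^bsub>M\<^esub> (\<ominus>\<^bsub>M\<^esub> k)"
      by (rule M.M.diff_eq_diff[OF k'(3)]) (fact cl)+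
    then have "(a \<oplus>\<^bsub>T\<^esub> (\<ominus>\<^bsub>T\<^esub> a')) \<odot>\<^bsub>M\<^esub> x = k' \<oplus>\<^bsub>M\<^esub> (\<ominus>\<^bsub>M\<^esub> k)"
      using a k' x by (simp add: M.lsmult_l_distr M.lsmult_minus_left)
    then have "a \<oplus>\<^bsub>T\<^esub> (\<ominus>\<^bsub>T\<^esub> a') \<in> I"
      using a k k' KM M.submodule_minus[OF K(1) k] by (simp add: I_def)
    then have "(a \<oplus>\<^bsub>T\<^esub> (\<ominus>\<^bsub>T\<^esub> a')) \<otimes>\<^bsub>T\<^esub> b = \<zero>\<^bsub>T\<^esub>"
      by (rule b)
    then have "a \<otimes>\<^bsub>T\<^esub> b \<oplus>\<^bsub>T\<^esub> (\<ominus>\<^bsub>T\<^esub> (a' \<otimes>\<^bsub>T\<^esub> b)) = \<zero>\<^bsub>T\<^esub>"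
      using a k' b by (simp add: M.T.l_distr M.T.l_minus)
    then have "a' \<otimes>\<^bsub>T\<^esub> b = a \<otimes>\<^bsub>T\<^esub> b"
      using a k'(1) b(1) by - (rule M.T.eq_if_diff_eq_zero[symmetric], simp_all)
    then show ?thesis
      unfolding f_def a'_def[symmetric] by (simp add: a'_def)
  qed
  have Ladd: "(a \<odot>\<^bsub>M\<^esub> x \<oplus>\<^bsub>M\<^esub> k) \<oplus>\<^bsub>M\<^esub> (a' \<odot>\<^bsub>M\<^esub> x \<oplus>\<^bsub>M\<^esub> k') = (a \<oplus>\<^bsub>T\<^esub> a') \<odot>\<^bsub>M\<^esub> x \<oplus>\<^bsub>M\<^esub> (k \<oplus>\<^bsub>M\<^esub> k')"
    if "a \<in> carrier T" "a' \<in> carrier T" "k \<in> K" "k' \<in> K" for a a' k k'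
    using that x KM(1) by (simp add: M.lsmult_closed M.lsmult_l_distr M.M.a_ac subsetD)
  have Lsm: "t \<odot>\<^bsub>M\<^esub> (a \<odot>\<^bsub>M\<^esub> x \<oplus>\<^bsub>M\<^esub> k) = (t \<otimes>\<^bsub>T\<^esub> a) \<odot>\<^bsub>M\<^esub> x \<oplus>\<^bsub>M\<^esub> t \<odot>\<^bsub>M\<^esub> k"
    if "a \<in> carrier T" "t \<in> carrier T" "k \<in> K" for a t k
    using that x KM(1) by (simp add: M.lsmult_closed M.lsmult_r_distr M.lsmult_assoc subsetD)
  have L: "submodule L T M"
    unfolding M.submodule_iff
  proof (intro conjI ballI)
    show "L \<subseteq> carrier M"
      unfolding L_def using x KM(1) by (auto simp: M.lsmult_closed)
    show "\<zero>\<^bsub>M\<^esub> \<in> L"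
      unfolding L_def using KM(2) x
      by (intro CollectI exI[of _ "\<zero>\<^bsub>T\<^esub>"] exI[of _ "\<zero>\<^bsub>M\<^esub>"]) simp
    show "u \<oplus>\<^bsub>M\<^esub> v \<in> L" if "u \<in> L" "v \<in> L" for u v
      using that Ladd KM(3) unfolding L_def by (smt (verit) M.T.a_closed mem_Collect_eq)
    show "t \<odot>\<^bsub>M\<^esub> u \<in> L" if "t \<in> carrier T" "u \<in> L" for t u
      using that Lsm KM(4) unfolding L_def by (smt (verit) M.T.m_closed mem_Collect_eq)
  qed
  have "f \<in> mod_hom T (M\<lparr>carrier := L\<rparr>) Q"
    unfolding mod_hom_iff
  proof (simp add: eq, intro conjI ballI)
    fix u assume "u \<in> L"
    then obtain a k where u: "u = a \<odot>\<^bsub>M\<^esub> x \<oplus>\<^bsub>M\<^esub> k" "a \<in> carrier T" "k \<in> K"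
      by (auto simp: L_def)
    show "f u \<in> carrier T"
      using u f b by simp
    show "f (t \<odot>\<^bsub>M\<^esub> u) = t \<otimes>\<^bsub>T\<^esub> f u" if t: "t \<in> carrier T" for t
      using u t b(1) f[OF u(2,3)] f[OF M.T.m_closed[OF t u(2)] KM(4)[OF t u(3)]] Lsm[OF u(2) t u(3)]
      by (simp add: M.T.m_assoc)
    fix v assume "v \<in> L"
    then obtain a' k' where v: "v = a' \<odot>\<^bsub>M\<^esub> x \<oplus>\<^bsub>M\<^esub> k'" "a' \<in> carrier T" "k' \<in> K"
      by (auto simp: L_def)
    show "f (u \<oplus>\<^bsub>M\<^esub> v) = f u \<oplus>\<^bsub>T\<^esub> f v"
      using u v b(1) f[OF u(2,3)] f[OF v(2,3)] f[OF M.T.a_closed[OF u(2) v(2)] KM(3)[OF u(3) v(3)]]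
        Ladd[OF u(2) v(2) u(3) v(3)]
      by (simp add: M.T.l_distr)
  qed
  then obtain g where g: "g \<in> mod_hom T M Q" "\<And>z. z \<in> L \<Longrightarrow> g z = f z"
    using injective_module_extend[OF Q(2) M L] by blast
  show thesis
  proof (rule that[OF g(1)])
    fix k assume k: "k \<in> K"
    have "k = \<zero>\<^bsub>T\<^esub> \<odot>\<^bsub>M\<^esub> x \<oplus>\<^bsub>M\<^esub> k"
      using x k KM(1) by (simp add: subsetD)
    then have "k \<in> L" "f k = \<zero>\<^bsub>T\<^esub>"
      using k f[OF M.T.zero_closed k] b(1) by (auto simp: L_def) 
    then show "g k = \<zero>\<^bsub>T\<^esub>"
      using g(2) by simp
  next
    have "x = \<one>\<^bsub>T\<^esub> \<odot>\<^bsub>M\<^esub> x \<oplus>\<^bsub>M\<^esub> \<zero>\<^bsub>M\<^esub>"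
      using x by (simp add: M.lsmult_one)
    then have "x \<in> L" "f x = b"
      using KM(2) f[OF M.T.one_closed KM(2)] b(1) by (auto simp: L_def) 
    then show "\<exists>x\<in>carrier M. g x \<noteq> \<zero>\<^bsub>T\<^esub>"
      using g(2)[of x] b(2) x(1) by (intro bexI[of _ x]) simp_all
  qed
qed

section \<open>Prime Artinian rings\<close>

lemma submodule_is_regular_iff:
  assumes "ring T" "is_regular T Q"
  shows "submodule H T Q \<longleftrightarrow>
    H \<subseteq> carrier T \<and> \<zero>\<^bsub>T\<^esub> \<in> H \<and> (\<forall>x\<in>H. \<forall>y\<in>H. x \<oplus>\<^bsub>T\<^esub> y \<in> H) \<and>
    (\<forall>a\<in>carrier T. \<forall>x\<in>H. a \<otimes>\<^bsub>T\<^esub> x \<in> H)"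
  using left_module.submodule_iff[OF left_module_is_regular[OF assms]] assms(2)
  by (simp add: is_regular_def)

lemma artinian_module_is_regular_cong:
  assumes "ring T" "is_regular T Q" "is_regular T Q'"
  shows "artinian_module T Q \<longleftrightarrow> artinian_module T Q'"
  unfolding artinian_module_def submodule_is_regular_iff[OF assms(1,2)]
    submodule_is_regular_iff[OF assms(1,3)] ..

lemma left_artinian_opposite:
  assumes "ring T"
  shows "left_artinian (opposite T) \<longleftrightarrow> right_artinian T"
  using artinian_module_is_regular_cong[OF ring_opposite[OF assms] is_regular_regular
        is_regular_right_mod_regular]
  by (simp only: left_artinian_def right_artinian_def)

lemma right_artinian_opposite:
  assumes "ring T"
  shows "right_artinian (opposite T) \<longleftrightarrow> left_artinian T"
  using left_artinian_opposite[OF ring_opposite[OF assms]] by (simp only: opposite_sel)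

lemma (in ring) ideal_iff:
  "ideal I R \<longleftrightarrow> I \<subseteq> carrier R \<and> \<zero> \<in> I \<and> (\<forall>x\<in>I. \<forall>y\<in>I. x \<oplus> y \<in> I) \<and>
     (\<forall>a\<in>carrier R. \<forall>x\<in>I. a \<otimes> x \<in> I \<and> x \<otimes> a \<in> I)"
    (is "_ \<longleftrightarrow> ?r")
proof
  assume "ideal I R"
  then interpret ideal I R .
  show ?r
    using a_subset by (simp add: I_l_closed I_r_closed additive_subgroup.a_closed)
next
  assume r: ?r
  then have "submodule I R (regular R)"
    unfolding submodule_is_regular_iff[OF ring_axioms is_regular_regular] by blast
  then have "subgroup I (add_monoid (regular R))"
    by (rule submodule.axioms(1))
  then have "subgroup I (add_monoid R)"
    by (simp add: subgroup_def regular_def m_inv_def)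
  with r show "ideal I R"
    by (intro idealI ring_axioms) blast+
qed

lemma ideal_opposite:
  assumes "ring T"
  shows "ideal I (opposite T) \<longleftrightarrow> ideal I T"
  unfolding ring.ideal_iff[OF assms] ring.ideal_iff[OF ring_opposite[OF assms]] by auto

text \<open>To get from ideals to elements, let \<open>I\<close> consist of everything that
  annihilates \<open>T y\<close> from the left, and let \<open>J\<close> be the set of all
  \<open>z\<close> for which \<open>I\<close> annihilates \<open>T z\<close>. Both are two-sided
  ideals, they contain \<open>x\<close> and \<open>y\<close>, and their product is zero.\<close>

lemma prime_ring_iff:
  fixes T (structure)
  assumes T: "ring T"
  shows "prime_ring T \<longleftrightarrow> carrier T \<noteq> {\<zero>} \<and>
    (\<forall>x\<in>carrier T. \<forall>y\<in>carrier T. (\<forall>t\<in>carrier T. x \<otimes> (t \<otimes> y) = \<zero>) \<longrightarrow> x = \<zero> \<or> y = \<zero>)"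
    (is "_ \<longleftrightarrow> ?n \<and> ?r")
proof -
  interpret ring T by fact
  show ?thesis
  proof
    assume p: "prime_ring T"
    have ?r
    proof (intro ballI impI)
      fix x y assume xy: "x \<in> carrier T" "y \<in> carrier T" "\<forall>t\<in>carrier T. x \<otimes> (t \<otimes> y) = \<zero>"
      define I where "I = {x \<in> carrier T. \<forall>t\<in>carrier T. x \<otimes> (t \<otimes> y) = \<zero>}"
      define J where "J = {y \<in> carrier T. \<forall>x\<in>I. \<forall>t\<in>carrier T. x \<otimes> (t \<otimes> y) = \<zero>}"
      have IT: "\<And>x. x \<in> I \<Longrightarrow> x \<in> carrier T" by (simp add: I_def)
      have I: "ideal I T"
        unfolding ideal_iff
      proof (intro conjI ballI)
        fix a i assume ai: "a \<in> carrier T" "i \<in> I"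
        then have "a \<otimes> i \<otimes> (t \<otimes> y) = \<zero>" "i \<otimes> a \<otimes> (t \<otimes> y) = \<zero>" if "t \<in> carrier T" for t
        proof -
          have "a \<otimes> (i \<otimes> (t \<otimes> y)) = \<zero>" "i \<otimes> (a \<otimes> t \<otimes> y) = \<zero>"
            using ai that by (simp_all add: I_def)
          then show "a \<otimes> i \<otimes> (t \<otimes> y) = \<zero>" "i \<otimes> a \<otimes> (t \<otimes> y) = \<zero>"
            using ai that xy(2) IT by (simp_all add: m_assoc)
        qed
        then show "a \<otimes> i \<in> I" "i \<otimes> a \<in> I"
          using ai by (simp_all add: I_def)
      qed (use xy(2) in \<open>auto simp: I_def l_distr\<close>)
      have J: "ideal J T"
        unfolding ideal_iff
      proof (intro conjI ballI)
        fix a j assume aj: "a \<in> carrier T" "j \<in> J"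
        then have "i \<otimes> (t \<otimes> (a \<otimes> j)) = \<zero>" "i \<otimes> (t \<otimes> (j \<otimes> a)) = \<zero>"
          if "t \<in> carrier T" "i \<in> I" for t i
        proof -
          have "i \<otimes> (t \<otimes> a \<otimes> j) = \<zero>" "i \<otimes> (t \<otimes> j) \<otimes> a = \<zero>" "j \<in> carrier T"
            using aj that by (simp_all add: J_def)
          then show "i \<otimes> (t \<otimes> (a \<otimes> j)) = \<zero>" "i \<otimes> (t \<otimes> (j \<otimes> a)) = \<zero>"
            using aj(1) that(1) IT[OF that(2)] by (simp_all add: m_assoc)
        qed
        then show "a \<otimes> j \<in> J" "j \<otimes> a \<in> J"
          using aj by (simp_all add: J_def)
      qed (auto simp: J_def r_distr IT)
      have IJ: "ideal_prod T I J = {\<zero>}"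
      proof
        show "ideal_prod T I J \<subseteq> {\<zero>}"
        proof
          fix z assume "z \<in> ideal_prod T I J"
          then show "z \<in> {\<zero>}"
          proof induction
            case (prod i j)
            then have "i \<otimes> (\<one> \<otimes> j) = \<zero>" "j \<in> carrier T"
              unfolding J_def using one_closed by blast+
            then show ?case by simp
          qed simp
        qed
        have "\<zero> \<in> I" "\<zero> \<in> J"
          using I J by (simp_all add: ideal_iff)
        then have "\<zero> \<otimes> \<zero> \<in> ideal_prod T I J"
          by (rule ideal_prod.prod)
        then show "{\<zero>} \<subseteq> ideal_prod T I J" by simp
      qed
      have "I = {\<zero>} \<or> J = {\<zero>}"
        using p I J IJ unfolding prime_ring_def by simp
      moreover have "x \<in> I" "y \<in> J"
        using xy by (simp_all add: I_def J_def)
      ultimately show "x = \<zero> \<or> y = \<zero>" by auto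
    qed
    with p show "?n \<and> ?r" by (simp add: prime_ring_def)
  next
    assume r: "?n \<and> ?r"
    show "prime_ring T"
      unfolding prime_ring_def
    proof (intro conjI allI impI ring_axioms)
      show ?n using r by simp
      fix I J assume IJ: "ideal I T" "ideal J T" "ideal_prod T I J = {\<zero>}"
      then have I: "I \<subseteq> carrier T" "\<zero> \<in> I" and J: "J \<subseteq> carrier T" "\<zero> \<in> J"
        "\<And>a x. a \<in> carrier T \<Longrightarrow> x \<in> J \<Longrightarrow> a \<otimes> x \<in> J"
        by (simp_all add: ideal_iff)
      show "I = {\<zero>} \<or> J = {\<zero>}"
      proof (rule ccontr)
        assume "\<not> ?thesis"
        then obtain i j where ij: "i \<in> I" "j \<in> J" "i \<noteq> \<zero>" "j \<noteq> \<zero>"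
          using I J by blast
        have "i \<otimes> (t \<otimes> j) = \<zero>" if "t \<in> carrier T" for t
          using ideal_prod.prod[OF ij(1) J(3)[OF that ij(2)], of T] IJ(3) by simp
        moreover have "i \<in> carrier T" "j \<in> carrier T"
          using ij I(1) J(1) by auto
        ultimately have "i = \<zero> \<or> j = \<zero>"
          by (intro r[THEN conjunct2, THEN bspec, THEN bspec, THEN mp] ballI)
        then show False
          using ij(3,4) by simp
      qed
    qed
  qed
qed

lemma prime_ringD:
  assumes "prime_ring T" "x \<in> carrier T" "y \<in> carrier T" "x \<noteq> \<zero>\<^bsub>T\<^esub>" "y \<noteq> \<zero>\<^bsub>T\<^esub>"
  obtains t where "t \<in> carrier T" "x \<otimes>\<^bsub>T\<^esub> (t \<otimes>\<^bsub>T\<^esub> y) \<noteq> \<zero>\<^bsub>T\<^esub>"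
proof -
  have "ring T" using assms(1) by (simp add: prime_ring_def)
  from prime_ring_iff[OF this] assms show thesis using that by auto
qed

lemma prime_ring_opposite:
  assumes "ring T"
  shows "prime_ring (opposite T) \<longleftrightarrow> prime_ring T"
proof -
  interpret ring T by fact
  show ?thesis
    unfolding prime_ring_iff[OF assms] prime_ring_iff[OF ring_opposite[OF assms]]
    by (simp add: m_assoc) meson
qed

lemma simple_artinian_ring_opposite:
  assumes "ring T"
  shows "simple_artinian_ring (opposite T) \<longleftrightarrow> simple_artinian_ring T"
  using assms ring_opposite[OF assms]
  by (auto simp: simple_artinian_ring_def ideal_opposite left_artinian_opposite right_artinian_opposite)

section \<open>Minimal left ideals and idempotents of prime rings\<close>

context ring
begin

definition lideal :: "'a set \<Rightarrow> bool"
  where "lideal H \<longleftrightarrow> submodule H R (regular R)"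

definition minimal_lideal :: "'a set \<Rightarrow> bool"
  where "minimal_lideal L \<longleftrightarrow> lideal L \<and> L \<noteq> {\<zero>} \<and>
    (\<forall>H. lideal H \<longrightarrow> H \<subseteq> L \<longrightarrow> H = {\<zero>} \<or> H = L)"

definition rideal :: "'a set \<Rightarrow> bool"
  where "rideal H \<longleftrightarrow> submodule H (opposite R) (right_mod (regular R))"

lemma lideal_iff:
  "lideal H \<longleftrightarrow> H \<subseteq> carrier R \<and> \<zero> \<in> H \<and> (\<forall>x\<in>H. \<forall>y\<in>H. x \<oplus> y \<in> H) \<and>
     (\<forall>a\<in>carrier R. \<forall>x\<in>H. a \<otimes> x \<in> H)"
  unfolding lideal_def by (rule submodule_is_regular_iff[OF ring_axioms is_regular_regular])

lemma rideal_iff: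
  "rideal H \<longleftrightarrow> H \<subseteq> carrier R \<and> \<zero> \<in> H \<and> (\<forall>x\<in>H. \<forall>y\<in>H. x \<oplus> y \<in> H) \<and>
     (\<forall>a\<in>carrier R. \<forall>x\<in>H. x \<otimes> a \<in> H)"
  unfolding rideal_def
  using submodule_is_regular_iff[OF ring_opposite[OF ring_axioms] is_regular_right_mod_regular]
  by simp

lemma lideal_image:
  assumes L: "lideal L" and z: "z \<in> carrier R"
  shows "lideal ((\<lambda>l. l \<otimes> z) ` L)"
  unfolding lideal_iff
proof (intro conjI ballI)
  note L' = L[unfolded lideal_iff]
  show "(\<lambda>l. l \<otimes> z) ` L \<subseteq> carrier R" using L' z by auto
  show "\<zero> \<in> (\<lambda>l. l \<otimes> z) ` L"
    using L' z by (intro image_eqI[of _ _ \<zero>]) auto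
  fix u assume "u \<in> (\<lambda>l. l \<otimes> z) ` L"
  then obtain l where l: "l \<in> L" "l \<in> carrier R" "u = l \<otimes> z" using L' by blast
  show "a \<otimes> u \<in> (\<lambda>l. l \<otimes> z) ` L" if "a \<in> carrier R" for a
    using L' l that z by (intro image_eqI[of _ _ "a \<otimes> l"]) (auto simp: m_assoc)
  fix v assume "v \<in> (\<lambda>l. l \<otimes> z) ` L"
  then obtain l' where l': "l' \<in> L" "l' \<in> carrier R" "v = l' \<otimes> z" using L' by blast
  show "u \<oplus> v \<in> (\<lambda>l. l \<otimes> z) ` L"
    using L' l l' z by (intro image_eqI[of _ _ "l \<oplus> l'"]) (auto simp: l_distr)
qed

lemma minimal_lidealD:
  assumes "minimal_lideal L" "lideal H" "H \<subseteq> L" "x \<in> H" "x \<noteq> \<zero>"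
  shows "H = L"
  using assms unfolding minimal_lideal_def by blast

text \<open>The left multiples of \<open>d\<close> form a nonzero left ideal inside
  \<open>L\<close>, hence all of \<open>L\<close>.\<close>

lemma minimal_lideal_principal:
  assumes L: "minimal_lideal L" and d: "d \<in> L" "d \<noteq> \<zero>" and x: "x \<in> L"
  obtains a where "a \<in> carrier R" "x = a \<otimes> d"
proof -
  have L': "lideal L" using L by (simp add: minimal_lideal_def)
  have dR: "d \<in> carrier R" using L' d(1) by (auto simp: lideal_iff)
  have "(\<lambda>a. a \<otimes> d) ` carrier R = L"
  proof (rule minimal_lidealD[OF L _ _ _ d(2)])
    show "lideal ((\<lambda>a. a \<otimes> d) ` carrier R)"
      by (rule lideal_image[OF _ dR]) (simp add: lideal_iff)
    show "(\<lambda>a. a \<otimes> d) ` carrier R \<subseteq> L"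
      using L' d(1) by (auto simp: lideal_iff)
    show "d \<in> (\<lambda>a. a \<otimes> d) ` carrier R"
      using dR by (intro image_eqI[of _ _ \<one>]) auto
  qed
  then have "x \<in> (\<lambda>a. a \<otimes> d) ` carrier R" using x by simp
  then show thesis using that by blast
qed

text \<open>Brauer's argument. Primeness gives \<open>z\<close> in \<open>L\<close> with
  \<open>x z\<close> nonzero, so that \<open>L z = L\<close> and \<open>z = e z\<close> for some
  \<open>e\<close> in \<open>L\<close>. The elements of \<open>L\<close> that kill \<open>z\<close>
  form a left ideal properly inside \<open>L\<close>, hence zero, and \<open>e e - e\<close> is one
  of them.\<close>

lemma minimal_lideal_idempotent:
  assumes prime: "prime_ring R" and L: "minimal_lideal L"
  obtains e where "e \<in> L" "e \<otimes> e = e" "e \<noteq> \<zero>"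
proof -
  have L': "lideal L" "\<And>x. x \<in> L \<Longrightarrow> x \<in> carrier R" "L \<noteq> {\<zero>}"
    "\<And>a x. a \<in> carrier R \<Longrightarrow> x \<in> L \<Longrightarrow> a \<otimes> x \<in> L" "\<zero> \<in> L"
    "\<And>x y. x \<in> L \<Longrightarrow> y \<in> L \<Longrightarrow> x \<oplus> y \<in> L"
    using L by (auto simp: minimal_lideal_def lideal_iff)
  then obtain x where x: "x \<in> L" "x \<noteq> \<zero>" by blast
  have xR: "x \<in> carrier R" using x(1) by (rule L'(2))
  obtain t where t: "t \<in> carrier R" "x \<otimes> (t \<otimes> x) \<noteq> \<zero>"
    by (rule prime_ringD[OF prime xR xR x(2) x(2)])
  define z where "z = t \<otimes> x"
  have z: "z \<in> L" "z \<in> carrier R" "x \<otimes> z \<noteq> \<zero>"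
    using L' x t xR by (simp_all add: z_def)
  have "(\<lambda>l. l \<otimes> z) ` L = L"
    by (rule minimal_lidealD[OF L lideal_image[OF L'(1) z(2)] _ _ z(3)])
      (use L'(2,4) z x in auto)
  then have "z \<in> (\<lambda>l. l \<otimes> z) ` L" using z(1) by simp
  then obtain e where e: "e \<in> L" "e \<otimes> z = z" by force
  have eR: "e \<in> carrier R" using e(1) by (rule L'(2))
  define N where "N = {l \<in> L. l \<otimes> z = \<zero>}"
  have "lideal N"
    unfolding lideal_iff N_def using L' z by (auto simp: l_distr m_assoc)
  moreover have "N \<subseteq> L" "N \<noteq> L"
    using x(1) z(3) by (auto simp: N_def)
  ultimately have N: "N = {\<zero>}"
    using L unfolding minimal_lideal_def by blast
  have "\<ominus> e = (\<ominus> \<one>) \<otimes> e"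
    using eR by (simp add: l_minus)
  then have "\<ominus> e \<in> L"
    using L'(4)[OF _ e(1), of "\<ominus> \<one>"] by simp
  then have "e \<otimes> e \<oplus> (\<ominus> e) \<in> N"
    unfolding N_def using L'(4,6) e z eR by (simp add: l_distr m_assoc l_minus r_neg)
  then have "e \<otimes> e \<oplus> (\<ominus> e) = \<zero>"
    using N by blast
  then have "e \<otimes> e = e"
    by (rule eq_if_diff_eq_zero) (use eR in simp_all)
  moreover have "e \<noteq> \<zero>"
    using e(2) z xR by auto
  ultimately show thesis
    using that e(1) by blast
qed

text \<open>The right ideal generated by \<open>e\<close> is minimal, too: the nonzero elements of the corner ring
  \<open>eRe\<close> are invertible.\<close>

lemma minimal_lideal_idempotent_right_minimal:
  assumes prime: "prime_ring R" and L: "minimal_lideal L"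
    and e: "e \<in> L" "e \<otimes> e = e" "e \<noteq> \<zero>"
    and x: "x \<in> carrier R" "e \<otimes> x = x" "x \<noteq> \<zero>"
  obtains y where "y \<in> carrier R" "x \<otimes> y = e"
proof -
  have L': "\<And>x. x \<in> L \<Longrightarrow> x \<in> carrier R" "\<And>a x. a \<in> carrier R \<Longrightarrow> x \<in> L \<Longrightarrow> a \<otimes> x \<in> L"
    using L by (auto simp: minimal_lideal_def lideal_iff)
  have eR: "e \<in> carrier R" using e(1) by (rule L')
  \<comment> \<open>Left inverses in the corner: a nonzero \<open>d\<close> of the corner lies in
    \<open>L\<close>, so \<open>e\<close> is a left multiple of it, and the factor can be moved into
    the corner.\<close>
  have inv: "\<exists>a\<in>carrier R. e \<otimes> a = a \<and> a \<otimes> e = a \<and> a \<otimes> d = e"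
    if d: "d \<in> carrier R" "e \<otimes> d = d" "d \<otimes> e = d" "d \<noteq> \<zero>" for d
  proof -
    have "d \<in> L" using L'(2)[OF d(1) e(1)] d(3) by simp
    then obtain a where a: "a \<in> carrier R" "e = a \<otimes> d"
      using minimal_lideal_principal[OF L _ d(4) e(1)] by blast
    have "e \<otimes> a \<otimes> e \<otimes> d = e \<otimes> (a \<otimes> (e \<otimes> d))"
      using eR a(1) d(1) by (simp add: m_assoc)
    also have "\<dots> = e \<otimes> e"
      using d(2) a(2) by simp
    finally have "e \<otimes> a \<otimes> e \<otimes> d = e"
      using e(2) by simp
    moreover have "e \<otimes> (e \<otimes> a \<otimes> e) = e \<otimes> e \<otimes> a \<otimes> e" "e \<otimes> a \<otimes> e \<otimes> e = e \<otimes> a \<otimes> (e \<otimes> e)"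
      using eR a(1) by (simp_all add: m_assoc)
    ultimately show ?thesis
      using e(2) eR a(1) by (intro bexI[of _ "e \<otimes> a \<otimes> e"]) simp_all
  qed
  \<comment> \<open>Primeness brings \<open>x\<close> into the corner: \<open>d = x t e\<close> is
    nonzero there, and a right inverse of \<open>d\<close> yields one of \<open>x\<close>.\<close>
  obtain t where t: "t \<in> carrier R" "x \<otimes> (t \<otimes> e) \<noteq> \<zero>"
    by (rule prime_ringD[OF prime x(1) eR x(3) e(3)])
  define d where "d = x \<otimes> (t \<otimes> e)"
  have "e \<otimes> d = e \<otimes> x \<otimes> (t \<otimes> e)" "d \<otimes> e = x \<otimes> (t \<otimes> (e \<otimes> e))"
    using x(1) t(1) eR by (simp_all add: d_def m_assoc)
  then have d: "d \<in> carrier R" "e \<otimes> d = d" "d \<otimes> e = d" "d \<noteq> \<zero>"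
    using x(1,2) t eR e(2) by (simp_all add: d_def)
  obtain a where a: "a \<in> carrier R" "e \<otimes> a = a" "a \<otimes> e = a" "a \<otimes> d = e"
    using inv[OF d] by blast
  have "a \<noteq> \<zero>"
    using a(4) d(1) e(3) by auto
  then obtain b where b: "b \<in> carrier R" "e \<otimes> b = b" "b \<otimes> e = b" "b \<otimes> a = e"
    using inv[OF a(1-3)] by blast
  \<comment> \<open>From \<open>a d = e\<close> and \<open>b a = e\<close> it follows that
    \<open>b = d\<close>; so the left inverse \<open>a\<close> of \<open>d\<close> is a right
    inverse as well.\<close>
  have "d = b \<otimes> a \<otimes> d"
    using b(4) d(2) by simp
  also have "\<dots> = b"
    using b(1,3) a(1,4) d(1) by (simp add: m_assoc)
  finally have "d \<otimes> a = e"
    using b(4) by simp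
  then have "x \<otimes> (t \<otimes> e \<otimes> a) = e"
    using x(1) t(1) eR a(1) by (simp add: d_def m_assoc)
  then show thesis
    using that[of "t \<otimes> e \<otimes> a"] t(1) eR a(1) by simp
qed

text \<open>\<open>F\<close> collects the idempotents that lie in every nonzero ideal and whose
  right ideal satisfies the descending chain condition. One whose left annihilator is minimal must
  be the unit: otherwise this annihilator contains a minimal left ideal, hence an idempotent
  \<open>g\<close> orthogonal to \<open>f\<close>, and \<open>f + g\<close> belongs to
  \<open>F\<close> with a strictly smaller annihilator. For \<open>f = \<one>\<close> the two
  defining properties of \<open>F\<close> are simplicity and the right chain condition.\<close>

lemma prime_left_artinian_imp_simple_artinian:
  assumes prime: "prime_ring R" and art: "left_artinian R"
  shows "simple_artinian_ring R"
proof -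
  \<comment> \<open>For an idempotent \<open>f\<close>, the equation \<open>f x = x\<close> says
    that \<open>x\<close> lies in the right ideal generated by \<open>f\<close>; so these are the
    chains of right ideals inside it.\<close>
  define dcc where "dcc f \<longleftrightarrow> (\<forall>N :: nat \<Rightarrow> 'a set. (\<forall>i. rideal (N i) \<and> N (Suc i) \<subseteq> N i) \<longrightarrow>
      (\<forall>x\<in>N 0. f \<otimes> x = x) \<longrightarrow> (\<exists>n. \<forall>i\<ge>n. N i = N n))" for f
  define F where "F = {f \<in> carrier R. f \<otimes> f = f \<and> (\<forall>I. ideal I R \<longrightarrow> I \<noteq> {\<zero>} \<longrightarrow> f \<in> I) \<and> dcc f}"
  define ann where "ann f = {a \<in> carrier R. a \<otimes> f = \<zero>}" for f
  have dec: "N j \<subseteq> N i" if "\<And>i. N (Suc i) \<subseteq> N i" "i \<le> j" for N :: "nat \<Rightarrow> 'a set" and i j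
    using lift_Suc_antimono_le[of N, OF that] .
  have ann: "lideal (ann f)" if "f \<in> carrier R" for f
    unfolding lideal_iff ann_def using that by (auto simp: l_distr m_assoc)
  have "\<zero> \<in> F"
  proof -
    have "dcc \<zero>"
      unfolding dcc_def
    proof (intro allI impI)
      fix N :: "nat \<Rightarrow> 'a set"
      assume N: "\<forall>i. rideal (N i) \<and> N (Suc i) \<subseteq> N i" and 0: "\<forall>x\<in>N 0. \<zero> \<otimes> x = x"
      have "N i = {\<zero>}" for i
      proof -
        have sub: "N i \<subseteq> N 0"
          by (rule dec) (simp_all add: N)
        have z: "\<zero> \<in> N i" "N i \<subseteq> carrier R"
          using N by (simp_all add: rideal_iff)
        have "N i \<subseteq> {\<zero>}"
        proof
          fix x assume x: "x \<in> N i"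
          then have "x \<in> carrier R" "\<zero> \<otimes> x = x"
            using z(2) sub 0 by auto
          then show "x \<in> {\<zero>}" by simp
        qed
        with z(1) show ?thesis by (simp add: subset_singleton_iff) force
      qed
      then show "\<exists>n. \<forall>i\<ge>n. N i = N n" by simp
    qed
    then show ?thesis by (simp add: F_def ideal_iff)
  qed
  obtain f where f: "f \<in> F" and min: "\<And>g. \<lbrakk>g \<in> F; ann g \<subseteq> ann f\<rbrakk> \<Longrightarrow> ann g = ann f"
  proof (rule artinian_module_minimal[OF art[unfolded left_artinian_def], of "ann ` F"])
    show "ann ` F \<noteq> {}" using \<open>\<zero> \<in> F\<close> by blast
    show "submodule N R (regular R)" if "N \<in> ann ` F" for N
      using that ann by (auto simp: lideal_def F_def)
    fix N assume N: "N \<in> ann ` F" "\<And>N'. N' \<in> ann ` F \<Longrightarrow> N' \<subseteq> N \<Longrightarrow> N' = N"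
    from N(1) obtain f where "f \<in> F" "N = ann f" by blast
    with N(2) show thesis by (intro that[of f]) blast+
  qed
  have fR: "f \<in> carrier R" and ff: "f \<otimes> f = f" and fI: "\<And>I. \<lbrakk>ideal I R; I \<noteq> {\<zero>}\<rbrakk> \<Longrightarrow> f \<in> I"
    and fdcc: "dcc f"
    using f by (simp_all add: F_def)
  have "ann f = {\<zero>}"
  proof (rule ccontr)
    assume nz: "ann f \<noteq> {\<zero>}"
    obtain L where L: "lideal L" "L \<subseteq> ann f" "L \<noteq> {\<zero>}"
      and Lmin: "\<And>H. \<lbrakk>lideal H; H \<subseteq> ann f; H \<noteq> {\<zero>}; H \<subseteq> L\<rbrakk> \<Longrightarrow> H = L"
    proof (rule artinian_module_minimal[OF art[unfolded left_artinian_def],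
          of "{H. lideal H \<and> H \<subseteq> ann f \<and> H \<noteq> {\<zero>}}"])
      show "{H. lideal H \<and> H \<subseteq> ann f \<and> H \<noteq> {\<zero>}} \<noteq> {}"
        using ann[OF fR] nz by blast
    qed (auto simp: lideal_def intro: that)
    have minL: "minimal_lideal L"
      unfolding minimal_lideal_def using L Lmin by blast
    have LR: "\<And>x. x \<in> L \<Longrightarrow> x \<in> carrier R" and Lm: "\<And>a x. a \<in> carrier R \<Longrightarrow> x \<in> L \<Longrightarrow> a \<otimes> x \<in> L"
      and La: "\<And>x y. x \<in> L \<Longrightarrow> y \<in> L \<Longrightarrow> x \<oplus> y \<in> L"
      using L(1) by (auto simp: lideal_iff)
    obtain e where e: "e \<in> L" "e \<otimes> e = e" "e \<noteq> \<zero>"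
      by (rule minimal_lideal_idempotent[OF prime minL])
    have eR: "e \<in> carrier R" using e(1) by (rule LR)
    have ef: "e \<otimes> f = \<zero>" using e(1) L(2) by (auto simp: ann_def)
    \<comment> \<open>\<open>e f\<close> vanishes but \<open>f e\<close> need not. Subtracting
      \<open>f e\<close> makes both products with \<open>f\<close> vanish and keeps
      \<open>e g = e\<close>, which in turn makes \<open>g\<close> idempotent.\<close>
    define g where "g = e \<oplus> (\<ominus> (f \<otimes> e))"
    have gR: "g \<in> carrier R" using eR fR by (simp add: g_def)
    have efe: "e \<otimes> (f \<otimes> e) = \<zero>"
      using ef eR fR by (simp add: m_assoc[symmetric])
    have eg: "e \<otimes> g = e"
      using eR fR efe e(2) by (simp add: g_def r_distr r_minus)
    have "f \<otimes> (f \<otimes> e) = f \<otimes> e"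
      using ff eR fR by (simp add: m_assoc[symmetric])
    then have fg: "f \<otimes> g = \<zero>"
      using eR fR by (simp add: g_def r_distr r_minus r_neg)
    have gf: "g \<otimes> f = \<zero>"
      using eR fR ef by (simp add: g_def l_distr l_minus m_assoc)
    have "g \<otimes> g = e \<otimes> g \<oplus> (\<ominus> (f \<otimes> (e \<otimes> g)))"
      using eR fR gR by (simp add: l_distr l_minus m_assoc g_def)
    then have gg: "g \<otimes> g = g"
      unfolding eg by (simp add: g_def)
    have g0: "g \<noteq> \<zero>"
      using eg e(3) eR by auto
    have "\<ominus> (f \<otimes> e) = (\<ominus> f) \<otimes> e"
      using eR fR by (simp add: l_minus)
    then have gL: "g \<in> L"
      using La[OF e(1) Lm[OF _ e(1), of "\<ominus> f"]] fR by (simp add: g_def)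
    define h where "h = f \<oplus> g"
    have hR: "h \<in> carrier R" using fR gR by (simp add: h_def)
    have hh: "h \<otimes> h = h"
      using fR gR ff gg fg gf by (simp add: h_def l_distr r_distr)
    have "h \<in> I" if I: "ideal I R" "I \<noteq> {\<zero>}" for I
    proof -
      note I' = I(1)[unfolded ideal_iff]
      obtain i where i: "i \<in> I" "i \<noteq> \<zero>" using I' I(2) by blast
      have iR: "i \<in> carrier R" using i(1) I' by blast
      \<comment> \<open>\<open>i t g\<close> is a nonzero element of both \<open>I\<close> and
        \<open>L\<close>, so minimality puts all of \<open>L\<close>, and with it \<open>g\<close>,
        inside \<open>I\<close>.\<close>
      obtain t where t: "t \<in> carrier R" "i \<otimes> (t \<otimes> g) \<noteq> \<zero>"
        by (rule prime_ringD[OF prime iR gR i(2) g0])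
      have "I \<inter> L = L"
      proof (rule minimal_lidealD[OF minL _ _ _ t(2)])
        show "lideal (I \<inter> L)"
          using I' L(1) by (simp add: lideal_iff le_infI1)
        have "t \<otimes> g \<in> L" using Lm t(1) gL by blast
        moreover have "i \<otimes> (t \<otimes> g) \<in> I" using I' i(1) t(1) gR by simp
        ultimately show "i \<otimes> (t \<otimes> g) \<in> I \<inter> L" using Lm iR by blast
      qed simp
      then have "g \<in> I" using gL by blast
      then show ?thesis
        using fI[OF I] I' by (simp add: h_def)
    qed
    moreover have "dcc h"
      unfolding dcc_def
    proof (intro allI impI)
      fix N :: "nat \<Rightarrow> 'a set"
      assume N: "\<forall>i. rideal (N i) \<and> N (Suc i) \<subseteq> N i" and h: "\<forall>x\<in>N 0. h \<otimes> x = x"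
      have N_dec: "N j \<subseteq> N i" if "i \<le> j" for i j
        by (rule dec[OF _ that]) (simp add: N)
      have NR: "\<And>i x. x \<in> N i \<Longrightarrow> x \<in> carrier R" and N0: "\<And>i. \<zero> \<in> N i"
        and Na: "\<And>i x y. x \<in> N i \<Longrightarrow> y \<in> N i \<Longrightarrow> x \<oplus> y \<in> N i"
        and Nm: "\<And>i a x. a \<in> carrier R \<Longrightarrow> x \<in> N i \<Longrightarrow> x \<otimes> a \<in> N i"
        using N by (simp_all add: rideal_iff subset_iff)
      \<comment> \<open>A chain below \<open>h = f + g\<close> is controlled by two others: its
        images under \<open>f\<close>, which are stationary since \<open>f\<close> is in
        \<open>F\<close>, and its parts \<open>B\<close> fixed by \<open>g\<close>. As
        \<open>g\<close> generates a minimal right ideal, each \<open>B i\<close> is zero or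
        everything.\<close>
      define A where "A i = (\<lambda>x. f \<otimes> x) ` N i" for i
      have "rideal (A i)" for i
        unfolding rideal_iff
      proof (intro conjI ballI)
        show "A i \<subseteq> carrier R" using NR fR by (auto simp: A_def)
        show "\<zero> \<in> A i"
          using N0 fR unfolding A_def by (intro image_eqI[of _ _ \<zero>]) auto
        fix u assume "u \<in> A i"
        then obtain x where x: "x \<in> N i" "u = f \<otimes> x" by (auto simp: A_def)
        show "u \<otimes> a \<in> A i" if "a \<in> carrier R" for a
          using Nm[OF that x(1)] that NR[OF x(1)] fR x(2) unfolding A_def
          by (intro image_eqI[of _ _ "x \<otimes> a"]) (auto simp: m_assoc)
        fix v assume "v \<in> A i"
        then obtain y where y: "y \<in> N i" "v = f \<otimes> y" by (auto simp: A_def)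
        show "u \<oplus> v \<in> A i"
          using Na[OF x(1) y(1)] NR[OF x(1)] NR[OF y(1)] fR x(2) y(2) unfolding A_def
          by (intro image_eqI[of _ _ "x \<oplus> y"]) (auto simp: r_distr)
      qed
      moreover have "A (Suc i) \<subseteq> A i" for i
        using N by (auto simp: A_def)
      moreover have "f \<otimes> x = x" if "x \<in> A 0" for x
        using that NR fR ff by (auto simp: A_def m_assoc[symmetric])
      ultimately have "\<exists>n. \<forall>i\<ge>n. A i = A n"
        by (intro fdcc[unfolded dcc_def, THEN spec, THEN mp, THEN mp]) simp_all
      then obtain n where n: "\<forall>i\<ge>n. A i = A n" ..
      define B where "B i = {x \<in> N i. g \<otimes> x = x}" for i
      have B: "B i = {\<zero>} \<or> B i = {x \<in> carrier R. g \<otimes> x = x}" for i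
      proof (cases "B i = {\<zero>}")
        case False
        moreover have "\<zero> \<in> B i" using N0 gR by (simp add: B_def)
        ultimately obtain x where x: "x \<in> N i" "g \<otimes> x = x" "x \<noteq> \<zero>"
          by (auto simp: B_def)
        obtain y where y: "y \<in> carrier R" "x \<otimes> y = g"
          by (rule minimal_lideal_idempotent_right_minimal[OF prime minL gL gg g0 NR[OF x(1)] x(2,3)])
        have "g \<in> N i" using Nm[OF y(1) x(1)] y(2) by simp
        then have "x \<in> N i" if "x \<in> carrier R" "g \<otimes> x = x" for x
          using Nm[OF that(1) \<open>g \<in> N i\<close>] that(2) by simp
        then show ?thesis using NR by (auto simp: B_def)
      qed simp
      have B_dec: "B j \<subseteq> B i" if "i \<le> j" for i j
        using N_dec[OF that] by (auto simp: B_def)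
      obtain m where m: "\<And>i. i \<ge> m \<Longrightarrow> B i = B m"
      proof (cases "\<exists>m. B m = {\<zero>}")
        case True
        then obtain m where m: "B m = {\<zero>}" by blast
        have "B i = B m" if "i \<ge> m" for i
          using B_dec[OF that] N0 gR m by (auto simp: B_def)
        then show thesis by (rule that)
      next
        case False
        then show thesis using that[of 0] B by metis
      qed
      \<comment> \<open>Beyond both indices, \<open>x\<close> in \<open>N i\<close> has the same
        image under \<open>f\<close> as some \<open>y\<close> in \<open>N j\<close>. Their
        difference is fixed by \<open>h\<close> and killed by \<open>f\<close>, hence fixed by
        \<open>g\<close>, and so it lies in \<open>B j\<close>.\<close>
      have "N i \<subseteq> N j" if ij: "max n m \<le> i" "max n m \<le> j" for i j
      proof
        fix x assume x: "x \<in> N i"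
        have "A i = A n" "A j = A n"
          by (rule n[THEN spec, THEN mp]; use ij in simp)+
        then have Aij: "A i = A j" by simp
        have "B (max n m) = B m" "B j = B m"
          by (rule m; use ij in simp)+
        then have Bij: "B (max n m) = B j" by simp
        have "f \<otimes> x \<in> A j" unfolding Aij[symmetric] using x by (simp add: A_def)
        then obtain y where y: "y \<in> N j" "f \<otimes> x = f \<otimes> y" by (auto simp: A_def)
        define z where "z = x \<oplus> (\<ominus> y)"
        have xy: "x \<in> N (max n m)" "y \<in> N (max n m)"
          using N_dec[OF ij(1)] N_dec[OF ij(2)] x y by blast+
        have R: "x \<in> carrier R" "y \<in> carrier R"
          using x y NR by blast+
        have "y \<otimes> (\<ominus> \<one>) \<in> N (max n m)"
          using Nm[OF _ xy(2)] by simp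
        then have z: "z \<in> N (max n m)"
          unfolding z_def using Na[OF xy(1)] R by (simp add: r_minus)
        then have "h \<otimes> z = z"
          using h N_dec[of 0 "max n m"] by blast
        moreover have "f \<otimes> z = \<zero>"
          using R fR y(2) by (simp add: z_def r_distr r_minus r_neg)
        ultimately have "g \<otimes> z = z"
          using fR gR NR[OF z] by (simp add: h_def l_distr)
        then have "z \<in> B (max n m)"
          using z by (simp add: B_def)
        then have "z \<in> B j"
          by (simp only: Bij)
        then have "z \<oplus> y \<in> N j"
          using Na y(1) by (simp add: B_def)
        then show "x \<in> N j"
          using R by (simp add: z_def a_assoc l_neg)
      qed
      then show "\<exists>n. \<forall>i\<ge>n. N i = N n"
        by (intro exI[of _ "max n m"] allI impI equalityI) simp_all
    qed
    ultimately have "h \<in> F"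
      using hR hh by (simp add: F_def)
    moreover have "ann h \<subseteq> ann f"
    proof
      fix a assume a: "a \<in> ann h"
      then have aR: "a \<in> carrier R" "a \<otimes> h = \<zero>" by (simp_all add: ann_def)
      have hf: "h \<otimes> f = f" using fR gR ff gf by (simp add: h_def l_distr)
      have "a \<otimes> (h \<otimes> f) = \<zero>"
        using m_assoc[OF aR(1) hR fR] aR(2) fR by simp
      then show "a \<in> ann f"
        using aR(1) hf by (simp add: ann_def)
    qed
    ultimately have "ann h = ann f" by (rule min)
    \<comment> \<open>\<open>g\<close> annihilates \<open>f\<close> but not \<open>h\<close>, since
      \<open>g h = g\<close>; so the annihilator did become strictly smaller.\<close>
    then have "g \<in> ann h" using gR gf by (simp add: ann_def)
    moreover have "g \<otimes> h = g" using gR fR gf gg by (simp add: h_def r_distr)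
    ultimately show False
      using g0 by (auto simp: ann_def)
  qed
  moreover have "\<one> \<oplus> (\<ominus> f) \<in> ann f"
    using fR ff by (simp add: ann_def l_distr l_minus r_neg)
  ultimately have "\<one> \<oplus> (\<ominus> f) = \<zero>" by blast
  then have f1: "f = \<one>"
    by (rule eq_if_diff_eq_zero[symmetric]) (use fR in simp_all)
  show ?thesis
    unfolding simple_artinian_ring_def
  proof (intro conjI allI impI ring_axioms art)
    show "carrier R \<noteq> {\<zero>}"
      using prime by (simp add: prime_ring_def)
    show "I = {\<zero>} \<or> I = carrier R" if "ideal I R" for I
      using fI[OF that] f1 ideal.one_imp_carrier[OF that] by blast
    show "right_artinian R"
      unfolding right_artinian_def artinian_module_def rideal_def[symmetric]
    proof (intro allI impI)
      fix N :: "nat \<Rightarrow> 'a set"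
      assume N: "\<forall>i. rideal (N i) \<and> N (Suc i) \<subseteq> N i"
      then have "\<forall>x\<in>N 0. f \<otimes> x = x"
        by (simp add: f1 rideal_iff subset_iff)
      with N show "\<exists>n. \<forall>i\<ge>n. N i = N n"
        by (intro fdcc[unfolded dcc_def, THEN spec, THEN mp, THEN mp])
    qed
  qed
qed

end

section \<open>Direct sums\<close>

lemma direct_sum_sel:
  "f \<in> carrier (direct_sum K I) \<longleftrightarrow> f \<in> I \<rightarrow>\<^sub>E carrier K \<and> finite {i \<in> I. f i \<noteq> \<zero>\<^bsub>K\<^esub>}"
  "\<zero>\<^bsub>direct_sum K I\<^esub> = (\<lambda>i\<in>I. \<zero>\<^bsub>K\<^esub>)"
  "f \<oplus>\<^bsub>direct_sum K I\<^esub> g = (\<lambda>i\<in>I. f i \<oplus>\<^bsub>K\<^esub> g i)"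
  "t \<odot>\<^bsub>direct_sum K I\<^esub> f = (\<lambda>i\<in>I. t \<odot>\<^bsub>K\<^esub> f i)"
  by (simp_all add: direct_sum_def)

lemma direct_sum_mem: "\<lbrakk>f \<in> carrier (direct_sum K I); i \<in> I\<rbrakk> \<Longrightarrow> f i \<in> carrier K"
  by (auto simp: direct_sum_sel)

context left_module
begin

lemma direct_sum_add_closed:
  assumes f: "f \<in> carrier (direct_sum M I)" and g: "g \<in> carrier (direct_sum M I)"
  shows "f \<oplus>\<^bsub>direct_sum M I\<^esub> g \<in> carrier (direct_sum M I)"
proof -
  have "{i \<in> I. (f \<oplus>\<^bsub>direct_sum M I\<^esub> g) i \<noteq> \<zero>\<^bsub>M\<^esub>} \<subseteq> {i \<in> I. f i \<noteq> \<zero>\<^bsub>M\<^esub>} \<union> {i \<in> I. g i \<noteq> \<zero>\<^bsub>M\<^esub>}"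
    by (auto simp: direct_sum_sel)
  moreover have "finite ({i \<in> I. f i \<noteq> \<zero>\<^bsub>M\<^esub>} \<union> {i \<in> I. g i \<noteq> \<zero>\<^bsub>M\<^esub>})"
    using f g by (simp add: direct_sum_sel)
  ultimately have "finite {i \<in> I. (f \<oplus>\<^bsub>direct_sum M I\<^esub> g) i \<noteq> \<zero>\<^bsub>M\<^esub>}"
    by (rule finite_subset)
  then show ?thesis
    using direct_sum_mem[OF f] direct_sum_mem[OF g] by (simp add: direct_sum_sel)
qed

lemma direct_sum_smult_closed:
  assumes t: "t \<in> carrier T" and f: "f \<in> carrier (direct_sum M I)"
  shows "t \<odot>\<^bsub>direct_sum M I\<^esub> f \<in> carrier (direct_sum M I)"
proof -
  have "{i \<in> I. (t \<odot>\<^bsub>direct_sum M I\<^esub> f) i \<noteq> \<zero>\<^bsub>M\<^esub>} \<subseteq> {i \<in> I. f i \<noteq> \<zero>\<^bsub>M\<^esub>}"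
    using t by (auto simp: direct_sum_sel)
  moreover have "finite {i \<in> I. f i \<noteq> \<zero>\<^bsub>M\<^esub>}"
    using f by (simp add: direct_sum_sel)
  ultimately have "finite {i \<in> I. (t \<odot>\<^bsub>direct_sum M I\<^esub> f) i \<noteq> \<zero>\<^bsub>M\<^esub>}"
    by (rule finite_subset)
  then show ?thesis
    using direct_sum_mem[OF f] t by (simp add: direct_sum_sel lsmult_closed)
qed

lemma left_module_direct_sum: "left_module T (direct_sum M I)"
proof (rule left_moduleI[OF T.ring_axioms])
  have zero: "\<zero>\<^bsub>direct_sum M I\<^esub> \<in> carrier (direct_sum M I)"
    by (simp add: direct_sum_sel)
  show "abelian_group (direct_sum M I)"
  proof (rule abelian_groupI)
    fix f assume f: "f \<in> carrier (direct_sum M I)"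
    note fm = direct_sum_mem[OF f]
    have "(\<ominus>\<^bsub>T\<^esub> \<one>\<^bsub>T\<^esub>) \<odot>\<^bsub>direct_sum M I\<^esub> f \<oplus>\<^bsub>direct_sum M I\<^esub> f = \<zero>\<^bsub>direct_sum M I\<^esub>"
      unfolding direct_sum_sel(2-4)
      by (rule restrict_ext) (simp add: fm lsmult_minus_left lsmult_one M.l_neg)
    moreover have "(\<ominus>\<^bsub>T\<^esub> \<one>\<^bsub>T\<^esub>) \<odot>\<^bsub>direct_sum M I\<^esub> f \<in> carrier (direct_sum M I)"
      using direct_sum_smult_closed[OF _ f] by simp
    ultimately show "\<exists>g\<in>carrier (direct_sum M I). g \<oplus>\<^bsub>direct_sum M I\<^esub> f = \<zero>\<^bsub>direct_sum M I\<^esub>" ..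
    have "(\<lambda>i\<in>I. (\<lambda>i\<in>I. \<zero>\<^bsub>M\<^esub>) i \<oplus>\<^bsub>M\<^esub> f i) = restrict f I"
      by (rule restrict_ext) (simp add: fm)
    then show "\<zero>\<^bsub>direct_sum M I\<^esub> \<oplus>\<^bsub>direct_sum M I\<^esub> f = f"
      using PiE_restrict[of f I "\<lambda>_. carrier M"] f unfolding direct_sum_sel by (auto simp only:)
    fix g assume g: "g \<in> carrier (direct_sum M I)"
    note gm = direct_sum_mem[OF g]
    show "f \<oplus>\<^bsub>direct_sum M I\<^esub> g \<in> carrier (direct_sum M I)"
      by (rule direct_sum_add_closed[OF f g])
    show "f \<oplus>\<^bsub>direct_sum M I\<^esub> g = g \<oplus>\<^bsub>direct_sum M I\<^esub> f"
      unfolding direct_sum_sel by (rule restrict_ext) (simp add: fm gm M.a_comm)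
    fix h assume h: "h \<in> carrier (direct_sum M I)"
    show "f \<oplus>\<^bsub>direct_sum M I\<^esub> g \<oplus>\<^bsub>direct_sum M I\<^esub> h = f \<oplus>\<^bsub>direct_sum M I\<^esub> (g \<oplus>\<^bsub>direct_sum M I\<^esub> h)"
      unfolding direct_sum_sel by (rule restrict_ext) (simp add: fm gm direct_sum_mem[OF h] M.a_assoc)
  qed (rule zero)
  fix a f assume a: "a \<in> carrier T" and f: "f \<in> carrier (direct_sum M I)"
  note fm = direct_sum_mem[OF f]
  show "a \<odot>\<^bsub>direct_sum M I\<^esub> f \<in> carrier (direct_sum M I)"
    by (rule direct_sum_smult_closed[OF a f])
  show "a \<odot>\<^bsub>direct_sum M I\<^esub> (f \<oplus>\<^bsub>direct_sum M I\<^esub> g) = a \<odot>\<^bsub>direct_sum M I\<^esub> f \<oplus>\<^bsub>direct_sum M I\<^esub> a \<odot>\<^bsub>direct_sum M I\<^esub> g"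
    if g: "g \<in> carrier (direct_sum M I)" for g
    unfolding direct_sum_sel by (rule restrict_ext) (simp add: a fm direct_sum_mem[OF g] lsmult_r_distr)
  fix b assume b: "b \<in> carrier T"
  show "(a \<oplus>\<^bsub>T\<^esub> b) \<odot>\<^bsub>direct_sum M I\<^esub> f = a \<odot>\<^bsub>direct_sum M I\<^esub> f \<oplus>\<^bsub>direct_sum M I\<^esub> b \<odot>\<^bsub>direct_sum M I\<^esub> f"
    unfolding direct_sum_sel by (rule restrict_ext) (simp add: a b fm lsmult_l_distr)
  show "(a \<otimes>\<^bsub>T\<^esub> b) \<odot>\<^bsub>direct_sum M I\<^esub> f = a \<odot>\<^bsub>direct_sum M I\<^esub> (b \<odot>\<^bsub>direct_sum M I\<^esub> f)"
    unfolding direct_sum_sel by (rule restrict_ext) (simp add: a b fm lsmult_assoc)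
next
  fix f assume f: "f \<in> carrier (direct_sum M I)"
  have "(\<lambda>i\<in>I. \<one>\<^bsub>T\<^esub> \<odot>\<^bsub>M\<^esub> f i) = restrict f I"
    by (rule restrict_ext) (simp add: direct_sum_mem[OF f] lsmult_one)
  then show "\<one>\<^bsub>T\<^esub> \<odot>\<^bsub>direct_sum M I\<^esub> f = f"
    using PiE_restrict[of f I "\<lambda>_. carrier M"] f unfolding direct_sum_sel by (auto simp only:)
qed

end

definition direct_sum_lift ::
    "('t, 'k, 'y) module_scheme \<Rightarrow> ('t, 'm, 'z) module_scheme \<Rightarrow> 'i set \<Rightarrow> ('i \<Rightarrow> 'k \<Rightarrow> 'm) \<Rightarrow> ('i \<Rightarrow> 'k) \<Rightarrow> 'm"
  where "direct_sum_lift K M I u f = (\<Oplus>\<^bsub>M\<^esub>j\<in>{j \<in> I. f j \<noteq> \<zero>\<^bsub>K\<^esub>}. u j (f j))"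

context
  fixes T :: "('t, 'x) ring_scheme" and K :: "('t, 'k, 'y) module_scheme"
    and M :: "('t, 'm, 'z) module_scheme" and I :: "'i set" and u :: "'i \<Rightarrow> 'k \<Rightarrow> 'm"
  assumes K: "left_module T K" and M: "left_module T M"
    and u: "\<And>j. j \<in> I \<Longrightarrow> u j \<in> mod_hom T K M"
begin

interpretation K: left_module T K by (rule K)
interpretation M: left_module T M by (rule M)

text \<open>Indices outside the support contribute zero. Additivity needs this freedom, because the
  supports of two summands and of their sum differ.\<close>

lemma direct_sum_lift_superset:
  assumes f: "f \<in> carrier (direct_sum K I)" and J: "finite J" "{j \<in> I. f j \<noteq> \<zero>\<^bsub>K\<^esub>} \<subseteq> J" "J \<subseteq> I"
  shows "direct_sum_lift K M I u f = (\<Oplus>\<^bsub>M\<^esub>j\<in>J. u j (f j))"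
  unfolding direct_sum_lift_def
proof (rule M.M.add.finprod_mono_neutral_cong_left[OF J(1,2)])
  show "u j (f j) = \<zero>\<^bsub>M\<^esub>" if j: "j \<in> J - {j \<in> I. f j \<noteq> \<zero>\<^bsub>K\<^esub>}" for j
  proof -
    have "j \<in> I" "f j = \<zero>\<^bsub>K\<^esub>" using j J(3) by auto
    then show ?thesis
      using K.mod_hom_zero[OF u M.M.abelian_group_axioms] by simp
  qed
  show "(\<lambda>j. u j (f j)) \<in> J \<rightarrow> carrier M"
    using J(3) mod_hom_closed[OF u direct_sum_mem[OF f]] by auto
qed simp

lemma direct_sum_lift_mod_hom: "direct_sum_lift K M I u \<in> mod_hom T (direct_sum K I) M"
  unfolding mod_hom_iff
proof (intro conjI ballI)
  let ?s = "\<lambda>f. {j \<in> I. f j \<noteq> \<zero>\<^bsub>K\<^esub>}"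
  fix f assume f: "f \<in> carrier (direct_sum K I)"
  note fu = mod_hom_closed[OF u direct_sum_mem[OF f]]
  have fin: "finite (?s f)" using f by (simp add: direct_sum_sel)
  show "direct_sum_lift K M I u f \<in> carrier M"
    unfolding direct_sum_lift_def using fu by (intro M.M.finsum_closed) auto
  show "direct_sum_lift K M I u (t \<odot>\<^bsub>direct_sum K I\<^esub> f) = t \<odot>\<^bsub>M\<^esub> direct_sum_lift K M I u f"
    if t: "t \<in> carrier T" for t
  proof -
    have "direct_sum_lift K M I u (t \<odot>\<^bsub>direct_sum K I\<^esub> f) = (\<Oplus>\<^bsub>M\<^esub>j\<in>?s f. u j ((t \<odot>\<^bsub>direct_sum K I\<^esub> f) j))"
      by (rule direct_sum_lift_superset[OF K.direct_sum_smult_closed[OF t f] fin])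
        (use t in \<open>auto simp: direct_sum_sel\<close>)
    also have "\<dots> = (\<Oplus>\<^bsub>M\<^esub>j\<in>?s f. t \<odot>\<^bsub>M\<^esub> u j (f j))"
      by (rule M.M.finsum_cong')
        (use t fu direct_sum_mem[OF f] in \<open>auto simp: direct_sum_sel M.lsmult_closed mod_hom_smult[OF u]\<close>)
    also have "\<dots> = t \<odot>\<^bsub>M\<^esub> direct_sum_lift K M I u f"
      unfolding direct_sum_lift_def using fu by (intro M.lsmult_finsum[OF t fin, symmetric]) auto
    finally show ?thesis .
  qed
  fix g assume g: "g \<in> carrier (direct_sum K I)"
  note gu = mod_hom_closed[OF u direct_sum_mem[OF g]]
  have J: "finite (?s f \<union> ?s g)" "?s f \<union> ?s g \<subseteq> I"
    using f g by (auto simp: direct_sum_sel)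
  have "direct_sum_lift K M I u (f \<oplus>\<^bsub>direct_sum K I\<^esub> g) =
      (\<Oplus>\<^bsub>M\<^esub>j\<in>?s f \<union> ?s g. u j ((f \<oplus>\<^bsub>direct_sum K I\<^esub> g) j))"
    by (rule direct_sum_lift_superset[OF K.direct_sum_add_closed[OF f g] J(1) _ J(2)])
      (auto simp: direct_sum_sel)
  also have "\<dots> = (\<Oplus>\<^bsub>M\<^esub>j\<in>?s f \<union> ?s g. u j (f j) \<oplus>\<^bsub>M\<^esub> u j (g j))"
    by (rule M.M.finsum_cong')
      (use fu gu direct_sum_mem[OF f] direct_sum_mem[OF g] in \<open>auto simp: direct_sum_sel mod_hom_add[OF u]\<close>)
  also have "\<dots> = (\<Oplus>\<^bsub>M\<^esub>j\<in>?s f \<union> ?s g. u j (f j)) \<oplus>\<^bsub>M\<^esub> (\<Oplus>\<^bsub>M\<^esub>j\<in>?s f \<union> ?s g. u j (g j))"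
    by (rule M.M.finsum_addf) (use fu gu in auto)
  also have "\<dots> = direct_sum_lift K M I u f \<oplus>\<^bsub>M\<^esub> direct_sum_lift K M I u g"
    using direct_sum_lift_superset[OF f J(1) _ J(2)] direct_sum_lift_superset[OF g J(1) _ J(2)] by simp
  finally show "direct_sum_lift K M I u (f \<oplus>\<^bsub>direct_sum K I\<^esub> g) =
      direct_sum_lift K M I u f \<oplus>\<^bsub>M\<^esub> direct_sum_lift K M I u g" .
qed

text \<open>The preimage is the element concentrated at the index \<open>j\<close> with value
  \<open>k\<close>.\<close>

lemma direct_sum_lift_image:
  assumes j: "j \<in> I" and k: "k \<in> carrier K"
  shows "u j k \<in> direct_sum_lift K M I u ` carrier (direct_sum K I)"
proof -
  define f where "f = (\<lambda>i\<in>I. if i = j then k else \<zero>\<^bsub>K\<^esub>)"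
  have s: "{i \<in> I. f i \<noteq> \<zero>\<^bsub>K\<^esub>} \<subseteq> {j}"
    by (auto simp: f_def)
  then have f: "f \<in> carrier (direct_sum K I)"
    using finite_subset[OF s] k by (auto simp: direct_sum_sel f_def)
  have "direct_sum_lift K M I u f = (\<Oplus>\<^bsub>M\<^esub>i\<in>{j}. u i (f i))"
    by (rule direct_sum_lift_superset[OF f _ s]) (use j in simp_all)
  moreover have "f j = k"
    using j by (simp add: f_def)
  ultimately have "direct_sum_lift K M I u f = u j k"
    using mod_hom_closed[OF u[OF j] k] by simp
  then show ?thesis using f by (metis imageI)
qed

end

section \<open>Commuting module structures\<close>

text \<open>
  A left \<open>S\<close>-module and a left \<open>U\<close>-module on the same abelian group, with commuting
  actions.  For a coring, \<open>S\<close> is the left dual ring and \<open>U\<close> the opposite of the right one.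
\<close>

locale commuting_modules = L: left_module S L + N: left_module U N
  for S (structure) and L :: "('s, 'm, 'y) module_scheme"
    and U :: "('u, 'z) ring_scheme" and N :: "('u, 'm, 'w) module_scheme" +
  assumes same_carrier: "carrier N = carrier L" and same_zero: "\<zero>\<^bsub>N\<^esub> = \<zero>\<^bsub>L\<^esub>" and same_add: "add N = add L"
    and commute: "\<lbrakk>s \<in> carrier S; u \<in> carrier U; x \<in> carrier L\<rbrakk>
      \<Longrightarrow> s \<odot>\<^bsub>L\<^esub> (u \<odot>\<^bsub>N\<^esub> x) = u \<odot>\<^bsub>N\<^esub> (s \<odot>\<^bsub>L\<^esub> x)"
    and nonzero: "carrier L \<noteq> {\<zero>\<^bsub>L\<^esub>}"
    and faithful: "\<lbrakk>s \<in> carrier S; \<And>x. x \<in> carrier L \<Longrightarrow> s \<odot>\<^bsub>L\<^esub> x = \<zero>\<^bsub>L\<^esub>\<rbrakk> \<Longrightarrow> s = \<zero>\<^bsub>S\<^esub>"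
    and annihilated: "\<lbrakk>submodule K S L; submodule K U N; K \<noteq> carrier L\<rbrakk>
      \<Longrightarrow> \<exists>s\<in>carrier S. s \<noteq> \<zero>\<^bsub>S\<^esub> \<and> (\<forall>x\<in>K. s \<odot>\<^bsub>L\<^esub> x = \<zero>\<^bsub>L\<^esub>)"
begin

definition subbimodule :: "'m set \<Rightarrow> bool"
  where "subbimodule K \<longleftrightarrow> submodule K S L \<and> submodule K U N"

definition simple :: bool
  where "simple \<longleftrightarrow> (\<forall>K. subbimodule K \<longrightarrow> K = {\<zero>\<^bsub>L\<^esub>} \<or> K = carrier L)"

text \<open>Full coprimeness for the comodule whose endomorphisms are the actions of the elements
  of \<open>U\<close>.\<close>

definition fully_coprime :: bool
  where "fully_coprime \<longleftrightarrow> (\<forall>X Y. subbimodule X \<longrightarrow> subbimodule Y \<longrightarrow>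
    (\<forall>u\<in>carrier U. (\<forall>x\<in>X. u \<odot>\<^bsub>N\<^esub> x = \<zero>\<^bsub>L\<^esub>) \<longrightarrow> (\<forall>c\<in>carrier L. u \<odot>\<^bsub>N\<^esub> c \<in> Y)) \<longrightarrow>
    X = carrier L \<or> Y = carrier L)"

lemma u_closed [simp]: "\<lbrakk>u \<in> carrier U; x \<in> carrier L\<rbrakk> \<Longrightarrow> u \<odot>\<^bsub>N\<^esub> x \<in> carrier L"
  using N.lsmult_closed by (simp add: same_carrier)

lemma s_closed [simp]: "\<lbrakk>s \<in> carrier S; x \<in> carrier L\<rbrakk> \<Longrightarrow> s \<odot>\<^bsub>L\<^esub> x \<in> carrier L"
  by (rule L.lsmult_closed)

lemma u_add: "\<lbrakk>u \<in> carrier U; x \<in> carrier L; y \<in> carrier L\<rbrakk>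
    \<Longrightarrow> u \<odot>\<^bsub>N\<^esub> (x \<oplus>\<^bsub>L\<^esub> y) = u \<odot>\<^bsub>N\<^esub> x \<oplus>\<^bsub>L\<^esub> u \<odot>\<^bsub>N\<^esub> y"
  using N.lsmult_r_distr by (simp add: same_carrier same_add)

lemma u_zero [simp]: "u \<in> carrier U \<Longrightarrow> u \<odot>\<^bsub>N\<^esub> \<zero>\<^bsub>L\<^esub> = \<zero>\<^bsub>L\<^esub>"
  using N.lsmult_zero_right by (simp add: same_zero)

lemma subbimodule_iff:
  "subbimodule K \<longleftrightarrow> K \<subseteq> carrier L \<and> \<zero>\<^bsub>L\<^esub> \<in> K \<and> (\<forall>x\<in>K. \<forall>y\<in>K. x \<oplus>\<^bsub>L\<^esub> y \<in> K) \<and>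
     (\<forall>s\<in>carrier S. \<forall>x\<in>K. s \<odot>\<^bsub>L\<^esub> x \<in> K) \<and> (\<forall>u\<in>carrier U. \<forall>x\<in>K. u \<odot>\<^bsub>N\<^esub> x \<in> K)"
  unfolding subbimodule_def L.submodule_iff N.submodule_iff same_carrier same_zero same_add by auto

lemma subbimodule_zero: "subbimodule {\<zero>\<^bsub>L\<^esub>}"
  by (simp add: subbimodule_iff)

text \<open>The largest subbimodule that \<open>x\<close> carries into \<open>X\<close>: quantifying
  over \<open>t\<close> gives stability under \<open>S\<close>, and commuting actions give stability
  under \<open>U\<close>. It mediates between products in the ring and subbimodules.\<close>

lemma subbimodule_colon:
  assumes X: "subbimodule X" and x: "x \<in> carrier S"
  shows "subbimodule {c \<in> carrier L. \<forall>t\<in>carrier S. x \<odot>\<^bsub>L\<^esub> (t \<odot>\<^bsub>L\<^esub> c) \<in> X}" (is "subbimodule ?W")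
  unfolding subbimodule_iff
proof (intro conjI ballI)
  note X' = X[unfolded subbimodule_iff]
  show "\<zero>\<^bsub>L\<^esub> \<in> ?W" using x X' by simp
  show "c \<oplus>\<^bsub>L\<^esub> d \<in> ?W" if "c \<in> ?W" "d \<in> ?W" for c d
    using that x X' by (simp add: L.lsmult_r_distr)
  fix c assume c: "c \<in> ?W"
  show "s \<odot>\<^bsub>L\<^esub> c \<in> ?W" if s: "s \<in> carrier S" for s
  proof -
    have "x \<odot>\<^bsub>L\<^esub> (t \<odot>\<^bsub>L\<^esub> (s \<odot>\<^bsub>L\<^esub> c)) \<in> X" if t: "t \<in> carrier S" for t
    proof -
      have "x \<odot>\<^bsub>L\<^esub> ((t \<otimes> s) \<odot>\<^bsub>L\<^esub> c) \<in> X" using c s t by simp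
      then show ?thesis using c s t by (simp add: L.lsmult_assoc)
    qed
    then show ?thesis using c s by simp
  qed
  show "u \<odot>\<^bsub>N\<^esub> c \<in> ?W" if u: "u \<in> carrier U" for u
    using c x u X' by (simp add: commute)
qed auto

lemma nonzero_element:
  obtains c where "c \<in> carrier L" "c \<noteq> \<zero>\<^bsub>L\<^esub>"
proof (rule ccontr)
  assume "\<not> thesis"
  with that have "carrier L \<subseteq> {\<zero>\<^bsub>L\<^esub>}" by (metis insertI1 subsetI)
  with L.M.zero_closed have "carrier L = {\<zero>\<^bsub>L\<^esub>}" by (intro equalityI) simp_all
  with nonzero show False ..
qed

lemma carrier_S_nonzero: "carrier S \<noteq> {\<zero>}"
proof
  assume *: "carrier S = {\<zero>}"
  then have 1: "\<one> = \<zero>" using L.T.one_closed by simp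
  obtain c where c: "c \<in> carrier L" "c \<noteq> \<zero>\<^bsub>L\<^esub>" by (rule nonzero_element)
  then show False
    using L.lsmult_one[OF c(1)] L.lsmult_zero_left[OF c(1)] 1 by simp
qed

text \<open>If \<open>x S y = 0\<close>, the subbimodule of all \<open>c\<close> with
  \<open>x S c = 0\<close> contains \<open>y L\<close>. When it is zero, \<open>y\<close> acts as
  zero; when it is everything, \<open>x\<close> does. Faithfulness finishes either case.\<close>

lemma simple_imp_prime_ring:
  assumes simple
  shows "prime_ring S"
  unfolding prime_ring_iff[OF L.T.ring_axioms]
proof (intro conjI ballI impI)
  show "carrier S \<noteq> {\<zero>}" by (rule carrier_S_nonzero)
  fix x y assume xy: "x \<in> carrier S" "y \<in> carrier S" "\<forall>t\<in>carrier S. x \<otimes> (t \<otimes> y) = \<zero>"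
  define W where "W = {c \<in> carrier L. \<forall>t\<in>carrier S. x \<odot>\<^bsub>L\<^esub> (t \<odot>\<^bsub>L\<^esub> c) \<in> {\<zero>\<^bsub>L\<^esub>}}"
  have "subbimodule W"
    unfolding W_def by (rule subbimodule_colon[OF subbimodule_zero xy(1)])
  then consider "W = {\<zero>\<^bsub>L\<^esub>}" | "W = carrier L"
    using assms unfolding simple_def by auto
  then show "x = \<zero> \<or> y = \<zero>"
  proof cases
    case 1
    have "y \<odot>\<^bsub>L\<^esub> c \<in> W" if c: "c \<in> carrier L" for c
    proof -
      have "x \<odot>\<^bsub>L\<^esub> (t \<odot>\<^bsub>L\<^esub> (y \<odot>\<^bsub>L\<^esub> c)) = \<zero>\<^bsub>L\<^esub>" if t: "t \<in> carrier S" for t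
        using xy t c L.lsmult_assoc[of x "t \<otimes> y" c] by (simp add: L.lsmult_assoc)
      then show ?thesis using xy(2) c by (simp add: W_def)
    qed
    then show ?thesis using faithful[OF xy(2)] 1 by simp
  next
    case 2
    have "x \<odot>\<^bsub>L\<^esub> c = \<zero>\<^bsub>L\<^esub>" if c: "c \<in> carrier L" for c
    proof -
      have "c \<in> W" using 2 c by simp
      then have "x \<odot>\<^bsub>L\<^esub> (\<one> \<odot>\<^bsub>L\<^esub> c) = \<zero>\<^bsub>L\<^esub>" by (simp add: W_def)
      then show ?thesis using c by (simp add: L.lsmult_one)
    qed
    then show ?thesis using faithful[OF xy(1)] by simp
  qed
qed

lemma annihilator_L: "annihilator S L = {\<zero>}"
  using faithful by (auto simp: annihilator_def)

lemma simple_artinian_ring_imp_simple: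
  assumes "simple_artinian_ring S"
  shows simple
  unfolding simple_def
proof (intro allI impI)
  fix K assume K: "subbimodule K"
  note K' = K[unfolded subbimodule_iff]
  show "K = {\<zero>\<^bsub>L\<^esub>} \<or> K = carrier L"
  proof (cases "K = carrier L")
    case False
    then obtain s where s: "s \<in> carrier S" "s \<noteq> \<zero>" "\<forall>x\<in>K. s \<odot>\<^bsub>L\<^esub> x = \<zero>\<^bsub>L\<^esub>"
      using annihilated K unfolding subbimodule_def by blast
    define I where "I = {s \<in> carrier S. \<forall>x\<in>K. s \<odot>\<^bsub>L\<^esub> x = \<zero>\<^bsub>L\<^esub>}"
    have KL: "\<And>x. x \<in> K \<Longrightarrow> x \<in> carrier L" using K' by auto
    have "ideal I S"
      unfolding L.T.ideal_iff I_def using K' by (auto simp: KL L.lsmult_l_distr L.lsmult_assoc)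
    moreover have "I \<noteq> {\<zero>}" using s by (auto simp: I_def)
    ultimately have "I = carrier S"
      using assms unfolding simple_artinian_ring_def by blast
    then have "\<one> \<in> I" by simp
    then have "x = \<zero>\<^bsub>L\<^esub>" if "x \<in> K" for x
      using that L.lsmult_one[OF KL[OF that]] by (simp add: I_def)
    then show ?thesis using K' by auto
  qed simp
qed

text \<open>A proper subbimodule is killed by a nonzero scalar, which primeness of a faithful module
  forbids unless the subbimodule is zero. Conversely, if \<open>s\<close> kills a nonzero submodule
  \<open>K\<close>, the subbimodule of all \<open>c\<close> with \<open>s S c = 0\<close> contains
  \<open>K\<close>, so by simplicity it is everything and \<open>s\<close> is zero.\<close>

lemma prime_module_iff_simple: "prime_module S L \<longleftrightarrow> simple"
proof
  assume p: "prime_module S L"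
  show simple
    unfolding simple_def
  proof (intro allI impI)
    fix K assume K: "subbimodule K"
    show "K = {\<zero>\<^bsub>L\<^esub>} \<or> K = carrier L"
    proof (rule ccontr)
      assume n: "\<not> ?thesis"
      then obtain s where s: "s \<in> carrier S" "s \<noteq> \<zero>" "\<forall>x\<in>K. s \<odot>\<^bsub>L\<^esub> x = \<zero>\<^bsub>L\<^esub>"
        using annihilated K unfolding subbimodule_def by blast
      then have "s \<in> annihilator S (L\<lparr>carrier := K\<rparr>)"
        by (simp add: annihilator_def)
      moreover have "annihilator S (L\<lparr>carrier := K\<rparr>) = annihilator S L"
        using p K n unfolding prime_module_def subbimodule_def by blast
      ultimately show False using annihilator_L s(2) by auto
    qed
  qed
next
  assume sim: simple
  show "prime_module S L"
    unfolding prime_module_def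
  proof (intro conjI allI impI nonzero)
    fix K assume K: "submodule K S L" "K \<noteq> {\<zero>\<^bsub>L\<^esub>}"
    note K' = K(1)[unfolded L.submodule_iff]
    show "annihilator S (L\<lparr>carrier := K\<rparr>) = annihilator S L"
      unfolding annihilator_L
    proof (intro equalityI subsetI)
      fix s assume "s \<in> annihilator S (L\<lparr>carrier := K\<rparr>)"
      then have s: "s \<in> carrier S" "\<And>x. x \<in> K \<Longrightarrow> s \<odot>\<^bsub>L\<^esub> x = \<zero>\<^bsub>L\<^esub>"
        by (simp_all add: annihilator_def)
      define W where "W = {c \<in> carrier L. \<forall>t\<in>carrier S. s \<odot>\<^bsub>L\<^esub> (t \<odot>\<^bsub>L\<^esub> c) \<in> {\<zero>\<^bsub>L\<^esub>}}"
      have "subbimodule W"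
        unfolding W_def by (rule subbimodule_colon[OF subbimodule_zero s(1)])
      moreover have "K \<subseteq> W" using s K' by (auto simp: W_def)
      then have "W \<noteq> {\<zero>\<^bsub>L\<^esub>}" using K(2) K' by auto
      ultimately have W: "W = carrier L" using sim unfolding simple_def by blast
      have "s \<odot>\<^bsub>L\<^esub> c = \<zero>\<^bsub>L\<^esub>" if c: "c \<in> carrier L" for c
      proof -
        have "c \<in> W" using W c by simp
        then have "s \<odot>\<^bsub>L\<^esub> (\<one> \<odot>\<^bsub>L\<^esub> c) = \<zero>\<^bsub>L\<^esub>" by (simp add: W_def)
        then show ?thesis using c by (simp add: L.lsmult_one)
      qed
      then show "s \<in> {\<zero>}" using faithful s(1) by simp
    qed (use K' in \<open>auto simp: annihilator_def subset_iff\<close>)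
  qed
qed

lemma prime_module_imp_diprime_module: "prime_module S L \<Longrightarrow> diprime_module S L"
  by (simp add: prime_module_def diprime_module_def)

text \<open>Scalar multiplication of a coset yields \<open>K\<close> plus the image of the coset. If
  \<open>s\<close> maps \<open>L\<close> into \<open>K\<close>, this set collapses to
  \<open>K\<close>, which is the zero of the quotient.\<close>

lemma annihilates_quotient_module:
  assumes K: "submodule K S L" and s: "s \<in> carrier S" "\<And>c. c \<in> carrier L \<Longrightarrow> s \<odot>\<^bsub>L\<^esub> c \<in> K"
  shows "s \<in> annihilator S (quotient_module L K)"
proof -
  note K' = K[unfolded L.submodule_iff]
  have "K <+>\<^bsub>L\<^esub> (\<lambda>x. s \<odot>\<^bsub>L\<^esub> x) ` X = K" if X: "X \<in> a_rcosets\<^bsub>L\<^esub> K" for X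
  proof -
    obtain c where c: "c \<in> carrier L" "X = K +>\<^bsub>L\<^esub> c"
      using X by (auto simp: A_RCOSETS_def')
    have XL: "x \<in> carrier L" if "x \<in> X" for x
      using that c K' by (auto simp: a_r_coset_def')
    have cX: "c \<in> X"
      using K' c by (auto simp: a_r_coset_def' intro!: bexI[of _ "\<zero>\<^bsub>L\<^esub>"])
    show ?thesis
    proof
      show "K <+>\<^bsub>L\<^esub> (\<lambda>x. s \<odot>\<^bsub>L\<^esub> x) ` X \<subseteq> K"
        using K' s(2) XL by (auto simp: set_add_def')
      show "K \<subseteq> K <+>\<^bsub>L\<^esub> (\<lambda>x. s \<odot>\<^bsub>L\<^esub> x) ` X"
      proof
        fix k assume k: "k \<in> K"
        have sc: "s \<odot>\<^bsub>L\<^esub> c \<in> K" by (rule s(2)[OF c(1)])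
        have "\<ominus>\<^bsub>L\<^esub> (s \<odot>\<^bsub>L\<^esub> c) \<in> K" by (rule L.submodule_minus[OF K sc])
        then have "k \<oplus>\<^bsub>L\<^esub> (\<ominus>\<^bsub>L\<^esub> (s \<odot>\<^bsub>L\<^esub> c)) \<in> K" using K' k by simp
        moreover have "k = k \<oplus>\<^bsub>L\<^esub> (\<ominus>\<^bsub>L\<^esub> (s \<odot>\<^bsub>L\<^esub> c)) \<oplus>\<^bsub>L\<^esub> s \<odot>\<^bsub>L\<^esub> c"
          using k sc K' by (simp add: L.M.a_assoc L.M.l_neg subset_iff)
        ultimately show "k \<in> K <+>\<^bsub>L\<^esub> (\<lambda>x. s \<odot>\<^bsub>L\<^esub> x) ` X"
          unfolding set_add_def' using cX by auto
      qed
    qed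
  qed
  then show ?thesis
    using s(1) by (simp add: annihilator_def quotient_module_def)
qed

text \<open>For \<open>x S y = 0\<close>, let \<open>W\<close> be the subbimodule of all
  \<open>c\<close> with \<open>x S c = 0\<close>. Then \<open>x\<close> kills \<open>W\<close> and
  \<open>y\<close> kills the quotient by \<open>W\<close>; diprimeness makes one of these
  annihilators zero. The extreme cases of \<open>W\<close> are settled by faithfulness.\<close>

lemma diprime_module_imp_prime_ring:
  assumes d: "diprime_module S L"
  shows "prime_ring S"
  unfolding prime_ring_iff[OF L.T.ring_axioms]
proof (intro conjI ballI impI)
  show "carrier S \<noteq> {\<zero>}" by (rule carrier_S_nonzero)
  fix x y assume xy: "x \<in> carrier S" "y \<in> carrier S" "\<forall>t\<in>carrier S. x \<otimes> (t \<otimes> y) = \<zero>"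
  define W where "W = {c \<in> carrier L. \<forall>t\<in>carrier S. x \<odot>\<^bsub>L\<^esub> (t \<odot>\<^bsub>L\<^esub> c) \<in> {\<zero>\<^bsub>L\<^esub>}}"
  have W: "subbimodule W"
    unfolding W_def by (rule subbimodule_colon[OF subbimodule_zero xy(1)])
  have yW: "y \<odot>\<^bsub>L\<^esub> c \<in> W" if c: "c \<in> carrier L" for c
  proof -
    have "x \<odot>\<^bsub>L\<^esub> (t \<odot>\<^bsub>L\<^esub> (y \<odot>\<^bsub>L\<^esub> c)) = \<zero>\<^bsub>L\<^esub>" if t: "t \<in> carrier S" for t
      using xy t c L.lsmult_assoc[of x "t \<otimes> y" c] by (simp add: L.lsmult_assoc)
    then show ?thesis using xy(2) c by (simp add: W_def)
  qed
  have xW: "x \<odot>\<^bsub>L\<^esub> c = \<zero>\<^bsub>L\<^esub>" if c: "c \<in> W" for c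
  proof -
    have "c \<in> carrier L" "x \<odot>\<^bsub>L\<^esub> (\<one> \<odot>\<^bsub>L\<^esub> c) = \<zero>\<^bsub>L\<^esub>" using c by (simp_all add: W_def)
    then show ?thesis by (simp add: L.lsmult_one)
  qed
  have SW: "submodule W S L" using W by (simp add: subbimodule_def)
  consider "W = {\<zero>\<^bsub>L\<^esub>}" | "W = carrier L" | "W \<noteq> {\<zero>\<^bsub>L\<^esub>}" "W \<noteq> carrier L" by blast
  then show "x = \<zero> \<or> y = \<zero>"
  proof cases
    case 1
    then show ?thesis using faithful[OF xy(2)] yW by simp
  next
    case 2
    then show ?thesis using faithful[OF xy(1)] xW by simp
  next
    case 3
    have "x \<in> annihilator S (L\<lparr>carrier := W\<rparr>)"
      using xy(1) xW by (simp add: annihilator_def)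
    moreover have "y \<in> annihilator S (quotient_module L W)"
      by (rule annihilates_quotient_module[OF SW xy(2) yW])
    moreover have "annihilator S (L\<lparr>carrier := W\<rparr>) = {\<zero>} \<or> annihilator S (quotient_module L W) = {\<zero>}"
      using d SW 3 unfolding diprime_module_def annihilator_L by simp
    ultimately show ?thesis by auto
  qed
qed

text \<open>The chain condition concerns left ideals of \<open>S\<close>, not subbimodules. So the
  annihilator is minimized over the proper subbimodules, and \<open>X\<close> is then replaced by
  the set \<open>X'\<close> of everything its annihilator kills. \<open>X'\<close> is proper because
  that annihilator is nonzero and \<open>S\<close> acts faithfully; any proper subbimodule above it
  has the same annihilator, hence is no larger.\<close>

lemma maximal_subbimodule:
  assumes art: "left_artinian S"
  obtains X where "subbimodule X" "X \<noteq> carrier L"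
    "\<And>Z. \<lbrakk>subbimodule Z; X \<subseteq> Z; Z \<noteq> carrier L\<rbrakk> \<Longrightarrow> Z = X"
proof -
  define ann where "ann K = {s \<in> carrier S. \<forall>x\<in>K. s \<odot>\<^bsub>L\<^esub> x = \<zero>\<^bsub>L\<^esub>}" for K
  let ?P = "{K. subbimodule K \<and> K \<noteq> carrier L}"
  obtain X where X: "subbimodule X" "X \<noteq> carrier L"
    and min: "\<And>Z. \<lbrakk>subbimodule Z; Z \<noteq> carrier L; ann Z \<subseteq> ann X\<rbrakk> \<Longrightarrow> ann Z = ann X"
  proof (rule artinian_module_minimal[OF art[unfolded left_artinian_def], of "ann ` ?P"])
    show "ann ` ?P \<noteq> {}" using subbimodule_zero nonzero by auto
    show "submodule N S (regular S)" if N: "N \<in> ann ` ?P" for N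
    proof -
      obtain K where K: "N = ann K" "subbimodule K"
        using N by auto
      then have "K \<subseteq> carrier L" by (simp add: subbimodule_iff)
      then have "\<And>x. x \<in> K \<Longrightarrow> x \<in> carrier L" by auto
      then show ?thesis
        unfolding K(1) submodule_is_regular_iff[OF L.T.ring_axioms is_regular_regular] ann_def
        by (auto simp: L.lsmult_l_distr L.lsmult_assoc)
    qed
    fix N assume N: "N \<in> ann ` ?P" "\<And>N'. N' \<in> ann ` ?P \<Longrightarrow> N' \<subseteq> N \<Longrightarrow> N' = N"
    from N(1) obtain K where "subbimodule K" "K \<noteq> carrier L" "N = ann K" by auto
    with N(2) show thesis by (intro that[of K]) auto
  qed
  define X' where "X' = {c \<in> carrier L. \<forall>s\<in>ann X. s \<odot>\<^bsub>L\<^esub> c = \<zero>\<^bsub>L\<^esub>}"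
  note X_iff = X(1)[unfolded subbimodule_iff]
  have ann_S: "\<And>s. s \<in> ann X \<Longrightarrow> s \<in> carrier S" by (simp add: ann_def)
  have ann_mult: "s \<otimes> t \<in> ann X" if "s \<in> ann X" "t \<in> carrier S" for s t
    using that X_iff by (simp add: ann_def subset_iff L.lsmult_assoc)
  have X'_sub: "subbimodule X'"
    unfolding subbimodule_iff
  proof (intro conjI ballI)
    fix c assume c: "c \<in> X'"
    show "t \<odot>\<^bsub>L\<^esub> c \<in> X'" if t: "t \<in> carrier S" for t
    proof -
      have "s \<odot>\<^bsub>L\<^esub> (t \<odot>\<^bsub>L\<^esub> c) = \<zero>\<^bsub>L\<^esub>" if s: "s \<in> ann X" for s
      proof -
        have "(s \<otimes> t) \<odot>\<^bsub>L\<^esub> c = \<zero>\<^bsub>L\<^esub>" using ann_mult[OF s t] c by (simp add: X'_def)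
        then show ?thesis using ann_S[OF s] t c by (simp add: X'_def L.lsmult_assoc)
      qed
      then show ?thesis using t c by (simp add: X'_def)
    qed
    show "u \<odot>\<^bsub>N\<^esub> c \<in> X'" if u: "u \<in> carrier U" for u
      using c u by (simp add: X'_def commute ann_S)
    show "c \<oplus>\<^bsub>L\<^esub> d \<in> X'" if "d \<in> X'" for d
      using c that by (simp add: X'_def ann_S L.lsmult_r_distr)
  qed (auto simp: X'_def ann_S)
  obtain s where s: "s \<in> ann X" "s \<noteq> \<zero>"
    using annihilated X unfolding subbimodule_def ann_def by auto
  have X'_ne: "X' \<noteq> carrier L"
  proof
    assume "X' = carrier L"
    then have "s \<odot>\<^bsub>L\<^esub> c = \<zero>\<^bsub>L\<^esub>" if "c \<in> carrier L" for c
      using that s(1) unfolding X'_def by auto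
    then show False using faithful[OF ann_S[OF s(1)]] s(2) by simp
  qed
  have XX': "X \<subseteq> X'" using X_iff by (auto simp: X'_def ann_def)
  have "Z = X'" if Z: "subbimodule Z" "X' \<subseteq> Z" "Z \<noteq> carrier L" for Z
  proof
    have "ann Z \<subseteq> ann X" using XX' Z(2) by (auto simp: ann_def)
    then have "ann Z = ann X" by (rule min[OF Z(1,3)])
    moreover have "Z \<subseteq> carrier L" using Z(1) by (simp add: subbimodule_iff)
    moreover have "s \<odot>\<^bsub>L\<^esub> c = \<zero>\<^bsub>L\<^esub>" if "s \<in> ann Z" "c \<in> Z" for s c
      using that by (simp add: ann_def)
    ultimately show "Z \<subseteq> X'" by (auto simp: X'_def)
  qed (rule Z(2))
  with X'_sub X'_ne show thesis by (rule that)
qed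

text \<open>Let \<open>X\<close> be a maximal subbimodule, \<open>I\<close> the set of all
  \<open>s\<close> that map \<open>L\<close> into \<open>X\<close>, and \<open>Y\<close> the set of
  elements killed by \<open>I\<close>. If \<open>u\<close> kills \<open>X\<close>, then
  \<open>s u c = u s c = 0\<close> for \<open>s\<close> in \<open>I\<close>, so \<open>u\<close>
  maps into \<open>Y\<close>; as \<open>X\<close> is proper, coprimeness makes \<open>Y\<close>
  everything and \<open>I\<close> zero. Now if \<open>x S y = 0\<close>, the subbimodule of all
  \<open>c\<close> with \<open>x S c \<subseteq> X\<close> contains \<open>X\<close>, so it is
  \<open>X\<close> or everything. Accordingly \<open>y\<close> or \<open>x\<close> belongs to
  \<open>I\<close>.\<close>

lemma fully_coprime_imp_prime_ring:
  assumes cop: fully_coprime and art: "left_artinian S"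
  shows "prime_ring S"
proof -
  obtain X where X: "subbimodule X" "X \<noteq> carrier L"
    and max: "\<And>Z. \<lbrakk>subbimodule Z; X \<subseteq> Z; Z \<noteq> carrier L\<rbrakk> \<Longrightarrow> Z = X"
    by (rule maximal_subbimodule[OF art], rule that)
  note X_iff = X(1)[unfolded subbimodule_iff]
  define I where "I = {s \<in> carrier S. \<forall>c\<in>carrier L. s \<odot>\<^bsub>L\<^esub> c \<in> X}"
  define Y where "Y = {c \<in> carrier L. \<forall>s\<in>I. s \<odot>\<^bsub>L\<^esub> c = \<zero>\<^bsub>L\<^esub>}"
  have IS: "\<And>s. s \<in> I \<Longrightarrow> s \<in> carrier S" by (simp add: I_def)
  have I_mult: "s \<otimes> t \<in> I" if "s \<in> I" "t \<in> carrier S" for s t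
    using that by (simp add: I_def L.lsmult_assoc)
  have Y: "subbimodule Y"
    unfolding subbimodule_iff
  proof (intro conjI ballI)
    fix c assume c: "c \<in> Y"
    show "t \<odot>\<^bsub>L\<^esub> c \<in> Y" if t: "t \<in> carrier S" for t
    proof -
      have "s \<odot>\<^bsub>L\<^esub> (t \<odot>\<^bsub>L\<^esub> c) = \<zero>\<^bsub>L\<^esub>" if s: "s \<in> I" for s
      proof -
        have "(s \<otimes> t) \<odot>\<^bsub>L\<^esub> c = \<zero>\<^bsub>L\<^esub>" using I_mult[OF s t] c by (simp add: Y_def)
        then show ?thesis using IS[OF s] t c by (simp add: Y_def L.lsmult_assoc)
      qed
      then show ?thesis using t c by (simp add: Y_def)
    qed
    show "u \<odot>\<^bsub>N\<^esub> c \<in> Y" if u: "u \<in> carrier U" for u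
      using c u by (simp add: Y_def commute IS)
    show "c \<oplus>\<^bsub>L\<^esub> d \<in> Y" if "d \<in> Y" for d
      using c that by (simp add: Y_def IS L.lsmult_r_distr)
  qed (auto simp: Y_def IS)
  have "u \<odot>\<^bsub>N\<^esub> c \<in> Y"
    if u: "u \<in> carrier U" "\<forall>x\<in>X. u \<odot>\<^bsub>N\<^esub> x = \<zero>\<^bsub>L\<^esub>" and c: "c \<in> carrier L" for u c
    using u c by (simp add: Y_def commute IS) (simp add: I_def)
  then have "X = carrier L \<or> Y = carrier L"
    using cop X(1) Y unfolding fully_coprime_def by simp
  then have Y_all: "Y = carrier L" using X(2) by simp
  have I0: "s = \<zero>" if s: "s \<in> carrier S" "\<And>c. c \<in> carrier L \<Longrightarrow> s \<odot>\<^bsub>L\<^esub> c \<in> X" for s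
  proof (rule faithful[OF s(1)])
    have "s \<in> I" using s by (simp add: I_def)
    fix c assume "c \<in> carrier L"
    then have "c \<in> Y" using Y_all by simp
    then show "s \<odot>\<^bsub>L\<^esub> c = \<zero>\<^bsub>L\<^esub>" using \<open>s \<in> I\<close> by (simp add: Y_def)
  qed
  show ?thesis
    unfolding prime_ring_iff[OF L.T.ring_axioms]
  proof (intro conjI ballI impI)
    show "carrier S \<noteq> {\<zero>}" by (rule carrier_S_nonzero)
    fix x y assume xy: "x \<in> carrier S" "y \<in> carrier S" "\<forall>t\<in>carrier S. x \<otimes> (t \<otimes> y) = \<zero>"
    define W where "W = {c \<in> carrier L. \<forall>t\<in>carrier S. x \<odot>\<^bsub>L\<^esub> (t \<odot>\<^bsub>L\<^esub> c) \<in> X}"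
    have W: "subbimodule W"
      unfolding W_def by (rule subbimodule_colon[OF X(1) xy(1)])
    have XW: "X \<subseteq> W" using X_iff xy(1) by (auto simp: W_def)
    show "x = \<zero> \<or> y = \<zero>"
    proof (cases "W = carrier L")
      case True
      have "x \<odot>\<^bsub>L\<^esub> c \<in> X" if c: "c \<in> carrier L" for c
      proof -
        have "c \<in> W" using True c by simp
        then have "x \<odot>\<^bsub>L\<^esub> (\<one> \<odot>\<^bsub>L\<^esub> c) \<in> X" by (simp add: W_def)
        then show ?thesis using c by (simp add: L.lsmult_one)
      qed
      then show ?thesis using I0[OF xy(1)] by simp
    next
      case False
      have "y \<odot>\<^bsub>L\<^esub> c \<in> X" if c: "c \<in> carrier L" for c
      proof -
        have "x \<odot>\<^bsub>L\<^esub> (t \<odot>\<^bsub>L\<^esub> (y \<odot>\<^bsub>L\<^esub> c)) = \<zero>\<^bsub>L\<^esub>" if t: "t \<in> carrier S" for t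
          using xy t c L.lsmult_assoc[of x "t \<otimes> y" c] by (simp add: L.lsmult_assoc)
        then have "y \<odot>\<^bsub>L\<^esub> c \<in> W" using xy(2) c X_iff by (simp add: W_def)
        then show ?thesis using max[OF W XW False] by simp
      qed
      then show ?thesis using I0[OF xy(2)] by simp
    qed
  qed
qed

text \<open>If \<open>X\<close> and \<open>Y\<close> were both zero, the unit of \<open>U\<close>
  would kill \<open>X\<close> and hence carry all of \<open>L\<close> into zero.\<close>

lemma simple_imp_fully_coprime:
  assumes simple
  shows fully_coprime
  unfolding fully_coprime_def
proof (intro allI impI)
  fix X Y assume XY: "subbimodule X" "subbimodule Y"
    and *: "\<forall>u\<in>carrier U. (\<forall>x\<in>X. u \<odot>\<^bsub>N\<^esub> x = \<zero>\<^bsub>L\<^esub>) \<longrightarrow> (\<forall>c\<in>carrier L. u \<odot>\<^bsub>N\<^esub> c \<in> Y)"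
  show "X = carrier L \<or> Y = carrier L"
  proof (rule ccontr)
    assume "\<not> ?thesis"
    then have "X = {\<zero>\<^bsub>L\<^esub>}" "Y = {\<zero>\<^bsub>L\<^esub>}"
      using assms XY unfolding simple_def by auto
    moreover have "\<one>\<^bsub>U\<^esub> \<odot>\<^bsub>N\<^esub> c = c" if "c \<in> carrier L" for c
      using N.lsmult_one that by (simp add: same_carrier)
    ultimately have "c = \<zero>\<^bsub>L\<^esub>" if "c \<in> carrier L" for c
      using *[THEN bspec, OF N.T.one_closed] that by simp
    then show False using nonzero_element by metis
  qed
qed

text \<open>What kills \<open>K\<close> also kills direct sums of copies of \<open>K\<close>, their
  epimorphic images and everything embedded in these, hence \<open>L\<close>; and \<open>S\<close>
  acts faithfully on \<open>L\<close>.\<close>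

lemma subgenerates_imp_annihilator:
  assumes K: "submodule K S L" and sg: "subgenerates S (L\<lparr>carrier := K\<rparr>) L"
    and s: "s \<in> carrier S" "\<And>x. x \<in> K \<Longrightarrow> s \<odot>\<^bsub>L\<^esub> x = \<zero>\<^bsub>L\<^esub>"
  shows "s = \<zero>"
proof -
  obtain Q :: "('s, ('m \<times> nat \<Rightarrow> 'm) set) module" and i where Q: "left_module S Q"
    and gen: "generates S (L\<lparr>carrier := K\<rparr>) Q" and i: "i \<in> mod_hom S L Q" "inj_on i (carrier L)"
    using sg unfolding subgenerates_def by auto
  interpret Q: left_module S Q by fact
  obtain I :: "(('m \<times> nat \<Rightarrow> 'm) set \<times> nat) set"
    where "\<exists>h\<in>mod_hom S (direct_sum (L\<lparr>carrier := K\<rparr>) I) Q.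
      h ` carrier (direct_sum (L\<lparr>carrier := K\<rparr>) I) = carrier Q"
    using gen unfolding generates_def ..
  then obtain h where h: "h \<in> mod_hom S (direct_sum (L\<lparr>carrier := K\<rparr>) I) Q"
    "h ` carrier (direct_sum (L\<lparr>carrier := K\<rparr>) I) = carrier Q" ..
  have K0: "\<zero>\<^bsub>L\<^esub> \<in> K" using K by (simp add: L.submodule_iff)
  have killQ: "s \<odot>\<^bsub>Q\<^esub> q = \<zero>\<^bsub>Q\<^esub>" if q: "q \<in> carrier Q" for q
  proof -
    define z where "z = (\<lambda>j\<in>I. \<zero>\<^bsub>L\<^esub>)"
    have z: "z \<in> carrier (direct_sum (L\<lparr>carrier := K\<rparr>) I)"
      using K0 by (simp add: direct_sum_def z_def)
    have kill: "s \<odot>\<^bsub>direct_sum (L\<lparr>carrier := K\<rparr>) I\<^esub> f = z"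
      if f: "f \<in> carrier (direct_sum (L\<lparr>carrier := K\<rparr>) I)" for f
      using f s by (auto simp: direct_sum_def z_def intro!: restrict_ext)
    have "z \<oplus>\<^bsub>direct_sum (L\<lparr>carrier := K\<rparr>) I\<^esub> z = z"
      by (auto simp: direct_sum_def z_def intro!: restrict_ext)
    then have "h z \<oplus>\<^bsub>Q\<^esub> h z = h z"
      using mod_hom_add[OF h(1) z z] by simp
    then have hz: "h z = \<zero>\<^bsub>Q\<^esub>"
      using mod_hom_closed[OF h(1) z] by simp
    obtain f where f: "f \<in> carrier (direct_sum (L\<lparr>carrier := K\<rparr>) I)" "q = h f"
      using q h(2) by auto
    then show ?thesis
      using mod_hom_smult[OF h(1) s(1) f(1)] kill[OF f(1)] hz by simp
  qed
  show ?thesis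
  proof (rule faithful[OF s(1)])
    fix x assume x: "x \<in> carrier L"
    have "i (s \<odot>\<^bsub>L\<^esub> x) = i \<zero>\<^bsub>L\<^esub>"
      using mod_hom_smult[OF i(1) s(1) x] killQ[OF mod_hom_closed[OF i(1) x]]
        L.mod_hom_zero[OF i(1) Q.M.abelian_group_axioms] by simp
    then show "s \<odot>\<^bsub>L\<^esub> x = \<zero>\<^bsub>L\<^esub>"
      by (rule inj_onD[OF i(2)]) (use s(1) x in simp_all)
  qed
qed

lemma strongly_prime_module_imp_prime_module:
  assumes "strongly_prime_module S L"
  shows "prime_module S L"
  unfolding prime_module_def
proof (intro conjI allI impI nonzero)
  fix K assume K: "submodule K S L" "K \<noteq> {\<zero>\<^bsub>L\<^esub>}"
  then have sg: "subgenerates S (L\<lparr>carrier := K\<rparr>) L"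
    using assms by (simp add: strongly_prime_module_def)
  show "annihilator S (L\<lparr>carrier := K\<rparr>) = annihilator S L"
    unfolding annihilator_L
  proof (intro equalityI subsetI)
    fix s assume "s \<in> annihilator S (L\<lparr>carrier := K\<rparr>)"
    then have "s \<in> carrier S" "\<And>x. x \<in> K \<Longrightarrow> s \<odot>\<^bsub>L\<^esub> x = \<zero>\<^bsub>L\<^esub>"
      by (simp_all add: annihilator_def)
    then show "s \<in> {\<zero>}" using subgenerates_imp_annihilator[OF K(1) sg] by simp
  qed (use K(1)[unfolded L.submodule_iff] in \<open>auto simp: annihilator_def subset_iff\<close>)
qed

text \<open>A list of pairs represents a finite sum of translates \<open>u k\<close>. Positions in
  the list later serve to number the summands.\<close>

fun usum :: "('u \<times> 'm) list \<Rightarrow> 'm"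
  where "usum [] = \<zero>\<^bsub>L\<^esub>" | "usum ((u, k) # ps) = u \<odot>\<^bsub>N\<^esub> k \<oplus>\<^bsub>L\<^esub> usum ps"

lemma usum_closed: "set ps \<subseteq> carrier U \<times> carrier L \<Longrightarrow> usum ps \<in> carrier L"
  by (induction ps rule: usum.induct) auto

lemma usum_append:
  "\<lbrakk>set ps \<subseteq> carrier U \<times> carrier L; set qs \<subseteq> carrier U \<times> carrier L\<rbrakk>
    \<Longrightarrow> usum (ps @ qs) = usum ps \<oplus>\<^bsub>L\<^esub> usum qs"
  by (induction ps rule: usum.induct) (auto simp: usum_closed L.M.a_assoc)

lemma usum_s:
  "\<lbrakk>s \<in> carrier S; set ps \<subseteq> carrier U \<times> carrier L\<rbrakk>
    \<Longrightarrow> s \<odot>\<^bsub>L\<^esub> usum ps = usum (map (\<lambda>(u, k). (u, s \<odot>\<^bsub>L\<^esub> k)) ps)"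
  by (induction ps rule: usum.induct) (auto simp: usum_closed L.lsmult_r_distr commute)

lemma usum_u:
  "\<lbrakk>v \<in> carrier U; set ps \<subseteq> carrier U \<times> carrier L\<rbrakk>
    \<Longrightarrow> v \<odot>\<^bsub>N\<^esub> usum ps = usum (map (\<lambda>(u, k). (v \<otimes>\<^bsub>U\<^esub> u, k)) ps)"
  by (induction ps rule: usum.induct) (auto simp: usum_closed u_add N.lsmult_assoc same_carrier)

text \<open>The finite sums of translates of elements of \<open>K\<close> form a subbimodule, stable
  under \<open>S\<close> because the actions commute; it contains \<open>K\<close>, so simplicity
  makes it everything.\<close>

lemma simple_usum:
  assumes sim: simple and K: "submodule K S L" "K \<noteq> {\<zero>\<^bsub>L\<^esub>}" and c: "c \<in> carrier L"
  obtains ps where "set ps \<subseteq> carrier U \<times> K" "c = usum ps"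
proof -
  note K' = K(1)[unfolded L.submodule_iff]
  define W where "W = {usum ps | ps. set ps \<subseteq> carrier U \<times> K}"
  have ps_L: "set ps \<subseteq> carrier U \<times> carrier L" if "set ps \<subseteq> carrier U \<times> K" for ps :: "('u \<times> 'm) list"
    using that K' by auto
  have "subbimodule W"
    unfolding subbimodule_iff
  proof (intro conjI ballI)
    show "W \<subseteq> carrier L" using usum_closed ps_L by (auto simp: W_def)
    show "\<zero>\<^bsub>L\<^esub> \<in> W" unfolding W_def by (intro CollectI exI[of _ "[]"]) simp
    fix x assume "x \<in> W"
    then obtain ps where ps: "x = usum ps" "set ps \<subseteq> carrier U \<times> K" by (auto simp: W_def)
    show "x \<oplus>\<^bsub>L\<^esub> y \<in> W" if y: "y \<in> W" for y
    proof -
      obtain qs where qs: "y = usum qs" "set qs \<subseteq> carrier U \<times> K" using y by (auto simp: W_def)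
      then have "x \<oplus>\<^bsub>L\<^esub> y = usum (ps @ qs)"
        using ps ps_L by (simp add: usum_append)
      then show ?thesis
        unfolding W_def using ps(2) qs(2) by (intro CollectI exI[of _ "ps @ qs"]) simp
    qed
    show "s \<odot>\<^bsub>L\<^esub> x \<in> W" if s: "s \<in> carrier S" for s
      unfolding W_def ps(1) usum_s[OF s ps_L[OF ps(2)]] using ps(2) s K'
      by (intro CollectI exI[of _ "map (\<lambda>(u, k). (u, s \<odot>\<^bsub>L\<^esub> k)) ps"] conjI refl) auto
    show "u \<odot>\<^bsub>N\<^esub> x \<in> W" if u: "u \<in> carrier U" for u
      unfolding W_def ps(1) usum_u[OF u ps_L[OF ps(2)]] using ps(2) u
      by (intro CollectI exI[of _ "map (\<lambda>(v, k). (u \<otimes>\<^bsub>U\<^esub> v, k)) ps"] conjI refl) auto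
  qed
  moreover have "W \<noteq> {\<zero>\<^bsub>L\<^esub>}"
  proof -
    obtain k where k: "k \<in> K" "k \<noteq> \<zero>\<^bsub>L\<^esub>" using K(2) K' by auto
    have "k \<in> carrier L" using k(1) K' by auto
    then have "k = usum [(\<one>\<^bsub>U\<^esub>, k)]" using N.lsmult_one by (simp add: same_carrier)
    then have "k \<in> W"
      unfolding W_def using k(1) by (intro CollectI exI[of _ "[(\<one>\<^bsub>U\<^esub>, k)]"]) simp
    then show ?thesis using k(2) by auto
  qed
  ultimately have "W = carrier L" using sim unfolding simple_def by auto
  then have "c \<in> W" using c by simp
  then show thesis using that by (auto simp: W_def)
qed

text \<open>The actions of the elements of \<open>U\<close> are \<open>S\<close>-linear, so that \<open>L\<close> is generated by any nonzero
  submodule if it is simple as a bimodule.\<close>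

lemma simple_imp_strongly_prime_module:
  assumes sim: simple
  shows "strongly_prime_module S L"
  unfolding strongly_prime_module_def
proof (intro conjI allI impI nonzero)
  fix K assume K: "submodule K S L" "K \<noteq> {\<zero>\<^bsub>L\<^esub>}"
  note K' = K(1)[unfolded L.submodule_iff]
  have KL: "\<And>x. x \<in> K \<Longrightarrow> x \<in> carrier L" using K' by auto
  define P where "P c = (SOME ps. set ps \<subseteq> carrier U \<times> K \<and> c = usum ps)" for c
  have P: "set (P c) \<subseteq> carrier U \<times> K" "usum (P c) = c" if c: "c \<in> carrier L" for c
  proof -
    have "\<exists>ps. set ps \<subseteq> carrier U \<times> K \<and> c = usum ps"
      using simple_usum[OF sim K c] by metis
    from someI_ex[OF this] show "set (P c) \<subseteq> carrier U \<times> K" "usum (P c) = c"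
      unfolding P_def by simp_all
  qed
  \<comment> \<open>\<open>subgenerates\<close> prescribes sets of functions as the elements of the
    generated module. \<open>L\<close> is transported there by replacing each \<open>c\<close> by
    the singleton of a constant function.\<close>
  define \<iota> :: "'m \<Rightarrow> ('m \<times> nat \<Rightarrow> 'm) set" where "\<iota> c = {\<lambda>_. c}" for c
  define \<kappa> :: "('m \<times> nat \<Rightarrow> 'm) set \<Rightarrow> 'm" where "\<kappa> X = the_elem X undefined" for X
  have \<kappa>\<iota> [simp]: "\<kappa> (\<iota> c) = c" for c by (simp add: \<kappa>_def \<iota>_def)
  define Q :: "('s, ('m \<times> nat \<Rightarrow> 'm) set) module" where
    "Q = \<lparr>carrier = \<iota> ` carrier L, mult = undefined, one = undefined, ring.zero = \<iota> \<zero>\<^bsub>L\<^esub>,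
      add = (\<lambda>X Y. \<iota> (\<kappa> X \<oplus>\<^bsub>L\<^esub> \<kappa> Y)), smult = (\<lambda>s X. \<iota> (s \<odot>\<^bsub>L\<^esub> \<kappa> X))\<rparr>"
  have Q: "left_module S Q"
  proof (rule left_moduleI[OF L.T.ring_axioms])
    show "abelian_group Q"
    proof (rule abelian_groupI)
      fix X assume "X \<in> carrier Q"
      then obtain x where x: "x \<in> carrier L" "X = \<iota> x" by (auto simp: Q_def)
      then show "\<exists>Y\<in>carrier Q. Y \<oplus>\<^bsub>Q\<^esub> X = \<zero>\<^bsub>Q\<^esub>"
        by (intro bexI[of _ "\<iota> (\<ominus>\<^bsub>L\<^esub> x)"]) (simp_all add: Q_def L.M.l_neg)
    qed (auto simp: Q_def L.M.a_ac)
  qed (auto simp: Q_def L.lsmult_l_distr L.lsmult_r_distr L.lsmult_assoc L.lsmult_one)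
  \<comment> \<open>One copy of \<open>K\<close> for each summand in the chosen expression of each
    element: the index consists of the element and the position of the summand, which fits the index
    type of \<open>generates\<close>.\<close>
  define I where "I = {(\<iota> c, i) | c i. c \<in> carrier L \<and> i < length (P c)}"
  define u where "u j = fst (P (\<kappa> (fst j)) ! snd j)" for j :: "('m \<times> nat \<Rightarrow> 'm) set \<times> nat"
  have uU: "u j \<in> carrier U" if jI: "j \<in> I" for j
  proof -
    obtain c i where j: "j = (\<iota> c, i)" "c \<in> carrier L" "i < length (P c)"
      using jI by (auto simp: I_def)
    have "P c ! i \<in> carrier U \<times> K" using P(1)[OF j(2)] nth_mem[OF j(3)] by auto
    then show ?thesis by (auto simp: u_def j(1))
  qed
  define D where "D = direct_sum (L\<lparr>carrier := K\<rparr>) I"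
  define h where "h = direct_sum_lift (L\<lparr>carrier := K\<rparr>) L I (\<lambda>j k. u j \<odot>\<^bsub>N\<^esub> k)"
  have KM: "left_module S (L\<lparr>carrier := K\<rparr>)" by (rule L.left_module_submodule[OF K(1)])
  have u_hom: "(\<lambda>k. u j \<odot>\<^bsub>N\<^esub> k) \<in> mod_hom S (L\<lparr>carrier := K\<rparr>) L" if "j \<in> I" for j
    using uU[OF that] KL by (simp add: mod_hom_iff u_add commute)
  have h_hom: "h \<in> mod_hom S D L"
    unfolding h_def D_def by (rule direct_sum_lift_mod_hom[OF KM L.left_module_axioms u_hom])
  have h_single: "u j \<odot>\<^bsub>N\<^esub> k \<in> h ` carrier D" if "j \<in> I" "k \<in> K" for j k
    unfolding h_def D_def
    by (rule direct_sum_lift_image[where u="\<lambda>j k. u j \<odot>\<^bsub>N\<^esub> k", OF KM L.left_module_axioms u_hom])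
      (use that in simp_all)
  have D_zero: "\<zero>\<^bsub>D\<^esub> \<in> carrier D" and D_add: "\<And>f g. \<lbrakk>f \<in> carrier D; g \<in> carrier D\<rbrakk> \<Longrightarrow> f \<oplus>\<^bsub>D\<^esub> g \<in> carrier D"
    and D_left: "left_module S D"
    using left_module.left_module_direct_sum[OF KM, of I] K'
      left_module.direct_sum_add_closed[OF KM, of _ I]
    by (auto simp: D_def direct_sum_sel(1,2))
  note h_zero = left_module.mod_hom_zero[OF D_left h_hom L.M.abelian_group_axioms]
  have img: "usum ps \<in> h ` carrier D"
    if "set ps \<subseteq> {(u j, k) | j k. j \<in> I \<and> k \<in> K}" for ps
    using that
  proof (induction ps)
    case Nil
    show ?case using D_zero h_zero by (metis imageI usum.simps(1))
  next
    case (Cons p ps)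
    then obtain j k where jk: "p = (u j, k)" "j \<in> I" "k \<in> K" by auto
    obtain f where f: "f \<in> carrier D" "u j \<odot>\<^bsub>N\<^esub> k = h f"
      using h_single[OF jk(2,3)] by auto
    obtain g where g: "g \<in> carrier D" "usum ps = h g"
      using Cons by auto
    have "usum (p # ps) = h (f \<oplus>\<^bsub>D\<^esub> g)"
      using mod_hom_add[OF h_hom f(1) g(1)] jk(1) f(2) g(2) by simp
    then show ?case using D_add[OF f(1) g(1)] by blast
  qed
  have P_sub: "set (P c) \<subseteq> {(u j, k) | j k. j \<in> I \<and> k \<in> K}" if c: "c \<in> carrier L" for c
  proof
    fix p assume p: "p \<in> set (P c)"
    then obtain i where i: "i < length (P c)" "p = P c ! i" by (metis in_set_conv_nth)
    have "(\<iota> c, i) \<in> I" using c i(1) by (auto simp: I_def)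
    moreover have "fst p = u (\<iota> c, i)" by (simp add: u_def i(2))
    moreover have "snd p \<in> K" using P(1)[OF c] p by auto
    ultimately show "p \<in> {(u j, k) | j k. j \<in> I \<and> k \<in> K}"
      by (metis (mono_tags, lifting) mem_Collect_eq prod.collapse)
  qed
  have surj: "c \<in> h ` carrier D" if "c \<in> carrier L" for c
    using img[OF P_sub[OF that]] unfolding P(2)[OF that] .
  have "(\<lambda>f. \<iota> (h f)) \<in> mod_hom S D Q"
    using mod_hom_closed[OF h_hom] mod_hom_add[OF h_hom] mod_hom_smult[OF h_hom]
    by (simp add: mod_hom_iff Q_def)
  moreover have "(\<lambda>f. \<iota> (h f)) ` carrier D = carrier Q"
  proof (intro equalityI subsetI)
    fix X assume "X \<in> carrier Q"
    then obtain c where c: "c \<in> carrier L" "X = \<iota> c" by (auto simp: Q_def)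
    obtain f where "f \<in> carrier D" "c = h f" using surj[OF c(1)] ..
    then show "X \<in> (\<lambda>f. \<iota> (h f)) ` carrier D" using c(2) by simp
  qed (use mod_hom_closed[OF h_hom] in \<open>auto simp: Q_def\<close>)
  ultimately have "generates S (L\<lparr>carrier := K\<rparr>) Q"
    unfolding generates_def D_def by blast
  moreover have "\<iota> \<in> mod_hom S L Q" "inj_on \<iota> (carrier L)"
    by (auto simp: mod_hom_iff Q_def intro: inj_on_inverseI[of _ \<kappa>])
  ultimately show "subgenerates S (L\<lparr>carrier := K\<rparr>) L"
    unfolding subgenerates_def using Q by blast
qed

end

section \<open>Tensor products\<close>

text \<open>The universal property of tensor products speaks of abelian groups, and many maps used
  with it, such as tensoring with a fixed element, are in general no more than additive.\<close>

definition additive :: "('m, 'y) ring_scheme \<Rightarrow> ('n, 'z) ring_scheme \<Rightarrow> ('m \<Rightarrow> 'n) \<Rightarrow> bool"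
  where "additive M N h \<longleftrightarrow> (\<forall>x\<in>carrier M. h x \<in> carrier N) \<and>
    (\<forall>x\<in>carrier M. \<forall>y\<in>carrier M. h (x \<oplus>\<^bsub>M\<^esub> y) = h x \<oplus>\<^bsub>N\<^esub> h y)"

lemma additiveI:
  assumes "\<And>x. x \<in> carrier M \<Longrightarrow> h x \<in> carrier N"
    and "\<And>x y. \<lbrakk>x \<in> carrier M; y \<in> carrier M\<rbrakk> \<Longrightarrow> h (x \<oplus>\<^bsub>M\<^esub> y) = h x \<oplus>\<^bsub>N\<^esub> h y"
  shows "additive M N h"
  using assms by (simp add: additive_def)

lemma additive_closed: "\<lbrakk>additive M N h; x \<in> carrier M\<rbrakk> \<Longrightarrow> h x \<in> carrier N"
  and additive_add: "\<lbrakk>additive M N h; x \<in> carrier M; y \<in> carrier M\<rbrakk>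
    \<Longrightarrow> h (x \<oplus>\<^bsub>M\<^esub> y) = h x \<oplus>\<^bsub>N\<^esub> h y"
  by (simp_all add: additive_def)

lemma additive_zero:
  assumes "additive M N h" "abelian_group M" "abelian_group N"
  shows "h \<zero>\<^bsub>M\<^esub> = \<zero>\<^bsub>N\<^esub>"
proof -
  interpret M: abelian_group M by fact
  interpret N: abelian_group N by fact
  show ?thesis
    using additive_add[OF assms(1) M.zero_closed M.zero_closed]
      additive_closed[OF assms(1) M.zero_closed] by simp
qed

lemma additive_minus:
  assumes "additive M N h" "abelian_group M" "abelian_group N" "x \<in> carrier M"
  shows "h (\<ominus>\<^bsub>M\<^esub> x) = \<ominus>\<^bsub>N\<^esub> h x"
proof -
  interpret M: abelian_group M by fact
  interpret N: abelian_group N by fact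
  have "h (\<ominus>\<^bsub>M\<^esub> x) \<oplus>\<^bsub>N\<^esub> h x = \<zero>\<^bsub>N\<^esub>"
    using additive_add[OF assms(1) M.a_inv_closed[OF assms(4)] assms(4)]
      additive_zero[OF assms(1-3)] assms(4) by (simp add: M.l_neg)
  then show ?thesis
    using additive_closed[OF assms(1)] assms(4) by (intro N.minus_equality[symmetric]) simp_all
qed

lemma right_mod_sel [simp]:
  "carrier (right_mod M) = carrier M" "\<zero>\<^bsub>right_mod M\<^esub> = \<zero>\<^bsub>M\<^esub>" "add (right_mod M) = add M"
  "a \<odot>\<^bsub>right_mod M\<^esub> x = rsmult M x a" "rsmult (right_mod M) = rsmult M"
  by (simp_all add: right_mod_def)

text \<open>The last three clauses correspond to the three families of generators in
  \<open>tensor_rel\<close>.\<close>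

definition balanced ::
    "('a, 'x) ring_scheme \<Rightarrow> ('a, 'm, 'y) bimodule_scheme \<Rightarrow> ('a, 'n, 'z) bimodule_scheme
      \<Rightarrow> ('g, 'w) ring_scheme \<Rightarrow> ('m \<Rightarrow> 'n \<Rightarrow> 'g) \<Rightarrow> bool"
  where "balanced A M N G \<beta> \<longleftrightarrow>
    (\<forall>x\<in>carrier M. \<forall>y\<in>carrier N. \<beta> x y \<in> carrier G) \<and>
    (\<forall>x\<in>carrier M. \<forall>x'\<in>carrier M. \<forall>y\<in>carrier N. \<beta> (x \<oplus>\<^bsub>M\<^esub> x') y = \<beta> x y \<oplus>\<^bsub>G\<^esub> \<beta> x' y) \<and>
    (\<forall>x\<in>carrier M. \<forall>y\<in>carrier N. \<forall>y'\<in>carrier N. \<beta> x (y \<oplus>\<^bsub>N\<^esub> y') = \<beta> x y \<oplus>\<^bsub>G\<^esub> \<beta> x y') \<and>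
    (\<forall>x\<in>carrier M. \<forall>a\<in>carrier A. \<forall>y\<in>carrier N. \<beta> (rsmult M x a) y = \<beta> x (a \<odot>\<^bsub>N\<^esub> y))"

lemma balancedI:
  assumes "\<And>x y. \<lbrakk>x \<in> carrier M; y \<in> carrier N\<rbrakk> \<Longrightarrow> \<beta> x y \<in> carrier G"
    and "\<And>x x' y. \<lbrakk>x \<in> carrier M; x' \<in> carrier M; y \<in> carrier N\<rbrakk>
      \<Longrightarrow> \<beta> (x \<oplus>\<^bsub>M\<^esub> x') y = \<beta> x y \<oplus>\<^bsub>G\<^esub> \<beta> x' y"
    and "\<And>x y y'. \<lbrakk>x \<in> carrier M; y \<in> carrier N; y' \<in> carrier N\<rbrakk>
      \<Longrightarrow> \<beta> x (y \<oplus>\<^bsub>N\<^esub> y') = \<beta> x y \<oplus>\<^bsub>G\<^esub> \<beta> x y'"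
    and "\<And>x a y. \<lbrakk>x \<in> carrier M; a \<in> carrier A; y \<in> carrier N\<rbrakk>
      \<Longrightarrow> \<beta> (rsmult M x a) y = \<beta> x (a \<odot>\<^bsub>N\<^esub> y)"
  shows "balanced A M N G \<beta>"
  using assms by (simp add: balanced_def)

lemma balanced_compose:
  assumes "balanced A M N G \<beta>" "additive G H h"
  shows "balanced A M N H (\<lambda>x y. h (\<beta> x y))"
  using assms by (simp add: balanced_def additive_def)

text \<open>Just the two inner actions, those that occur in the tensor relations, are assumed. The
  outer actions enter later, under bimodule assumptions on one factor at a time.\<close>

locale tensor_pair =
  fixes A :: "('a, 'x) ring_scheme" and M :: "('a, 'm, 'y) bimodule_scheme"
    and N :: "('a, 'n, 'z) bimodule_scheme"
  assumes right: "left_module (opposite A) (right_mod M)" and left: "left_module A N"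
begin

sublocale MR: left_module "opposite A" "right_mod M" by (rule right)
sublocale NL: left_module A N by (rule left)

abbreviation F where "F \<equiv> free_Abelian_group (carrier M \<times> carrier N)"
abbreviation U where "U \<equiv> tensor_rel A M N"
abbreviation pt where "pt \<equiv> pure_tensor A M N"

text \<open>Cosets are written with the total addition on finitely supported functions, which spares
  carrier conditions in the arithmetic of representatives.\<close>

definition cls :: "('m \<times> 'n \<Rightarrow>\<^sub>0 int) \<Rightarrow> ('m \<times> 'n \<Rightarrow>\<^sub>0 int) set"
  where "cls p = (\<lambda>u. u + p) ` U"

lemma abelian_group_M: "abelian_group M"
  by (rule abelian_group_cong[OF MR.M.abelian_group_axioms]) simp_all

lemma r_smult_closed [simp]:
  "\<lbrakk>x \<in> carrier M; a \<in> carrier A\<rbrakk> \<Longrightarrow> rsmult M x a \<in> carrier M"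
  using MR.lsmult_closed by simp

lemma M_add_closed [simp]: "\<lbrakk>x \<in> carrier M; y \<in> carrier M\<rbrakk> \<Longrightarrow> x \<oplus>\<^bsub>M\<^esub> y \<in> carrier M"
  using abelian_groupE(1)[OF abelian_group_M] .

lemma subgroup_U: "subgroup U F"
  unfolding tensor_rel_def
proof (rule group.generate_is_subgroup[OF group_free_Abelian_group])
  have k3: "Poly_Mapping.keys (frag_of k - frag_of l - frag_of m) \<subseteq> carrier M \<times> carrier N"
    if "k \<in> carrier M \<times> carrier N" "l \<in> carrier M \<times> carrier N" "m \<in> carrier M \<times> carrier N"
    for k l m :: "'m \<times> 'n"
  proof -
    have "Poly_Mapping.keys (frag_of k - frag_of l - frag_of m) \<subseteq> {k, l, m}"
      using keys_diff[of "frag_of k - frag_of l" "frag_of m"] keys_diff[of "frag_of k" "frag_of l"]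
      by (simp add: keys_frag_of) blast
    then show ?thesis using that by blast
  qed
  have k2: "Poly_Mapping.keys (frag_of k - frag_of l) \<subseteq> carrier M \<times> carrier N"
    if "k \<in> carrier M \<times> carrier N" "l \<in> carrier M \<times> carrier N" for k l :: "'m \<times> 'n"
  proof -
    have "Poly_Mapping.keys (frag_of k - frag_of l) \<subseteq> {k, l}"
      using keys_diff[of "frag_of k" "frag_of l"] by (simp add: keys_frag_of) blast
    then show ?thesis using that by blast
  qed
  show "{frag_of (x \<oplus>\<^bsub>M\<^esub> x', y) - frag_of (x, y) - frag_of (x', y) | x x' y.
        x \<in> carrier M \<and> x' \<in> carrier M \<and> y \<in> carrier N} \<union>
     {frag_of (x, y \<oplus>\<^bsub>N\<^esub> y') - frag_of (x, y) - frag_of (x, y') | x y y'.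
        x \<in> carrier M \<and> y \<in> carrier N \<and> y' \<in> carrier N} \<union>
     {frag_of (rsmult M x a, y) - frag_of (x, a \<odot>\<^bsub>N\<^esub> y) | x a y.
        x \<in> carrier M \<and> a \<in> carrier A \<and> y \<in> carrier N} \<subseteq> carrier F"
    by (intro Un_least subsetI; elim CollectE exE conjE;
        simp only: carrier_free_Abelian_group_iff; rule k3 k2; simp add: NL.lsmult_closed)
qed

lemma U_keys: "p \<in> U \<Longrightarrow> Poly_Mapping.keys p \<subseteq> carrier M \<times> carrier N"
  using subsetD[OF subgroup.subset[OF subgroup_U]] by simp

lemma U_zero: "0 \<in> U"
  using subgroup.one_closed[OF subgroup_U] by simp

lemma U_add: "\<lbrakk>p \<in> U; q \<in> U\<rbrakk> \<Longrightarrow> p + q \<in> U"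
  using subgroup.m_closed[OF subgroup_U] by simp

lemma U_minus: "p \<in> U \<Longrightarrow> - p \<in> U"
  using subgroup.m_inv_closed[OF subgroup_U, of p] U_keys[of p] by simp

lemma U_rels:
  "\<lbrakk>x \<in> carrier M; x' \<in> carrier M; y \<in> carrier N\<rbrakk>
    \<Longrightarrow> frag_of (x \<oplus>\<^bsub>M\<^esub> x', y) - frag_of (x, y) - frag_of (x', y) \<in> U"
  "\<lbrakk>x \<in> carrier M; y \<in> carrier N; y' \<in> carrier N\<rbrakk>
    \<Longrightarrow> frag_of (x, y \<oplus>\<^bsub>N\<^esub> y') - frag_of (x, y) - frag_of (x, y') \<in> U"
  "\<lbrakk>x \<in> carrier M; a \<in> carrier A; y \<in> carrier N\<rbrakk>
    \<Longrightarrow> frag_of (rsmult M x a, y) - frag_of (x, a \<odot>\<^bsub>N\<^esub> y) \<in> U"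
  unfolding tensor_rel_def by (rule generate.incl, blast)+

lemma cls_eq_iff: "cls p = cls q \<longleftrightarrow> p - q \<in> U"
proof
  assume "cls p = cls q"
  moreover have "p \<in> cls p" unfolding cls_def using U_zero by (intro image_eqI[of _ _ 0]) simp_all
  ultimately obtain u where "u \<in> U" "p = u + q" by (auto simp: cls_def)
  then show "p - q \<in> U" by simp
next
  assume d: "p - q \<in> U"
  show "cls p = cls q"
  proof (intro equalityI subsetI)
    fix r assume "r \<in> cls p"
    then obtain u where "u \<in> U" "r = u + p" by (auto simp: cls_def)
    then show "r \<in> cls q"
      unfolding cls_def using U_add[OF _ d] by (intro image_eqI[of _ _ "u + (p - q)"]) simp_all
  next
    fix r assume "r \<in> cls q"
    then obtain u where "u \<in> U" "r = u + q" by (auto simp: cls_def)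
    then show "r \<in> cls p"
      unfolding cls_def using U_add[OF _ U_minus[OF d]]
      by (intro image_eqI[of _ _ "u + - (p - q)"]) simp_all
  qed
qed

lemma r_coset_eq: "U #>\<^bsub>F\<^esub> p = cls p"
  by (auto simp: r_coset_def cls_def)

lemma tensor_carrier: "carrier (tensor A M N) = cls ` {p. Poly_Mapping.keys p \<subseteq> carrier M \<times> carrier N}"
  by (auto simp: tensor_def Let_def RCOSETS_def r_coset_eq)

lemma tensor_zero: "\<zero>\<^bsub>tensor A M N\<^esub> = cls 0"
  by (simp add: tensor_def Let_def cls_def)

lemma tensor_add: "cls p \<oplus>\<^bsub>tensor A M N\<^esub> cls q = cls (p + q)"
proof -
  have "set_mult F (cls p) (cls q) = cls (p + q)"
  proof (intro equalityI subsetI)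
    fix r assume "r \<in> set_mult F (cls p) (cls q)"
    then obtain u v where "u \<in> U" "v \<in> U" "r = (u + p) + (v + q)"
      by (auto simp: set_mult_def cls_def)
    then show "r \<in> cls (p + q)"
      unfolding cls_def using U_add[of u v] by (intro image_eqI[of _ _ "u + v"]) simp_all
  next
    fix r assume "r \<in> cls (p + q)"
    then obtain u where u: "u \<in> U" "r = (u + p) + (0 + q)"
      by (auto simp: cls_def add.assoc)
    have "u + p \<in> cls p" "0 + q \<in> cls q"
      unfolding cls_def by (rule imageI[OF u(1)], rule imageI[OF U_zero])
    then show "r \<in> set_mult F (cls p) (cls q)"
      unfolding set_mult_def u(2) mult_free_Abelian_group by blast
  qed
  then show ?thesis by (simp add: tensor_def Let_def)
qed

lemma pure_tensor_eq: "pt x y = cls (frag_of (x, y))"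
  by (simp add: pure_tensor_def r_coset_eq)

lemma keys_add_subset: "\<lbrakk>Poly_Mapping.keys p \<subseteq> S; Poly_Mapping.keys q \<subseteq> S\<rbrakk> \<Longrightarrow> Poly_Mapping.keys (p + q) \<subseteq> S" for p q :: "'k \<Rightarrow>\<^sub>0 int"
  using keys_add[of p q] by auto

lemma abelian_group_tensor: "abelian_group (tensor A M N)"
proof (rule abelian_groupI)
  fix X assume "X \<in> carrier (tensor A M N)"
  then obtain p where p: "Poly_Mapping.keys p \<subseteq> carrier M \<times> carrier N" "X = cls p"
    by (auto simp: tensor_carrier)
  show "\<exists>Y\<in>carrier (tensor A M N). Y \<oplus>\<^bsub>tensor A M N\<^esub> X = \<zero>\<^bsub>tensor A M N\<^esub>"
    using p by (intro bexI[of _ "cls (- p)"]) (auto simp: tensor_carrier tensor_add tensor_zero)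
next
  fix X Y assume "X \<in> carrier (tensor A M N)" "Y \<in> carrier (tensor A M N)"
  then obtain p q where "Poly_Mapping.keys p \<subseteq> carrier M \<times> carrier N" "X = cls p"
    "Poly_Mapping.keys q \<subseteq> carrier M \<times> carrier N" "Y = cls q"
    by (auto simp: tensor_carrier)
  then show "X \<oplus>\<^bsub>tensor A M N\<^esub> Y \<in> carrier (tensor A M N)"
    by (simp add: tensor_add tensor_carrier keys_add_subset)
qed (auto simp: tensor_carrier tensor_zero tensor_add add_ac)

sublocale TN: abelian_group "tensor A M N" by (rule abelian_group_tensor)

lemma pure_tensor_closed [simp]:
  "\<lbrakk>x \<in> carrier M; y \<in> carrier N\<rbrakk> \<Longrightarrow> pt x y \<in> carrier (tensor A M N)"
  by (auto simp: pure_tensor_eq tensor_carrier keys_frag_of)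

lemma balanced_pure_tensor: "balanced A M N (tensor A M N) pt"
  using U_rels by (intro balancedI)
    (simp_all add: pure_tensor_eq[symmetric], simp_all add: pure_tensor_eq tensor_add cls_eq_iff diff_diff_eq)

text \<open>Differences replace sums, as in the induction rule for free abelian groups, so that
  negative coefficients are covered by the same case.\<close>

lemma tensor_induct [consumes 1, case_names zero pure diff]:
  assumes X: "X \<in> carrier (tensor A M N)"
    and zero: "P \<zero>\<^bsub>tensor A M N\<^esub>"
    and pure: "\<And>x y. \<lbrakk>x \<in> carrier M; y \<in> carrier N\<rbrakk> \<Longrightarrow> P (pt x y)"
    and diff: "\<And>X Y. \<lbrakk>X \<in> carrier (tensor A M N); Y \<in> carrier (tensor A M N); P X; P Y\<rbrakk>
      \<Longrightarrow> P (X \<oplus>\<^bsub>tensor A M N\<^esub> \<ominus>\<^bsub>tensor A M N\<^esub> Y)"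
  shows "P X"
proof -
  obtain p where p: "Poly_Mapping.keys p \<subseteq> carrier M \<times> carrier N" "X = cls p"
    using X by (auto simp: tensor_carrier)
  have "P (cls p)"
    using p(1)
  proof (induction p rule: free_Abelian_group_induct [consumes 1, case_names zero diff one])
    case (diff p q)
    have cl: "cls p \<in> carrier (tensor A M N)" "cls q \<in> carrier (tensor A M N)"
      using diff.hyps by (auto simp: tensor_carrier)
    have q': "cls (- q) \<in> carrier (tensor A M N)"
      using diff.hyps by (auto simp: tensor_carrier)
    have "cls (- q) \<oplus>\<^bsub>tensor A M N\<^esub> cls q = \<zero>\<^bsub>tensor A M N\<^esub>"
      by (simp add: tensor_add tensor_zero)
    then have "\<ominus>\<^bsub>tensor A M N\<^esub> cls q = cls (- q)"
      using TN.minus_equality[OF _ cl(2) q'] by simp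
    then have "cls p \<oplus>\<^bsub>tensor A M N\<^esub> \<ominus>\<^bsub>tensor A M N\<^esub> cls q = cls (p - q)"
      by (simp add: tensor_add)
    then show ?case using assms(4)[OF cl diff.IH] by simp
  qed (use zero pure in \<open>auto simp: tensor_zero pure_tensor_eq\<close>)
  then show ?thesis using p(2) by simp
qed

text \<open>The uniqueness half of the universal property: pure tensors generate the tensor product
  as a group.\<close>

lemma additive_eqI:
  assumes h: "additive (tensor A M N) G h" and k: "additive (tensor A M N) G k" and G: "abelian_group G"
    and eq: "\<And>x y. \<lbrakk>x \<in> carrier M; y \<in> carrier N\<rbrakk> \<Longrightarrow> h (pt x y) = k (pt x y)"
    and X: "X \<in> carrier (tensor A M N)"
  shows "h X = k X"
  using X
proof (induction rule: tensor_induct)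
  case (diff X Y)
  then show ?case
    by (simp add: additive_add[OF h] additive_add[OF k] additive_minus[OF h abelian_group_tensor G]
        additive_minus[OF k abelian_group_tensor G])
qed (use eq in \<open>simp_all add: additive_zero[OF h abelian_group_tensor G]
    additive_zero[OF k abelian_group_tensor G]\<close>)

section \<open>Existence half of the universal property\<close>

definition lift_frag :: "('g, 'w) ring_scheme \<Rightarrow> ('m \<Rightarrow> 'n \<Rightarrow> 'g) \<Rightarrow> ('m \<times> 'n \<Rightarrow>\<^sub>0 int) \<Rightarrow> 'g"
  where "lift_frag G \<beta> p =
    (\<Oplus>\<^bsub>G\<^esub>k\<in>Poly_Mapping.keys p. add_pow G (Poly_Mapping.lookup p k) (\<beta> (fst k) (snd k)))"

context
  fixes G :: "('g, 'w) ring_scheme" and \<beta> :: "'m \<Rightarrow> 'n \<Rightarrow> 'g"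
  assumes G: "abelian_group G" and \<beta>: "balanced A M N G \<beta>"
begin

interpretation G: abelian_group G by (rule G)

lemma \<beta>_closed: "\<lbrakk>x \<in> carrier M; y \<in> carrier N\<rbrakk> \<Longrightarrow> \<beta> x y \<in> carrier G"
  using \<beta> by (simp add: balanced_def)

lemma add_pow_0: "add_pow G (0::int) x = \<zero>\<^bsub>G\<^esub>"
  by (simp add: add_pow_def)

lemma lift_frag_superset:
  assumes "finite J" "Poly_Mapping.keys p \<subseteq> J" "J \<subseteq> carrier M \<times> carrier N"
  shows "lift_frag G \<beta> p = (\<Oplus>\<^bsub>G\<^esub>k\<in>J. add_pow G (Poly_Mapping.lookup p k) (\<beta> (fst k) (snd k)))"
  unfolding lift_frag_def
  by (rule G.add.finprod_mono_neutral_cong_left)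
    (use assms \<beta>_closed in \<open>auto simp: not_in_keys_iff_lookup_eq_zero subset_iff add_pow_0\<close>)

lemma lift_frag_closed: "Poly_Mapping.keys p \<subseteq> carrier M \<times> carrier N \<Longrightarrow> lift_frag G \<beta> p \<in> carrier G"
  unfolding lift_frag_def using \<beta>_closed
  by (intro G.finsum_closed) (auto simp: subset_iff)

lemma lift_frag_add:
  assumes p: "Poly_Mapping.keys p \<subseteq> carrier M \<times> carrier N" and q: "Poly_Mapping.keys q \<subseteq> carrier M \<times> carrier N"
  shows "lift_frag G \<beta> (p + q) = lift_frag G \<beta> p \<oplus>\<^bsub>G\<^esub> lift_frag G \<beta> q"
proof -
  let ?J = "Poly_Mapping.keys p \<union> Poly_Mapping.keys q"
  have J: "finite ?J" "?J \<subseteq> carrier M \<times> carrier N" "Poly_Mapping.keys (p + q) \<subseteq> ?J"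
    using p q keys_add[of p q] by auto
  have cl: "\<beta> (fst k) (snd k) \<in> carrier G" if "k \<in> ?J" for k
    using that J(2) \<beta>_closed by (cases k) auto
  have "lift_frag G \<beta> (p + q) =
      (\<Oplus>\<^bsub>G\<^esub>k\<in>?J. add_pow G (Poly_Mapping.lookup p k) (\<beta> (fst k) (snd k)) \<oplus>\<^bsub>G\<^esub>
        add_pow G (Poly_Mapping.lookup q k) (\<beta> (fst k) (snd k)))"
    unfolding lift_frag_superset[OF J(1,3,2)]
    by (rule G.finsum_cong')
      (use cl in \<open>auto simp: lookup_add G.add.int_pow_mult\<close>)
  also have "\<dots> = lift_frag G \<beta> p \<oplus>\<^bsub>G\<^esub> lift_frag G \<beta> q"
    unfolding lift_frag_superset[OF J(1) Un_upper1 J(2)] lift_frag_superset[OF J(1) Un_upper2 J(2)]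
    by (rule G.finsum_addf) (use cl in \<open>auto\<close>)
  finally show ?thesis .
qed

lemma lift_frag_of: "\<lbrakk>x \<in> carrier M; y \<in> carrier N\<rbrakk> \<Longrightarrow> lift_frag G \<beta> (frag_of (x, y)) = \<beta> x y"
  using \<beta>_closed[of x y]
  by (subst lift_frag_superset[of "{(x, y)}"])
    (simp_all add: keys_frag_of)

lemma lift_frag_minus:
  assumes "Poly_Mapping.keys p \<subseteq> carrier M \<times> carrier N"
  shows "lift_frag G \<beta> (- p) = \<ominus>\<^bsub>G\<^esub> lift_frag G \<beta> p"
proof -
  have "lift_frag G \<beta> (- p) \<oplus>\<^bsub>G\<^esub> lift_frag G \<beta> p = \<zero>\<^bsub>G\<^esub>"
    using lift_frag_add[of "- p" p] assms by (simp add: lift_frag_def)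
  then show ?thesis
    using lift_frag_closed[of p] lift_frag_closed[of "- p"] assms
    by (intro G.minus_equality[symmetric]) simp_all
qed

text \<open>The formal sums with value zero form a subgroup, and balancedness puts the generators of
  the relations into it.\<close>

lemma lift_frag_U:
  assumes "p \<in> U"
  shows "lift_frag G \<beta> p = \<zero>\<^bsub>G\<^esub>"
proof -
  have kd: "Poly_Mapping.keys (p - q) \<subseteq> S" if "Poly_Mapping.keys p \<subseteq> S" "Poly_Mapping.keys q \<subseteq> S" for p q :: "'m \<times> 'n \<Rightarrow>\<^sub>0 int" and S
    using that keys_diff[of p q] by auto
  have diff: "lift_frag G \<beta> (p - q) = lift_frag G \<beta> p \<oplus>\<^bsub>G\<^esub> \<ominus>\<^bsub>G\<^esub> lift_frag G \<beta> q"
    if "Poly_Mapping.keys p \<subseteq> carrier M \<times> carrier N" "Poly_Mapping.keys q \<subseteq> carrier M \<times> carrier N" for p q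
    using lift_frag_add[of p "- q"] lift_frag_minus[of q] that by simp
  have frag: "Poly_Mapping.keys (frag_of k) \<subseteq> carrier M \<times> carrier N" if "k \<in> carrier M \<times> carrier N" for k
    using that by (simp add: keys_frag_of)
  have can: "b \<oplus>\<^bsub>G\<^esub> c \<oplus>\<^bsub>G\<^esub> \<ominus>\<^bsub>G\<^esub> b \<oplus>\<^bsub>G\<^esub> \<ominus>\<^bsub>G\<^esub> c = \<zero>\<^bsub>G\<^esub>" if "b \<in> carrier G" "c \<in> carrier G" for b c
  proof -
    have "b \<oplus>\<^bsub>G\<^esub> c \<oplus>\<^bsub>G\<^esub> \<ominus>\<^bsub>G\<^esub> b \<oplus>\<^bsub>G\<^esub> \<ominus>\<^bsub>G\<^esub> c = (b \<oplus>\<^bsub>G\<^esub> \<ominus>\<^bsub>G\<^esub> b) \<oplus>\<^bsub>G\<^esub> (c \<oplus>\<^bsub>G\<^esub> \<ominus>\<^bsub>G\<^esub> c)"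
      using that by (simp add: G.a_ac)
    then show ?thesis using that by (simp add: G.r_neg)
  qed
  define Ker where "Ker = {p. Poly_Mapping.keys p \<subseteq> carrier M \<times> carrier N \<and> lift_frag G \<beta> p = \<zero>\<^bsub>G\<^esub>}"
  have "subgroup Ker F"
    by (rule subgroup.intro) (auto simp: Ker_def lift_frag_add lift_frag_minus keys_add_subset,
        simp add: lift_frag_def)
  then have "U \<subseteq> Ker"
    unfolding tensor_rel_def
  proof (rule group.generate_subgroup_incl[OF group_free_Abelian_group, rotated], intro Un_least subsetI)
    fix p assume "p \<in> {frag_of (x \<oplus>\<^bsub>M\<^esub> x', y) - frag_of (x, y) - frag_of (x', y) | x x' y.
        x \<in> carrier M \<and> x' \<in> carrier M \<and> y \<in> carrier N}"
    then obtain x x' y where *: "x \<in> carrier M" "x' \<in> carrier M" "y \<in> carrier N"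
      "p = frag_of (x \<oplus>\<^bsub>M\<^esub> x', y) - frag_of (x, y) - frag_of (x', y)" by blast
    then show "p \<in> Ker"
      using \<beta> by (simp add: Ker_def diff frag kd lift_frag_of can balanced_def)
  next
    fix p assume "p \<in> {frag_of (x, y \<oplus>\<^bsub>N\<^esub> y') - frag_of (x, y) - frag_of (x, y') | x y y'.
        x \<in> carrier M \<and> y \<in> carrier N \<and> y' \<in> carrier N}"
    then obtain x y y' where *: "x \<in> carrier M" "y \<in> carrier N" "y' \<in> carrier N"
      "p = frag_of (x, y \<oplus>\<^bsub>N\<^esub> y') - frag_of (x, y) - frag_of (x, y')" by blast
    then show "p \<in> Ker"
      using \<beta> by (simp add: Ker_def diff frag kd lift_frag_of can balanced_def)
  next
    fix p assume "p \<in> {frag_of (rsmult M x a, y) - frag_of (x, a \<odot>\<^bsub>N\<^esub> y) | x a y.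
        x \<in> carrier M \<and> a \<in> carrier A \<and> y \<in> carrier N}"
    then obtain x a y where *: "x \<in> carrier M" "a \<in> carrier A" "y \<in> carrier N"
      "p = frag_of (rsmult M x a, y) - frag_of (x, a \<odot>\<^bsub>N\<^esub> y)" by blast
    then show "p \<in> Ker"
      using \<beta> by (simp add: Ker_def diff frag kd lift_frag_of NL.lsmult_closed balanced_def G.r_neg)
  qed
  then show ?thesis using assms by (auto simp: Ker_def)
qed

text \<open>Representatives of one coset differ by relations, whose value is zero. So the image of
  the coset is a singleton, and \<open>the_elem\<close> in \<open>tensor_lift\<close> is
  meaningful.\<close>

lemma tensor_lift_cls:
  assumes p: "Poly_Mapping.keys p \<subseteq> carrier M \<times> carrier N"
  shows "tensor_lift G \<beta> (cls p) = lift_frag G \<beta> p"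
proof -
  have "lift_frag G \<beta> (u + p) = lift_frag G \<beta> p" if u: "u \<in> U" for u
    using lift_frag_add[OF U_keys[OF u] p] lift_frag_U[OF u] lift_frag_closed[OF p] by simp
  then have "lift_frag G \<beta> ` cls p = {lift_frag G \<beta> p}"
    using U_zero by (auto simp: cls_def image_image)
  then show ?thesis
    by (simp add: tensor_lift_def lift_frag_def[abs_def])
qed

lemma additive_tensor_lift: "additive (tensor A M N) G (tensor_lift G \<beta>)"
proof (rule additiveI)
  fix X assume "X \<in> carrier (tensor A M N)"
  then obtain p where p: "Poly_Mapping.keys p \<subseteq> carrier M \<times> carrier N" "X = cls p"
    by (auto simp: tensor_carrier)
  then show "tensor_lift G \<beta> X \<in> carrier G"
    by (simp add: tensor_lift_cls lift_frag_closed)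
  fix Y assume "Y \<in> carrier (tensor A M N)"
  then obtain q where q: "Poly_Mapping.keys q \<subseteq> carrier M \<times> carrier N" "Y = cls q"
    by (auto simp: tensor_carrier)
  show "tensor_lift G \<beta> (X \<oplus>\<^bsub>tensor A M N\<^esub> Y) = tensor_lift G \<beta> X \<oplus>\<^bsub>G\<^esub> tensor_lift G \<beta> Y"
    using p q by (simp add: tensor_add tensor_lift_cls keys_add_subset lift_frag_add)
qed

lemma tensor_lift_pure:
  "\<lbrakk>x \<in> carrier M; y \<in> carrier N\<rbrakk> \<Longrightarrow> tensor_lift G \<beta> (pt x y) = \<beta> x y"
  by (simp add: pure_tensor_eq tensor_lift_cls keys_frag_of lift_frag_of)

lemma tensor_lift_unique:
  assumes "additive (tensor A M N) G h" "X \<in> carrier (tensor A M N)"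
    and "\<And>x y. \<lbrakk>x \<in> carrier M; y \<in> carrier N\<rbrakk> \<Longrightarrow> h (pt x y) = \<beta> x y"
  shows "tensor_lift G \<beta> X = h X"
  by (rule additive_eqI[OF additive_tensor_lift assms(1) G _ assms(2)])
    (simp add: tensor_lift_pure assms(3))

end

text \<open>Pushes an additive map inside a Sweedler sum. Together with
  \<open>tensor_lift_cong\<close>, which rewrites the summands, this is the calculus of all later
  computations.\<close>

lemma tensor_lift_compose:
  assumes "abelian_group G" "balanced A M N G \<beta>" and H: "abelian_group H" and h: "additive G H h"
    and X: "X \<in> carrier (tensor A M N)"
  shows "h (tensor_lift G \<beta> X) = tensor_lift H (\<lambda>x y. h (\<beta> x y)) X"
proof (rule tensor_lift_unique[symmetric, OF H balanced_compose[OF assms(2) h] _ X])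
  note lift = additive_tensor_lift[OF assms(1,2)]
  show "additive (tensor A M N) H (\<lambda>X. h (tensor_lift G \<beta> X))"
    by (rule additiveI) (simp_all add: additive_closed[OF h] additive_closed[OF lift]
        additive_add[OF h] additive_add[OF lift])
  show "h (tensor_lift G \<beta> (pt x y)) = h (\<beta> x y)" if "x \<in> carrier M" "y \<in> carrier N" for x y
    using tensor_lift_pure[OF assms(1,2) that] by simp
qed

lemma balanced_cong:
  assumes "balanced A M N G \<beta>" "\<And>x y. \<lbrakk>x \<in> carrier M; y \<in> carrier N\<rbrakk> \<Longrightarrow> \<gamma> x y = \<beta> x y"
  shows "balanced A M N G \<gamma>"
  using assms NL.lsmult_closed by (simp add: balanced_def)

lemma tensor_lift_cong:
  assumes "abelian_group G" "balanced A M N G \<beta>" "X \<in> carrier (tensor A M N)"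
    and eq: "\<And>x y. \<lbrakk>x \<in> carrier M; y \<in> carrier N\<rbrakk> \<Longrightarrow> \<gamma> x y = \<beta> x y"
  shows "tensor_lift G \<gamma> X = tensor_lift G \<beta> X"
  by (rule tensor_lift_unique[OF assms(1) balanced_cong[OF assms(2) eq]
        additive_tensor_lift[OF assms(1,2)] assms(3)])
    (simp_all add: eq tensor_lift_pure[OF assms(1,2)])

lemma tensor_lift_closed:
  assumes "abelian_group G" "balanced A M N G \<beta>" "X \<in> carrier (tensor A M N)"
  shows "tensor_lift G \<beta> X \<in> carrier G"
  by (rule additive_closed[OF additive_tensor_lift[OF assms(1,2)] assms(3)])

lemma tensor_lift_pure_tensor:
  assumes "X \<in> carrier (tensor A M N)"
  shows "tensor_lift (tensor A M N) pt X = X"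
  by (rule tensor_lift_unique[OF abelian_group_tensor balanced_pure_tensor _ assms])
    (simp_all add: additive_def)

lemma tensor_lift_add_fun:
  assumes G: "abelian_group G" and \<beta>: "balanced A M N G \<beta>" and \<gamma>: "balanced A M N G \<gamma>"
    and X: "X \<in> carrier (tensor A M N)"
  shows "tensor_lift G (\<lambda>x y. \<beta> x y \<oplus>\<^bsub>G\<^esub> \<gamma> x y) X = tensor_lift G \<beta> X \<oplus>\<^bsub>G\<^esub> tensor_lift G \<gamma> X"
proof -
  interpret G: abelian_group G by fact
  note cl = additive_closed[OF additive_tensor_lift[OF G \<beta>]] additive_closed[OF additive_tensor_lift[OF G \<gamma>]]
  note ad = additive_add[OF additive_tensor_lift[OF G \<beta>]] additive_add[OF additive_tensor_lift[OF G \<gamma>]]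
  have "balanced A M N G (\<lambda>x y. \<beta> x y \<oplus>\<^bsub>G\<^esub> \<gamma> x y)"
    using \<beta> \<gamma> by (simp add: balanced_def G.a_ac)
  then show ?thesis
    by (rule tensor_lift_unique[OF G _ _ X])
      (auto intro!: additiveI simp: cl ad G.a_ac tensor_lift_pure[OF G \<beta>] tensor_lift_pure[OF G \<gamma>])
qed

text \<open>Outer actions and the flip are defined by substituting pairs inside formal sums. When
  the substitution \<open>\<sigma>\<close> induces a balanced map, it computes the lift of that map;
  since lifts vanish on relations, it also sends relations to relations.\<close>

lemma cls_frag_extend:
  assumes N': "tensor_pair A' M' N'"
    and \<sigma>: "\<And>x y. \<lbrakk>x \<in> carrier M; y \<in> carrier N\<rbrakk> \<Longrightarrow> \<sigma> (x, y) \<in> carrier M' \<times> carrier N'"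
    and bal: "balanced A M N (tensor A' M' N') (\<lambda>x y. pure_tensor A' M' N' (fst (\<sigma> (x, y))) (snd (\<sigma> (x, y))))"
  shows "Poly_Mapping.keys p \<subseteq> carrier M \<times> carrier N \<Longrightarrow>
      Poly_Mapping.keys (frag_extend (\<lambda>k. frag_of (\<sigma> k)) p) \<subseteq> carrier M' \<times> carrier N' \<and>
      tensor_pair.cls A' M' N' (frag_extend (\<lambda>k. frag_of (\<sigma> k)) p) =
        lift_frag (tensor A' M' N') (\<lambda>x y. pure_tensor A' M' N' (fst (\<sigma> (x, y))) (snd (\<sigma> (x, y)))) p"
    (is "_ \<Longrightarrow> _ \<and> _ = lift_frag _ ?\<beta> p")
    and "p \<in> U \<Longrightarrow> frag_extend (\<lambda>k. frag_of (\<sigma> k)) p \<in> tensor_rel A' M' N'"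
proof -
  interpret T': tensor_pair A' M' N' by fact
  note lf_add = lift_frag_add[OF T'.abelian_group_tensor bal]
  note lf_minus = lift_frag_minus[OF T'.abelian_group_tensor bal]
  let ?s = "frag_extend (\<lambda>k. frag_of (\<sigma> k))"
  have keys: "Poly_Mapping.keys (?s p) \<subseteq> carrier M' \<times> carrier N'"
    if "Poly_Mapping.keys p \<subseteq> carrier M \<times> carrier N" for p
    using keys_frag_extend[of "\<lambda>k. frag_of (\<sigma> k)" p] that \<sigma> by (force simp: keys_frag_of)
  have cls: "T'.cls (?s p) = lift_frag (tensor A' M' N') ?\<beta> p"
    if "Poly_Mapping.keys p \<subseteq> carrier M \<times> carrier N" for p
    using that
  proof (induction p rule: free_Abelian_group_induct [consumes 1, case_names zero diff one])
    case zero
    show ?case by (simp add: lift_frag_def T'.tensor_zero)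
  next
    case (diff p q)
    have "T'.cls (?s (p - q)) = T'.cls (?s p) \<oplus>\<^bsub>tensor A' M' N'\<^esub> T'.cls (?s (- q))"
      by (simp add: T'.tensor_add frag_extend_diff frag_extend_minus)
    also have "T'.cls (?s (- q)) = \<ominus>\<^bsub>tensor A' M' N'\<^esub> T'.cls (?s q)"
      using keys[OF diff.hyps(2)] T'.tensor_carrier
      by (intro T'.TN.minus_equality[symmetric])
        (auto simp: T'.tensor_add frag_extend_minus T'.tensor_zero)
    finally show ?case
      using lf_add[of p "- q"] lf_minus[of q] diff by simp
  next
    case (one k)
    then show ?case
      using lift_frag_of[OF T'.abelian_group_tensor bal, of "fst k" "snd k"]
      by (auto simp: T'.pure_tensor_eq)
  qed
  show "Poly_Mapping.keys (?s p) \<subseteq> carrier M' \<times> carrier N' \<and>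
      T'.cls (?s p) = lift_frag (tensor A' M' N') ?\<beta> p"
    if "Poly_Mapping.keys p \<subseteq> carrier M \<times> carrier N"
    using keys[OF that] cls[OF that] ..
  show "?s p \<in> tensor_rel A' M' N'" if "p \<in> U"
    using cls[OF U_keys[OF that]] lift_frag_U[OF T'.abelian_group_tensor bal that]
      T'.cls_eq_iff[of "?s p" 0] T'.tensor_zero by simp
qed

lemma coset_frag_extend:
  assumes N': "tensor_pair A' M' N'"
    and \<sigma>: "\<And>x y. \<lbrakk>x \<in> carrier M; y \<in> carrier N\<rbrakk> \<Longrightarrow> \<sigma> (x, y) \<in> carrier M' \<times> carrier N'"
    and bal: "balanced A M N (tensor A' M' N') (\<lambda>x y. pure_tensor A' M' N' (fst (\<sigma> (x, y))) (snd (\<sigma> (x, y))))"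
    and X: "X \<in> carrier (tensor A M N)"
  shows "tensor_rel A' M' N' <#>\<^bsub>free_Abelian_group (carrier M' \<times> carrier N')\<^esub>
        frag_extend (\<lambda>k. frag_of (\<sigma> k)) ` X =
      tensor_lift (tensor A' M' N') (\<lambda>x y. pure_tensor A' M' N' (fst (\<sigma> (x, y))) (snd (\<sigma> (x, y)))) X"
proof -
  interpret T': tensor_pair A' M' N' by fact
  let ?s = "frag_extend (\<lambda>k. frag_of (\<sigma> k))"
  obtain p where p: "Poly_Mapping.keys p \<subseteq> carrier M \<times> carrier N" "X = cls p"
    using X by (auto simp: tensor_carrier)
  have "set_mult (free_Abelian_group (carrier M' \<times> carrier N')) (tensor_rel A' M' N') (?s ` X) = T'.cls (?s p)"
  proof (intro equalityI subsetI)
    fix r assume "r \<in> set_mult (free_Abelian_group (carrier M' \<times> carrier N')) (tensor_rel A' M' N') (?s ` X)"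
    then obtain v u where vu: "v \<in> tensor_rel A' M' N'" "u \<in> U" "r = v + ?s (u + p)"
      by (auto simp: set_mult_def p(2) cls_def)
    then have "v + ?s u \<in> tensor_rel A' M' N'"
      using T'.U_add cls_frag_extend(2)[OF N' \<sigma> bal] by blast
    then show "r \<in> T'.cls (?s p)"
      unfolding T'.cls_def vu(3) by (intro image_eqI[of _ _ "v + ?s u"]) (simp_all add: frag_extend_add)
  next
    fix r assume "r \<in> T'.cls (?s p)"
    then obtain v where v: "v \<in> tensor_rel A' M' N'" "r = v + ?s p"
      by (auto simp: T'.cls_def)
    have "p \<in> X" unfolding p(2) cls_def using U_zero by (intro image_eqI[of _ _ 0]) simp_all
    then show "r \<in> set_mult (free_Abelian_group (carrier M' \<times> carrier N')) (tensor_rel A' M' N') (?s ` X)"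
      using v by (auto simp: set_mult_def)
  qed
  then show ?thesis
    using cls_frag_extend(1)[OF N' \<sigma> bal p(1)] tensor_lift_cls[OF T'.abelian_group_tensor bal p(1)]
    by (simp add: p(2))
qed

end

lemma bimoduleD:
  assumes "bimodule A M"
  shows "left_module A M" "left_module (opposite A) (right_mod M)"
    and "\<lbrakk>a \<in> carrier A; b \<in> carrier A; x \<in> carrier M\<rbrakk>
      \<Longrightarrow> rsmult M (a \<odot>\<^bsub>M\<^esub> x) b = a \<odot>\<^bsub>M\<^esub> rsmult M x b"
  using assms by (simp_all add: bimodule_def)

lemma left_module_cong:
  assumes M: "left_module T M" and eq: "carrier M' = carrier M" "\<zero>\<^bsub>M'\<^esub> = \<zero>\<^bsub>M\<^esub>" "add M' = add M" "smult M' = smult M"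
  shows "left_module T M'"
proof -
  interpret M: left_module T M by fact
  show ?thesis
    by (rule left_moduleI[OF M.T.ring_axioms abelian_group_cong[OF M.M.abelian_group_axioms eq(1-3)]])
      (simp_all add: eq M.lsmult_closed M.lsmult_l_distr M.lsmult_r_distr M.lsmult_assoc M.lsmult_one)
qed

section \<open>The outer module structures of a tensor product\<close>

context tensor_pair
begin

context
  assumes bi: "bimodule A M"
begin

interpretation LM: left_module A M by (rule bimoduleD(1)[OF bi])

text \<open>The bimodule law for the two actions on \<open>M\<close> is what keeps the modified map
  balanced.\<close>

lemma balanced_smult:
  assumes \<beta>: "balanced A M N G \<beta>" and a: "a \<in> carrier A"
  shows "balanced A M N G (\<lambda>x y. \<beta> (a \<odot>\<^bsub>M\<^esub> x) y)"
  using \<beta> a bimoduleD(3)[OF bi, symmetric]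
  by (simp add: balanced_def LM.lsmult_closed LM.lsmult_r_distr)

lemma tensor_smult:
  assumes a: "a \<in> carrier A" and X: "X \<in> carrier (tensor A M N)"
  shows "a \<odot>\<^bsub>tensor A M N\<^esub> X = tensor_lift (tensor A M N) (\<lambda>x y. pt (a \<odot>\<^bsub>M\<^esub> x) y) X"
proof -
  let ?\<sigma> = "\<lambda>(x, y). (a \<odot>\<^bsub>M\<^esub> x, y)"
  have eq: "(\<lambda>(x, y). frag_of (a \<odot>\<^bsub>M\<^esub> x, y)) = (\<lambda>k. frag_of (?\<sigma> k))"
    by (simp add: fun_eq_iff)
  have "U <#>\<^bsub>F\<^esub> frag_extend (\<lambda>k. frag_of (?\<sigma> k)) ` X
      = tensor_lift (tensor A M N) (\<lambda>x y. pt (fst (?\<sigma> (x, y))) (snd (?\<sigma> (x, y)))) X"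
    by (rule coset_frag_extend[OF tensor_pair_axioms _ _ X])
      (use a balanced_smult[OF balanced_pure_tensor a] in \<open>simp_all add: LM.lsmult_closed\<close>)
  then show ?thesis
    by (simp add: tensor_def Let_def eq)
qed

lemma smult_pure_tensor:
  "\<lbrakk>a \<in> carrier A; x \<in> carrier M; y \<in> carrier N\<rbrakk>
    \<Longrightarrow> a \<odot>\<^bsub>tensor A M N\<^esub> pt x y = pt (a \<odot>\<^bsub>M\<^esub> x) y"
  using tensor_lift_pure[OF abelian_group_tensor balanced_smult[OF balanced_pure_tensor]]
  by (simp add: tensor_smult)

lemma tensor_lift_smult:
  assumes G: "abelian_group G" and \<beta>: "balanced A M N G \<beta>"
    and a: "a \<in> carrier A" and X: "X \<in> carrier (tensor A M N)"
  shows "tensor_lift G \<beta> (a \<odot>\<^bsub>tensor A M N\<^esub> X) = tensor_lift G (\<lambda>x y. \<beta> (a \<odot>\<^bsub>M\<^esub> x) y) X"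
proof -
  note b = balanced_smult[OF balanced_pure_tensor a]
  have "tensor_lift G \<beta> (a \<odot>\<^bsub>tensor A M N\<^esub> X) = tensor_lift G (\<lambda>x y. tensor_lift G \<beta> (pt (a \<odot>\<^bsub>M\<^esub> x) y)) X"
    unfolding tensor_smult[OF a X]
    by (rule tensor_lift_compose[OF abelian_group_tensor b G additive_tensor_lift[OF G \<beta>] X])
  also have "\<dots> = tensor_lift G (\<lambda>x y. \<beta> (a \<odot>\<^bsub>M\<^esub> x) y) X"
    by (rule tensor_lift_cong[OF G balanced_smult[OF \<beta> a] X])
      (simp add: tensor_lift_pure[OF G \<beta>] LM.lsmult_closed a)
  finally show ?thesis .
qed

lemma left_module_tensor: "left_module A (tensor A M N)"
proof (rule left_moduleI[OF NL.T.ring_axioms abelian_group_tensor])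
  note ab = abelian_group_tensor
  note b = balanced_smult[OF balanced_pure_tensor]
  fix a X assume a: "a \<in> carrier A" and X: "X \<in> carrier (tensor A M N)"
  show aX: "a \<odot>\<^bsub>tensor A M N\<^esub> X \<in> carrier (tensor A M N)"
    unfolding tensor_smult[OF a X] by (rule tensor_lift_closed[OF ab b[OF a] X])
  show "a \<odot>\<^bsub>tensor A M N\<^esub> (X \<oplus>\<^bsub>tensor A M N\<^esub> Y) =
      a \<odot>\<^bsub>tensor A M N\<^esub> X \<oplus>\<^bsub>tensor A M N\<^esub> a \<odot>\<^bsub>tensor A M N\<^esub> Y" if "Y \<in> carrier (tensor A M N)" for Y
    using additive_add[OF additive_tensor_lift[OF ab b[OF a]] X that]
    by (simp add: tensor_smult a X that)
  fix c assume c: "c \<in> carrier A"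
  show "(a \<oplus>\<^bsub>A\<^esub> c) \<odot>\<^bsub>tensor A M N\<^esub> X = a \<odot>\<^bsub>tensor A M N\<^esub> X \<oplus>\<^bsub>tensor A M N\<^esub> c \<odot>\<^bsub>tensor A M N\<^esub> X"
  proof -
    have "balanced A M N (tensor A M N) (\<lambda>x y. pt (a \<odot>\<^bsub>M\<^esub> x) y \<oplus>\<^bsub>tensor A M N\<^esub> pt (c \<odot>\<^bsub>M\<^esub> x) y)"
      using b[OF a] b[OF c] by (simp add: balanced_def TN.a_ac)
    then have "tensor_lift (tensor A M N) (\<lambda>x y. pt ((a \<oplus>\<^bsub>A\<^esub> c) \<odot>\<^bsub>M\<^esub> x) y) X = tensor_lift (tensor A M N)
        (\<lambda>x y. pt (a \<odot>\<^bsub>M\<^esub> x) y \<oplus>\<^bsub>tensor A M N\<^esub> pt (c \<odot>\<^bsub>M\<^esub> x) y) X"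
      by (rule tensor_lift_cong[OF ab _ X])
        (use balanced_pure_tensor a c in \<open>simp add: LM.lsmult_l_distr LM.lsmult_closed balanced_def\<close>)
    then show ?thesis
      using a c X tensor_lift_add_fun[OF ab b[OF a] b[OF c] X] by (simp add: tensor_smult)
  qed
  show "(a \<otimes>\<^bsub>A\<^esub> c) \<odot>\<^bsub>tensor A M N\<^esub> X = a \<odot>\<^bsub>tensor A M N\<^esub> (c \<odot>\<^bsub>tensor A M N\<^esub> X)"
  proof -
    have cX: "c \<odot>\<^bsub>tensor A M N\<^esub> X \<in> carrier (tensor A M N)"
      unfolding tensor_smult[OF c X] by (rule tensor_lift_closed[OF ab b[OF c] X])
    have "a \<odot>\<^bsub>tensor A M N\<^esub> (c \<odot>\<^bsub>tensor A M N\<^esub> X) = tensor_lift (tensor A M N) (\<lambda>x y. pt (a \<odot>\<^bsub>M\<^esub> (c \<odot>\<^bsub>M\<^esub> x)) y) X"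
      unfolding tensor_smult[OF a cX] by (rule tensor_lift_smult[OF ab b[OF a] c X])
    also have "\<dots> = tensor_lift (tensor A M N) (\<lambda>x y. pt ((a \<otimes>\<^bsub>A\<^esub> c) \<odot>\<^bsub>M\<^esub> x) y) X"
      by (rule tensor_lift_cong[OF ab b[of "a \<otimes>\<^bsub>A\<^esub> c"] X]) (simp_all add: a c LM.lsmult_assoc)
    finally show ?thesis using a c X by (simp add: tensor_smult)
  qed
next
  fix X assume X: "X \<in> carrier (tensor A M N)"
  have "tensor_lift (tensor A M N) (\<lambda>x y. pt (\<one>\<^bsub>A\<^esub> \<odot>\<^bsub>M\<^esub> x) y) X = tensor_lift (tensor A M N) pt X"
    by (rule tensor_lift_cong[OF abelian_group_tensor balanced_pure_tensor X]) (simp add: LM.lsmult_one)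
  then show "\<one>\<^bsub>A\<^esub> \<odot>\<^bsub>tensor A M N\<^esub> X = X"
    using X by (simp add: tensor_smult tensor_lift_pure_tensor)
qed

end

context
  assumes bi: "bimodule A N"
begin

interpretation NR: left_module "opposite A" "right_mod N" by (rule bimoduleD(2)[OF bi])

lemma balanced_rsmult:
  assumes \<beta>: "balanced A M N G \<beta>" and a: "a \<in> carrier A"
  shows "balanced A M N G (\<lambda>x y. \<beta> x (rsmult N y a))"
  using \<beta> a bimoduleD(3)[OF bi] NR.lsmult_closed[of a] NR.lsmult_r_distr[of a]
  by (simp add: balanced_def)

lemma tensor_rsmult:
  assumes a: "a \<in> carrier A" and X: "X \<in> carrier (tensor A M N)"
  shows "rsmult (tensor A M N) X a = tensor_lift (tensor A M N) (\<lambda>x y. pt x (rsmult N y a)) X"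
proof -
  let ?\<sigma> = "\<lambda>(x, y). (x, rsmult N y a)"
  have eq: "(\<lambda>(x, y). frag_of (x, rsmult N y a)) = (\<lambda>k. frag_of (?\<sigma> k))"
    by (simp add: fun_eq_iff)
  have "U <#>\<^bsub>F\<^esub> frag_extend (\<lambda>k. frag_of (?\<sigma> k)) ` X
      = tensor_lift (tensor A M N) (\<lambda>x y. pt (fst (?\<sigma> (x, y))) (snd (?\<sigma> (x, y)))) X"
    by (rule coset_frag_extend[OF tensor_pair_axioms _ _ X])
      (use a balanced_rsmult[OF balanced_pure_tensor a] NR.lsmult_closed[of a] in simp_all)
  then show ?thesis
    by (simp add: tensor_def Let_def eq)
qed

lemma rsmult_pure_tensor:
  "\<lbrakk>a \<in> carrier A; x \<in> carrier M; y \<in> carrier N\<rbrakk>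
    \<Longrightarrow> rsmult (tensor A M N) (pt x y) a = pt x (rsmult N y a)"
  using tensor_lift_pure[OF abelian_group_tensor balanced_rsmult[OF balanced_pure_tensor]]
  by (simp add: tensor_rsmult)

lemma tensor_lift_rsmult:
  assumes G: "abelian_group G" and \<beta>: "balanced A M N G \<beta>"
    and a: "a \<in> carrier A" and X: "X \<in> carrier (tensor A M N)"
  shows "tensor_lift G \<beta> (rsmult (tensor A M N) X a) = tensor_lift G (\<lambda>x y. \<beta> x (rsmult N y a)) X"
proof -
  note b = balanced_rsmult[OF balanced_pure_tensor a]
  have "tensor_lift G \<beta> (rsmult (tensor A M N) X a) = tensor_lift G (\<lambda>x y. tensor_lift G \<beta> (pt x (rsmult N y a))) X"
    unfolding tensor_rsmult[OF a X]
    by (rule tensor_lift_compose[OF abelian_group_tensor b G additive_tensor_lift[OF G \<beta>] X])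
  also have "\<dots> = tensor_lift G (\<lambda>x y. \<beta> x (rsmult N y a)) X"
    by (rule tensor_lift_cong[OF G balanced_rsmult[OF \<beta> a] X])
      (use NR.lsmult_closed[of a] in \<open>simp add: tensor_lift_pure[OF G \<beta>] a\<close>)
  finally show ?thesis .
qed

end

end

section \<open>Interchanging the sides\<close>

text \<open>A bimodule read over the opposite ring. Unlike \<open>right_mod\<close>, which
  overwrites the left action, it keeps both actions and is an involution.\<close>

definition flip_mod :: "('a, 'm, 'y) bimodule_scheme \<Rightarrow> ('a, 'm, 'y) bimodule_scheme"
  where "flip_mod M = M\<lparr>smult := \<lambda>a x. rsmult M x a, rsmult := \<lambda>x a. smult M a x\<rparr>"

lemma flip_mod_sel [simp]:
  "carrier (flip_mod M) = carrier M" "\<zero>\<^bsub>flip_mod M\<^esub> = \<zero>\<^bsub>M\<^esub>" "add (flip_mod M) = add M"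
  "a \<odot>\<^bsub>flip_mod M\<^esub> x = rsmult M x a" "rsmult (flip_mod M) x a = a \<odot>\<^bsub>M\<^esub> x"
  "flip_mod (flip_mod M) = M"
  by (simp_all add: flip_mod_def)

text \<open>Acting directly on representatives makes this an involution on arbitrary sets of formal
  sums, without any module hypotheses. That it sends \<open>x \<otimes> y\<close> to
  \<open>y \<otimes> x\<close> is a fact about cosets.\<close>

definition flip_tensor :: "('m \<times> 'n \<Rightarrow>\<^sub>0 int) set \<Rightarrow> ('n \<times> 'm \<Rightarrow>\<^sub>0 int) set"
  where "flip_tensor X = frag_extend (\<lambda>k. frag_of (prod.swap k)) ` X"

lemma frag_extend_swap_swap:
  "frag_extend (\<lambda>k. frag_of (prod.swap k)) (frag_extend (\<lambda>k. frag_of (prod.swap k)) p) = p"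
  using frag_extend_compose[of "\<lambda>k. frag_of (prod.swap k)" prod.swap p] frag_expansion[of p]
  by (simp add: comp_def)

lemma flip_tensor_flip_tensor [simp]: "flip_tensor (flip_tensor X) = X"
  by (simp add: flip_tensor_def image_image frag_extend_swap_swap)

lemma left_module_flip_mod:
  "left_module T (flip_mod M) \<longleftrightarrow> left_module T (right_mod M)"
  "left_module T (right_mod (flip_mod M)) \<longleftrightarrow> left_module T M"
  by (auto elim!: left_module_cong simp: fun_eq_iff)

lemma balanced_flip:
  "balanced (opposite A) (flip_mod N) (flip_mod M) G (\<lambda>y x. \<beta> x y) \<longleftrightarrow> balanced A M N G \<beta>"
  unfolding balanced_def by (auto; metis)

lemma bimodule_flip_mod:
  assumes "bimodule A M"
  shows "bimodule (opposite A) (flip_mod M)"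
  using assms by (simp add: bimodule_def left_module_flip_mod)

context tensor_pair
begin

lemma tensor_pair_flip: "tensor_pair (opposite A) (flip_mod N) (flip_mod M)"
  using right left by (simp add: tensor_pair_def left_module_flip_mod)

interpretation FT: tensor_pair "opposite A" "flip_mod N" "flip_mod M" by (rule tensor_pair_flip)

lemma flip_tensor_eq:
  assumes X: "X \<in> carrier (tensor A M N)"
  shows "flip_tensor X \<in> carrier (tensor (opposite A) (flip_mod N) (flip_mod M))"
    and "flip_tensor X = tensor_lift (tensor (opposite A) (flip_mod N) (flip_mod M))
      (\<lambda>x y. pure_tensor (opposite A) (flip_mod N) (flip_mod M) y x) X"
proof -
  let ?s = "frag_extend (\<lambda>k. frag_of (prod.swap k))"
  let ?T' = "tensor (opposite A) (flip_mod N) (flip_mod M)"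
  let ?pt' = "pure_tensor (opposite A) (flip_mod N) (flip_mod M)"
  obtain p where p: "Poly_Mapping.keys p \<subseteq> carrier M \<times> carrier N" "X = cls p"
    using X by (auto simp: tensor_carrier)
  have b: "balanced A M N ?T' (\<lambda>x y. ?pt' y x)"
    using FT.balanced_pure_tensor balanced_flip[of A N M ?T' "\<lambda>x y. ?pt' y x"] by simp
  have b': "balanced (opposite A) (flip_mod N) (flip_mod M) (tensor A M N) (\<lambda>y x. pt x y)"
    using balanced_pure_tensor balanced_flip[of A N M "tensor A M N" pt] by simp
  have U: "?s u \<in> FT.U" if "u \<in> U" for u
    by (rule cls_frag_extend(2)[OF tensor_pair_flip _ _ that]) (use b in simp_all)
  have U': "?s u \<in> U" if "u \<in> FT.U" for u
    by (rule FT.cls_frag_extend(2)[OF tensor_pair_axioms _ _ that]) (use b' in simp_all)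
  \<comment> \<open>Swapping maps each of the two relation subgroups into the other and is its own
    inverse, so the image of a coset is a full coset.\<close>
  have "?s ` U = FT.U"
  proof (intro equalityI subsetI)
    fix u assume "u \<in> FT.U"
    then show "u \<in> ?s ` U"
      using U'[of u] by (intro image_eqI[of _ _ "?s u"]) (simp_all add: frag_extend_swap_swap)
  qed (use U in auto)
  then have "(\<lambda>u. u + ?s p) ` ?s ` U = FT.cls (?s p)"
    by (simp add: FT.cls_def)
  then have eq: "flip_tensor X = FT.cls (?s p)"
    by (simp add: flip_tensor_def p(2) cls_def image_image frag_extend_add)
  have *: "Poly_Mapping.keys (?s p) \<subseteq> carrier (flip_mod N) \<times> carrier (flip_mod M) \<and>
      FT.cls (?s p) = lift_frag ?T' (\<lambda>x y. ?pt' (fst (prod.swap (x, y))) (snd (prod.swap (x, y)))) p"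
    by (rule cls_frag_extend(1)[OF tensor_pair_flip _ _ p(1)]) (use b in simp_all)
  show "flip_tensor X \<in> carrier ?T'"
    using * by (auto simp: eq FT.tensor_carrier)
  show "flip_tensor X = tensor_lift ?T' (\<lambda>x y. ?pt' y x) X"
    using * tensor_lift_cls[OF FT.abelian_group_tensor b p(1)] by (simp add: eq[unfolded p(2)] p(2))
qed

lemma tensor_lift_flip:
  assumes X: "X \<in> carrier (tensor A M N)" and G: "abelian_group G"
    and \<beta>: "balanced A M N G \<beta>"
  shows "tensor_lift G (\<lambda>y x. \<beta> x y) (flip_tensor X) = tensor_lift G \<beta> X"
proof -
  let ?T' = "tensor (opposite A) (flip_mod N) (flip_mod M)"
  let ?pt' = "pure_tensor (opposite A) (flip_mod N) (flip_mod M)"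
  have b: "balanced A M N ?T' (\<lambda>x y. ?pt' y x)"
    using FT.balanced_pure_tensor balanced_flip[of A N M ?T' "\<lambda>x y. ?pt' y x"] by simp
  have b': "balanced (opposite A) (flip_mod N) (flip_mod M) G (\<lambda>y x. \<beta> x y)"
    using \<beta> by (simp add: balanced_flip)
  have "tensor_lift G (\<lambda>y x. \<beta> x y) (flip_tensor X) =
      tensor_lift G (\<lambda>x y. tensor_lift G (\<lambda>y x. \<beta> x y) (?pt' y x)) X"
    unfolding flip_tensor_eq(2)[OF X]
    by (rule tensor_lift_compose[OF FT.abelian_group_tensor b G FT.additive_tensor_lift[OF G b'] X])
  also have "\<dots> = tensor_lift G \<beta> X"
    by (rule tensor_lift_cong[OF G \<beta> X]) (simp add: FT.tensor_lift_pure[OF G b'])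
  finally show ?thesis .
qed

lemma flip_tensor_additive:
  "additive (tensor A M N) (tensor (opposite A) (flip_mod N) (flip_mod M)) flip_tensor"
proof (rule additiveI)
  let ?T' = "tensor (opposite A) (flip_mod N) (flip_mod M)"
  let ?pt' = "pure_tensor (opposite A) (flip_mod N) (flip_mod M)"
  have b: "balanced A M N ?T' (\<lambda>x y. ?pt' y x)"
    using FT.balanced_pure_tensor balanced_flip[of A N M ?T' "\<lambda>x y. ?pt' y x"] by simp
  show "flip_tensor X \<in> carrier ?T'" if "X \<in> carrier (tensor A M N)" for X
    by (rule flip_tensor_eq(1)[OF that])
  show "flip_tensor (X \<oplus>\<^bsub>tensor A M N\<^esub> Y) = flip_tensor X \<oplus>\<^bsub>?T'\<^esub> flip_tensor Y"
    if "X \<in> carrier (tensor A M N)" "Y \<in> carrier (tensor A M N)" for X Y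
    using that additive_add[OF additive_tensor_lift[OF FT.abelian_group_tensor b] that]
    by (simp add: flip_tensor_eq(2))
qed

lemma flip_tensor_pure:
  assumes "x \<in> carrier M" "y \<in> carrier N"
  shows "flip_tensor (pt x y) = pure_tensor (opposite A) (flip_mod N) (flip_mod M) y x"
proof -
  let ?T' = "tensor (opposite A) (flip_mod N) (flip_mod M)"
  let ?pt' = "pure_tensor (opposite A) (flip_mod N) (flip_mod M)"
  have b: "balanced A M N ?T' (\<lambda>x y. ?pt' y x)"
    using FT.balanced_pure_tensor balanced_flip[of A N M ?T' "\<lambda>x y. ?pt' y x"] by simp
  show ?thesis
    using assms by (simp add: flip_tensor_eq(2) tensor_lift_pure[OF FT.abelian_group_tensor b])
qed

lemma flip_tensor_smult:
  assumes bi: "bimodule A M" and a: "a \<in> carrier A" and X: "X \<in> carrier (tensor A M N)"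
  shows "flip_tensor (a \<odot>\<^bsub>tensor A M N\<^esub> X) =
    rsmult (tensor (opposite A) (flip_mod N) (flip_mod M)) (flip_tensor X) a"
proof -
  let ?T' = "tensor (opposite A) (flip_mod N) (flip_mod M)"
  let ?pt' = "pure_tensor (opposite A) (flip_mod N) (flip_mod M)"
  have b: "balanced A M N ?T' (\<lambda>x y. ?pt' y x)"
    using FT.balanced_pure_tensor balanced_flip[of A N M ?T' "\<lambda>x y. ?pt' y x"] by simp
  have a': "a \<in> carrier (opposite A)" using a by simp
  have LM: "a \<odot>\<^bsub>M\<^esub> x \<in> carrier M" if "x \<in> carrier M" for x
    using left_module.lsmult_closed[OF bimoduleD(1)[OF bi] a that] .
  have "flip_tensor (a \<odot>\<^bsub>tensor A M N\<^esub> X) = tensor_lift ?T' (\<lambda>x y. flip_tensor (pt (a \<odot>\<^bsub>M\<^esub> x) y)) X"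
    unfolding tensor_smult[OF bi a X]
    by (rule tensor_lift_compose[OF abelian_group_tensor balanced_smult[OF bi balanced_pure_tensor a]
          FT.abelian_group_tensor flip_tensor_additive X])
  also have "\<dots> = tensor_lift ?T' (\<lambda>x y. ?pt' y (a \<odot>\<^bsub>M\<^esub> x)) X"
    by (rule tensor_lift_cong[OF FT.abelian_group_tensor balanced_smult[OF bi b a] X])
      (simp add: flip_tensor_pure LM)
  also have "\<dots> = tensor_lift ?T' (\<lambda>y x. ?pt' y (a \<odot>\<^bsub>M\<^esub> x)) (flip_tensor X)"
    by (rule tensor_lift_flip[OF X FT.abelian_group_tensor balanced_smult[OF bi b a], symmetric])
  also have "\<dots> = rsmult ?T' (flip_tensor X) a"
    using FT.tensor_rsmult[OF bimodule_flip_mod[OF bi] a' flip_tensor_eq(1)[OF X]] by simp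
  finally show ?thesis .
qed

lemma flip_tensor_rsmult:
  assumes bi: "bimodule A N" and a: "a \<in> carrier A" and X: "X \<in> carrier (tensor A M N)"
  shows "flip_tensor (rsmult (tensor A M N) X a) =
    a \<odot>\<^bsub>tensor (opposite A) (flip_mod N) (flip_mod M)\<^esub> flip_tensor X"
  using tensor_pair.flip_tensor_smult[OF tensor_pair_flip bimodule_flip_mod[OF bi] _ flip_tensor_eq(1)[OF X], of a] a
  by (metis flip_mod_sel(6) flip_tensor_flip_tensor opposite_sel(1,6))

text \<open>The flip is injective and turns the right action into the left action on the flipped
  product, where the axioms are already known.\<close>

lemma right_module_tensor:
  assumes bi: "bimodule A N"
  shows "left_module (opposite A) (right_mod (tensor A M N))"
proof -
  let ?T = "tensor A M N" and ?T' = "tensor (opposite A) (flip_mod N) (flip_mod M)"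
  interpret T': left_module "opposite A" ?T'
    by (rule FT.left_module_tensor[OF bimodule_flip_mod[OF bi]])
  have inj: "X = Y" if "flip_tensor X = flip_tensor Y" for X Y :: "('m \<times> 'n \<Rightarrow>\<^sub>0 int) set"
    using arg_cong[OF that, of flip_tensor] by simp
  note rs = flip_tensor_rsmult[OF bi]
  note fa = additive_add[OF flip_tensor_additive] and fc = flip_tensor_eq(1)
  have cl: "rsmult ?T X a \<in> carrier ?T" if "a \<in> carrier A" "X \<in> carrier ?T" for a X
    unfolding tensor_rsmult[OF bi that]
    by (rule tensor_lift_closed[OF abelian_group_tensor balanced_rsmult[OF bi balanced_pure_tensor that(1)] that(2)])
  show ?thesis
  proof (rule left_moduleI[OF MR.T.ring_axioms]; (simp only: right_mod_sel opposite_sel)?)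
    show "abelian_group (right_mod ?T)"
      by (rule abelian_group_cong[OF abelian_group_tensor]) simp_all
    fix a X assume a: "a \<in> carrier A" and X: "X \<in> carrier ?T"
    show "rsmult ?T X a \<in> carrier ?T" by (rule cl[OF a X])
    show "rsmult ?T (X \<oplus>\<^bsub>?T\<^esub> Y) a = rsmult ?T X a \<oplus>\<^bsub>?T\<^esub> rsmult ?T Y a" if Y: "Y \<in> carrier ?T" for Y
      by (rule inj) (simp add: a X Y cl rs fa fc T'.lsmult_r_distr)
    fix b assume b: "b \<in> carrier A"
    show "rsmult ?T X (a \<oplus>\<^bsub>A\<^esub> b) = rsmult ?T X a \<oplus>\<^bsub>?T\<^esub> rsmult ?T X b"
      using T'.lsmult_l_distr[of a b "flip_tensor X"]
      by (intro inj) (simp add: a b X cl rs fa fc NL.T.a_closed)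
    show "rsmult ?T X (b \<otimes>\<^bsub>A\<^esub> a) = rsmult ?T (rsmult ?T X b) a"
      using T'.lsmult_assoc[of a b "flip_tensor X"]
      by (intro inj) (simp add: a b X cl rs fc NL.T.m_closed)
  next
    fix X assume X: "X \<in> carrier ?T"
    show "rsmult ?T X \<one>\<^bsub>A\<^esub> = X"
      using T'.lsmult_one[of "flip_tensor X"]
      by (intro inj) (simp add: X rs fc NL.T.one_closed)
  qed
qed

end

section \<open>Coassociativity\<close>

lemma mod_hom_right_modD:
  assumes "f \<in> mod_hom (opposite A) (right_mod P) (right_mod Q)"
  shows "x \<in> carrier P \<Longrightarrow> f x \<in> carrier Q"
    and "\<lbrakk>x \<in> carrier P; y \<in> carrier P\<rbrakk> \<Longrightarrow> f (x \<oplus>\<^bsub>P\<^esub> y) = f x \<oplus>\<^bsub>Q\<^esub> f y"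
    and "\<lbrakk>a \<in> carrier A; x \<in> carrier P\<rbrakk> \<Longrightarrow> f (rsmult P x a) = rsmult Q (f x) a"
  using assms by (simp_all add: mod_hom_iff)

lemma mod_hom_right_modI:
  assumes "\<And>x. x \<in> carrier P \<Longrightarrow> f x \<in> carrier Q"
    and "\<And>x y. \<lbrakk>x \<in> carrier P; y \<in> carrier P\<rbrakk> \<Longrightarrow> f (x \<oplus>\<^bsub>P\<^esub> y) = f x \<oplus>\<^bsub>Q\<^esub> f y"
    and "\<And>a x. \<lbrakk>a \<in> carrier A; x \<in> carrier P\<rbrakk> \<Longrightarrow> f (rsmult P x a) = rsmult Q (f x) a"
  shows "f \<in> mod_hom (opposite A) (right_mod P) (right_mod Q)"
  using assms by (simp add: mod_hom_iff)

text \<open>Applying \<open>f \<otimes> id\<close> and reassociating involves cosets of cosets. Here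
  the composite becomes a double Sweedler sum: of the elements
  \<open>x \<otimes> (y \<otimes> z)\<close>, where \<open>x \<otimes> y\<close> runs through the
  summands of \<open>f u\<close>.\<close>

lemma tensor_assoc_tensor_map:
  fixes A :: "('a, 'x) ring_scheme" and L :: "('a, 'l, 'y) bimodule_scheme"
    and M :: "('a, 'm, 'z) bimodule_scheme" and N :: "('a, 'n, 'w) bimodule_scheme"
    and P :: "('a, 'p, 'v) bimodule_scheme"
  assumes L: "left_module (opposite A) (right_mod L)" and M: "bimodule A M" and N: "left_module A N"
    and P: "left_module (opposite A) (right_mod P)"
    and f: "f \<in> mod_hom (opposite A) (right_mod P) (right_mod (tensor A L M))"
    and X: "X \<in> carrier (tensor A P N)"
  defines "G \<equiv> tensor A L (tensor A M N)"
  defines "t \<equiv> \<lambda>x y z. pure_tensor A L (tensor A M N) x (pure_tensor A M N y z)"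
  shows "tensor_assoc A L M N (tensor_map A (tensor A L M) N f id X) =
      tensor_lift G (\<lambda>u z. tensor_lift G (\<lambda>x y. t x y z) (f u)) X"
    and "balanced A P N G (\<lambda>u z. tensor_lift G (\<lambda>x y. t x y z) (f u))"
proof -
  interpret LM: tensor_pair A L M by (rule tensor_pair.intro[OF L bimoduleD(1)[OF M]])
  interpret MN: tensor_pair A M N by (rule tensor_pair.intro[OF bimoduleD(2)[OF M] N])
  interpret PN: tensor_pair A P N by (rule tensor_pair.intro[OF P N])
  interpret L_MN: tensor_pair A L "tensor A M N"
    by (rule tensor_pair.intro[OF L MN.left_module_tensor[OF M]])
  interpret LM_N: tensor_pair A "tensor A L M" N
    by (rule tensor_pair.intro[OF LM.right_module_tensor[OF M] N])
  interpret NL: left_module A N by fact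
  interpret MR: left_module "opposite A" "right_mod M" by (rule bimoduleD(2)[OF M])
  note G_def [simp] and t_def [simp]
  have G: "abelian_group G" using L_MN.abelian_group_tensor by simp
  have tri: "balanced A L M G (\<lambda>x y. t x y z)" if z: "z \<in> carrier N" for z
    using L_MN.balanced_pure_tensor MN.balanced_pure_tensor z
      MN.smult_pure_tensor[OF M, symmetric] unfolding balanced_def by simp
  have t_add: "t x y (z \<oplus>\<^bsub>N\<^esub> z') = t x y z \<oplus>\<^bsub>G\<^esub> t x y z'"
    if "x \<in> carrier L" "y \<in> carrier M" "z \<in> carrier N" "z' \<in> carrier N" for x y z z'
    using L_MN.balanced_pure_tensor MN.balanced_pure_tensor that unfolding balanced_def by simp
  have t_bal: "t x (rsmult M y a) z = t x y (a \<odot>\<^bsub>N\<^esub> z)"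
    if "x \<in> carrier L" "y \<in> carrier M" "z \<in> carrier N" "a \<in> carrier A" for x y z a
    using MN.balanced_pure_tensor that unfolding balanced_def by simp
  \<comment> \<open>The inner lift for a fixed last component; its balancedness is what makes the
    reassociation map well defined.\<close>
  define \<alpha> where "\<alpha> = (\<lambda>X z. tensor_lift G (\<lambda>x y. t x y z) X)"
  have \<alpha>: "balanced A (tensor A L M) N G \<alpha>"
  proof (rule balancedI)
    fix X z assume X: "X \<in> carrier (tensor A L M)" and z: "z \<in> carrier N"
    show "\<alpha> X z \<in> carrier G"
      unfolding \<alpha>_def by (rule LM.tensor_lift_closed[OF G tri[OF z] X])
    show "\<alpha> (X \<oplus>\<^bsub>tensor A L M\<^esub> Y) z = \<alpha> X z \<oplus>\<^bsub>G\<^esub> \<alpha> Y z" if "Y \<in> carrier (tensor A L M)" for Y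
      unfolding \<alpha>_def by (rule additive_add[OF LM.additive_tensor_lift[OF G tri[OF z]] X that])
    show "\<alpha> X (z \<oplus>\<^bsub>N\<^esub> z') = \<alpha> X z \<oplus>\<^bsub>G\<^esub> \<alpha> X z'" if z': "z' \<in> carrier N" for z'
    proof -
      have "\<alpha> X (z \<oplus>\<^bsub>N\<^esub> z') = tensor_lift G (\<lambda>x y. t x y z \<oplus>\<^bsub>G\<^esub> t x y z') X"
        unfolding \<alpha>_def
        by (rule LM.tensor_lift_cong[symmetric, OF G tri X]) (use z z' t_add in simp_all)
      then show ?thesis
        unfolding \<alpha>_def LM.tensor_lift_add_fun[OF G tri[OF z] tri[OF z'] X] .
    qed
    show "\<alpha> (rsmult (tensor A L M) X a) z = \<alpha> X (a \<odot>\<^bsub>N\<^esub> z)" if a: "a \<in> carrier A" for a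
    proof -
      have "\<alpha> (rsmult (tensor A L M) X a) z = tensor_lift G (\<lambda>x y. t x (rsmult M y a) z) X"
        unfolding \<alpha>_def by (rule LM.tensor_lift_rsmult[OF M G tri[OF z] a X])
      also have "\<dots> = \<alpha> X (a \<odot>\<^bsub>N\<^esub> z)"
        unfolding \<alpha>_def
        by (rule LM.tensor_lift_cong[OF G tri X]) (use a z t_bal MN.NL.lsmult_closed in simp_all)
      finally show ?thesis .
    qed
  qed
  have b: "balanced A P N (tensor A (tensor A L M) N) (\<lambda>u z. LM_N.pt (f u) (id z))"
    using LM_N.balanced_pure_tensor mod_hom_right_modD[OF f] by (simp add: balanced_def)
  have assoc: "tensor_assoc A L M N = tensor_lift G \<alpha>"
    by (simp add: tensor_assoc_def \<alpha>_def)
  have eq: "tensor_lift G \<alpha> (LM_N.pt (f u) (id z)) = \<alpha> (f u) z" if "u \<in> carrier P" "z \<in> carrier N" for u z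
    using LM_N.tensor_lift_pure[OF G \<alpha>] mod_hom_right_modD(1)[OF f] that by simp
  have b': "balanced A P N G (\<lambda>u z. tensor_lift G \<alpha> (LM_N.pt (f u) (id z)))"
    by (rule balanced_compose[OF b LM_N.additive_tensor_lift[OF G \<alpha>]])
  have b'': "balanced A P N G (\<lambda>u z. \<alpha> (f u) z)"
    by (rule PN.balanced_cong[OF b']) (simp only: eq)
  then show "balanced A P N G (\<lambda>u z. tensor_lift G (\<lambda>x y. t x y z) (f u))"
    unfolding \<alpha>_def .
  have "tensor_assoc A L M N (tensor_map A (tensor A L M) N f id X) =
      tensor_lift G (\<lambda>u z. tensor_lift G \<alpha> (LM_N.pt (f u) (id z))) X"
    unfolding assoc tensor_map_def
    by (rule PN.tensor_lift_compose[OF LM_N.abelian_group_tensor b G LM_N.additive_tensor_lift[OF G \<alpha>] X])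
  also have "\<dots> = tensor_lift G (\<lambda>u z. \<alpha> (f u) z) X"
    by (rule PN.tensor_lift_cong[OF G b'' X]) (simp only: eq)
  finally show "tensor_assoc A L M N (tensor_map A (tensor A L M) N f id X) =
      tensor_lift G (\<lambda>u z. tensor_lift G (\<lambda>x y. t x y z) (f u)) X"
    unfolding \<alpha>_def .
qed

section \<open>Corings, and coassociativity in Sweedler form\<close>

locale A_coring =
  fixes A :: "('a, 'x) ring_scheme" and C :: "('a, 'c, 'y) coring_scheme"
  assumes coring: "coring A C"
begin

abbreviation \<Delta> where "\<Delta> \<equiv> comult C"
abbreviation \<epsilon> where "\<epsilon> \<equiv> counit C"

lemma bimodule_C: "bimodule A C"
  using coring by (simp add: coring_def)

sublocale CL: left_module A C by (rule bimoduleD(1)[OF bimodule_C])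
sublocale CR: left_module "opposite A" "right_mod C" by (rule bimoduleD(2)[OF bimodule_C])
sublocale CC: tensor_pair A C C
  by (rule tensor_pair.intro) (rule CR.left_module_axioms CL.left_module_axioms)+

lemma abelian_group_A: "abelian_group A" by (rule CL.T.is_abelian_group)

lemma rsmult_closed: "\<lbrakk>x \<in> carrier C; a \<in> carrier A\<rbrakk> \<Longrightarrow> rsmult C x a \<in> carrier C"
  using CR.lsmult_closed by simp

lemma rsmult_add: "\<lbrakk>x \<in> carrier C; y \<in> carrier C; a \<in> carrier A\<rbrakk>
    \<Longrightarrow> rsmult C (x \<oplus>\<^bsub>C\<^esub> y) a = rsmult C x a \<oplus>\<^bsub>C\<^esub> rsmult C y a"
  using CR.lsmult_r_distr by simp

lemma rsmult_add_left: "\<lbrakk>x \<in> carrier C; a \<in> carrier A; b \<in> carrier A\<rbrakk>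
    \<Longrightarrow> rsmult C x (a \<oplus>\<^bsub>A\<^esub> b) = rsmult C x a \<oplus>\<^bsub>C\<^esub> rsmult C x b"
  using CR.lsmult_l_distr[of a b x] by simp

lemma rsmult_assoc: "\<lbrakk>x \<in> carrier C; a \<in> carrier A; b \<in> carrier A\<rbrakk>
    \<Longrightarrow> rsmult C (rsmult C x a) b = rsmult C x (a \<otimes>\<^bsub>A\<^esub> b)"
  using CR.lsmult_assoc[of b a x] by simp

lemmas smult_rsmult = bimoduleD(3)[OF bimodule_C]

lemma comult_closed: "c \<in> carrier C \<Longrightarrow> \<Delta> c \<in> carrier (tensor A C C)"
  and comult_add: "\<lbrakk>c \<in> carrier C; d \<in> carrier C\<rbrakk> \<Longrightarrow> \<Delta> (c \<oplus>\<^bsub>C\<^esub> d) = \<Delta> c \<oplus>\<^bsub>tensor A C C\<^esub> \<Delta> d"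
  and comult_smult: "\<lbrakk>a \<in> carrier A; c \<in> carrier C\<rbrakk> \<Longrightarrow> \<Delta> (a \<odot>\<^bsub>C\<^esub> c) = a \<odot>\<^bsub>tensor A C C\<^esub> \<Delta> c"
  and comult_rsmult: "\<lbrakk>a \<in> carrier A; c \<in> carrier C\<rbrakk> \<Longrightarrow> \<Delta> (rsmult C c a) = rsmult (tensor A C C) (\<Delta> c) a"
  using coring by (simp_all add: coring_def bimodule_hom_def mod_hom_iff)

lemma counit_closed: "c \<in> carrier C \<Longrightarrow> \<epsilon> c \<in> carrier A"
  and counit_add: "\<lbrakk>c \<in> carrier C; d \<in> carrier C\<rbrakk> \<Longrightarrow> \<epsilon> (c \<oplus>\<^bsub>C\<^esub> d) = \<epsilon> c \<oplus>\<^bsub>A\<^esub> \<epsilon> d"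
  and counit_smult: "\<lbrakk>a \<in> carrier A; c \<in> carrier C\<rbrakk> \<Longrightarrow> \<epsilon> (a \<odot>\<^bsub>C\<^esub> c) = a \<otimes>\<^bsub>A\<^esub> \<epsilon> c"
  and counit_rsmult: "\<lbrakk>a \<in> carrier A; c \<in> carrier C\<rbrakk> \<Longrightarrow> \<epsilon> (rsmult C c a) = \<epsilon> c \<otimes>\<^bsub>A\<^esub> a"
  using coring by (simp_all add: coring_def bimodule_hom_def mod_hom_iff regular_def)

lemma comult_right: "\<Delta> \<in> mod_hom (opposite A) (right_mod C) (right_mod (tensor A C C))"
  using coring by (simp add: coring_def bimodule_hom_def)

lemma counit_left_eq: "c \<in> carrier C \<Longrightarrow> tensor_lift C (\<lambda>x y. \<epsilon> x \<odot>\<^bsub>C\<^esub> y) (\<Delta> c) = c"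
  and counit_right_eq: "c \<in> carrier C \<Longrightarrow> tensor_lift C (\<lambda>x y. rsmult C x (\<epsilon> y)) (\<Delta> c) = c"
  using coring by (simp_all add: coring_def)

lemma right_comodule_C: "right_comodule A C C \<Delta>"
  using coring CR.left_module_axioms comult_right by (simp add: right_comodule_def coring_def)

text \<open>A map of three variables, balanced in each pair of neighbours, becomes balanced in its
  first variable and \<open>C \<otimes> C\<close> once the other two variables are lifted. It
  thereby defines a map on the threefold tensor product.\<close>

lemma balanced_tensor_lift:
  assumes G: "abelian_group G"
    and \<gamma>1: "\<And>z. z \<in> carrier C \<Longrightarrow> balanced A M C G (\<lambda>x y. \<gamma> x y z)"
    and \<gamma>2: "\<And>x. x \<in> carrier M \<Longrightarrow> balanced A C C G (\<lambda>y z. \<gamma> x y z)"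
    and M: "left_module (opposite A) (right_mod M)"
  shows "balanced A M (tensor A C C) G (\<lambda>x. tensor_lift G (\<gamma> x))"
proof -
  interpret MC: tensor_pair A M C by (rule tensor_pair.intro[OF M CL.left_module_axioms])
  define \<phi> where "\<phi> = (\<lambda>x. tensor_lift G (\<gamma> x))"
  have "balanced A M (tensor A C C) G \<phi>"
  proof (rule balancedI)
    fix x Y assume x: "x \<in> carrier M" and Y: "Y \<in> carrier (tensor A C C)"
    show "\<phi> x Y \<in> carrier G"
      unfolding \<phi>_def by (rule CC.tensor_lift_closed[OF G \<gamma>2[OF x] Y])
    show "\<phi> x (Y \<oplus>\<^bsub>tensor A C C\<^esub> Y') = \<phi> x Y \<oplus>\<^bsub>G\<^esub> \<phi> x Y'" if "Y' \<in> carrier (tensor A C C)" for Y'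
      unfolding \<phi>_def by (rule additive_add[OF CC.additive_tensor_lift[OF G \<gamma>2[OF x]] Y that])
    show "\<phi> (x \<oplus>\<^bsub>M\<^esub> x') Y = \<phi> x Y \<oplus>\<^bsub>G\<^esub> \<phi> x' Y" if x': "x' \<in> carrier M" for x'
    proof -
      have "\<phi> (x \<oplus>\<^bsub>M\<^esub> x') Y = tensor_lift G (\<lambda>y z. \<gamma> x y z \<oplus>\<^bsub>G\<^esub> \<gamma> x' y z) Y"
        unfolding \<phi>_def
        by (rule CC.tensor_lift_cong[symmetric, OF G \<gamma>2 Y]) (use x x' \<gamma>1 in \<open>simp_all add: balanced_def\<close>)
      then show ?thesis
        unfolding \<phi>_def CC.tensor_lift_add_fun[OF G \<gamma>2[OF x] \<gamma>2[OF x'] Y] .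
    qed
    show "\<phi> (rsmult M x a) Y = \<phi> x (a \<odot>\<^bsub>tensor A C C\<^esub> Y)" if a: "a \<in> carrier A" for a
    proof -
      have "\<phi> (rsmult M x a) Y = tensor_lift G (\<lambda>y z. \<gamma> x (a \<odot>\<^bsub>C\<^esub> y) z) Y"
        unfolding \<phi>_def
        by (rule CC.tensor_lift_cong[OF G CC.balanced_smult[OF bimodule_C \<gamma>2[OF x] a] Y])
          (use x a \<gamma>1 in \<open>simp add: balanced_def\<close>)
      then show ?thesis
        unfolding \<phi>_def CC.tensor_lift_smult[OF bimodule_C G \<gamma>2[OF x] a Y] .
    qed
  qed
  then show ?thesis unfolding \<phi>_def .
qed

text \<open>The map \<open>\<Phi>\<close> that \<open>\<gamma>\<close> induces on
  \<open>M \<otimes> (C \<otimes> C)\<close> is applied to the coassociativity equation: in a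
  threefold Sweedler sum the left factor may be split instead of the right one. The two balancedness
  statements are by-products on which later rewriting of such sums depends.\<close>

lemma right_comodule_coassoc:
  fixes M :: "('a, 'm, 'z) bimodule_scheme"
  assumes M: "right_comodule A C M \<rho>" and G: "abelian_group G"
    and \<gamma>1: "\<And>z. z \<in> carrier C \<Longrightarrow> balanced A M C G (\<lambda>x y. \<gamma> x y z)"
    and \<gamma>2: "\<And>x. x \<in> carrier M \<Longrightarrow> balanced A C C G (\<lambda>y z. \<gamma> x y z)"
    and m: "m \<in> carrier M"
  shows "tensor_lift G (\<lambda>u z. tensor_lift G (\<lambda>x y. \<gamma> x y z) (\<rho> u)) (\<rho> m) =
      tensor_lift G (\<lambda>u v. tensor_lift G (\<lambda>y z. \<gamma> u y z) (\<Delta> v)) (\<rho> m)" (is "?lhs = ?rhs")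
    and "balanced A M C G (\<lambda>u z. tensor_lift G (\<lambda>x y. \<gamma> x y z) (\<rho> u))"
    and "balanced A M C G (\<lambda>u v. tensor_lift G (\<lambda>y z. \<gamma> u y z) (\<Delta> v))"
proof -
  have MR: "left_module (opposite A) (right_mod M)"
    and \<rho>: "\<rho> \<in> mod_hom (opposite A) (right_mod M) (right_mod (tensor A M C))"
    and co: "tensor_assoc A M C C (tensor_map A (tensor A M C) C \<rho> id (\<rho> m)) =
       tensor_map A M (tensor A C C) id \<Delta> (\<rho> m)"
    using M m by (simp_all add: right_comodule_def)
  interpret MC: tensor_pair A M C by (rule tensor_pair.intro[OF MR CL.left_module_axioms])
  interpret M_CC: tensor_pair A M "tensor A C C"
    by (rule tensor_pair.intro[OF MR CC.left_module_tensor[OF bimodule_C]])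
  note \<rho>D = mod_hom_right_modD[OF \<rho>]
  let ?T3 = "tensor A M (tensor A C C)"
  let ?t = "\<lambda>x y z. M_CC.pt x (CC.pt y z)"
  define \<phi> where "\<phi> = (\<lambda>x. tensor_lift G (\<gamma> x))"
  have \<phi>: "balanced A M (tensor A C C) G \<phi>"
    unfolding \<phi>_def by (rule balanced_tensor_lift[OF G \<gamma>1 \<gamma>2 MR])
  define \<Phi> where "\<Phi> = tensor_lift G \<phi>"
  have \<Phi>: "additive ?T3 G \<Phi>"
    unfolding \<Phi>_def by (rule M_CC.additive_tensor_lift[OF G \<phi>])
  have \<Phi>_pure: "\<Phi> (M_CC.pt x Y) = tensor_lift G (\<gamma> x) Y"
    if "x \<in> carrier M" "Y \<in> carrier (tensor A C C)" for x Y
    using M_CC.tensor_lift_pure[OF G \<phi> that] by (simp add: \<Phi>_def \<phi>_def)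
  have tri: "balanced A M C ?T3 (\<lambda>x y. ?t x y z)" if z: "z \<in> carrier C" for z
    using M_CC.balanced_pure_tensor CC.balanced_pure_tensor z
      CC.smult_pure_tensor[OF bimodule_C, symmetric] unfolding balanced_def by simp
  note assoc = tensor_assoc_tensor_map[OF MR bimodule_C CL.left_module_axioms MR \<rho> \<rho>D(1)[OF m]]
  have eq1: "\<Phi> (tensor_lift ?T3 (\<lambda>x y. ?t x y z) (\<rho> u)) = tensor_lift G (\<lambda>x y. \<gamma> x y z) (\<rho> u)"
    if u: "u \<in> carrier M" and z: "z \<in> carrier C" for u z
  proof -
    have "\<Phi> (tensor_lift ?T3 (\<lambda>x y. ?t x y z) (\<rho> u)) = tensor_lift G (\<lambda>x y. \<Phi> (?t x y z)) (\<rho> u)"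
      by (rule MC.tensor_lift_compose[OF M_CC.abelian_group_tensor tri[OF z] G \<Phi> \<rho>D(1)[OF u]])
    also have "\<dots> = tensor_lift G (\<lambda>x y. \<gamma> x y z) (\<rho> u)"
      by (rule MC.tensor_lift_cong[OF G \<gamma>1[OF z] \<rho>D(1)[OF u]])
        (use z in \<open>simp add: \<Phi>_pure CC.tensor_lift_pure[OF G \<gamma>2]\<close>)
    finally show ?thesis .
  qed
  show b1: "balanced A M C G (\<lambda>u z. tensor_lift G (\<lambda>x y. \<gamma> x y z) (\<rho> u))"
    by (rule MC.balanced_cong[OF balanced_compose[OF assoc(2) \<Phi>]]) (simp only: eq1)
  have b2: "balanced A M C ?T3 (\<lambda>u v. M_CC.pt (id u) (\<Delta> v))"
    using M_CC.balanced_pure_tensor by (simp add: balanced_def comult_closed comult_add comult_smult)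
  have eq2: "\<Phi> (M_CC.pt (id u) (\<Delta> v)) = tensor_lift G (\<gamma> u) (\<Delta> v)"
    if "u \<in> carrier M" "v \<in> carrier C" for u v
    using that by (simp add: \<Phi>_pure comult_closed)
  show b3: "balanced A M C G (\<lambda>u v. tensor_lift G (\<lambda>y z. \<gamma> u y z) (\<Delta> v))"
    by (rule MC.balanced_cong[OF balanced_compose[OF b2 \<Phi>]]) (simp only: eq2)
  have "?lhs = \<Phi> (tensor_assoc A M C C (tensor_map A (tensor A M C) C \<rho> id (\<rho> m)))"
    unfolding assoc(1) MC.tensor_lift_compose[OF M_CC.abelian_group_tensor assoc(2) G \<Phi> \<rho>D(1)[OF m]]
    by (rule MC.tensor_lift_cong[symmetric, OF G b1 \<rho>D(1)[OF m]]) (simp only: eq1)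
  also have "\<dots> = \<Phi> (tensor_lift ?T3 (\<lambda>u v. M_CC.pt (id u) (\<Delta> v)) (\<rho> m))"
    unfolding co by (simp add: tensor_map_def)
  also have "\<dots> = ?rhs"
    unfolding MC.tensor_lift_compose[OF M_CC.abelian_group_tensor b2 G \<Phi> \<rho>D(1)[OF m]]
    by (rule MC.tensor_lift_cong[OF G b3 \<rho>D(1)[OF m]]) (simp only: eq2)
  finally show "?lhs = ?rhs" .
qed

lemmas coassoc = right_comodule_coassoc[OF right_comodule_C]

end

section \<open>The dual rings\<close>

lemma regular_sel [simp]:
  "carrier (regular T) = carrier T" "\<zero>\<^bsub>regular T\<^esub> = \<zero>\<^bsub>T\<^esub>" "add (regular T) = add T"
  "smult (regular T) = mult T" "rsmult (regular T) = mult T"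
  by (simp_all add: regular_def)

section \<open>The actions of the dual rings on the coring\<close>

context A_coring
begin

abbreviation R where "R \<equiv> right_dual A C"
abbreviation T2 where "T2 \<equiv> tensor A C C"

text \<open>\<open>ract g c\<close> is \<open>c \<leftharpoonup> g\<close>, and \<open>lact f c\<close> is \<open>f \<rightharpoonup> c\<close>.\<close>

definition ract :: "('c \<Rightarrow> 'a) \<Rightarrow> 'c \<Rightarrow> 'c"
  where "ract g c = tensor_lift C (\<lambda>x y. g x \<odot>\<^bsub>C\<^esub> y) (\<Delta> c)"

definition lact :: "('c \<Rightarrow> 'a) \<Rightarrow> 'c \<Rightarrow> 'c"
  where "lact f c = tensor_lift C (\<lambda>x y. rsmult C x (f y)) (\<Delta> c)"

text \<open>Unlike the elements of the dual rings, these maps need not be extensional, so composites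
  can be used without restricting them each time.\<close>

definition left_linear :: "('c \<Rightarrow> 'a) \<Rightarrow> bool"
  where "left_linear f \<longleftrightarrow> f \<in> mod_hom A C (regular A)"

definition right_linear :: "('c \<Rightarrow> 'a) \<Rightarrow> bool"
  where "right_linear g \<longleftrightarrow> g \<in> mod_hom (opposite A) (right_mod C) (right_mod (regular A))"

lemma left_linearD:
  assumes "left_linear f"
  shows "x \<in> carrier C \<Longrightarrow> f x \<in> carrier A"
    and "\<lbrakk>x \<in> carrier C; y \<in> carrier C\<rbrakk> \<Longrightarrow> f (x \<oplus>\<^bsub>C\<^esub> y) = f x \<oplus>\<^bsub>A\<^esub> f y"
    and "\<lbrakk>a \<in> carrier A; x \<in> carrier C\<rbrakk> \<Longrightarrow> f (a \<odot>\<^bsub>C\<^esub> x) = a \<otimes>\<^bsub>A\<^esub> f x"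
  using assms by (simp_all add: left_linear_def mod_hom_iff)

lemma right_linearD:
  assumes "right_linear g"
  shows "x \<in> carrier C \<Longrightarrow> g x \<in> carrier A"
    and "\<lbrakk>x \<in> carrier C; y \<in> carrier C\<rbrakk> \<Longrightarrow> g (x \<oplus>\<^bsub>C\<^esub> y) = g x \<oplus>\<^bsub>A\<^esub> g y"
    and "\<lbrakk>a \<in> carrier A; x \<in> carrier C\<rbrakk> \<Longrightarrow> g (rsmult C x a) = g x \<otimes>\<^bsub>A\<^esub> a"
  using assms by (simp_all add: right_linear_def mod_hom_iff)

lemma right_linear_additive: "right_linear g \<Longrightarrow> additive C A g"
  by (simp add: additive_def right_linearD)

lemma right_linear_counit: "right_linear \<epsilon>"
  by (simp add: right_linear_def mod_hom_iff counit_closed counit_add counit_rsmult)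

lemma left_linear_counit: "left_linear \<epsilon>"
  by (simp add: left_linear_def mod_hom_iff counit_closed counit_add counit_smult)

lemma balanced_ract: "right_linear g \<Longrightarrow> balanced A C C C (\<lambda>x y. g x \<odot>\<^bsub>C\<^esub> y)"
  by (simp add: balanced_def right_linearD CL.lsmult_closed CL.lsmult_l_distr CL.lsmult_r_distr CL.lsmult_assoc)

lemma balanced_lact: "left_linear f \<Longrightarrow> balanced A C C C (\<lambda>x y. rsmult C x (f y))"
  by (simp add: balanced_def left_linearD rsmult_closed rsmult_add rsmult_add_left rsmult_assoc)

lemma ract_closed: "\<lbrakk>right_linear g; c \<in> carrier C\<rbrakk> \<Longrightarrow> ract g c \<in> carrier C"
  unfolding ract_def
  by (rule CC.tensor_lift_closed[OF CL.M.abelian_group_axioms balanced_ract comult_closed])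

lemma lact_closed: "\<lbrakk>left_linear f; c \<in> carrier C\<rbrakk> \<Longrightarrow> lact f c \<in> carrier C"
  unfolding lact_def
  by (rule CC.tensor_lift_closed[OF CL.M.abelian_group_axioms balanced_lact comult_closed])

lemma ract_add: "\<lbrakk>right_linear g; c \<in> carrier C; d \<in> carrier C\<rbrakk>
    \<Longrightarrow> ract g (c \<oplus>\<^bsub>C\<^esub> d) = ract g c \<oplus>\<^bsub>C\<^esub> ract g d"
  unfolding ract_def
  using additive_add[OF CC.additive_tensor_lift[OF CL.M.abelian_group_axioms balanced_ract]]
  by (simp add: comult_add comult_closed)

lemma lact_add: "\<lbrakk>left_linear f; c \<in> carrier C; d \<in> carrier C\<rbrakk>
    \<Longrightarrow> lact f (c \<oplus>\<^bsub>C\<^esub> d) = lact f c \<oplus>\<^bsub>C\<^esub> lact f d"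
  unfolding lact_def
  using additive_add[OF CC.additive_tensor_lift[OF CL.M.abelian_group_axioms balanced_lact]]
  by (simp add: comult_add comult_closed)

lemma ract_additive: "right_linear g \<Longrightarrow> additive C C (ract g)"
  by (simp add: additive_def ract_closed ract_add)

lemma lact_additive: "left_linear f \<Longrightarrow> additive C C (lact f)"
  by (simp add: additive_def lact_closed lact_add)

lemma additive_rsmult: "a \<in> carrier A \<Longrightarrow> additive C C (\<lambda>x. rsmult C x a)"
  by (simp add: additive_def rsmult_closed rsmult_add)

lemma additive_smult: "a \<in> carrier A \<Longrightarrow> additive C C (\<lambda>x. a \<odot>\<^bsub>C\<^esub> x)"
  by (simp add: additive_def CL.lsmult_closed CL.lsmult_r_distr)

lemma ract_smult:
  assumes g: "right_linear g" and a: "a \<in> carrier A" and c: "c \<in> carrier C"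
  shows "ract g (a \<odot>\<^bsub>C\<^esub> c) = tensor_lift C (\<lambda>x y. g (a \<odot>\<^bsub>C\<^esub> x) \<odot>\<^bsub>C\<^esub> y) (\<Delta> c)"
  using CC.tensor_lift_smult[OF bimodule_C CL.M.abelian_group_axioms balanced_ract[OF g] a comult_closed[OF c]]
  by (simp add: ract_def comult_smult a c)

lemma ract_rsmult:
  assumes g: "right_linear g" and a: "a \<in> carrier A" and c: "c \<in> carrier C"
  shows "ract g (rsmult C c a) = rsmult C (ract g c) a"
proof -
  note ab = CL.M.abelian_group_axioms and \<Delta>c = comult_closed[OF c]
  note b = balanced_compose[OF balanced_ract[OF g] additive_rsmult[OF a]]
  have "ract g (rsmult C c a) = tensor_lift C (\<lambda>x y. g x \<odot>\<^bsub>C\<^esub> rsmult C y a) (\<Delta> c)"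
    unfolding ract_def comult_rsmult[OF a c]
    by (rule CC.tensor_lift_rsmult[OF bimodule_C ab balanced_ract[OF g] a \<Delta>c])
  also have "\<dots> = tensor_lift C (\<lambda>x y. rsmult C (g x \<odot>\<^bsub>C\<^esub> y) a) (\<Delta> c)"
    by (rule CC.tensor_lift_cong[OF ab b \<Delta>c]) (simp add: smult_rsmult right_linearD[OF g] a)
  also have "\<dots> = rsmult C (ract g c) a"
    unfolding ract_def
    by (rule CC.tensor_lift_compose[OF ab balanced_ract[OF g] ab additive_rsmult[OF a] \<Delta>c, symmetric])
  finally show ?thesis .
qed

lemma lact_smult:
  assumes f: "left_linear f" and a: "a \<in> carrier A" and c: "c \<in> carrier C"
  shows "lact f (a \<odot>\<^bsub>C\<^esub> c) = a \<odot>\<^bsub>C\<^esub> lact f c"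
proof -
  note ab = CL.M.abelian_group_axioms and \<Delta>c = comult_closed[OF c]
  note b = balanced_compose[OF balanced_lact[OF f] additive_smult[OF a]]
  have "lact f (a \<odot>\<^bsub>C\<^esub> c) = tensor_lift C (\<lambda>x y. rsmult C (a \<odot>\<^bsub>C\<^esub> x) (f y)) (\<Delta> c)"
    unfolding lact_def comult_smult[OF a c]
    by (rule CC.tensor_lift_smult[OF bimodule_C ab balanced_lact[OF f] a \<Delta>c])
  also have "\<dots> = tensor_lift C (\<lambda>x y. a \<odot>\<^bsub>C\<^esub> rsmult C x (f y)) (\<Delta> c)"
    by (rule CC.tensor_lift_cong[OF ab b \<Delta>c]) (simp add: smult_rsmult left_linearD[OF f] a)
  also have "\<dots> = a \<odot>\<^bsub>C\<^esub> lact f c"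
    unfolding lact_def
    by (rule CC.tensor_lift_compose[OF ab balanced_lact[OF f] ab additive_smult[OF a] \<Delta>c, symmetric])
  finally show ?thesis .
qed

lemma ract_cong: "\<lbrakk>right_linear g; \<And>x. x \<in> carrier C \<Longrightarrow> h x = g x; c \<in> carrier C\<rbrakk> \<Longrightarrow> ract h c = ract g c"
  unfolding ract_def
  by (rule CC.tensor_lift_cong[OF CL.M.abelian_group_axioms balanced_ract comult_closed]) simp_all

lemma ract_counit: "c \<in> carrier C \<Longrightarrow> ract \<epsilon> c = c"
  by (simp add: ract_def counit_left_eq)

text \<open>Each summand \<open>\<epsilon> (g x y)\<close> equals \<open>g x\<close> times
  \<open>\<epsilon> y\<close>, that is \<open>g (x \<epsilon> y)\<close>, and the right counit law
  collapses the sum. Recovering \<open>g\<close> from its action in this way gives faithfulness and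
  the right unit law of the dual ring.\<close>

lemma counit_ract:
  assumes g: "right_linear g" and c: "c \<in> carrier C"
  shows "\<epsilon> (ract g c) = g c"
proof -
  note ab = CL.M.abelian_group_axioms and \<Delta>c = comult_closed[OF c]
  note b = balanced_compose[OF balanced_lact[OF left_linear_counit] right_linear_additive[OF g]]
  have "\<epsilon> (ract g c) = tensor_lift A (\<lambda>x y. \<epsilon> (g x \<odot>\<^bsub>C\<^esub> y)) (\<Delta> c)"
    unfolding ract_def
    by (rule CC.tensor_lift_compose[OF ab balanced_ract[OF g] abelian_group_A
          right_linear_additive[OF right_linear_counit] \<Delta>c])
  also have "\<dots> = tensor_lift A (\<lambda>x y. g (rsmult C x (\<epsilon> y))) (\<Delta> c)"
    by (rule CC.tensor_lift_cong[OF abelian_group_A b \<Delta>c])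
      (simp add: right_linearD[OF g] counit_smult counit_closed)
  also have "\<dots> = g (tensor_lift C (\<lambda>x y. rsmult C x (\<epsilon> y)) (\<Delta> c))"
    by (rule CC.tensor_lift_compose[OF ab balanced_lact[OF left_linear_counit] abelian_group_A
          right_linear_additive[OF g] \<Delta>c, symmetric])
  finally show ?thesis using c by (simp add: counit_right_eq)
qed

lemma right_linear_comp_ract:
  assumes f: "right_linear f" and g: "right_linear g"
  shows "right_linear (\<lambda>c. g (ract f c))"
  using right_linearD[OF g] ract_closed[OF f] ract_add[OF f] ract_rsmult[OF f]
  by (simp add: right_linear_def mod_hom_iff)

text \<open>\<open>g \<circ> (\<leftharpoonup> f)\<close> is the convolution product of \<open>f\<close> and \<open>g\<close>.\<close>

lemma ract_ract:
  assumes f: "right_linear f" and g: "right_linear g" and c: "c \<in> carrier C"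
  shows "ract g (ract f c) = ract (\<lambda>c. g (ract f c)) c"
proof -
  note ab = CL.M.abelian_group_axioms and \<Delta>c = comult_closed[OF c]
  note fD = right_linearD[OF f] and gD = right_linearD[OF g]
  \<comment> \<open>Both sides are sums of \<open>g (f x u) v\<close> over the iterated
    comultiplication.\<close>
  let ?\<gamma> = "\<lambda>x u v. g (f x \<odot>\<^bsub>C\<^esub> u) \<odot>\<^bsub>C\<^esub> v"
  have b1: "balanced A C C C (\<lambda>x u. ?\<gamma> x u v)" if "v \<in> carrier C" for v
    using that fD gD
    by (simp add: balanced_def CL.lsmult_closed CL.lsmult_l_distr CL.lsmult_r_distr CL.lsmult_assoc)
  have b2: "balanced A C C C (\<lambda>u v. ?\<gamma> x u v)" if "x \<in> carrier C" for x
    using that fD gD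
    by (simp add: balanced_def CL.lsmult_closed CL.lsmult_l_distr CL.lsmult_r_distr CL.lsmult_assoc
        flip: smult_rsmult)
  note co = coassoc[OF ab b1 b2 c]
  have "ract g (ract f c) = tensor_lift C (\<lambda>x y. ract g (f x \<odot>\<^bsub>C\<^esub> y)) (\<Delta> c)"
    unfolding ract_def[of f]
    by (rule CC.tensor_lift_compose[OF ab balanced_ract[OF f] ab ract_additive[OF g] \<Delta>c])
  also have "\<dots> = tensor_lift C (\<lambda>x y. tensor_lift C (\<lambda>u v. ?\<gamma> x u v) (\<Delta> y)) (\<Delta> c)"
    by (rule CC.tensor_lift_cong[OF ab co(3) \<Delta>c]) (simp_all add: ract_smult[OF g] fD)
  also have "\<dots> = tensor_lift C (\<lambda>w v. tensor_lift C (\<lambda>x u. ?\<gamma> x u v) (\<Delta> w)) (\<Delta> c)"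
    by (rule co(1)[symmetric])
  also have "\<dots> = ract (\<lambda>c. g (ract f c)) c"
    unfolding ract_def[of "\<lambda>c. g (ract f c)"]
  proof (rule CC.tensor_lift_cong[OF ab balanced_ract[OF right_linear_comp_ract[OF f g]] \<Delta>c])
    fix w v assume w: "w \<in> carrier C" and v: "v \<in> carrier C"
    have "additive C C (\<lambda>z. g z \<odot>\<^bsub>C\<^esub> v)"
      using gD v by (simp add: additive_def CL.lsmult_closed CL.lsmult_l_distr)
    from CC.tensor_lift_compose[OF ab balanced_ract[OF f] ab this comult_closed[OF w]]
    show "tensor_lift C (\<lambda>x u. ?\<gamma> x u v) (\<Delta> w) = g (ract f w) \<odot>\<^bsub>C\<^esub> v"
      by (simp add: ract_def)
  qed
  finally show ?thesis .
qed

text \<open>Both composites are sums of \<open>g x u (f v)\<close> over the iterated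
  comultiplication, bracketed in the two possible ways.\<close>

lemma lact_ract:
  assumes f: "left_linear f" and g: "right_linear g" and c: "c \<in> carrier C"
  shows "lact f (ract g c) = ract g (lact f c)"
proof -
  note ab = CL.M.abelian_group_axioms and \<Delta>c = comult_closed[OF c]
  note fD = left_linearD[OF f] and gD = right_linearD[OF g]
  let ?\<gamma> = "\<lambda>x u v. g x \<odot>\<^bsub>C\<^esub> rsmult C u (f v)"
  have b1: "balanced A C C C (\<lambda>x u. ?\<gamma> x u v)" if "v \<in> carrier C" for v
    using that fD gD
    by (simp add: balanced_def CL.lsmult_closed CL.lsmult_l_distr CL.lsmult_r_distr CL.lsmult_assoc
        rsmult_closed rsmult_add smult_rsmult)
  have b2: "balanced A C C C (\<lambda>u v. ?\<gamma> x u v)" if "x \<in> carrier C" for x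
    using balanced_compose[OF balanced_lact[OF f] additive_smult] gD(1) that by blast
  note co = coassoc[OF ab b1 b2 c]
  have "lact f (ract g c) = tensor_lift C (\<lambda>x y. lact f (g x \<odot>\<^bsub>C\<^esub> y)) (\<Delta> c)"
    unfolding ract_def
    by (rule CC.tensor_lift_compose[OF ab balanced_ract[OF g] ab lact_additive[OF f] \<Delta>c])
  also have "\<dots> = tensor_lift C (\<lambda>x y. tensor_lift C (\<lambda>u v. ?\<gamma> x u v) (\<Delta> y)) (\<Delta> c)"
  proof (rule CC.tensor_lift_cong[OF ab co(3) \<Delta>c])
    fix x y assume x: "x \<in> carrier C" and y: "y \<in> carrier C"
    show "lact f (g x \<odot>\<^bsub>C\<^esub> y) = tensor_lift C (\<lambda>u v. ?\<gamma> x u v) (\<Delta> y)"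
      using CC.tensor_lift_compose[OF ab balanced_lact[OF f] ab additive_smult[OF gD(1)[OF x]] comult_closed[OF y]]
      by (simp add: lact_smult[OF f gD(1)[OF x] y]) (simp add: lact_def)
  qed
  also have "\<dots> = tensor_lift C (\<lambda>w v. tensor_lift C (\<lambda>x u. ?\<gamma> x u v) (\<Delta> w)) (\<Delta> c)"
    by (rule co(1)[symmetric])
  also have "\<dots> = tensor_lift C (\<lambda>w v. ract g (rsmult C w (f v))) (\<Delta> c)"
  proof (rule CC.tensor_lift_cong[OF ab balanced_compose[OF balanced_lact[OF f] ract_additive[OF g]] \<Delta>c])
    fix w v assume w: "w \<in> carrier C" and v: "v \<in> carrier C"
    have "ract g (rsmult C w (f v)) = tensor_lift C (\<lambda>x u. g x \<odot>\<^bsub>C\<^esub> rsmult C u (f v)) (\<Delta> w)"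
      unfolding ract_def comult_rsmult[OF fD(1)[OF v] w]
      by (rule CC.tensor_lift_rsmult[OF bimodule_C ab balanced_ract[OF g] fD(1)[OF v] comult_closed[OF w]])
    then show "tensor_lift C (\<lambda>x u. ?\<gamma> x u v) (\<Delta> w) = ract g (rsmult C w (f v))" by simp
  qed
  also have "\<dots> = ract g (lact f c)"
    unfolding lact_def
    by (rule CC.tensor_lift_compose[OF ab balanced_lact[OF f] ab ract_additive[OF g] \<Delta>c, symmetric])
  finally show ?thesis .
qed

lemma right_dual_sel:
  "g \<in> carrier R \<longleftrightarrow> right_linear g \<and> g \<in> extensional (carrier C)"
  "\<one>\<^bsub>R\<^esub> = restrict \<epsilon> (carrier C)" "\<zero>\<^bsub>R\<^esub> = (\<lambda>c\<in>carrier C. \<zero>\<^bsub>A\<^esub>)"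
  "f \<oplus>\<^bsub>R\<^esub> g = (\<lambda>c\<in>carrier C. f c \<oplus>\<^bsub>A\<^esub> g c)"
  by (simp_all add: right_dual_def right_linear_def)

text \<open>With the product expressed through the action, the ring axioms reduce to the laws of
  \<open>ract\<close> instead of further computations with tensors.\<close>

lemma right_dual_mult:
  assumes f: "right_linear f" and g: "right_linear g"
  shows "f \<otimes>\<^bsub>R\<^esub> g = (\<lambda>c\<in>carrier C. g (ract f c))"
proof -
  have "tensor_lift A (\<lambda>x y. g (f x \<odot>\<^bsub>C\<^esub> y)) (\<Delta> c) = g (ract f c)" if c: "c \<in> carrier C" for c
    unfolding ract_def
    by (rule CC.tensor_lift_compose[OF CL.M.abelian_group_axioms balanced_ract[OF f] abelian_group_A
          right_linear_additive[OF g] comult_closed[OF c], symmetric])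
  then show ?thesis by (auto simp: right_dual_def intro!: restrict_ext)
qed

lemma right_linear_restrict: "right_linear (restrict g (carrier C)) \<longleftrightarrow> right_linear g"
  by (simp add: right_linear_def mod_hom_iff rsmult_closed)

lemma right_linear_add:
  assumes "right_linear f" "right_linear g"
  shows "right_linear (\<lambda>c. f c \<oplus>\<^bsub>A\<^esub> g c)"
  unfolding right_linear_def mod_hom_iff
  by (simp add: right_linearD[OF assms(1)] right_linearD[OF assms(2)] CL.T.a_ac CL.T.l_distr)

lemma right_linear_minus:
  assumes "right_linear f"
  shows "right_linear (\<lambda>c. \<ominus>\<^bsub>A\<^esub> f c)"
  unfolding right_linear_def mod_hom_iff
  by (simp add: right_linearD[OF assms] CL.T.minus_add CL.T.l_minus)

lemma right_linear_zero: "right_linear (\<lambda>c. \<zero>\<^bsub>A\<^esub>)"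
  by (simp add: right_linear_def mod_hom_iff)

lemma ract_add_fun:
  assumes "right_linear f" "right_linear g" "c \<in> carrier C"
  shows "ract (\<lambda>c. f c \<oplus>\<^bsub>A\<^esub> g c) c = ract f c \<oplus>\<^bsub>C\<^esub> ract g c"
proof -
  have "ract (\<lambda>c. f c \<oplus>\<^bsub>A\<^esub> g c) c = tensor_lift C (\<lambda>x y. f x \<odot>\<^bsub>C\<^esub> y \<oplus>\<^bsub>C\<^esub> g x \<odot>\<^bsub>C\<^esub> y) (\<Delta> c)"
    unfolding ract_def
    by (rule CC.tensor_lift_cong[symmetric, OF CL.M.abelian_group_axioms
          balanced_ract[OF right_linear_add[OF assms(1,2)]] comult_closed[OF assms(3)]])
      (simp add: CL.lsmult_l_distr right_linearD[OF assms(1)] right_linearD[OF assms(2)])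
  then show ?thesis
    unfolding ract_def CC.tensor_lift_add_fun[OF CL.M.abelian_group_axioms
        balanced_ract[OF assms(1)] balanced_ract[OF assms(2)] comult_closed[OF assms(3)]] .
qed

lemma ring_right_dual: "ring R"
proof (rule ringI)
  show "abelian_group R"
  proof (rule abelian_groupI)
    fix f assume f: "f \<in> carrier R"
    have "(\<lambda>c\<in>carrier C. \<ominus>\<^bsub>A\<^esub> f c) \<oplus>\<^bsub>R\<^esub> f = \<zero>\<^bsub>R\<^esub>"
      using f by (auto simp: right_dual_sel CL.T.l_neg right_linearD intro!: restrict_ext)
    moreover have "(\<lambda>c\<in>carrier C. \<ominus>\<^bsub>A\<^esub> f c) \<in> carrier R"
      using f by (simp add: right_dual_sel right_linear_restrict right_linear_minus)
    ultimately show "\<exists>g\<in>carrier R. g \<oplus>\<^bsub>R\<^esub> f = \<zero>\<^bsub>R\<^esub>" by blast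
  next
    fix f assume f: "f \<in> carrier R"
    show "\<zero>\<^bsub>R\<^esub> \<oplus>\<^bsub>R\<^esub> f = f"
      using f by (auto simp: right_dual_sel right_linearD extensional_def fun_eq_iff)
  qed (auto simp: right_dual_sel right_linear_restrict right_linear_add right_linear_zero
      right_linearD CL.T.a_ac intro!: restrict_ext)
  show "monoid R"
  proof (rule monoidI)
    fix f g h assume "f \<in> carrier R" "g \<in> carrier R" "h \<in> carrier R"
    then have f: "right_linear f" and g: "right_linear g" and h: "right_linear h"
      by (simp_all add: right_dual_sel)
    show "f \<otimes>\<^bsub>R\<^esub> g \<in> carrier R"
      using right_linear_comp_ract[OF f g]
      by (simp add: right_dual_mult[OF f g] right_dual_sel right_linear_restrict)
    have fg: "right_linear (\<lambda>c\<in>carrier C. g (ract f c))" and gh: "right_linear (\<lambda>c\<in>carrier C. h (ract g c))"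
      using right_linear_comp_ract f g h by (simp_all add: right_linear_restrict)
    have "ract (\<lambda>c\<in>carrier C. g (ract f c)) c = ract g (ract f c)" if "c \<in> carrier C" for c
      unfolding ract_ract[OF f g that]
      by (rule ract_cong[OF right_linear_comp_ract[OF f g] _ that]) simp
    then show "f \<otimes>\<^bsub>R\<^esub> g \<otimes>\<^bsub>R\<^esub> h = f \<otimes>\<^bsub>R\<^esub> (g \<otimes>\<^bsub>R\<^esub> h)"
      by (auto simp: right_dual_mult[OF f g] right_dual_mult[OF g h] right_dual_mult[OF fg h]
          right_dual_mult[OF f gh] ract_closed[OF f] intro!: restrict_ext)
  next
    fix f assume "f \<in> carrier R"
    then have f: "right_linear f" and fe: "f \<in> extensional (carrier C)"
      by (simp_all add: right_dual_sel)
    have e: "right_linear (restrict \<epsilon> (carrier C))"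
      using right_linear_counit by (simp add: right_linear_restrict)
    have "ract (restrict \<epsilon> (carrier C)) c = c" if "c \<in> carrier C" for c
      using ract_cong[OF right_linear_counit, of "restrict \<epsilon> (carrier C)" c] that by (simp add: ract_counit)
    then have "\<one>\<^bsub>R\<^esub> \<otimes>\<^bsub>R\<^esub> f = (\<lambda>c\<in>carrier C. f c)"
      unfolding right_dual_sel(2) right_dual_mult[OF e f] by (intro restrict_ext) simp
    then show "\<one>\<^bsub>R\<^esub> \<otimes>\<^bsub>R\<^esub> f = f"
      using fe by (simp add: extensional_restrict)
    have "f \<otimes>\<^bsub>R\<^esub> \<one>\<^bsub>R\<^esub> = (\<lambda>c\<in>carrier C. f c)"
      unfolding right_dual_sel(2) right_dual_mult[OF f e]
      by (intro restrict_ext) (simp add: ract_closed[OF f] counit_ract[OF f])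
    then show "f \<otimes>\<^bsub>R\<^esub> \<one>\<^bsub>R\<^esub> = f"
      using fe by (simp add: extensional_restrict)
  qed (simp add: right_dual_sel right_linear_restrict right_linear_counit)
  fix f g h assume "f \<in> carrier R" "g \<in> carrier R" "h \<in> carrier R"
  then have f: "right_linear f" and g: "right_linear g" and h: "right_linear h"
    by (simp_all add: right_dual_sel)
  have add: "right_linear (\<lambda>c\<in>carrier C. f c \<oplus>\<^bsub>A\<^esub> g c)"
    using right_linear_add[OF f g] by (simp add: right_linear_restrict)
  have "ract (\<lambda>c\<in>carrier C. f c \<oplus>\<^bsub>A\<^esub> g c) c = ract f c \<oplus>\<^bsub>C\<^esub> ract g c" if c: "c \<in> carrier C" for c
    using ract_cong[OF right_linear_add[OF f g], of "\<lambda>c\<in>carrier C. f c \<oplus>\<^bsub>A\<^esub> g c" c]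
    by (simp add: c ract_add_fun[OF f g])
  then have "(f \<oplus>\<^bsub>R\<^esub> g) \<otimes>\<^bsub>R\<^esub> h = (\<lambda>c\<in>carrier C. h (ract f c) \<oplus>\<^bsub>A\<^esub> h (ract g c))"
    unfolding right_dual_sel(4) right_dual_mult[OF add h]
    by (intro restrict_ext) (simp add: right_linearD[OF h] ract_closed f g)
  also have "\<dots> = f \<otimes>\<^bsub>R\<^esub> h \<oplus>\<^bsub>R\<^esub> g \<otimes>\<^bsub>R\<^esub> h"
    unfolding right_dual_sel(4) right_dual_mult[OF f h] right_dual_mult[OF g h]
    by (intro restrict_ext) simp
  finally show "(f \<oplus>\<^bsub>R\<^esub> g) \<otimes>\<^bsub>R\<^esub> h = f \<otimes>\<^bsub>R\<^esub> h \<oplus>\<^bsub>R\<^esub> g \<otimes>\<^bsub>R\<^esub> h" .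
  show "h \<otimes>\<^bsub>R\<^esub> (f \<oplus>\<^bsub>R\<^esub> g) = h \<otimes>\<^bsub>R\<^esub> f \<oplus>\<^bsub>R\<^esub> h \<otimes>\<^bsub>R\<^esub> g"
    unfolding right_dual_sel(4) right_dual_mult[OF h add] right_dual_mult[OF h f] right_dual_mult[OF h g]
    by (intro restrict_ext) (simp add: ract_closed h)
qed

lemma right_dual_mod_sel [simp]:
  "carrier (right_dual_mod C) = carrier C" "\<zero>\<^bsub>right_dual_mod C\<^esub> = \<zero>\<^bsub>C\<^esub>"
  "add (right_dual_mod C) = add C" "smult (right_dual_mod C) = ract"
  by (simp_all add: right_dual_mod_def ract_def fun_eq_iff)

lemma left_module_right_dual: "left_module (opposite R) (right_dual_mod C)"
proof (rule left_moduleI[OF ring_opposite[OF ring_right_dual]];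
    (simp only: opposite_sel right_dual_mod_sel)?)
  show "abelian_group (right_dual_mod C)"
    by (rule abelian_group_cong[OF CL.M.abelian_group_axioms]) simp_all
  fix f c assume f: "f \<in> carrier R" and c: "c \<in> carrier C"
  then have fl: "right_linear f" by (simp add: right_dual_sel)
  show "ract f c \<in> carrier C" by (rule ract_closed[OF fl c])
  show "ract f (c \<oplus>\<^bsub>C\<^esub> d) = ract f c \<oplus>\<^bsub>C\<^esub> ract f d" if "d \<in> carrier C" for d
    by (rule ract_add[OF fl c that])
  fix g assume "g \<in> carrier R"
  then have gl: "right_linear g" by (simp add: right_dual_sel)
  show "ract (f \<oplus>\<^bsub>R\<^esub> g) c = ract f c \<oplus>\<^bsub>C\<^esub> ract g c"
    using ract_cong[OF right_linear_add[OF fl gl], of "f \<oplus>\<^bsub>R\<^esub> g" c]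
    by (simp add: c right_dual_sel ract_add_fun[OF fl gl])
  show "ract (g \<otimes>\<^bsub>R\<^esub> f) c = ract f (ract g c)"
    unfolding ract_ract[OF gl fl c] right_dual_mult[OF gl fl]
    by (rule ract_cong[OF right_linear_comp_ract[OF gl fl] _ c]) simp
next
  fix c assume c: "c \<in> carrier C"
  show "ract \<one>\<^bsub>R\<^esub> c = c"
    using ract_cong[OF right_linear_counit, of "\<one>\<^bsub>R\<^esub>" c] c by (simp add: right_dual_sel ract_counit)
qed

lemma right_dual_faithful:
  assumes g: "g \<in> carrier R" and z: "\<And>c. c \<in> carrier C \<Longrightarrow> ract g c = \<zero>\<^bsub>C\<^esub>"
  shows "g = \<zero>\<^bsub>R\<^esub>"
proof (rule extensionalityI[of _ "carrier C"])
  show "g \<in> extensional (carrier C)" "\<zero>\<^bsub>R\<^esub> \<in> extensional (carrier C)"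
    using g by (simp_all add: right_dual_sel)
  have gl: "right_linear g" using g by (simp add: right_dual_sel)
  fix c assume c: "c \<in> carrier C"
  have "\<epsilon> \<zero>\<^bsub>C\<^esub> = \<zero>\<^bsub>A\<^esub>"
    by (rule additive_zero[OF right_linear_additive[OF right_linear_counit] CL.M.abelian_group_axioms abelian_group_A])
  then show "g c = \<zero>\<^bsub>R\<^esub> c"
    using counit_ract[OF gl c] z[OF c] c by (simp add: right_dual_sel)
qed

section \<open>Colinear endomorphisms as actions of the dual ring\<close>

lemma right_colinear_endosI:
  assumes g: "right_linear g"
  shows "ract g \<in> right_colinear_endos A C"
  unfolding right_colinear_endos_def right_colinear_def
proof (intro CollectI conjI ballI)
  show "ract g \<in> mod_hom (opposite A) (right_mod C) (right_mod C)"
    using ract_closed[OF g] ract_add[OF g] ract_rsmult[OF g] by (simp add: mod_hom_iff)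
  fix c assume c: "c \<in> carrier C"
  note ab = CC.abelian_group_tensor and \<Delta>c = comult_closed[OF c]
  note gD = right_linearD[OF g]
  \<comment> \<open>Coassociativity once more, now with values in
    \<open>C \<otimes> C\<close>.\<close>
  let ?\<gamma> = "\<lambda>x u v. CC.pt (g x \<odot>\<^bsub>C\<^esub> u) v"
  have b1: "balanced A C C T2 (\<lambda>x u. ?\<gamma> x u v)" if "v \<in> carrier C" for v
    using CC.balanced_pure_tensor balanced_ract[OF g] that by (simp add: balanced_def)
  have b2: "balanced A C C T2 (\<lambda>u v. ?\<gamma> x u v)" if "x \<in> carrier C" for x
    using CC.balanced_smult[OF bimodule_C CC.balanced_pure_tensor gD(1)[OF that]] .
  note co = coassoc[OF ab b1 b2 c]
  have \<Delta>_add: "additive C T2 \<Delta>"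
    by (simp add: additive_def comult_closed comult_add)
  have "\<Delta> (ract g c) = tensor_lift T2 (\<lambda>x y. \<Delta> (g x \<odot>\<^bsub>C\<^esub> y)) (\<Delta> c)"
    unfolding ract_def
    by (rule CC.tensor_lift_compose[OF CL.M.abelian_group_axioms balanced_ract[OF g] ab \<Delta>_add \<Delta>c])
  also have "\<dots> = tensor_lift T2 (\<lambda>x y. tensor_lift T2 (\<lambda>u v. ?\<gamma> x u v) (\<Delta> y)) (\<Delta> c)"
    by (rule CC.tensor_lift_cong[OF ab co(3) \<Delta>c])
      (simp_all add: gD comult_smult comult_closed CC.tensor_smult[OF bimodule_C])
  also have "\<dots> = tensor_lift T2 (\<lambda>w v. tensor_lift T2 (\<lambda>x u. ?\<gamma> x u v) (\<Delta> w)) (\<Delta> c)"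
    by (rule co(1)[symmetric])
  also have "\<dots> = tensor_map A C C (ract g) id (\<Delta> c)"
    unfolding tensor_map_def
  proof (rule CC.tensor_lift_cong[OF ab _ \<Delta>c])
    show "balanced A C C T2 (\<lambda>x y. CC.pt (ract g x) (id y))"
      using CC.balanced_pure_tensor ract_closed[OF g] ract_add[OF g] ract_rsmult[OF g]
      by (simp add: balanced_def)
    fix w v assume w: "w \<in> carrier C" and v: "v \<in> carrier C"
    have "additive C T2 (\<lambda>z. CC.pt z v)"
      using CC.balanced_pure_tensor v by (simp add: balanced_def additive_def)
    from CC.tensor_lift_compose[OF CL.M.abelian_group_axioms balanced_ract[OF g] ab this comult_closed[OF w]]
    show "tensor_lift T2 (\<lambda>x u. ?\<gamma> x u v) (\<Delta> w) = CC.pt (ract g w) (id v)"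
      by (simp add: ract_def)
  qed
  finally show "\<Delta> (ract g c) = tensor_map A C C (ract g) id (\<Delta> c)" .
qed

text \<open>The functional is \<open>\<epsilon>\<close> after \<open>f\<close>: applying
  \<open>\<epsilon> \<otimes> id\<close> to the colinearity equation leaves \<open>f c\<close> on
  one side, by the counit law, and the action of this functional on the other.\<close>

lemma right_colinear_endosE:
  assumes f: "f \<in> right_colinear_endos A C"
  obtains g where "g \<in> carrier R" "\<And>c. c \<in> carrier C \<Longrightarrow> f c = ract g c"
proof
  have fl: "f \<in> mod_hom (opposite A) (right_mod C) (right_mod C)"
    and co: "\<And>c. c \<in> carrier C \<Longrightarrow> \<Delta> (f c) = tensor_map A C C f id (\<Delta> c)"
    using f by (simp_all add: right_colinear_endos_def right_colinear_def)
  note fD = mod_hom_right_modD[OF fl]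
  have ef: "right_linear (\<lambda>c. \<epsilon> (f c))"
    using fD by (simp add: right_linear_def mod_hom_iff counit_closed counit_add counit_rsmult)
  show "(\<lambda>c\<in>carrier C. \<epsilon> (f c)) \<in> carrier R"
    using ef by (simp add: right_dual_sel right_linear_restrict)
  fix c assume c: "c \<in> carrier C"
  note ab = CL.M.abelian_group_axioms and \<Delta>c = comult_closed[OF c]
  have b: "balanced A C C T2 (\<lambda>x y. CC.pt (f x) (id y))"
    using CC.balanced_pure_tensor fD by (simp add: balanced_def)
  have "f c = tensor_lift C (\<lambda>x y. \<epsilon> x \<odot>\<^bsub>C\<^esub> y) (tensor_lift T2 (\<lambda>x y. CC.pt (f x) (id y)) (\<Delta> c))"
    using counit_left_eq[OF fD(1)[OF c]] co[OF c] by (simp add: tensor_map_def)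
  also have "\<dots> = tensor_lift C (\<lambda>x y. tensor_lift C (\<lambda>x y. \<epsilon> x \<odot>\<^bsub>C\<^esub> y) (CC.pt (f x) (id y))) (\<Delta> c)"
    by (rule CC.tensor_lift_compose[OF CC.abelian_group_tensor b ab
          CC.additive_tensor_lift[OF ab balanced_ract[OF right_linear_counit]] \<Delta>c])
  also have "\<dots> = ract (\<lambda>c. \<epsilon> (f c)) c"
    unfolding ract_def[of "\<lambda>c. \<epsilon> (f c)"]
    by (rule CC.tensor_lift_cong[OF ab balanced_ract[OF ef] \<Delta>c])
      (simp add: CC.tensor_lift_pure[OF ab balanced_ract[OF right_linear_counit]] fD)
  also have "\<dots> = ract (\<lambda>c\<in>carrier C. \<epsilon> (f c)) c"
    by (rule ract_cong[OF ef _ c, symmetric]) simp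
  finally show "f c = ract (\<lambda>c\<in>carrier C. \<epsilon> (f c)) c" .
qed

end

section \<open>Coideals\<close>

text \<open>The sum of the \<open>\<theta> e W\<close> over \<open>e \<in> B\<close> has finite support and value \<open>W\<close>.\<close>

definition eventually_id :: "('w, 'x) ring_scheme \<Rightarrow> 'e set \<Rightarrow> ('e \<Rightarrow> 'w \<Rightarrow> 'w) \<Rightarrow> 'w \<Rightarrow> bool"
  where "eventually_id T B \<theta> W \<longleftrightarrow> (\<exists>E. finite E \<and> E \<subseteq> B \<and>
    (\<forall>E'. finite E' \<longrightarrow> E \<subseteq> E' \<longrightarrow> E' \<subseteq> B \<longrightarrow> finsum T (\<lambda>e. \<theta> e W) E' = W))"

lemma additive_finsum_fun:
  assumes T: "abelian_group T" and E: "finite E"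
    and \<theta>: "\<And>e. e \<in> E \<Longrightarrow> additive S T (\<theta> e)"
  shows "additive S T (\<lambda>W. finsum T (\<lambda>e. \<theta> e W) E)"
proof -
  interpret T: abelian_group T by fact
  show ?thesis
  proof (rule additiveI)
    show "finsum T (\<lambda>e. \<theta> e W) E \<in> carrier T" if "W \<in> carrier S" for W
      using additive_closed[OF \<theta> that] by (intro T.finsum_closed) auto
    show "finsum T (\<lambda>e. \<theta> e (V \<oplus>\<^bsub>S\<^esub> W)) E = finsum T (\<lambda>e. \<theta> e V) E \<oplus>\<^bsub>T\<^esub> finsum T (\<lambda>e. \<theta> e W) E"
      if V: "V \<in> carrier S" and W: "W \<in> carrier S" for V W
    proof -
      have "finsum T (\<lambda>e. \<theta> e (V \<oplus>\<^bsub>S\<^esub> W)) E = finsum T (\<lambda>e. \<theta> e V \<oplus>\<^bsub>T\<^esub> \<theta> e W) E"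
        by (rule T.finsum_cong')
          (use additive_closed[OF \<theta> V] additive_closed[OF \<theta> W] additive_add[OF \<theta> V W] in auto)
      also have "\<dots> = finsum T (\<lambda>e. \<theta> e V) E \<oplus>\<^bsub>T\<^esub> finsum T (\<lambda>e. \<theta> e W) E"
        by (rule T.finsum_addf) (use additive_closed[OF \<theta> V] additive_closed[OF \<theta> W] in auto)
      finally show ?thesis .
    qed
  qed
qed

lemma additive_finsum:
  assumes h: "additive S T h" and S: "abelian_group S" and T: "abelian_group T"
    and E: "finite E" and f: "f \<in> E \<rightarrow> carrier S"
  shows "h (finsum S f E) = finsum T (\<lambda>e. h (f e)) E"
proof -
  interpret S: abelian_group S by fact
  interpret T: abelian_group T by fact
  show ?thesis
    using E f
  proof (induction E rule: finite_induct)
    case empty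
    show ?case using additive_zero[OF h S T] by simp
  next
    case (insert e E)
    then have fE: "f \<in> E \<rightarrow> carrier S" and fe: "f e \<in> carrier S" by auto
    have hE: "(\<lambda>e. h (f e)) \<in> E \<rightarrow> carrier T" and he: "h (f e) \<in> carrier T"
      using additive_closed[OF h] fE fe by auto
    show ?case
      using insert.hyps insert.IH[OF fE] fE fe hE he
      by (simp add: additive_add[OF h] S.finsum_closed)
  qed
qed

text \<open>The two finite index sets are united; this is why \<open>eventually_id\<close> requires
  the equation for all larger finite sets and not just for one set.\<close>

lemma eventually_id_diff:
  assumes T: "abelian_group T" and \<theta>: "\<And>e. e \<in> B \<Longrightarrow> additive T T (\<theta> e)"
    and V: "V \<in> carrier T" "eventually_id T B \<theta> V" and W: "W \<in> carrier T" "eventually_id T B \<theta> W"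
  shows "eventually_id T B \<theta> (V \<oplus>\<^bsub>T\<^esub> \<ominus>\<^bsub>T\<^esub> W)"
proof -
  interpret T: abelian_group T by fact
  obtain E where E: "finite E" "E \<subseteq> B"
    "\<And>E'. \<lbrakk>finite E'; E \<subseteq> E'; E' \<subseteq> B\<rbrakk> \<Longrightarrow> finsum T (\<lambda>e. \<theta> e V) E' = V"
    using V(2) unfolding eventually_id_def by metis
  obtain F where F: "finite F" "F \<subseteq> B"
    "\<And>E'. \<lbrakk>finite E'; F \<subseteq> E'; E' \<subseteq> B\<rbrakk> \<Longrightarrow> finsum T (\<lambda>e. \<theta> e W) E' = W"
    using W(2) unfolding eventually_id_def by metis
  have "finsum T (\<lambda>e. \<theta> e (V \<oplus>\<^bsub>T\<^esub> \<ominus>\<^bsub>T\<^esub> W)) E' = V \<oplus>\<^bsub>T\<^esub> \<ominus>\<^bsub>T\<^esub> W"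
    if E': "finite E'" "E \<union> F \<subseteq> E'" "E' \<subseteq> B" for E'
  proof -
    have add: "additive T T (\<lambda>W. finsum T (\<lambda>e. \<theta> e W) E')"
      by (rule additive_finsum_fun[OF T E'(1)]) (use E'(3) \<theta> in auto)
    show ?thesis
      using additive_add[OF add V(1) T.a_inv_closed[OF W(1)]] additive_minus[OF add T T W(1)]
        E(3)[of E'] F(3)[of E'] E' by simp
  qed
  then show ?thesis
    unfolding eventually_id_def using E(1,2) F(1,2) by (intro exI[of _ "E \<union> F"]) simp
qed

lemma (in tensor_pair) eventually_id_tensor:
  assumes \<theta>: "\<And>e. e \<in> B \<Longrightarrow> additive (tensor A M N) (tensor A M N) (\<theta> e)"
    and pure: "\<And>x y. \<lbrakk>x \<in> carrier M; y \<in> carrier N\<rbrakk> \<Longrightarrow> eventually_id (tensor A M N) B \<theta> (pt x y)"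
    and W: "W \<in> carrier (tensor A M N)"
  shows "eventually_id (tensor A M N) B \<theta> W"
  using W
proof (induction rule: tensor_induct)
  case zero
  have "finsum (tensor A M N) (\<lambda>e. \<theta> e \<zero>\<^bsub>tensor A M N\<^esub>) E = \<zero>\<^bsub>tensor A M N\<^esub>" if "finite E" "E \<subseteq> B" for E
    by (rule additive_zero[where h="\<lambda>W. finsum (tensor A M N) (\<lambda>e. \<theta> e W) E",
          OF additive_finsum_fun[OF abelian_group_tensor that(1)] abelian_group_tensor abelian_group_tensor])
      (use \<theta> that(2) in auto)
  then show ?case unfolding eventually_id_def by (intro exI[of _ "{}"]) simp
next
  case (diff V W)
  then show ?case by (intro eventually_id_diff[OF abelian_group_tensor \<theta>]) simp_all
qed (rule pure)

text \<open>The dual basis lemma; the basis consists of the elements of \<open>P\<close> themselves.\<close>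

lemma projective_dual_basis:
  fixes T :: "('a, 'x) ring_scheme" and P :: "('a, 'c, 'y) module_scheme"
  assumes P: "projective_module T P"
  obtains H where "\<And>e. e \<in> carrier P \<Longrightarrow> (\<lambda>x. H x e) \<in> mod_hom T P (regular T)"
    and "\<And>x. x \<in> carrier P \<Longrightarrow> eventually_id P (carrier P) (\<lambda>e x. H x e \<odot>\<^bsub>P\<^esub> e) x"
proof -
  interpret P: left_module T P using P by (simp add: projective_module_def)
  let ?A = "regular T" and ?I = "carrier P"
  \<comment> \<open>A copy of \<open>P\<close> in the record type that
    \<open>projective_module\<close> prescribes for the target of an epimorphism.\<close>
  define L :: "('a, 'c) module" where "L = \<lparr>carrier = carrier P, mult = undefined, one = undefined,
    ring.zero = \<zero>\<^bsub>P\<^esub>, add = add P, smult = smult P\<rparr>"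
  have L: "left_module T L"
    by (rule left_module_cong[OF P.left_module_axioms]) (simp_all add: L_def)
  have A: "left_module T ?A" by (rule left_module_is_regular[OF P.T.ring_axioms is_regular_regular])
  have u: "(\<lambda>a. a \<odot>\<^bsub>P\<^esub> e) \<in> mod_hom T ?A L" if "e \<in> ?I" for e
    using that by (simp add: mod_hom_iff L_def P.lsmult_closed P.lsmult_l_distr P.lsmult_assoc)
  define g where "g = direct_sum_lift ?A L ?I (\<lambda>e a. a \<odot>\<^bsub>P\<^esub> e)"
  have g: "g \<in> mod_hom T (direct_sum ?A ?I) L"
    unfolding g_def by (rule direct_sum_lift_mod_hom[OF A L u])
  have "g ` carrier (direct_sum ?A ?I) = carrier L"
  proof (intro equalityI subsetI)
    fix e assume "e \<in> carrier L"
    then have e: "e \<in> ?I" by (simp add: L_def)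
    have "\<one>\<^bsub>T\<^esub> \<odot>\<^bsub>P\<^esub> e \<in> g ` carrier (direct_sum ?A ?I)"
      unfolding g_def
      by (rule direct_sum_lift_image[where u="\<lambda>e a. a \<odot>\<^bsub>P\<^esub> e", OF A L u e]) simp_all
    then show "e \<in> g ` carrier (direct_sum ?A ?I)" using e by (simp add: P.lsmult_one)
  qed (use mod_hom_closed[OF g] in auto)
  moreover have "(\<lambda>x. x) \<in> mod_hom T P L" by (simp add: mod_hom_iff L_def)
  \<comment> \<open>Projectivity splits the epimorphism from the free module on the elements of
    \<open>P\<close>. The coordinates of the splitting are the functionals of the dual
    basis.\<close>
  ultimately obtain H where H: "H \<in> mod_hom T P (direct_sum ?A ?I)" "\<forall>x\<in>?I. g (H x) = x"
    using P g L left_module.left_module_direct_sum[OF A, of ?I] unfolding projective_module_def by metis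
  show thesis
  proof
    fix e assume e: "e \<in> ?I"
    show "(\<lambda>x. H x e) \<in> mod_hom T P ?A"
      using direct_sum_mem[OF mod_hom_closed[OF H(1)] e] mod_hom_add[OF H(1)] mod_hom_smult[OF H(1)] e
      by (simp add: mod_hom_iff direct_sum_sel)
  next
    fix x assume x: "x \<in> ?I"
    let ?E = "{e \<in> ?I. H x e \<noteq> \<zero>\<^bsub>T\<^esub>}"
    have Hx: "H x \<in> carrier (direct_sum ?A ?I)" by (rule mod_hom_closed[OF H(1) x])
    have fin: "finite ?E" using Hx by (simp add: direct_sum_sel)
    have "finsum P (\<lambda>e. H x e \<odot>\<^bsub>P\<^esub> e) E = x" if E: "finite E" "?E \<subseteq> E" "E \<subseteq> ?I" for E
    proof -
      have "x = (\<Oplus>\<^bsub>L\<^esub>e\<in>E. H x e \<odot>\<^bsub>P\<^esub> e)"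
        using direct_sum_lift_superset[where u="\<lambda>e a. a \<odot>\<^bsub>P\<^esub> e", OF A L u Hx E(1) _ E(3)] E(2) H(2) x
        by (simp add: g_def)
      also have "\<dots> = (\<Oplus>\<^bsub>P\<^esub>e\<in>E. H x e \<odot>\<^bsub>P\<^esub> e)"
      proof (rule additive_finsum[where h="\<lambda>x. x", OF _ left_module.axioms(2)[OF L] P.M.abelian_group_axioms E(1)])
        show "additive L P (\<lambda>x. x)" by (simp add: additive_def L_def)
        show "(\<lambda>e. H x e \<odot>\<^bsub>P\<^esub> e) \<in> E \<rightarrow> carrier L"
          using direct_sum_mem[OF Hx] E(3) by (auto simp: L_def intro!: P.lsmult_closed)
      qed
      finally show ?thesis ..
    qed
    then show "eventually_id P ?I (\<lambda>e x. H x e \<odot>\<^bsub>P\<^esub> e) x"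
      unfolding eventually_id_def using fin by (intro exI[of _ ?E]) blast
  qed
qed

section \<open>From coideals to stable subsets\<close>

context A_coring
begin

lemma left_linear_restrict: "left_linear (restrict f (carrier C)) \<longleftrightarrow> left_linear f"
  by (simp add: left_linear_def mod_hom_iff CL.lsmult_closed)

lemma lact_cong: "\<lbrakk>left_linear f; \<And>x. x \<in> carrier C \<Longrightarrow> h x = f x; c \<in> carrier C\<rbrakk> \<Longrightarrow> lact h c = lact f c"
  unfolding lact_def
  by (rule CC.tensor_lift_cong[OF CL.M.abelian_group_axioms balanced_lact comult_closed]) simp_all

definition lact_stable :: "'c set \<Rightarrow> bool"
  where "lact_stable K \<longleftrightarrow> K \<subseteq> carrier C \<and> \<zero>\<^bsub>C\<^esub> \<in> K \<and> (\<forall>x\<in>K. \<forall>y\<in>K. x \<oplus>\<^bsub>C\<^esub> y \<in> K) \<and>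
    (\<forall>f. left_linear f \<longrightarrow> (\<forall>x\<in>K. lact f x \<in> K))"

text \<open>Right multiplication by scalars is part of the action of the dual ring, so a stable
  subset is automatically a right submodule.\<close>

lemma lact_counit_mult:
  assumes a: "a \<in> carrier A" and c: "c \<in> carrier C"
  shows "left_linear (\<lambda>y. \<epsilon> y \<otimes>\<^bsub>A\<^esub> a)" and "lact (\<lambda>y. \<epsilon> y \<otimes>\<^bsub>A\<^esub> a) c = rsmult C c a"
proof -
  show l: "left_linear (\<lambda>y. \<epsilon> y \<otimes>\<^bsub>A\<^esub> a)"
    using a by (simp add: left_linear_def mod_hom_iff counit_closed counit_add counit_smult
        CL.T.l_distr CL.T.m_assoc)
  note ab = CL.M.abelian_group_axioms and \<Delta>c = comult_closed[OF c]
  have "lact (\<lambda>y. \<epsilon> y \<otimes>\<^bsub>A\<^esub> a) c = tensor_lift C (\<lambda>x y. rsmult C (rsmult C x (\<epsilon> y)) a) (\<Delta> c)"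
    unfolding lact_def
    by (rule CC.tensor_lift_cong[symmetric, OF ab balanced_lact[OF l] \<Delta>c])
      (simp add: rsmult_assoc counit_closed a)
  also have "\<dots> = rsmult C (tensor_lift C (\<lambda>x y. rsmult C x (\<epsilon> y)) (\<Delta> c)) a"
    by (rule CC.tensor_lift_compose[OF ab balanced_lact[OF left_linear_counit] ab additive_rsmult[OF a] \<Delta>c, symmetric])
  finally show "lact (\<lambda>y. \<epsilon> y \<otimes>\<^bsub>A\<^esub> a) c = rsmult C c a"
    using c by (simp add: counit_right_eq)
qed

context
  fixes K :: "'c set"
  assumes K: "submodule K (opposite A) (right_mod C)"
begin

abbreviation "CK \<equiv> C\<lparr>carrier := K\<rparr>"

lemma K_iff: "K \<subseteq> carrier C" "\<zero>\<^bsub>C\<^esub> \<in> K" "\<And>x y. \<lbrakk>x \<in> K; y \<in> K\<rbrakk> \<Longrightarrow> x \<oplus>\<^bsub>C\<^esub> y \<in> K"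
  "\<And>a x. \<lbrakk>a \<in> carrier A; x \<in> K\<rbrakk> \<Longrightarrow> rsmult C x a \<in> K"
  using K by (simp_all add: CR.submodule_iff)

lemma K_carrier: "x \<in> K \<Longrightarrow> x \<in> carrier C"
  using K_iff(1) by auto

lemma right_mod_CK: "left_module (opposite A) (right_mod CK)"
  by (rule left_module_cong[OF CR.left_module_submodule[OF K]]) (simp_all add: right_mod_def)

lemma abelian_group_CK: "abelian_group CK"
  by (rule abelian_group_cong[OF left_module.axioms(2)[OF right_mod_CK]]) simp_all

lemma tensor_pair_CK: "tensor_pair A CK C"
  by (rule tensor_pair.intro[OF right_mod_CK CL.left_module_axioms])

lemma balanced_CK: "balanced A C N G \<beta> \<Longrightarrow> balanced A CK N G \<beta>"
  by (simp add: balanced_def K_carrier)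

end

text \<open>If \<open>\<Delta> k\<close> comes from \<open>K \<otimes> C\<close>, Sweedler sums for
  \<open>k\<close> may be formed with all first factors in \<open>K\<close>.\<close>

lemma comult_factor:
  assumes K: "submodule K (opposite A) (right_mod C)" and X: "X \<in> carrier (tensor A (C\<lparr>carrier := K\<rparr>) C)"
    and \<Delta>k: "\<Delta> k = tensor_map A C C id id X"
    and G: "abelian_group G" and \<beta>: "balanced A C C G \<beta>"
  shows "tensor_lift G \<beta> (\<Delta> k) = tensor_lift G \<beta> X"
proof -
  let ?CK = "C\<lparr>carrier := K\<rparr>"
  interpret KC: tensor_pair A ?CK C by (rule tensor_pair_CK[OF K])
  have b: "balanced A ?CK C T2 (\<lambda>x y. CC.pt (id x) (id y))"
    using balanced_CK[OF K CC.balanced_pure_tensor] by simp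
  have "tensor_lift G \<beta> (\<Delta> k) = tensor_lift G (\<lambda>x y. tensor_lift G \<beta> (CC.pt (id x) (id y))) X"
    unfolding \<Delta>k tensor_map_def
    by (rule KC.tensor_lift_compose[OF CC.abelian_group_tensor b G CC.additive_tensor_lift[OF G \<beta>] X])
  also have "\<dots> = tensor_lift G \<beta> X"
    by (rule KC.tensor_lift_cong[OF G balanced_CK[OF K \<beta>] X])
      (simp add: CC.tensor_lift_pure[OF G \<beta>] K_carrier[OF K])
  finally show ?thesis .
qed

lemma lact_mem:
  assumes K: "submodule K (opposite A) (right_mod C)" and X: "X \<in> carrier (tensor A (C\<lparr>carrier := K\<rparr>) C)"
    and \<Delta>k: "\<Delta> k = tensor_map A C C id id X" and f: "left_linear f"
  shows "lact f k \<in> K"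
proof -
  let ?CK = "C\<lparr>carrier := K\<rparr>"
  interpret KC: tensor_pair A ?CK C by (rule tensor_pair_CK[OF K])
  note ab = CL.M.abelian_group_axioms and abK = abelian_group_CK[OF K] and KD = K_iff[OF K]
  have bK: "balanced A ?CK C ?CK (\<lambda>x y. rsmult C x (f y))"
    using left_linearD[OF f] by (simp add: balanced_def KD(4) K_carrier[OF K] rsmult_add rsmult_add_left rsmult_assoc)
  have inc_add: "additive ?CK C (\<lambda>x. x)" by (simp add: additive_def K_carrier[OF K])
  have "lact f k = tensor_lift C (\<lambda>x y. rsmult C x (f y)) X"
    unfolding lact_def by (rule comult_factor[OF K X \<Delta>k ab balanced_lact[OF f]])
  also have "\<dots> = tensor_lift ?CK (\<lambda>x y. rsmult C x (f y)) X"
    by (rule KC.tensor_lift_compose[OF abK bK ab inc_add X, symmetric])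
  finally show ?thesis
    using KC.tensor_lift_closed[OF abK bK X] by simp
qed

lemma right_coidealE:
  assumes "right_coideal A C K"
  obtains "submodule K (opposite A) (right_mod C)"
    and "\<And>k. k \<in> K \<Longrightarrow> \<exists>X\<in>carrier (tensor A (C\<lparr>carrier := K\<rparr>) C). \<Delta> k = tensor_map A C C id id X"
proof -
  obtain \<rho> where K: "submodule K (opposite A) (right_mod C)"
    and co: "right_comodule A C (C\<lparr>carrier := K\<rparr>) \<rho>"
    and inc: "id \<in> right_colinear A C (C\<lparr>carrier := K\<rparr>) \<rho> C \<Delta>"
    using assms unfolding right_coideal_def by blast
  show thesis
  proof (rule that[OF K])
    fix k assume k: "k \<in> K"
    have "\<rho> k \<in> carrier (tensor A (C\<lparr>carrier := K\<rparr>) C)"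
      using co k mod_hom_right_modD(1)[of \<rho> A "C\<lparr>carrier := K\<rparr>" "tensor A (C\<lparr>carrier := K\<rparr>) C" k]
      by (simp add: right_comodule_def)
    moreover have "\<Delta> k = tensor_map A C C id id (\<rho> k)"
      using inc k by (simp add: right_colinear_def)
    ultimately show "\<exists>X\<in>carrier (tensor A (C\<lparr>carrier := K\<rparr>) C). \<Delta> k = tensor_map A C C id id X" ..
  qed
qed

lemma right_coideal_lact_stable:
  assumes "right_coideal A C K"
  shows "lact_stable K"
proof (rule right_coidealE[OF assms])
  assume K: "submodule K (opposite A) (right_mod C)"
    and X: "\<And>k. k \<in> K \<Longrightarrow> \<exists>X\<in>carrier (tensor A (C\<lparr>carrier := K\<rparr>) C). \<Delta> k = tensor_map A C C id id X"
  have "lact f k \<in> K" if "left_linear f" "k \<in> K" for f k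
    using X[OF that(2)] lact_mem[OF K _ _ that(1)] by blast
  then show ?thesis
    unfolding lact_stable_def using K_iff[OF K] by simp
qed

text \<open>With first factors \<open>x\<close> in \<open>K\<close>, every summand
  \<open>g x y\<close> vanishes.\<close>

lemma right_coideal_ract_eq_zero:
  assumes "right_coideal A C K" and g: "right_linear g" and z: "\<And>x. x \<in> K \<Longrightarrow> g x = \<zero>\<^bsub>A\<^esub>" and k: "k \<in> K"
  shows "ract g k = \<zero>\<^bsub>C\<^esub>"
proof (rule right_coidealE[OF assms(1)])
  assume K: "submodule K (opposite A) (right_mod C)"
    and "\<And>k. k \<in> K \<Longrightarrow> \<exists>X\<in>carrier (tensor A (C\<lparr>carrier := K\<rparr>) C). \<Delta> k = tensor_map A C C id id X"
  then obtain X where X: "X \<in> carrier (tensor A (C\<lparr>carrier := K\<rparr>) C)" and \<Delta>k: "\<Delta> k = tensor_map A C C id id X"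
    using k by blast
  let ?CK = "C\<lparr>carrier := K\<rparr>"
  interpret KC: tensor_pair A ?CK C by (rule tensor_pair_CK[OF K])
  note ab = CL.M.abelian_group_axioms
  have "ract g k = tensor_lift C (\<lambda>x y. g x \<odot>\<^bsub>C\<^esub> y) X"
    unfolding ract_def by (rule comult_factor[OF K X \<Delta>k ab balanced_ract[OF g]])
  also have "\<dots> = \<zero>\<^bsub>C\<^esub>"
    by (rule KC.tensor_lift_unique[where h="\<lambda>_. \<zero>\<^bsub>C\<^esub>", OF ab balanced_CK[OF K balanced_ract[OF g]] _ X])
      (simp_all add: additive_def z)
  finally show ?thesis .
qed

end

lemma eventually_idE:
  assumes "eventually_id T B \<theta> W"
  obtains E where "finite E" "E \<subseteq> B" "finsum T (\<lambda>e. \<theta> e W) E = W"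
  using assms unfolding eventually_id_def by blast

lemma eventually_id_zero:
  assumes T: "abelian_group T" and W: "eventually_id T B \<theta> W" and z: "\<And>e. e \<in> B \<Longrightarrow> \<theta> e W = \<zero>\<^bsub>T\<^esub>"
  shows "W = \<zero>\<^bsub>T\<^esub>"
proof -
  interpret T: abelian_group T by fact
  obtain E where E: "finite E" "E \<subseteq> B" "finsum T (\<lambda>e. \<theta> e W) E = W"
    using W unfolding eventually_id_def by blast
  have "finsum T (\<lambda>e. \<theta> e W) E = finsum T (\<lambda>e. \<zero>\<^bsub>T\<^esub>) E"
    by (rule T.finsum_cong') (use z E(2) in auto)
  then show ?thesis using E by simp
qed

lemma additive_injI:
  assumes h: "additive S T h" and S: "abelian_group S" and T: "abelian_group T"
    and ker: "\<And>x. \<lbrakk>x \<in> carrier S; h x = \<zero>\<^bsub>T\<^esub>\<rbrakk> \<Longrightarrow> x = \<zero>\<^bsub>S\<^esub>"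
    and xy: "x \<in> carrier S" "y \<in> carrier S" "h x = h y"
  shows "x = y"
proof -
  interpret S: abelian_group S by fact
  interpret T: abelian_group T by fact
  have "h (x \<oplus>\<^bsub>S\<^esub> \<ominus>\<^bsub>S\<^esub> y) = \<zero>\<^bsub>T\<^esub>"
    using xy additive_closed[OF h xy(2)]
    by (simp add: additive_add[OF h] additive_minus[OF h S T] T.r_neg)
  then have "x \<oplus>\<^bsub>S\<^esub> \<ominus>\<^bsub>S\<^esub> y = \<zero>\<^bsub>S\<^esub>"
    using ker xy by simp
  then show ?thesis using xy by (intro S.eq_if_diff_eq_zero[of x y])
qed

text \<open>
  Let \<open>(H(_, e), e)\<close> be a dual basis of the left \<open>A\<close>-module \<open>C\<close>.  An element \<open>Z\<close> of \<open>K \<otimes> C\<close> is the sum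
  of the \<open>coeff K H(_, e) Z \<otimes> e\<close>, so that \<open>K \<otimes> C \<rightarrow> C \<otimes> C\<close> is injective.  Moreover
  \<open>\<Delta> k\<close> is the sum of the \<open>lact H(_, e) k \<otimes> e\<close>, which lies in the image of \<open>K \<otimes> C\<close> if \<open>K\<close> is
  stable; this yields the coaction \<open>\<rho>K\<close>.
\<close>

context A_coring
begin

text \<open>One term serves as the canonical map out of \<open>K \<otimes> C\<close> for every
  \<open>K\<close>, because \<open>tensor_lift\<close> evaluates representatives without mentioning
  the source module.\<close>

definition \<iota>2 where "\<iota>2 = tensor_lift T2 CC.pt"
definition \<iota>3 where "\<iota>3 = tensor_lift (tensor A C T2) (pure_tensor A C T2)"

definition coeff :: "'c set \<Rightarrow> ('c \<Rightarrow> 'a) \<Rightarrow> ('c \<times> 'c \<Rightarrow>\<^sub>0 int) set \<Rightarrow> 'c"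
  where "coeff K f = tensor_lift (C\<lparr>carrier := K\<rparr>) (\<lambda>x y. rsmult C x (f y))"

text \<open>The threefold analogue of \<open>coeff\<close>: it applies \<open>f\<close> to the last
  factor of \<open>K \<otimes> (C \<otimes> C)\<close> and lets the value act on the middle one,
  which leaves an element of \<open>K \<otimes> C\<close>.\<close>

definition coeff3 :: "'c set \<Rightarrow> ('c \<Rightarrow> 'a) \<Rightarrow> _ \<Rightarrow> ('c \<times> 'c \<Rightarrow>\<^sub>0 int) set"
  where "coeff3 K f = tensor_lift (tensor A (C\<lparr>carrier := K\<rparr>) C) (\<lambda>x. tensor_lift (tensor A (C\<lparr>carrier := K\<rparr>) C)
    (\<lambda>y z. pure_tensor A (C\<lparr>carrier := K\<rparr>) C x (rsmult C y (f z))))"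

text \<open>Tensoring with \<open>e\<close> on the right, regrouped so that the result lies in
  \<open>K \<otimes> (C \<otimes> C)\<close>.\<close>

definition append_basis :: "'c set \<Rightarrow> 'c \<Rightarrow> ('c \<times> 'c \<Rightarrow>\<^sub>0 int) set \<Rightarrow> _"
  where "append_basis K e = tensor_lift (tensor A (C\<lparr>carrier := K\<rparr>) T2)
    (\<lambda>x y. pure_tensor A (C\<lparr>carrier := K\<rparr>) T2 x (CC.pt y e))"

lemma carrier_update_id: "C\<lparr>carrier := carrier C\<rparr> = C"
  by simp

text \<open>Makes \<open>C\<close> itself an admissible \<open>K\<close>, so that the expansion of
  tensors also applies to \<open>C \<otimes> C\<close>.\<close>

lemma submodule_carrier: "submodule (carrier C) (opposite A) (right_mod C)"
  by (simp add: CR.submodule_iff rsmult_closed)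

context
  fixes K :: "'c set"
  assumes K: "submodule K (opposite A) (right_mod C)"
begin

interpretation KC: tensor_pair A "C\<lparr>carrier := K\<rparr>" C by (rule tensor_pair_CK[OF K])
interpretation K_CC: tensor_pair A "C\<lparr>carrier := K\<rparr>" "tensor A C C"
  by (rule tensor_pair.intro[OF right_mod_CK[OF K] CC.left_module_tensor[OF bimodule_C]])

abbreviation "CK' \<equiv> C\<lparr>carrier := K\<rparr>"
abbreviation "KT2 \<equiv> tensor A CK' C"
abbreviation "KT3 \<equiv> tensor A CK' (tensor A C C)"

lemma K_carr: "x \<in> K \<Longrightarrow> x \<in> carrier C"
  using K_iff(1)[OF K] by auto

lemma balanced_\<iota>2: "balanced A CK' C T2 CC.pt"
  by (rule balanced_CK[OF K CC.balanced_pure_tensor])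

lemma \<iota>2_additive: "additive KT2 T2 \<iota>2"
  unfolding \<iota>2_def by (rule KC.additive_tensor_lift[OF CC.abelian_group_tensor balanced_\<iota>2])

lemma \<iota>2_pure: "\<lbrakk>x \<in> K; y \<in> carrier C\<rbrakk> \<Longrightarrow> \<iota>2 (KC.pt x y) = CC.pt x y"
  unfolding \<iota>2_def using KC.tensor_lift_pure[OF CC.abelian_group_tensor balanced_\<iota>2] by simp

lemma tensor_lift_\<iota>2:
  assumes G: "abelian_group G" and \<beta>: "balanced A C C G \<beta>" and Z: "Z \<in> carrier KT2"
  shows "tensor_lift G \<beta> (\<iota>2 Z) = tensor_lift G \<beta> Z"
proof -
  have "tensor_lift G \<beta> (\<iota>2 Z) = tensor_lift G (\<lambda>x y. tensor_lift G \<beta> (CC.pt x y)) Z"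
    unfolding \<iota>2_def
    by (rule KC.tensor_lift_compose[OF CC.abelian_group_tensor balanced_\<iota>2 G CC.additive_tensor_lift[OF G \<beta>] Z])
  also have "\<dots> = tensor_lift G \<beta> Z"
    by (rule KC.tensor_lift_cong[OF G balanced_CK[OF K \<beta>] Z])
      (simp add: CC.tensor_lift_pure[OF G \<beta>] K_carr)
  finally show ?thesis .
qed

lemma balanced_coeff: "left_linear f \<Longrightarrow> balanced A CK' C CK' (\<lambda>x y. rsmult C x (f y))"
  using K_iff(4)[OF K]
  by (simp add: balanced_def left_linearD K_carr rsmult_add rsmult_add_left rsmult_assoc)

lemma coeff_additive: "left_linear f \<Longrightarrow> additive KT2 CK' (coeff K f)"
  unfolding coeff_def by (rule KC.additive_tensor_lift[OF abelian_group_CK[OF K] balanced_coeff])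

text \<open>The coefficients can be read off after the passage to \<open>C \<otimes> C\<close>;
  hence a tensor that becomes zero there has zero coefficients.\<close>

lemma coeff_eq:
  assumes f: "left_linear f" and Z: "Z \<in> carrier KT2"
  shows "coeff K f Z = tensor_lift C (\<lambda>x y. rsmult C x (f y)) (\<iota>2 Z)"
proof -
  have inc: "additive CK' C (\<lambda>x. x)" by (simp add: additive_def K_carr)
  have "coeff K f Z = tensor_lift C (\<lambda>x y. rsmult C x (f y)) Z"
    unfolding coeff_def
    by (rule KC.tensor_lift_compose[OF abelian_group_CK[OF K] balanced_coeff[OF f] CL.M.abelian_group_axioms inc Z])
  then show ?thesis
    using tensor_lift_\<iota>2[OF CL.M.abelian_group_axioms balanced_lact[OF f] Z] by simp
qed

lemma coeff3_inner:
  assumes f: "left_linear f"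
  shows "x \<in> K \<Longrightarrow> balanced A C C KT2 (\<lambda>y z. KC.pt x (rsmult C y (f z)))"
    and "z \<in> carrier C \<Longrightarrow> balanced A CK' C KT2 (\<lambda>x y. KC.pt x (rsmult C y (f z)))"
proof -
  show "balanced A C C KT2 (\<lambda>y z. KC.pt x (rsmult C y (f z)))" if x: "x \<in> K"
  proof -
    have "additive C KT2 (KC.pt x)"
      using KC.balanced_pure_tensor x by (simp add: balanced_def additive_def)
    from balanced_compose[OF balanced_lact[OF f] this] show ?thesis .
  qed
  show "balanced A CK' C KT2 (\<lambda>x y. KC.pt x (rsmult C y (f z)))" if "z \<in> carrier C"
    by (rule KC.balanced_rsmult[OF bimodule_C KC.balanced_pure_tensor left_linearD(1)[OF f that]])
qed

lemma balanced_coeff3: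
  assumes f: "left_linear f"
  shows "balanced A CK' T2 KT2 (\<lambda>x. tensor_lift KT2 (\<lambda>y z. KC.pt x (rsmult C y (f z))))"
  by (rule balanced_tensor_lift[OF KC.abelian_group_tensor coeff3_inner(2)[OF f] coeff3_inner(1)[OF f]
        right_mod_CK[OF K]]) simp_all

lemma coeff3_additive: "left_linear f \<Longrightarrow> additive KT3 KT2 (coeff3 K f)"
  unfolding coeff3_def by (rule K_CC.additive_tensor_lift[OF KC.abelian_group_tensor balanced_coeff3])

lemma coeff3_pure:
  assumes f: "left_linear f" and x: "x \<in> K" and Y: "Y \<in> carrier T2"
  shows "coeff3 K f (K_CC.pt x Y) = tensor_lift KT2 (\<lambda>y z. KC.pt x (rsmult C y (f z))) Y"
  unfolding coeff3_def using K_CC.tensor_lift_pure[OF KC.abelian_group_tensor balanced_coeff3[OF f]] x Y by simp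

context
  fixes H :: "'c \<Rightarrow> 'c \<Rightarrow> 'a"
  assumes H: "\<And>e. e \<in> carrier C \<Longrightarrow> left_linear (\<lambda>x. H x e)"
    and basis: "\<And>x. x \<in> carrier C \<Longrightarrow> eventually_id C (carrier C) (\<lambda>e x. H x e \<odot>\<^bsub>C\<^esub> e) x"
begin

lemma H_closed: "\<lbrakk>x \<in> carrier C; e \<in> carrier C\<rbrakk> \<Longrightarrow> H x e \<in> carrier A"
  by (rule left_linearD(1)[OF H])

text \<open>Carries the dual basis expansion of \<open>z\<close> along \<open>h\<close>; in the
  applications \<open>h\<close> places \<open>z\<close> in the last factor of a pure tensor.\<close>

lemma basis_image:
  assumes T: "abelian_group T" and h: "additive C T h" and z: "z \<in> carrier C"
    and \<theta>: "\<And>e. e \<in> carrier C \<Longrightarrow> \<theta> e (h z) = h (H z e \<odot>\<^bsub>C\<^esub> e)"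
  shows "eventually_id T (carrier C) \<theta> (h z)"
proof -
  obtain E where E: "finite E" "E \<subseteq> carrier C"
    "\<And>E'. \<lbrakk>finite E'; E \<subseteq> E'; E' \<subseteq> carrier C\<rbrakk> \<Longrightarrow> finsum C (\<lambda>e. H z e \<odot>\<^bsub>C\<^esub> e) E' = z"
    using basis[OF z] unfolding eventually_id_def by metis
  interpret T: abelian_group T by fact
  have "finsum T (\<lambda>e. \<theta> e (h z)) E' = h z" if E': "finite E'" "E \<subseteq> E'" "E' \<subseteq> carrier C" for E'
  proof -
    have cl: "H z e \<odot>\<^bsub>C\<^esub> e \<in> carrier C" if "e \<in> E'" for e
      using that E'(3) H_closed[OF z] CL.lsmult_closed by auto
    have "finsum T (\<lambda>e. \<theta> e (h z)) E' = finsum T (\<lambda>e. h (H z e \<odot>\<^bsub>C\<^esub> e)) E'"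
      by (rule T.finsum_cong') (use \<theta> E'(3) cl additive_closed[OF h] in auto)
    also have "\<dots> = h (finsum C (\<lambda>e. H z e \<odot>\<^bsub>C\<^esub> e) E')"
      by (rule additive_finsum[OF h CL.M.abelian_group_axioms T E'(1), symmetric]) (use cl in auto)
    finally show ?thesis using E(3)[OF E'] by simp
  qed
  then show ?thesis
    unfolding eventually_id_def using E(1,2) by (intro exI[of _ E]) simp
qed

lemma additive_pure_left: "e \<in> carrier C \<Longrightarrow> additive CK' KT2 (\<lambda>x. KC.pt x e)"
  using KC.balanced_pure_tensor by (simp add: balanced_def additive_def)

lemma additive_pure_right: "x \<in> K \<Longrightarrow> additive C KT2 (KC.pt x)"
  using KC.balanced_pure_tensor by (simp add: balanced_def additive_def)

lemma tensor_eventually_id: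
  assumes Z: "Z \<in> carrier KT2"
  shows "eventually_id KT2 (carrier C) (\<lambda>e Z. KC.pt (coeff K (\<lambda>x. H x e) Z) e) Z"
proof (rule KC.eventually_id_tensor[OF _ _ Z])
  show "additive KT2 KT2 (\<lambda>Z. KC.pt (coeff K (\<lambda>x. H x e) Z) e)" if e: "e \<in> carrier C" for e
    using coeff_additive[OF H[OF e]] additive_pure_left[OF e] by (simp add: additive_def)
  fix x z assume x: "x \<in> carrier CK'" and z: "z \<in> carrier C"
  show "eventually_id KT2 (carrier C) (\<lambda>e Z. KC.pt (coeff K (\<lambda>x. H x e) Z) e) (KC.pt x z)"
  proof (rule basis_image[OF KC.abelian_group_tensor additive_pure_right z])
    fix e assume e: "e \<in> carrier C"
    have "coeff K (\<lambda>x. H x e) (KC.pt x z) = rsmult C x (H z e)"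
      unfolding coeff_def
      using KC.tensor_lift_pure[OF abelian_group_CK[OF K] balanced_coeff[OF H[OF e]]] x z by simp
    then show "KC.pt (coeff K (\<lambda>x. H x e) (KC.pt x z)) e = KC.pt x (H z e \<odot>\<^bsub>C\<^esub> e)"
      using KC.balanced_pure_tensor x e H_closed[OF z e] by (simp add: balanced_def)
  qed (use x in simp)
qed

lemma pure_zero: "e \<in> carrier C \<Longrightarrow> KC.pt \<zero>\<^bsub>C\<^esub> e = \<zero>\<^bsub>KT2\<^esub>"
  using additive_zero[OF additive_pure_left abelian_group_CK[OF K] KC.abelian_group_tensor] by simp

lemma \<iota>2_kernel:
  assumes Z: "Z \<in> carrier KT2" and z: "\<iota>2 Z = \<zero>\<^bsub>T2\<^esub>"
  shows "Z = \<zero>\<^bsub>KT2\<^esub>"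
proof (rule eventually_id_zero[OF KC.abelian_group_tensor tensor_eventually_id[OF Z]])
  fix e assume e: "e \<in> carrier C"
  have "coeff K (\<lambda>x. H x e) Z = tensor_lift C (\<lambda>x y. rsmult C x (H y e)) \<zero>\<^bsub>T2\<^esub>"
    using coeff_eq[OF H[OF e] Z] z by simp
  also have "\<dots> = \<zero>\<^bsub>C\<^esub>"
    by (rule additive_zero[OF CC.additive_tensor_lift[OF CL.M.abelian_group_axioms balanced_lact[OF H[OF e]]]
          CC.abelian_group_tensor CL.M.abelian_group_axioms])
  finally show "KC.pt (coeff K (\<lambda>x. H x e) Z) e = \<zero>\<^bsub>KT2\<^esub>"
    using pure_zero[OF e] by simp
qed

lemma \<iota>2_inj:
  assumes "Z \<in> carrier KT2" "Z' \<in> carrier KT2" "\<iota>2 Z = \<iota>2 Z'"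
  shows "Z = Z'"
  by (rule additive_injI[OF \<iota>2_additive KC.abelian_group_tensor CC.abelian_group_tensor _ assms])
    (rule \<iota>2_kernel)

end

end

section \<open>Injectivity for the threefold tensor product\<close>

context
  fixes H :: "'c \<Rightarrow> 'c \<Rightarrow> 'a" and K :: "'c set"
  assumes K: "submodule K (opposite A) (right_mod C)"
    and H: "\<And>e. e \<in> carrier C \<Longrightarrow> left_linear (\<lambda>x. H x e)"
    and basis: "\<And>x. x \<in> carrier C \<Longrightarrow> eventually_id C (carrier C) (\<lambda>e x. H x e \<odot>\<^bsub>C\<^esub> e) x"
begin

interpretation KC: tensor_pair A "C\<lparr>carrier := K\<rparr>" C by (rule tensor_pair_CK[OF K])
interpretation C_CC: tensor_pair A C "tensor A C C"
  by (rule tensor_pair.intro[OF CR.left_module_axioms CC.left_module_tensor[OF bimodule_C]])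
interpretation K_CC: tensor_pair A "C\<lparr>carrier := K\<rparr>" "tensor A C C"
  by (rule tensor_pair.intro[OF right_mod_CK[OF K] CC.left_module_tensor[OF bimodule_C]])

abbreviation "CK2 \<equiv> C\<lparr>carrier := K\<rparr>"
abbreviation "TK2 \<equiv> tensor A CK2 C"
abbreviation "TK3 \<equiv> tensor A CK2 T2"
abbreviation "T3 \<equiv> tensor A C T2"

lemma balanced_\<iota>3: "balanced A CK2 T2 T3 C_CC.pt"
  by (rule balanced_CK[OF K C_CC.balanced_pure_tensor])

lemma \<iota>3_additive: "additive TK3 T3 \<iota>3"
  unfolding \<iota>3_def by (rule K_CC.additive_tensor_lift[OF C_CC.abelian_group_tensor balanced_\<iota>3])

lemma \<iota>3_pure: "\<lbrakk>x \<in> K; Y \<in> carrier T2\<rbrakk> \<Longrightarrow> \<iota>3 (K_CC.pt x Y) = C_CC.pt x Y"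
  unfolding \<iota>3_def using K_CC.tensor_lift_pure[OF C_CC.abelian_group_tensor balanced_\<iota>3] by simp

text \<open>Naturality of the coefficients in \<open>K\<close>. It reduces injectivity in the
  threefold case to the twofold one.\<close>

lemma \<iota>2_coeff3:
  assumes f: "left_linear f" and W: "W \<in> carrier TK3"
  shows "\<iota>2 (coeff3 K f W) = coeff3 (carrier C) f (\<iota>3 W)"
proof (rule K_CC.additive_eqI[OF _ _ CC.abelian_group_tensor _ W])
  note c3C = coeff3_additive[OF submodule_carrier f, unfolded carrier_update_id]
  show "additive TK3 T2 (\<lambda>W. \<iota>2 (coeff3 K f W))"
    using coeff3_additive[OF K f] \<iota>2_additive[OF K] by (simp add: additive_def)
  show "additive TK3 T2 (\<lambda>W. coeff3 (carrier C) f (\<iota>3 W))"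
    using c3C \<iota>3_additive by (simp add: additive_def)
  fix x Y assume x: "x \<in> carrier CK2" and Y: "Y \<in> carrier T2"
  then have xK: "x \<in> K" "x \<in> carrier C" using K_carr[OF K] by simp_all
  have bC: "balanced A C C T2 (\<lambda>y z. CC.pt x (rsmult C y (f z)))"
    using coeff3_inner(1)[OF submodule_carrier f xK(2)] by (simp only: carrier_update_id)
  have "\<iota>2 (coeff3 K f (K_CC.pt x Y)) = tensor_lift T2 (\<lambda>y z. \<iota>2 (KC.pt x (rsmult C y (f z)))) Y"
    unfolding coeff3_pure[OF K f xK(1) Y]
    by (rule CC.tensor_lift_compose[OF KC.abelian_group_tensor coeff3_inner(1)[OF K f xK(1)]
          CC.abelian_group_tensor \<iota>2_additive[OF K] Y])
  also have "\<dots> = tensor_lift T2 (\<lambda>y z. CC.pt x (rsmult C y (f z))) Y"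
    by (rule CC.tensor_lift_cong[OF CC.abelian_group_tensor bC Y])
      (simp add: \<iota>2_pure[OF K] xK left_linearD[OF f] rsmult_closed)
  also have "\<dots> = coeff3 (carrier C) f (C_CC.pt x Y)"
    using coeff3_pure[OF submodule_carrier f xK(2) Y] by (simp only: carrier_update_id)
  finally show "\<iota>2 (coeff3 K f (K_CC.pt x Y)) = coeff3 (carrier C) f (\<iota>3 (K_CC.pt x Y))"
    by (simp add: \<iota>3_pure xK Y)
qed

lemma balanced_append_basis:
  assumes e: "e \<in> carrier C"
  shows "balanced A CK2 C TK3 (\<lambda>x y. K_CC.pt x (CC.pt y e))"
  using K_CC.balanced_pure_tensor CC.balanced_pure_tensor e CC.smult_pure_tensor[OF bimodule_C, symmetric]
  unfolding balanced_def by simp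

lemma append_basis_additive: "e \<in> carrier C \<Longrightarrow> additive TK2 TK3 (append_basis K e)"
  unfolding append_basis_def
  by (rule KC.additive_tensor_lift[OF K_CC.abelian_group_tensor balanced_append_basis])

text \<open>A pure tensor of the outer product still has an arbitrary second component in
  \<open>C \<otimes> C\<close>, whence a second induction, on that component, inside the
  first.\<close>

lemma tensor3_eventually_id:
  assumes W: "W \<in> carrier TK3"
  shows "eventually_id TK3 (carrier C) (\<lambda>e W. append_basis K e (coeff3 K (\<lambda>x. H x e) W)) W"
proof (rule K_CC.eventually_id_tensor[OF _ _ W])
  show add: "additive TK3 TK3 (\<lambda>W. append_basis K e (coeff3 K (\<lambda>x. H x e) W))" if e: "e \<in> carrier C" for e
    using coeff3_additive[OF K H[OF e]] append_basis_additive[OF e] by (simp add: additive_def)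
  fix x Y assume x: "x \<in> carrier CK2" and Y: "Y \<in> carrier T2"
  have xK: "x \<in> K" using x by simp
  have pt_add: "additive T2 TK3 (K_CC.pt x)"
    using K_CC.balanced_pure_tensor xK by (simp add: balanced_def additive_def)
  show "eventually_id TK3 (carrier C) (\<lambda>e W. append_basis K e (coeff3 K (\<lambda>x. H x e) W)) (K_CC.pt x Y)"
    using Y
  proof (induction rule: CC.tensor_induct)
    case zero
    have "finsum TK3 (\<lambda>e. append_basis K e (coeff3 K (\<lambda>x. H x e) \<zero>\<^bsub>TK3\<^esub>)) E = \<zero>\<^bsub>TK3\<^esub>"
      if "finite E" "E \<subseteq> carrier C" for E
      by (rule additive_zero[where h="\<lambda>W. finsum TK3 (\<lambda>e. append_basis K e (coeff3 K (\<lambda>x. H x e) W)) E",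
            OF additive_finsum_fun[OF K_CC.abelian_group_tensor that(1)]
              K_CC.abelian_group_tensor K_CC.abelian_group_tensor])
        (use add that(2) in auto)
    then show ?case
      unfolding eventually_id_def additive_zero[OF pt_add CC.abelian_group_tensor K_CC.abelian_group_tensor]
      by (intro exI[of _ "{}"]) simp
  next
    case (diff V V')
    show ?case
      using eventually_id_diff[OF K_CC.abelian_group_tensor add additive_closed[OF pt_add diff.hyps(1)] diff.IH(1)
          additive_closed[OF pt_add diff.hyps(2)] diff.IH(2)]
        diff.hyps
      by (simp add: additive_add[OF pt_add]
          additive_minus[OF pt_add CC.abelian_group_tensor K_CC.abelian_group_tensor])
  next
    case (pure y z)
    have h: "additive C TK3 (\<lambda>z. K_CC.pt x (CC.pt y z))"
      using pt_add CC.balanced_pure_tensor pure(1) by (simp add: balanced_def additive_def)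
    show ?case
    proof (rule basis_image[where K=K and H=H, OF K H basis K_CC.abelian_group_tensor h pure(2)])
      fix e assume e: "e \<in> carrier C"
      note Hz = H_closed[where K=K and H=H, OF K H basis pure(2) e]
      have "coeff3 K (\<lambda>x. H x e) (K_CC.pt x (CC.pt y z)) = KC.pt x (rsmult C y (H z e))"
        unfolding coeff3_pure[OF K H[OF e] xK CC.pure_tensor_closed[OF pure]]
        by (rule CC.tensor_lift_pure[OF KC.abelian_group_tensor coeff3_inner(1)[OF K H[OF e] xK] pure])
      then have "append_basis K e (coeff3 K (\<lambda>x. H x e) (K_CC.pt x (CC.pt y z))) =
          K_CC.pt x (CC.pt (rsmult C y (H z e)) e)"
        unfolding append_basis_def
        using KC.tensor_lift_pure[OF K_CC.abelian_group_tensor balanced_append_basis[OF e], of x "rsmult C y (H z e)"]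
          xK pure(1) Hz by (simp add: rsmult_closed)
      also have "\<dots> = K_CC.pt x (CC.pt y (H z e \<odot>\<^bsub>C\<^esub> e))"
        using CC.balanced_pure_tensor pure(1) Hz e by (simp add: balanced_def)
      finally show "append_basis K e (coeff3 K (\<lambda>x. H x e) (K_CC.pt x (CC.pt y z))) =
          K_CC.pt x (CC.pt y (H z e \<odot>\<^bsub>C\<^esub> e))" .
    qed
  qed
qed

lemma \<iota>3_kernel:
  assumes W: "W \<in> carrier TK3" and z: "\<iota>3 W = \<zero>\<^bsub>T3\<^esub>"
  shows "W = \<zero>\<^bsub>TK3\<^esub>"
proof (rule eventually_id_zero[OF K_CC.abelian_group_tensor tensor3_eventually_id[OF W]])
  fix e assume e: "e \<in> carrier C"
  note c3C = coeff3_additive[OF submodule_carrier H[OF e], unfolded carrier_update_id]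
  have "\<iota>2 (coeff3 K (\<lambda>x. H x e) W) = \<zero>\<^bsub>T2\<^esub>"
    unfolding \<iota>2_coeff3[OF H[OF e] W] z
    by (rule additive_zero[OF c3C C_CC.abelian_group_tensor CC.abelian_group_tensor])
  moreover have "coeff3 K (\<lambda>x. H x e) W \<in> carrier TK2"
    by (rule additive_closed[OF coeff3_additive[OF K H[OF e]] W])
  ultimately have "coeff3 K (\<lambda>x. H x e) W = \<zero>\<^bsub>TK2\<^esub>"
    using \<iota>2_kernel[where K=K and H=H, OF K H basis] by simp
  then show "append_basis K e (coeff3 K (\<lambda>x. H x e) W) = \<zero>\<^bsub>TK3\<^esub>"
    using additive_zero[OF append_basis_additive[OF e] KC.abelian_group_tensor K_CC.abelian_group_tensor] by simp
qed

lemma \<iota>3_inj: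
  assumes "Z \<in> carrier TK3" "Z' \<in> carrier TK3" "\<iota>3 Z = \<iota>3 Z'"
  shows "Z = Z'"
  by (rule additive_injI[OF \<iota>3_additive K_CC.abelian_group_tensor C_CC.abelian_group_tensor _ assms])
    (rule \<iota>3_kernel)

section \<open>The coaction of a stable submodule\<close>

context
  assumes stable: "\<And>f k. \<lbrakk>left_linear f; k \<in> K\<rbrakk> \<Longrightarrow> lact f k \<in> K"
begin

lemma comult_image:
  assumes k: "k \<in> K"
  obtains Z where "Z \<in> carrier TK2" "\<iota>2 Z = \<Delta> k"
proof -
  have kC: "k \<in> carrier C" by (rule K_carr[OF K k])
  have "eventually_id T2 (carrier C) (\<lambda>e Z. CC.pt (coeff (carrier C) (\<lambda>x. H x e) Z) e) (\<Delta> k)"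
    using tensor_eventually_id[where K="carrier C" and H=H, OF submodule_carrier H basis] comult_closed[OF kC]
    by (simp only: carrier_update_id)
  then obtain E where E: "finite E" "E \<subseteq> carrier C"
    "finsum T2 (\<lambda>e. CC.pt (coeff (carrier C) (\<lambda>x. H x e) (\<Delta> k)) e) E = \<Delta> k"
    by (rule eventually_idE)
  have co: "coeff (carrier C) f (\<Delta> k) = lact f k" for f
    using coeff_def[of "carrier C" f] by (simp add: lact_def)
  have mem: "lact (\<lambda>x. H x e) k \<in> K" if "e \<in> E" for e
    using stable[OF H k] E(2) that by auto
  have "\<iota>2 (finsum TK2 (\<lambda>e. KC.pt (lact (\<lambda>x. H x e) k) e) E) =
      finsum T2 (\<lambda>e. \<iota>2 (KC.pt (lact (\<lambda>x. H x e) k) e)) E"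
    by (rule additive_finsum[OF \<iota>2_additive[OF K] KC.abelian_group_tensor CC.abelian_group_tensor E(1)])
      (use mem E(2) in auto)
  also have "\<dots> = finsum T2 (\<lambda>e. CC.pt (coeff (carrier C) (\<lambda>x. H x e) (\<Delta> k)) e) E"
    unfolding co
    by (rule CC.TN.finsum_cong') (use mem E(2) K_carr[OF K] in \<open>auto simp: \<iota>2_pure[OF K]\<close>)
  also note E(3)
  finally show thesis
    by (rule that[rotated]) (use mem E(2) in \<open>auto intro!: KC.TN.finsum_closed\<close>)
qed

lemma \<iota>2_rsmult:
  assumes a: "a \<in> carrier A" and Z: "Z \<in> carrier TK2"
  shows "\<iota>2 (rsmult TK2 Z a) = rsmult T2 (\<iota>2 Z) a"
proof -
  interpret R2: left_module "opposite A" "right_mod T2" by (rule CC.right_module_tensor[OF bimodule_C])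
  have add: "additive T2 T2 (\<lambda>X. rsmult T2 X a)"
    using R2.lsmult_closed[of a] R2.lsmult_r_distr[of a] a by (simp add: additive_def)
  have b: "balanced A CK2 C T2 (\<lambda>x y. CC.pt x (rsmult C y a))"
    by (rule KC.balanced_rsmult[OF bimodule_C balanced_\<iota>2[OF K] a])
  have "\<iota>2 (rsmult TK2 Z a) = tensor_lift T2 (\<lambda>x y. CC.pt x (rsmult C y a)) Z"
    unfolding \<iota>2_def by (rule KC.tensor_lift_rsmult[OF bimodule_C CC.abelian_group_tensor balanced_\<iota>2[OF K] a Z])
  also have "\<dots> = tensor_lift T2 (\<lambda>x y. rsmult T2 (CC.pt x y) a) Z"
    by (rule KC.tensor_lift_cong[symmetric, OF CC.abelian_group_tensor b Z])
      (simp add: CC.rsmult_pure_tensor[OF bimodule_C] a K_carr[OF K])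
  also have "\<dots> = rsmult T2 (\<iota>2 Z) a"
    unfolding \<iota>2_def
    by (rule KC.tensor_lift_compose[OF CC.abelian_group_tensor balanced_\<iota>2[OF K] CC.abelian_group_tensor add Z, symmetric])
  finally show ?thesis .
qed

text \<open>Injectivity of \<open>\<iota>2\<close> makes the chosen element unique; so equations for
  \<open>\<rho>K\<close> may be checked after the passage to \<open>C \<otimes> C\<close>, where
  they become equations for \<open>\<Delta>\<close>.\<close>

definition \<rho>K :: "'c \<Rightarrow> ('c \<times> 'c \<Rightarrow>\<^sub>0 int) set"
  where "\<rho>K k = (SOME Z. Z \<in> carrier TK2 \<and> \<iota>2 Z = \<Delta> k)"

lemma \<rho>K:
  assumes k: "k \<in> K"
  shows "\<rho>K k \<in> carrier TK2" "\<iota>2 (\<rho>K k) = \<Delta> k"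
proof -
  obtain Z where "Z \<in> carrier TK2" "\<iota>2 Z = \<Delta> k" by (rule comult_image[OF k])
  then have "\<exists>Z. Z \<in> carrier TK2 \<and> \<iota>2 Z = \<Delta> k" by (intro exI conjI)
  from someI_ex[OF this] show "\<rho>K k \<in> carrier TK2" "\<iota>2 (\<rho>K k) = \<Delta> k"
    unfolding \<rho>K_def by simp_all
qed

lemma \<iota>2_injD: "\<lbrakk>Z \<in> carrier TK2; Z' \<in> carrier TK2; \<iota>2 Z = \<iota>2 Z'\<rbrakk> \<Longrightarrow> Z = Z'"
  by (rule \<iota>2_inj[where K=K and H=H, OF K H basis])

lemma \<rho>K_mod_hom: "\<rho>K \<in> mod_hom (opposite A) (right_mod CK2) (right_mod TK2)"
proof (rule mod_hom_right_modI)
  interpret RK: left_module "opposite A" "right_mod TK2" by (rule KC.right_module_tensor[OF bimodule_C])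
  note KD = K_iff[OF K] and KC' = K_carr[OF K]
  fix k assume "k \<in> carrier CK2"
  then have k: "k \<in> K" by simp
  show "\<rho>K k \<in> carrier TK2" by (rule \<rho>K(1)[OF k])
  show "\<rho>K (k \<oplus>\<^bsub>CK2\<^esub> l) = \<rho>K k \<oplus>\<^bsub>TK2\<^esub> \<rho>K l" if "l \<in> carrier CK2" for l
  proof -
    have l: "l \<in> K" using that by simp
    have "\<rho>K (k \<oplus>\<^bsub>C\<^esub> l) = \<rho>K k \<oplus>\<^bsub>TK2\<^esub> \<rho>K l"
      by (rule \<iota>2_injD)
        (simp_all add: \<rho>K k l KD(3) additive_add[OF \<iota>2_additive[OF K]] comult_add KC')
    then show ?thesis by simp
  qed
  show "\<rho>K (rsmult CK2 k a) = rsmult TK2 (\<rho>K k) a" if a: "a \<in> carrier A" for a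
  proof -
    have "rsmult TK2 (\<rho>K k) a \<in> carrier TK2"
      using RK.lsmult_closed[of a "\<rho>K k"] a \<rho>K(1)[OF k] by simp
    then have "\<rho>K (rsmult C k a) = rsmult TK2 (\<rho>K k) a"
      by - (rule \<iota>2_injD, simp_all add: \<rho>K k a KD(4) \<iota>2_rsmult comult_rsmult KC')
    then show ?thesis by simp
  qed
qed

lemma tensor_lift_\<rho>K:
  assumes "abelian_group G" "balanced A C C G \<beta>" "k \<in> K"
  shows "tensor_lift G \<beta> (\<rho>K k) = tensor_lift G \<beta> (\<Delta> k)"
  using tensor_lift_\<iota>2[OF K assms(1,2) \<rho>K(1)[OF assms(3)]] \<rho>K(2)[OF assms(3)] by simp

lemma triple_balanced:
  "z \<in> carrier C \<Longrightarrow> balanced A C C T3 (\<lambda>x y. C_CC.pt x (CC.pt y z))"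
  "x \<in> carrier C \<Longrightarrow> balanced A C C T3 (\<lambda>y z. C_CC.pt x (CC.pt y z))"
proof -
  show "balanced A C C T3 (\<lambda>x y. C_CC.pt x (CC.pt y z))" if "z \<in> carrier C"
    using C_CC.balanced_pure_tensor CC.balanced_pure_tensor CC.smult_pure_tensor[OF bimodule_C, symmetric] that
    unfolding balanced_def by simp
  have "additive T2 T3 (C_CC.pt x)" if "x \<in> carrier C"
    using C_CC.balanced_pure_tensor that by (simp add: balanced_def additive_def)
  from balanced_compose[OF CC.balanced_pure_tensor this]
  show "balanced A C C T3 (\<lambda>y z. C_CC.pt x (CC.pt y z))" if "x \<in> carrier C"
    using that .
qed

text \<open>Both sides are compared in \<open>C \<otimes> (C \<otimes> C)\<close>, where the
  equation is coassociativity of \<open>\<Delta>\<close>, and injectivity of \<open>\<iota>3\<close>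
  brings it back.\<close>

lemma \<rho>K_coassoc:
  assumes k: "k \<in> K"
  shows "tensor_assoc A CK2 C C (tensor_map A TK2 C \<rho>K id (\<rho>K k)) = tensor_map A CK2 T2 id \<Delta> (\<rho>K k)"
proof -
  note KC' = K_carr[OF K] and ab3 = C_CC.abelian_group_tensor
  note assoc = tensor_assoc_tensor_map[OF right_mod_CK[OF K] bimodule_C CL.left_module_axioms
      right_mod_CK[OF K] \<rho>K_mod_hom \<rho>K(1)[OF k]]
  note co = coassoc[OF ab3 triple_balanced KC'[OF k]]
  let ?tK = "\<lambda>x y z. K_CC.pt x (CC.pt y z)" and ?t = "\<lambda>x y z. C_CC.pt x (CC.pt y z)"
  have triK: "balanced A CK2 C TK3 (\<lambda>x y. ?tK x y z)" if "z \<in> carrier C" for z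
    by (rule balanced_append_basis[OF that])
  have bR: "balanced A CK2 C TK3 (\<lambda>u v. K_CC.pt (id u) (\<Delta> v))"
    using K_CC.balanced_pure_tensor by (simp add: balanced_def comult_closed comult_add comult_smult)
  have inner: "\<iota>3 (tensor_lift TK3 (\<lambda>x y. ?tK x y z) (\<rho>K u)) = tensor_lift T3 (\<lambda>x y. ?t x y z) (\<Delta> u)"
    if u: "u \<in> K" and z: "z \<in> carrier C" for u z
  proof -
    have "\<iota>3 (tensor_lift TK3 (\<lambda>x y. ?tK x y z) (\<rho>K u)) = tensor_lift T3 (\<lambda>x y. \<iota>3 (?tK x y z)) (\<rho>K u)"
      by (rule KC.tensor_lift_compose[OF K_CC.abelian_group_tensor triK[OF z] ab3 \<iota>3_additive \<rho>K(1)[OF u]])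
    also have "\<dots> = tensor_lift T3 (\<lambda>x y. ?t x y z) (\<rho>K u)"
      by (rule KC.tensor_lift_cong[OF ab3 balanced_CK[OF K triple_balanced(1)[OF z]] \<rho>K(1)[OF u]])
        (simp add: \<iota>3_pure z)
    also have "\<dots> = tensor_lift T3 (\<lambda>x y. ?t x y z) (\<Delta> u)"
      by (rule tensor_lift_\<rho>K[OF ab3 triple_balanced(1)[OF z] u])
    finally show ?thesis .
  qed
  have "\<iota>3 (tensor_assoc A CK2 C C (tensor_map A TK2 C \<rho>K id (\<rho>K k))) =
      tensor_lift T3 (\<lambda>u z. \<iota>3 (tensor_lift TK3 (\<lambda>x y. ?tK x y z) (\<rho>K u))) (\<rho>K k)"
    unfolding assoc(1)
    by (rule KC.tensor_lift_compose[OF K_CC.abelian_group_tensor assoc(2) ab3 \<iota>3_additive \<rho>K(1)[OF k]])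
  also have "\<dots> = tensor_lift T3 (\<lambda>u z. tensor_lift T3 (\<lambda>x y. ?t x y z) (\<Delta> u)) (\<rho>K k)"
    by (rule KC.tensor_lift_cong[OF ab3 balanced_CK[OF K co(2)] \<rho>K(1)[OF k]]) (simp_all add: inner)
  also have "\<dots> = tensor_lift T3 (\<lambda>u z. tensor_lift T3 (\<lambda>x y. ?t x y z) (\<Delta> u)) (\<Delta> k)"
    by (rule tensor_lift_\<rho>K[OF ab3 co(2) k])
  also have "\<dots> = tensor_lift T3 (\<lambda>u v. tensor_lift T3 (\<lambda>y z. ?t u y z) (\<Delta> v)) (\<Delta> k)"
    by (rule co(1))
  also have "\<dots> = tensor_lift T3 (\<lambda>u v. tensor_lift T3 (\<lambda>y z. ?t u y z) (\<Delta> v)) (\<rho>K k)"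
    by (rule tensor_lift_\<rho>K[OF ab3 co(3) k, symmetric])
  also have "\<dots> = tensor_lift T3 (\<lambda>u v. \<iota>3 (K_CC.pt (id u) (\<Delta> v))) (\<rho>K k)"
  proof (rule KC.tensor_lift_cong[symmetric, OF ab3 balanced_CK[OF K co(3)] \<rho>K(1)[OF k]])
    fix u v assume u: "u \<in> carrier CK2" and v: "v \<in> carrier C"
    have uC: "u \<in> K" "u \<in> carrier C" using u KC' by simp_all
    have "additive T2 T3 (C_CC.pt u)"
      using C_CC.balanced_pure_tensor uC(2) by (simp add: balanced_def additive_def)
    from CC.tensor_lift_compose[OF CC.abelian_group_tensor CC.balanced_pure_tensor ab3 this comult_closed[OF v]]
    show "\<iota>3 (K_CC.pt (id u) (\<Delta> v)) = tensor_lift T3 (\<lambda>y z. ?t u y z) (\<Delta> v)"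
      using uC v by (simp add: \<iota>3_pure comult_closed CC.tensor_lift_pure_tensor)
  qed
  also have "\<dots> = \<iota>3 (tensor_map A CK2 T2 id \<Delta> (\<rho>K k))"
    unfolding tensor_map_def
    by (rule KC.tensor_lift_compose[OF K_CC.abelian_group_tensor bR ab3 \<iota>3_additive \<rho>K(1)[OF k], symmetric])
  finally have eq: "\<iota>3 (tensor_assoc A CK2 C C (tensor_map A TK2 C \<rho>K id (\<rho>K k))) =
      \<iota>3 (tensor_map A CK2 T2 id \<Delta> (\<rho>K k))" .
  have "tensor_assoc A CK2 C C (tensor_map A TK2 C \<rho>K id (\<rho>K k)) \<in> carrier TK3"
    unfolding assoc(1) by (rule KC.tensor_lift_closed[OF K_CC.abelian_group_tensor assoc(2) \<rho>K(1)[OF k]])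
  moreover have "tensor_map A CK2 T2 id \<Delta> (\<rho>K k) \<in> carrier TK3"
    unfolding tensor_map_def by (rule KC.tensor_lift_closed[OF K_CC.abelian_group_tensor bR \<rho>K(1)[OF k]])
  ultimately show ?thesis
    using eq by (rule \<iota>3_inj)
qed

lemma right_coideal_K: "right_coideal A C K"
  unfolding right_coideal_def
proof (intro conjI exI K)
  note KC' = K_carr[OF K]
  show "right_comodule A C CK2 \<rho>K"
    unfolding right_comodule_def
  proof (intro conjI ballI right_mod_CK[OF K] \<rho>K_mod_hom)
    fix k assume "k \<in> carrier CK2"
    then have k: "k \<in> K" by simp
    show "tensor_assoc A CK2 C C (tensor_map A TK2 C \<rho>K id (\<rho>K k)) = tensor_map A CK2 T2 id \<Delta> (\<rho>K k)"
      by (rule \<rho>K_coassoc[OF k])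
    have inc: "additive CK2 C (\<lambda>x. x)" by (simp add: additive_def KC')
    have "tensor_lift CK2 (\<lambda>y c. rsmult C y (\<epsilon> c)) (\<rho>K k) = tensor_lift C (\<lambda>y c. rsmult C y (\<epsilon> c)) (\<rho>K k)"
      by (rule KC.tensor_lift_compose[OF abelian_group_CK[OF K] balanced_coeff[OF K left_linear_counit]
            CL.M.abelian_group_axioms inc \<rho>K(1)[OF k]])
    also have "\<dots> = k"
      using tensor_lift_\<rho>K[OF CL.M.abelian_group_axioms balanced_lact[OF left_linear_counit] k]
        counit_right_eq[OF KC'[OF k]] by simp
    finally show "tensor_lift CK2 (\<lambda>y c. rsmult CK2 y (\<epsilon> c)) (\<rho>K k) = k" by simp
  qed
  show "id \<in> right_colinear A C CK2 \<rho>K C \<Delta>"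
    unfolding right_colinear_def
  proof (intro CollectI conjI ballI)
    show "id \<in> mod_hom (opposite A) (right_mod CK2) (right_mod C)"
      by (simp add: mod_hom_iff KC')
    fix k assume "k \<in> carrier CK2"
    then show "\<Delta> (id k) = tensor_map A C C id id (\<rho>K k)"
      using \<rho>K(2)[of k] by (simp add: \<iota>2_def tensor_map_def)
  qed
qed

end

end

theorem right_coideal_iff_lact_stable:
  assumes P: "projective_module A C"
  shows "right_coideal A C K \<longleftrightarrow> lact_stable K"
proof (rule iffI)
  assume st: "lact_stable K"
  obtain H where H: "\<And>e. e \<in> carrier C \<Longrightarrow> left_linear (\<lambda>x. H x e)"
    "\<And>x. x \<in> carrier C \<Longrightarrow> eventually_id C (carrier C) (\<lambda>e x. H x e \<odot>\<^bsub>C\<^esub> e) x"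
    by (fact projective_dual_basis[OF P, folded left_linear_def])
  have K: "submodule K (opposite A) (right_mod C)"
    unfolding CR.submodule_iff
  proof (intro conjI ballI; (simp only: right_mod_sel)?)
    fix a k assume ak: "a \<in> carrier (opposite A)" "k \<in> K"
    \<comment> \<open>Scalar multiplication by \<open>a\<close> is the action of
      \<open>\<epsilon>\<close> followed by \<open>a\<close>. The zero element only fills an
      argument that the linearity statement does not mention.\<close>
    then have "lact (\<lambda>y. \<epsilon> y \<otimes>\<^bsub>A\<^esub> a) k \<in> K" "k \<in> carrier C"
      using st lact_counit_mult(1)[of a "\<zero>\<^bsub>C\<^esub>"] by (auto simp: lact_stable_def)
    then show "rsmult C k a \<in> K"
      using lact_counit_mult(2)[of a k] ak by simp
  qed (use st in \<open>auto simp: lact_stable_def\<close>)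
  show "right_coideal A C K"
    by (rule right_coideal_K[OF K H]) (use st in \<open>simp_all add: lact_stable_def\<close>)
qed (rule right_coideal_lact_stable)

end

section \<open>Left-hand versions\<close>

text \<open>Over the opposite ring the two sides of a coring are interchanged: the left-hand results are the
  right-hand ones for the flipped coring.\<close>

definition flip_coring :: "('a, 'c, 'y) coring_scheme \<Rightarrow> ('a, 'c, 'y) coring_scheme"
  where "flip_coring C = (flip_mod C)\<lparr>comult := \<lambda>c. flip_tensor (comult C c)\<rparr>"

lemma flip_coring_sel [simp]:
  "carrier (flip_coring C) = carrier C" "\<zero>\<^bsub>flip_coring C\<^esub> = \<zero>\<^bsub>C\<^esub>" "add (flip_coring C) = add C"
  "a \<odot>\<^bsub>flip_coring C\<^esub> x = rsmult C x a" "rsmult (flip_coring C) x a = a \<odot>\<^bsub>C\<^esub> x"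
  "comult (flip_coring C) c = flip_tensor (comult C c)" "counit (flip_coring C) = counit C"
  "flip_coring (flip_coring C) = C"
  by (simp_all add: flip_coring_def flip_mod_def)

text \<open>\<open>flip_coring C\<close> and \<open>flip_mod C\<close> are different records with
  the same module part. Tensor products see only that part, so the two become interchangeable in
  them.\<close>

lemma tensor_rel_cong:
  assumes "carrier M' = carrier M" "add M' = add M" "rsmult M' = rsmult M"
    and "carrier N' = carrier N" "add N' = add N" "smult N' = smult N"
  shows "tensor_rel A M' N' = tensor_rel A M N"
  unfolding tensor_rel_def assms ..

lemma pure_tensor_cong:
  assumes "carrier M' = carrier M" "add M' = add M" "rsmult M' = rsmult M"
    and "carrier N' = carrier N" "add N' = add N" "smult N' = smult N"
  shows "pure_tensor A M' N' = pure_tensor A M N"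
  unfolding pure_tensor_def tensor_rel_cong[OF assms] assms ..

lemma tensor_cong:
  assumes "carrier M' = carrier M" "add M' = add M" "smult M' = smult M" "rsmult M' = rsmult M"
    and "carrier N' = carrier N" "add N' = add N" "smult N' = smult N" "rsmult N' = rsmult N"
  shows "tensor A M' N' = tensor A M N"
  unfolding tensor_def tensor_rel_cong[OF assms(1,2,4-7)] assms ..

lemma tensor_lift_add_monoid:
  fixes G H :: "('g, 'x) ring_scheme"
  assumes "carrier H = carrier G" "\<zero>\<^bsub>H\<^esub> = \<zero>\<^bsub>G\<^esub>" "add H = add G"
  shows "tensor_lift H = tensor_lift G"
proof -
  have "add_monoid H = add_monoid G" by (simp add: assms)
  then show ?thesis
    unfolding tensor_lift_def finsum_def add_pow_def by presburger
qed

lemma tensor_lift_flip_coring [simp]: "tensor_lift (flip_coring C) = tensor_lift C"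
  by (rule tensor_lift_add_monoid) simp_all

lemma tensor_flip_coring [simp]:
  "tensor B (flip_coring C) N = tensor B (flip_mod C) N"
  "tensor B N (flip_coring C) = tensor B N (flip_mod C)"
  "pure_tensor B (flip_coring C) N = pure_tensor B (flip_mod C) N"
  "pure_tensor B N (flip_coring C) = pure_tensor B N (flip_mod C)"
  by (rule tensor_cong pure_tensor_cong; simp add: fun_eq_iff)+

text \<open>Naturality of the flip, which carries colinearity of maps from one side to the
  other.\<close>

lemma (in tensor_pair) flip_tensor_map:
  fixes P :: "('a, 'p, 'v) bimodule_scheme" and Q :: "('a, 'q, 'u) bimodule_scheme"
  assumes PQ: "tensor_pair A P Q" and b: "balanced A P Q (tensor A M N) (\<lambda>x y. pt (p x) (q y))"
    and p: "\<And>x. x \<in> carrier P \<Longrightarrow> p x \<in> carrier M" and q: "\<And>y. y \<in> carrier Q \<Longrightarrow> q y \<in> carrier N"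
    and X: "X \<in> carrier (tensor A P Q)"
  shows "flip_tensor (tensor_map A M N p q X) =
    tensor_map (opposite A) (flip_mod N) (flip_mod M) q p (flip_tensor X)"
proof -
  interpret PQ: tensor_pair A P Q by fact
  interpret FT: tensor_pair "opposite A" "flip_mod N" "flip_mod M" by (rule tensor_pair_flip)
  have eq: "flip_tensor (pt (p x) (q y)) = FT.pt (q y) (p x)" if "x \<in> carrier P" "y \<in> carrier Q" for x y
    by (rule flip_tensor_pure) (simp_all add: that p q)
  have b1: "balanced A P Q (tensor (opposite A) (flip_mod N) (flip_mod M)) (\<lambda>x y. FT.pt (q y) (p x))"
    by (rule PQ.balanced_cong[OF balanced_compose[OF b flip_tensor_additive]]) (simp add: eq)
  have "flip_tensor (tensor_map A M N p q X) =
      tensor_lift (tensor (opposite A) (flip_mod N) (flip_mod M)) (\<lambda>x y. flip_tensor (pt (p x) (q y))) X"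
    unfolding tensor_map_def
    by (rule PQ.tensor_lift_compose[OF abelian_group_tensor b FT.abelian_group_tensor flip_tensor_additive X])
  also have "\<dots> = tensor_lift (tensor (opposite A) (flip_mod N) (flip_mod M)) (\<lambda>x y. FT.pt (q y) (p x)) X"
    by (rule PQ.tensor_lift_cong[OF FT.abelian_group_tensor b1 X]) (simp add: eq)
  also have "\<dots> = tensor_map (opposite A) (flip_mod N) (flip_mod M) q p (flip_tensor X)"
    unfolding tensor_map_def
    by (rule PQ.tensor_lift_flip[OF X FT.abelian_group_tensor b1, symmetric])
  finally show ?thesis .
qed

context A_coring
begin

lemma bimodule_flip_coring: "bimodule (opposite A) (flip_coring C)"
proof -
  have "bimodule (opposite A) (flip_mod C)" by (rule bimodule_flip_mod[OF bimodule_C])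
  then show ?thesis
    by (auto simp: bimodule_def fun_eq_iff elim!: left_module_cong)
qed

text \<open>The substantial axiom is coassociativity. Both of its sides are rewritten as double
  Sweedler sums along the unflipped coaction, and there the Sweedler form for \<open>M\<close>
  identifies them.\<close>

lemma left_comodule_flip:
  fixes M :: "('a, 'm, 'z) bimodule_scheme"
  assumes M: "right_comodule A C M \<rho>"
  shows "left_comodule (opposite A) (flip_coring C) (flip_mod M) (\<lambda>m. flip_tensor (\<rho> m))"
proof -
  let ?B = "opposite A" and ?C' = "flip_mod C" and ?M' = "flip_mod M"
  have MR: "left_module ?B (right_mod M)"
    and \<rho>: "\<rho> \<in> mod_hom ?B (right_mod M) (right_mod (tensor A M C))"
    and cu: "\<And>m. m \<in> carrier M \<Longrightarrow> tensor_lift M (\<lambda>y c. rsmult M y (\<epsilon> c)) (\<rho> m) = m"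
    using M by (simp_all add: right_comodule_def)
  interpret MR: left_module ?B "right_mod M" by (rule MR)
  note \<rho>D = mod_hom_right_modD[OF \<rho>]
  note bi' = bimodule_flip_mod[OF bimodule_C]
  interpret MC: tensor_pair A M C by (rule tensor_pair.intro[OF MR CL.left_module_axioms])
  interpret CM': tensor_pair ?B ?C' ?M' by (rule MC.tensor_pair_flip)
  interpret CC': tensor_pair ?B ?C' ?C' by (rule CC.tensor_pair_flip)
  interpret C_CM': tensor_pair ?B ?C' "tensor ?B ?C' ?M'"
    by (rule tensor_pair.intro[OF bimoduleD(2)[OF bi'] CM'.left_module_tensor[OF bi']])
  let ?T' = "tensor ?B ?C' (tensor ?B ?C' ?M')"
  let ?t = "\<lambda>x y z. C_CM'.pt x (CM'.pt y z)"
  note ab' = C_CM'.abelian_group_tensor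
  have M': "left_module ?B ?M'" using MR by (simp add: left_module_flip_mod)
  have \<Delta>': "(\<lambda>c. flip_tensor (\<Delta> c)) \<in> mod_hom (opposite ?B) (right_mod ?C') (right_mod (tensor ?B ?C' ?C'))"
    by (rule mod_hom_right_modI)
      (simp_all add: comult_closed comult_add comult_smult CC.flip_tensor_eq(1)
        additive_add[OF CC.flip_tensor_additive] CC.flip_tensor_smult[OF bimodule_C])
  have \<rho>': "(\<lambda>m. flip_tensor (\<rho> m)) \<in> mod_hom ?B ?M' (tensor ?B ?C' ?M')"
    by (simp add: mod_hom_iff \<rho>D MC.flip_tensor_eq(1) additive_add[OF MC.flip_tensor_additive]
        MC.flip_tensor_rsmult[OF bimodule_C])
  have abM: "abelian_group M"
    by (rule abelian_group_cong[OF MR.M.abelian_group_axioms]) simp_all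
  have bcu: "balanced A M C M (\<lambda>y c. rsmult M y (\<epsilon> c))"
    using MR.lsmult_closed MR.lsmult_l_distr MR.lsmult_r_distr MR.lsmult_assoc
    by (simp add: balanced_def counit_closed counit_add counit_smult)
  have triL: "balanced ?B ?C' ?C' ?T' (\<lambda>x y. ?t x y z)" if "z \<in> carrier M" for z
    using C_CM'.balanced_pure_tensor CM'.balanced_pure_tensor CM'.smult_pure_tensor[OF bi', symmetric] that
    unfolding balanced_def by simp
  have triR: "balanced ?B ?C' ?M' ?T' (\<lambda>y z. ?t x y z)" if x: "x \<in> carrier C" for x
  proof -
    have "additive (tensor ?B ?C' ?M') ?T' (C_CM'.pt x)"
      using C_CM'.balanced_pure_tensor x by (simp add: balanced_def additive_def)
    from balanced_compose[OF CM'.balanced_pure_tensor this] show ?thesis .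
  qed
  \<comment> \<open>Flipping reverses threefold tensors: for \<open>M\<close> the variables come in
    the order \<open>z\<close>, \<open>y\<close>, \<open>x\<close>, which is why \<open>?t\<close>
    is read backwards here.\<close>
  have g1: "balanced A M C ?T' (\<lambda>z y. ?t x y z)" if "x \<in> carrier C" for x
    using triR[OF that] balanced_flip[of A C M ?T' "\<lambda>z y. ?t x y z"] by simp
  have g2: "balanced A C C ?T' (\<lambda>y x. ?t x y z)" if "z \<in> carrier M" for z
    using triL[OF that] balanced_flip[of A C C ?T' "\<lambda>y x. ?t x y z"] by simp
  have coassoc': "tensor_assoc ?B ?C' ?C' ?M'
        (tensor_map ?B (tensor ?B ?C' ?C') ?M' (\<lambda>c. flip_tensor (\<Delta> c)) id (flip_tensor (\<rho> m))) =
      tensor_map ?B ?C' (tensor ?B ?C' ?M') id (\<lambda>m. flip_tensor (\<rho> m)) (flip_tensor (\<rho> m))"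
    if m: "m \<in> carrier M" for m
  proof -
    note co = right_comodule_coassoc[OF M ab' g1 g2 m]
    note X' = MC.flip_tensor_eq(1)[OF \<rho>D(1)[OF m]]
    note assoc = tensor_assoc_tensor_map[OF bimoduleD(2)[OF bi'] bi' M' bimoduleD(2)[OF bi'] \<Delta>' X']
    have in1: "tensor_lift ?T' (\<lambda>x y. ?t x y z) (flip_tensor (\<Delta> u)) = tensor_lift ?T' (\<lambda>y x. ?t x y z) (\<Delta> u)"
      if "u \<in> carrier C" "z \<in> carrier M" for u z
      by (rule CC.tensor_lift_flip[OF comult_closed[OF that(1)] ab' g2[OF that(2)]])
    have bl: "balanced A M C ?T' (\<lambda>z u. tensor_lift ?T' (\<lambda>x y. ?t x y z) (flip_tensor (\<Delta> u)))"
      using assoc(2) balanced_flip[of A C M ?T' "\<lambda>z u. tensor_lift ?T' (\<lambda>x y. ?t x y z) (flip_tensor (\<Delta> u))"] by simp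
    have in2: "tensor_lift ?T' (\<lambda>z y. ?t x y z) (\<rho> u) = C_CM'.pt x (flip_tensor (\<rho> u))"
      if u: "u \<in> carrier M" and x: "x \<in> carrier C" for u x
    proof -
      have "additive (tensor ?B ?C' ?M') ?T' (C_CM'.pt x)"
        using C_CM'.balanced_pure_tensor x by (simp add: balanced_def additive_def)
      moreover have "balanced A M C (tensor ?B ?C' ?M') (\<lambda>z y. CM'.pt y z)"
        using CM'.balanced_pure_tensor balanced_flip[of A C M "tensor ?B ?C' ?M'" "\<lambda>z y. CM'.pt y z"] by simp
      ultimately show ?thesis
        unfolding MC.flip_tensor_eq(2)[OF \<rho>D(1)[OF u]]
        using MC.tensor_lift_compose[OF CM'.abelian_group_tensor _ ab' _ \<rho>D(1)[OF u]] by metis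
    qed
    have br: "balanced A M C ?T' (\<lambda>u x. C_CM'.pt x (flip_tensor (\<rho> u)))"
      by (rule MC.balanced_cong[OF co(2)]) (assumption | rule in2[symmetric])+
    have "tensor_assoc ?B ?C' ?C' ?M'
        (tensor_map ?B (tensor ?B ?C' ?C') ?M' (\<lambda>c. flip_tensor (\<Delta> c)) id (flip_tensor (\<rho> m))) =
      tensor_lift ?T' (\<lambda>z u. tensor_lift ?T' (\<lambda>x y. ?t x y z) (flip_tensor (\<Delta> u))) (\<rho> m)"
      unfolding assoc(1) by (rule MC.tensor_lift_flip[OF \<rho>D(1)[OF m] ab' bl])
    also have "\<dots> = tensor_lift ?T' (\<lambda>z u. tensor_lift ?T' (\<lambda>y x. ?t x y z) (\<Delta> u)) (\<rho> m)"
      by (rule MC.tensor_lift_cong[OF ab' co(3) \<rho>D(1)[OF m]]) (assumption | rule in1)+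
    also have "\<dots> = tensor_lift ?T' (\<lambda>u x. tensor_lift ?T' (\<lambda>z y. ?t x y z) (\<rho> u)) (\<rho> m)"
      by (rule co(1)[symmetric])
    also have "\<dots> = tensor_lift ?T' (\<lambda>u x. C_CM'.pt x (flip_tensor (\<rho> u))) (\<rho> m)"
      by (rule MC.tensor_lift_cong[OF ab' br \<rho>D(1)[OF m]]) (assumption | rule in2)+
    also have "\<dots> = tensor_lift ?T' (\<lambda>x u. C_CM'.pt x (flip_tensor (\<rho> u))) (flip_tensor (\<rho> m))"
      by (rule MC.tensor_lift_flip[OF \<rho>D(1)[OF m] ab' br, symmetric])
    finally show ?thesis by (simp add: tensor_map_def)
  qed
  show ?thesis
    unfolding left_comodule_def
  proof (intro conjI ballI)
    show "left_module ?B ?M'" by (rule M')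
    show "(\<lambda>m. flip_tensor (\<rho> m)) \<in> mod_hom ?B ?M' (tensor ?B (flip_coring C) ?M')"
      using \<rho>' by simp
    fix m assume "m \<in> carrier ?M'"
    then have m: "m \<in> carrier M" by simp
    have "comult (flip_coring C) = (\<lambda>c. flip_tensor (\<Delta> c))" by (simp add: fun_eq_iff)
    then show "tensor_assoc ?B (flip_coring C) (flip_coring C) ?M'
        (tensor_map ?B (tensor ?B (flip_coring C) (flip_coring C)) ?M' (comult (flip_coring C)) id (flip_tensor (\<rho> m))) =
      tensor_map ?B (flip_coring C) (tensor ?B (flip_coring C) ?M') id (\<lambda>m. flip_tensor (\<rho> m)) (flip_tensor (\<rho> m))"
      using coassoc'[OF m] unfolding tensor_assoc_def tensor_map_def tensor_flip_coring by simp
    have "tensor_lift ?M' (\<lambda>c y. rsmult M y (\<epsilon> c)) (flip_tensor (\<rho> m)) =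
        tensor_lift M (\<lambda>c y. rsmult M y (\<epsilon> c)) (flip_tensor (\<rho> m))"
      by (subst tensor_lift_add_monoid[of ?M' M]) simp_all
    also have "\<dots> = m"
      using MC.tensor_lift_flip[OF \<rho>D(1)[OF m] abM bcu] cu[OF m] by simp
    finally show "tensor_lift ?M' (\<lambda>c y. counit (flip_coring C) c \<odot>\<^bsub>?M'\<^esub> y) (flip_tensor (\<rho> m)) = m"
      by simp
  qed
qed

end

text \<open>Restricting the carrier before or after flipping gives records that differ in the
  comultiplication field, though not in their module structure.\<close>

lemma left_comodule_cong:
  fixes M M' :: "('a, 'm, 'z) bimodule_scheme"
  assumes eq: "carrier M' = carrier M" "\<zero>\<^bsub>M'\<^esub> = \<zero>\<^bsub>M\<^esub>" "add M' = add M" "smult M' = smult M" "rsmult M' = rsmult M"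
    and M: "left_comodule A C M \<rho>"
  shows "left_comodule A C M' \<rho>"
proof -
  have t: "tensor A N M' = tensor A N M" "pure_tensor A N M' = pure_tensor A N M"
    for N :: "('a, 'n, 'w) bimodule_scheme"
    by (rule tensor_cong; simp add: eq) (rule pure_tensor_cong; simp add: eq)
  have "left_module A M'"
    using M by (auto simp: left_comodule_def eq elim!: left_module_cong)
  then show ?thesis
    using M unfolding left_comodule_def tensor_assoc_def tensor_map_def t tensor_lift_add_monoid[OF eq(1-3)]
    by (simp add: eq mod_hom_iff)
qed

lemma smult_flip_coring: "smult (flip_coring C) = (\<lambda>a x. rsmult C x a)"
  by (simp add: fun_eq_iff)

lemma mod_hom_flip_coring: "mod_hom T (flip_coring C) N = mod_hom T (right_mod C) N"
  by (auto simp: mod_hom_iff)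

text \<open>Products are compared on the carrier alone, since the products of two dual rings are not
  claimed to agree at maps that are not linear.\<close>

lemma ring_cong:
  assumes R: "ring R" and "carrier S = carrier R" "\<zero>\<^bsub>S\<^esub> = \<zero>\<^bsub>R\<^esub>" "\<one>\<^bsub>S\<^esub> = \<one>\<^bsub>R\<^esub>" "add S = add R"
    and mult: "\<And>x y. \<lbrakk>x \<in> carrier R; y \<in> carrier R\<rbrakk> \<Longrightarrow> x \<otimes>\<^bsub>S\<^esub> y = x \<otimes>\<^bsub>R\<^esub> y"
  shows "ring S"
proof -
  interpret ring R by fact
  note [simp] = assms(2-5) mult
  show ?thesis
    by (rule ringI)
      (auto intro!: abelian_group_cong[OF is_abelian_group] monoidI simp: m_assoc l_distr r_distr)
qed

section \<open>The flipped coring and the left dual ring\<close>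

context A_coring
begin

lemma coring_flip: "coring (opposite A) (flip_coring C)"
proof -
  let ?B = "opposite A" and ?C' = "flip_coring C"
  note ab = CL.M.abelian_group_axioms
  have co: "left_comodule ?B ?C' (flip_mod C) (\<lambda>m. flip_tensor (\<Delta> m))"
    by (rule left_comodule_flip[OF right_comodule_C])
  have \<Delta>': "comult ?C' = (\<lambda>c. flip_tensor (\<Delta> c))" by (simp add: fun_eq_iff)
  have "comult ?C' \<in> bimodule_hom ?B ?C' (tensor ?B ?C' ?C')"
    by (simp add: bimodule_hom_def mod_hom_iff comult_closed comult_add comult_smult comult_rsmult
        CC.flip_tensor_eq(1) additive_add[OF CC.flip_tensor_additive]
        CC.flip_tensor_smult[OF bimodule_C] CC.flip_tensor_rsmult[OF bimodule_C])
  moreover have "counit ?C' \<in> bimodule_hom ?B ?C' (regular ?B)"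
    by (simp add: bimodule_hom_def mod_hom_iff counit_closed counit_add counit_smult counit_rsmult)
  moreover have "tensor_assoc ?B ?C' ?C' ?C' (tensor_map ?B (tensor ?B ?C' ?C') ?C' (comult ?C') id (comult ?C' c)) =
      tensor_map ?B ?C' (tensor ?B ?C' ?C') id (comult ?C') (comult ?C' c)" if "c \<in> carrier C" for c
    using co that unfolding left_comodule_def tensor_assoc_def tensor_map_def tensor_flip_coring \<Delta>' by simp
  moreover have "tensor_lift ?C' (\<lambda>x y. rsmult C y (\<epsilon> x)) (flip_tensor (\<Delta> c)) = c"
    "tensor_lift ?C' (\<lambda>x y. \<epsilon> y \<odot>\<^bsub>C\<^esub> x) (flip_tensor (\<Delta> c)) = c" if c: "c \<in> carrier C" for c
    using CC.tensor_lift_flip[OF comult_closed[OF c] ab balanced_lact[OF left_linear_counit]]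
      CC.tensor_lift_flip[OF comult_closed[OF c] ab balanced_ract[OF right_linear_counit]]
      counit_left_eq[OF c] counit_right_eq[OF c] by simp_all
  ultimately show ?thesis
    using ring_opposite[OF CL.T.ring_axioms] bimodule_flip_coring
    unfolding coring_def by (simp add: smult_flip_coring)
qed

interpretation F: A_coring "opposite A" "flip_coring C" by (rule A_coring.intro[OF coring_flip])

lemma flip_linear: "F.left_linear g \<longleftrightarrow> right_linear g" "F.right_linear g \<longleftrightarrow> left_linear g"
  by (simp_all add: F.left_linear_def right_linear_def F.right_linear_def left_linear_def mod_hom_iff)

lemma flip_ract: "\<lbrakk>left_linear f; c \<in> carrier C\<rbrakk> \<Longrightarrow> F.ract f c = lact f c"
  unfolding F.ract_def lact_def
  using CC.tensor_lift_flip[OF comult_closed CL.M.abelian_group_axioms balanced_lact]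
  by (simp add: smult_flip_coring)

lemma flip_lact: "\<lbrakk>right_linear g; c \<in> carrier C\<rbrakk> \<Longrightarrow> F.lact g c = ract g c"
  unfolding F.lact_def ract_def
  using CC.tensor_lift_flip[OF comult_closed CL.M.abelian_group_axioms balanced_ract] by simp

abbreviation L where "L \<equiv> left_dual A C"

lemma left_dual_sel:
  "f \<in> carrier L \<longleftrightarrow> left_linear f \<and> f \<in> extensional (carrier C)"
  "\<one>\<^bsub>L\<^esub> = restrict \<epsilon> (carrier C)" "\<zero>\<^bsub>L\<^esub> = (\<lambda>c\<in>carrier C. \<zero>\<^bsub>A\<^esub>)"
  "f \<oplus>\<^bsub>L\<^esub> g = (\<lambda>c\<in>carrier C. f c \<oplus>\<^bsub>A\<^esub> g c)"
  by (simp_all add: left_dual_def left_linear_def)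

lemma left_dual_flip:
  "carrier L = carrier F.R" "\<one>\<^bsub>L\<^esub> = \<one>\<^bsub>F.R\<^esub>" "\<zero>\<^bsub>L\<^esub> = \<zero>\<^bsub>F.R\<^esub>" "add L = add F.R"
  by (auto simp: left_dual_sel F.right_dual_sel flip_linear fun_eq_iff)

text \<open>Identifies the left dual ring with the opposite of the right dual ring of the flipped
  coring, from which it inherits the ring and module axioms.\<close>

lemma left_dual_mult_flip:
  assumes "f \<in> carrier L" "g \<in> carrier L"
  shows "f \<otimes>\<^bsub>L\<^esub> g = g \<otimes>\<^bsub>F.R\<^esub> f"
proof -
  have f: "left_linear f" and g: "left_linear g" using assms by (simp_all add: left_dual_sel)
  have fa: "additive C A f" by (simp add: additive_def left_linearD[OF f])
  have "tensor_lift A (\<lambda>x y. f (rsmult C x (g y))) (\<Delta> c) = f (lact g c)" if c: "c \<in> carrier C" for c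
    unfolding lact_def
    by (rule CC.tensor_lift_compose[OF CL.M.abelian_group_axioms balanced_lact[OF g] abelian_group_A
          fa comult_closed[OF c], symmetric])
  then show ?thesis
    using f g by (auto simp: left_dual_def F.right_dual_mult flip_linear flip_ract intro!: restrict_ext)
qed

lemma ring_left_dual: "ring L"
  by (rule ring_cong[OF ring_opposite[OF F.ring_right_dual]])
    (simp_all add: left_dual_flip left_dual_mult_flip opposite_def)

lemma left_dual_mod_sel [simp]:
  "carrier (left_dual_mod C) = carrier C" "\<zero>\<^bsub>left_dual_mod C\<^esub> = \<zero>\<^bsub>C\<^esub>"
  "add (left_dual_mod C) = add C" "smult (left_dual_mod C) = lact"
  by (simp_all add: left_dual_mod_def lact_def fun_eq_iff)

lemma left_module_left_dual: "left_module L (left_dual_mod C)"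
proof -
  interpret FM: left_module "opposite F.R" "right_dual_mod (flip_coring C)"
    by (rule F.left_module_right_dual)
  interpret L: ring L by (rule ring_left_dual)
  have eq: "F.ract f c = lact f c" if "f \<in> carrier L" "c \<in> carrier C" for f c
    using that by (simp add: flip_ract left_dual_sel)
  have cl: "lact f c \<in> carrier C" if "f \<in> carrier L" "c \<in> carrier C" for f c
    using that by (simp add: lact_closed left_dual_sel)
  show ?thesis
  proof (rule left_moduleI[OF ring_left_dual]; (simp only: left_dual_mod_sel)?)
    show "abelian_group (left_dual_mod C)"
      by (rule abelian_group_cong[OF CL.M.abelian_group_axioms]) simp_all
    fix f c assume f: "f \<in> carrier L" and c: "c \<in> carrier C"
    then have f': "f \<in> carrier (opposite F.R)" by (simp add: left_dual_flip)
    show "lact f c \<in> carrier C" by (rule cl[OF f c])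
    show "lact f (c \<oplus>\<^bsub>C\<^esub> d) = lact f c \<oplus>\<^bsub>C\<^esub> lact f d" if "d \<in> carrier C" for d
      using f c that by (simp add: lact_add left_dual_sel)
    fix g assume g: "g \<in> carrier L"
    then have g': "g \<in> carrier (opposite F.R)" by (simp add: left_dual_flip)
    show "lact (f \<oplus>\<^bsub>L\<^esub> g) c = lact f c \<oplus>\<^bsub>C\<^esub> lact g c"
      using FM.lsmult_l_distr[OF f' g', of c] c eq[OF f c] eq[OF g c] eq[OF L.add.m_closed[OF f g] c]
      by (simp add: left_dual_flip)
    show "lact (f \<otimes>\<^bsub>L\<^esub> g) c = lact f (lact g c)"
      using FM.lsmult_assoc[OF f' g', of c] c eq[OF f cl[OF g c]] eq[OF g c] eq[OF L.m_closed[OF f g] c]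
      by (simp add: left_dual_mult_flip[OF f g])
  next
    fix c assume c: "c \<in> carrier C"
    show "lact \<one>\<^bsub>L\<^esub> c = c"
      using FM.lsmult_one[of c] eq[OF L.one_closed c] c by (simp add: left_dual_flip)
  qed
qed

lemma left_dual_faithful:
  assumes f: "f \<in> carrier L" and z: "\<And>c. c \<in> carrier C \<Longrightarrow> lact f c = \<zero>\<^bsub>C\<^esub>"
  shows "f = \<zero>\<^bsub>L\<^esub>"
  unfolding left_dual_flip
  by (rule F.right_dual_faithful) (use f z in \<open>simp_all add: flip_ract left_dual_flip[symmetric] left_dual_sel\<close>)

lemma left_colinear_endos_flip: "left_colinear_endos A C = right_colinear_endos (opposite A) (flip_coring C)"
proof -
  have "flip_tensor (\<Delta> (f c)) = tensor_map (opposite A) (flip_coring C) (flip_coring C) f id (flip_tensor (\<Delta> c)) \<longleftrightarrow>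
      \<Delta> (f c) = tensor_map A C C id f (\<Delta> c)" if f: "f \<in> mod_hom A C C" and c: "c \<in> carrier C" for f c
  proof -
    have b: "balanced A C C T2 (\<lambda>x y. CC.pt (id x) (f y))"
      using CC.balanced_pure_tensor mod_hom_closed[OF f] mod_hom_add[OF f] mod_hom_smult[OF f]
      by (simp add: balanced_def)
    have "flip_tensor (tensor_map A C C id f (\<Delta> c)) =
        tensor_map (opposite A) (flip_coring C) (flip_coring C) f id (flip_tensor (\<Delta> c))"
      using CC.flip_tensor_map[OF CC.tensor_pair_axioms b _ _ comult_closed[OF c]] mod_hom_closed[OF f]
      by (simp add: tensor_map_def)
    then show ?thesis
      by (metis flip_tensor_flip_tensor)
  qed
  moreover have "mod_hom (opposite (opposite A)) (right_mod (flip_coring C)) (right_mod (flip_coring C)) = mod_hom A C C"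
    by (auto simp: mod_hom_iff)
  ultimately show ?thesis
    unfolding left_colinear_endos_def left_colinear_def right_colinear_endos_def right_colinear_def
    by (intro Collect_cong conj_cong ball_cong) simp_all
qed

text \<open>The auxiliary \<open>h\<close> appears because the flipped action and
  \<open>lact f\<close> are compared on the carrier only, whereas being an endomorphism is stated of
  a function as a whole.\<close>

lemma left_colinear_endosI:
  assumes "left_linear f"
  obtains h where "h \<in> left_colinear_endos A C" "\<And>c. c \<in> carrier C \<Longrightarrow> h c = lact f c"
proof
  show "F.ract f \<in> left_colinear_endos A C"
    using assms by (simp add: left_colinear_endos_flip F.right_colinear_endosI flip_linear)
  show "F.ract f c = lact f c" if "c \<in> carrier C" for c
    by (rule flip_ract[OF assms that])
qed

lemma left_colinear_endosE:
  assumes "h \<in> left_colinear_endos A C"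
  obtains f where "f \<in> carrier L" "\<And>c. c \<in> carrier C \<Longrightarrow> h c = lact f c"
proof -
  obtain f where f: "f \<in> carrier F.R" "\<And>c. c \<in> carrier (flip_coring C) \<Longrightarrow> h c = F.ract f c"
    using F.right_colinear_endosE assms unfolding left_colinear_endos_flip by metis
  then have "left_linear f" by (simp add: F.right_dual_sel flip_linear)
  then show thesis
    using f by (intro that[of f]) (simp_all add: left_dual_flip flip_ract)
qed

definition ract_stable :: "'c set \<Rightarrow> bool"
  where "ract_stable K \<longleftrightarrow> K \<subseteq> carrier C \<and> \<zero>\<^bsub>C\<^esub> \<in> K \<and> (\<forall>x\<in>K. \<forall>y\<in>K. x \<oplus>\<^bsub>C\<^esub> y \<in> K) \<and>
    (\<forall>g. right_linear g \<longrightarrow> (\<forall>x\<in>K. ract g x \<in> K))"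

lemma lact_stable_flip: "F.lact_stable K \<longleftrightarrow> ract_stable K"
proof -
  have "F.lact g x \<in> K \<longleftrightarrow> ract g x \<in> K" if "right_linear g" "x \<in> K" "K \<subseteq> carrier C" for g x
    using flip_lact[OF that(1), of x] that by auto
  then show ?thesis
    unfolding F.lact_stable_def ract_stable_def flip_linear flip_coring_sel by meson
qed

lemma submodule_flip: "submodule K (opposite A) (flip_coring C) \<longleftrightarrow> submodule K (opposite A) (right_mod C)"
  "submodule K (opposite (opposite A)) (right_mod (flip_coring C)) \<longleftrightarrow> submodule K A C"
  unfolding CR.submodule_iff F.CL.submodule_iff CL.submodule_iff F.CR.submodule_iff by simp_all

lemma left_coideal_flip:
  assumes "right_coideal A C K"
  shows "left_coideal (opposite A) (flip_coring C) K"
proof -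
  let ?CK = "C\<lparr>carrier := K\<rparr>" and ?CK' = "(flip_coring C)\<lparr>carrier := K\<rparr>"
  obtain \<rho> where K: "submodule K (opposite A) (right_mod C)"
    and co: "right_comodule A C ?CK \<rho>"
    and inc: "id \<in> right_colinear A C ?CK \<rho> C \<Delta>"
    using assms unfolding right_coideal_def by blast
  interpret KC: tensor_pair A ?CK C by (rule tensor_pair_CK[OF K])
  have b: "balanced A ?CK C T2 (\<lambda>x y. CC.pt (id x) (id y))"
    using balanced_CK[OF K CC.balanced_pure_tensor] by simp
  have \<rho>: "\<rho> k \<in> carrier (tensor A ?CK C)" if "k \<in> K" for k
    using co that mod_hom_right_modD(1)[of \<rho> A ?CK "tensor A ?CK C" k] by (simp add: right_comodule_def)
  have "left_comodule (opposite A) (flip_coring C) ?CK' (\<lambda>m. flip_tensor (\<rho> m))"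
    by (rule left_comodule_cong[OF _ _ _ _ _ left_comodule_flip[OF co]])
      (simp_all add: fun_eq_iff flip_coring_def flip_mod_def)
  moreover have "id \<in> left_colinear (opposite A) (flip_coring C) ?CK' (\<lambda>m. flip_tensor (\<rho> m)) (flip_coring C)
      (comult (flip_coring C))"
    unfolding left_colinear_def
  proof (intro CollectI conjI ballI)
    show "id \<in> mod_hom (opposite A) ?CK' (flip_coring C)"
      using K_carrier[OF K] by (simp add: mod_hom_iff flip_coring_def flip_mod_def)
    fix k assume "k \<in> carrier ?CK'"
    then have k: "k \<in> K" by simp
    have "\<Delta> k = tensor_map A C C id id (\<rho> k)" using inc k by (simp add: right_colinear_def)
    then show "comult (flip_coring C) (id k) =
        tensor_map (opposite A) (flip_coring C) (flip_coring C) id id (flip_tensor (\<rho> k))"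
      using CC.flip_tensor_map[OF KC.tensor_pair_axioms b _ _ \<rho>[OF k]] K_carrier[OF K]
      by (simp add: tensor_map_def)
  qed
  ultimately show ?thesis
    using K unfolding left_coideal_def submodule_flip by blast
qed

text \<open>It suffices to flip, for each \<open>k\<close>, the factorization of
  \<open>\<Delta> k\<close> through \<open>C \<otimes> K\<close>; membership is then an instance of
  \<open>lact_mem\<close> for the flipped coring.\<close>

lemma left_coideal_ract_stable:
  assumes "left_coideal A C K"
  shows "ract_stable K"
proof -
  let ?CK = "C\<lparr>carrier := K\<rparr>" and ?CK' = "(flip_coring C)\<lparr>carrier := K\<rparr>"
  obtain \<rho> where K: "submodule K A C"
    and co: "left_comodule A C ?CK \<rho>"
    and inc: "id \<in> left_colinear A C ?CK \<rho> C \<Delta>"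
    using assms unfolding left_coideal_def by blast
  have CK: "left_module A ?CK" using co by (simp add: left_comodule_def)
  interpret CK: tensor_pair A C ?CK by (rule tensor_pair.intro[OF CR.left_module_axioms CK])
  have KD: "K \<subseteq> carrier C" "\<zero>\<^bsub>C\<^esub> \<in> K" "\<forall>x\<in>K. \<forall>y\<in>K. x \<oplus>\<^bsub>C\<^esub> y \<in> K"
    using K by (simp_all add: CL.submodule_iff)
  have K': "submodule K (opposite (opposite A)) (right_mod (flip_coring C))"
    unfolding submodule_flip by (rule K)
  have "ract g k \<in> K" if g: "right_linear g" and k: "k \<in> K" for g k
  proof -
    have \<rho>: "\<rho> k \<in> carrier (tensor A C ?CK)"
      using co k mod_hom_closed[of \<rho> A ?CK "tensor A C ?CK" k] by (simp add: left_comodule_def)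
    have b: "balanced A C ?CK T2 (\<lambda>x y. CC.pt (id x) (id y))"
      using CC.balanced_pure_tensor KD(1) unfolding balanced_def by (auto simp: subset_iff)
    have "tensor (opposite A) ?CK' (flip_mod C) = tensor (opposite A) (flip_mod ?CK) (flip_mod C)"
      by (rule tensor_cong) (simp_all add: flip_coring_def flip_mod_def)
    then have X: "flip_tensor (\<rho> k) \<in> carrier (tensor (opposite A) ?CK' (flip_coring C))"
      using CK.flip_tensor_eq(1)[OF \<rho>] by simp
    have "\<Delta> k = tensor_map A C C id id (\<rho> k)" using inc k by (simp add: left_colinear_def)
    then have "comult (flip_coring C) k =
        tensor_map (opposite A) (flip_coring C) (flip_coring C) id id (flip_tensor (\<rho> k))"
      using CC.flip_tensor_map[OF CK.tensor_pair_axioms b _ _ \<rho>] KD(1)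
      by (auto simp: tensor_map_def)
    from F.lact_mem[OF K' X this] have "F.lact g k \<in> K"
      using g by (simp add: flip_linear)
    then show ?thesis using flip_lact[OF g, of k] k KD(1) by auto
  qed
  then show ?thesis
    unfolding ract_stable_def using KD by simp
qed

lemma projective_module_flip:
  assumes "projective_module (opposite A) (right_mod C)"
  shows "projective_module (opposite A) (flip_coring C)"
  using assms F.CL.left_module_axioms unfolding projective_module_def mod_hom_flip_coring by simp

lemma flip_right_coideal_iff:
  "projective_module (opposite A) (right_mod C) \<Longrightarrow>
    right_coideal (opposite A) (flip_coring C) K \<longleftrightarrow> ract_stable K"
  using F.right_coideal_iff_lact_stable[OF projective_module_flip] by (simp add: lact_stable_flip)

theorem left_coideal_iff_ract_stable:
  assumes P: "projective_module (opposite A) (right_mod C)"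
  shows "left_coideal A C K \<longleftrightarrow> ract_stable K"
proof (rule iffI)
  assume "ract_stable K"
  then have "right_coideal (opposite A) (flip_coring C) K" by (simp add: flip_right_coideal_iff[OF P])
  \<comment> \<open>Flipping twice returns the original ring and coring.\<close>
  from A_coring.left_coideal_flip[OF F.A_coring_axioms this] show "left_coideal A C K" by simp
qed (rule left_coideal_ract_stable)

lemma ract_stable_lact_eq_zero:
  assumes P: "projective_module (opposite A) (right_mod C)" and K: "ract_stable K"
    and f: "left_linear f" and z: "\<And>x. x \<in> K \<Longrightarrow> f x = \<zero>\<^bsub>A\<^esub>" and k: "k \<in> K"
  shows "lact f k = \<zero>\<^bsub>C\<^esub>"
proof -
  have "F.ract f k = \<zero>\<^bsub>flip_coring C\<^esub>"
    by (rule F.right_coideal_ract_eq_zero[of K])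
      (use K f z k in \<open>simp_all add: flip_right_coideal_iff[OF P] flip_linear\<close>)
  moreover have "k \<in> carrier C" using K k by (auto simp: ract_stable_def)
  ultimately show ?thesis using flip_ract[OF f, of k] by simp
qed

end

text \<open>The chain condition enters twice: it makes prime rings simple Artinian, and it yields
  the maximal subbimodule behind full coprimeness.\<close>

lemma (in commuting_modules) equivalent_conditions:
  assumes art: "left_artinian S"
  shows "prime_ring S \<longleftrightarrow> simple" "diprime_module S L \<longleftrightarrow> simple" "prime_module S L \<longleftrightarrow> simple"
    "simple_artinian_ring S \<longleftrightarrow> simple" "strongly_prime_module S L \<longleftrightarrow> simple" "fully_coprime \<longleftrightarrow> simple"
proof -
  have sa: "prime_ring S \<Longrightarrow> simple_artinian_ring S"
    by (rule L.T.prime_left_artinian_imp_simple_artinian[OF _ art])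
  note facts = sa simple_artinian_ring_imp_simple simple_imp_prime_ring prime_module_iff_simple
    prime_module_imp_diprime_module diprime_module_imp_prime_ring simple_imp_strongly_prime_module
    strongly_prime_module_imp_prime_module simple_imp_fully_coprime fully_coprime_imp_prime_ring[OF _ art]
  show "prime_ring S \<longleftrightarrow> simple" using facts(1-3) by blast
  show "simple_artinian_ring S \<longleftrightarrow> simple" using facts(1-3) by blast
  show "prime_module S L \<longleftrightarrow> simple" by (rule facts(4))
  show "diprime_module S L \<longleftrightarrow> simple" using facts(1-6) by blast
  show "strongly_prime_module S L \<longleftrightarrow> simple" using facts(4,7,8) by blast
  show "fully_coprime \<longleftrightarrow> simple" using facts(1-3,9,10) by blast
qed

section \<open>The coring as a pair of commuting modules\<close>

context A_coring
begin

text \<open>Elements of the dual ring are extensional, while stability quantifies over all linear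
  maps; restricting a map to the carrier does not change its action there.\<close>

lemma ract_all_iff:
  assumes "X \<subseteq> carrier C"
  shows "(\<forall>g\<in>carrier R. \<forall>x\<in>X. P (ract g x)) \<longleftrightarrow> (\<forall>g. right_linear g \<longrightarrow> (\<forall>x\<in>X. P (ract g x)))"
proof (intro iffI allI impI ballI)
  fix g x assume *: "\<forall>g\<in>carrier R. \<forall>x\<in>X. P (ract g x)" and g: "right_linear g" and x: "x \<in> X"
  have "restrict g (carrier C) \<in> carrier R"
    using g by (simp add: right_dual_sel right_linear_restrict)
  then have "P (ract (restrict g (carrier C)) x)" using * x by blast
  then show "P (ract g x)" using ract_cong[OF g, of "restrict g (carrier C)" x] assms x by auto
qed (simp add: right_dual_sel)

lemma lact_all_iff:
  assumes "X \<subseteq> carrier C"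
  shows "(\<forall>f\<in>carrier L. \<forall>x\<in>X. P (lact f x)) \<longleftrightarrow> (\<forall>f. left_linear f \<longrightarrow> (\<forall>x\<in>X. P (lact f x)))"
proof (intro iffI allI impI ballI)
  fix f x assume *: "\<forall>f\<in>carrier L. \<forall>x\<in>X. P (lact f x)" and f: "left_linear f" and x: "x \<in> X"
  have "restrict f (carrier C) \<in> carrier L"
    using f by (simp add: left_dual_sel left_linear_restrict)
  then have "P (lact (restrict f (carrier C)) x)" using * x by blast
  then show "P (lact f x)" using lact_cong[OF f, of "restrict f (carrier C)" x] assms x by auto
qed (simp add: left_dual_sel)

lemma submodule_left_dual_iff: "submodule K L (left_dual_mod C) \<longleftrightarrow> lact_stable K"
  unfolding left_module.submodule_iff[OF left_module_left_dual] lact_stable_def left_dual_mod_sel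
  using lact_all_iff[of K "\<lambda>y. y \<in> K"] by blast

lemma submodule_right_dual_iff: "submodule K (opposite R) (right_dual_mod C) \<longleftrightarrow> ract_stable K"
  unfolding left_module.submodule_iff[OF left_module_right_dual] ract_stable_def right_dual_mod_sel opposite_sel
  using ract_all_iff[of K "\<lambda>y. y \<in> K"] by blast

text \<open>Shaped for two uses: with \<open>X\<close> empty it expresses full invariance of
  \<open>Y = Z\<close>, and with \<open>Y\<close> the carrier it expresses the internal coproduct of
  \<open>X\<close> and \<open>Z\<close>.\<close>

lemma right_colinear_endos_all_iff:
  assumes X: "X \<subseteq> carrier C" and Y: "Y \<subseteq> carrier C"
  shows "(\<forall>h\<in>right_colinear_endos A C. (\<forall>x\<in>X. h x = \<zero>\<^bsub>C\<^esub>) \<longrightarrow> (\<forall>y\<in>Y. h y \<in> Z)) \<longleftrightarrow>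
    (\<forall>g\<in>carrier R. (\<forall>x\<in>X. ract g x = \<zero>\<^bsub>C\<^esub>) \<longrightarrow> (\<forall>y\<in>Y. ract g y \<in> Z))" (is "?l \<longleftrightarrow> ?r")
proof (rule iffI)
  assume ?l
  then show ?r using right_colinear_endosI by (simp add: right_dual_sel)
next
  assume r: ?r
  show ?l
  proof (intro ballI impI)
    fix h y assume h: "h \<in> right_colinear_endos A C" "\<forall>x\<in>X. h x = \<zero>\<^bsub>C\<^esub>" and y: "y \<in> Y"
    obtain g where g: "g \<in> carrier R" "\<And>c. c \<in> carrier C \<Longrightarrow> h c = ract g c"
      using right_colinear_endosE[OF h(1)] by metis
    have "\<forall>x\<in>X. ract g x = \<zero>\<^bsub>C\<^esub>" using h(2) g(2) X by (simp add: subset_iff)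
    then have "ract g y \<in> Z" using r g(1) y by blast
    then show "h y \<in> Z" using g(2)[of y] Y y by auto
  qed
qed

lemma left_colinear_endos_all_iff:
  assumes X: "X \<subseteq> carrier C" and Y: "Y \<subseteq> carrier C"
  shows "(\<forall>h\<in>left_colinear_endos A C. (\<forall>x\<in>X. h x = \<zero>\<^bsub>C\<^esub>) \<longrightarrow> (\<forall>y\<in>Y. h y \<in> Z)) \<longleftrightarrow>
    (\<forall>f\<in>carrier L. (\<forall>x\<in>X. lact f x = \<zero>\<^bsub>C\<^esub>) \<longrightarrow> (\<forall>y\<in>Y. lact f y \<in> Z))" (is "?l \<longleftrightarrow> ?r")
proof (rule iffI)
  assume l: ?l
  show ?r
  proof (intro ballI impI)
    fix f y assume f: "f \<in> carrier L" "\<forall>x\<in>X. lact f x = \<zero>\<^bsub>C\<^esub>" and y: "y \<in> Y"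
    have fl: "left_linear f" using f(1) by (simp add: left_dual_sel)
    obtain h where h: "h \<in> left_colinear_endos A C" "\<And>c. c \<in> carrier C \<Longrightarrow> h c = lact f c"
      using left_colinear_endosI[OF fl] by metis
    have "\<forall>x\<in>X. h x = \<zero>\<^bsub>C\<^esub>" using h(2) f(2) X by (simp add: subset_iff)
    then have "h y \<in> Z" using l h(1) y by blast
    then show "lact f y \<in> Z" using h(2)[of y] Y y by auto
  qed
next
  assume r: ?r
  show ?l
  proof (intro ballI impI)
    fix h y assume h: "h \<in> left_colinear_endos A C" "\<forall>x\<in>X. h x = \<zero>\<^bsub>C\<^esub>" and y: "y \<in> Y"
    obtain f where f: "f \<in> carrier L" "\<And>c. c \<in> carrier C \<Longrightarrow> h c = lact f c"
      using left_colinear_endosE[OF h(1)] by metis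
    have "\<forall>x\<in>X. lact f x = \<zero>\<^bsub>C\<^esub>" using h(2) f(2) X by (simp add: subset_iff)
    then have "lact f y \<in> Z" using r f(1) y by blast
    then show "h y \<in> Z" using f(2)[of y] Y y by auto
  qed
qed

lemma lact_stable_carrier: "lact_stable K \<Longrightarrow> K \<subseteq> carrier C"
  and ract_stable_carrier: "ract_stable K \<Longrightarrow> K \<subseteq> carrier C"
  by (simp_all add: lact_stable_def ract_stable_def)

text \<open>Being a coideal contributes stability under one dual ring, full invariance that under
  the other; the result is symmetric although its ingredients are one-sided.\<close>

lemma fully_invariant_right_coideal_iff:
  assumes P: "projective_module A C"
  shows "fully_invariant_right_coideal A C K \<longleftrightarrow> lact_stable K \<and> ract_stable K"
proof -
  have "(\<forall>h\<in>right_colinear_endos A C. h ` K \<subseteq> K) \<longleftrightarrow> ract_stable K" if K: "lact_stable K"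
  proof -
    have "(\<forall>h\<in>right_colinear_endos A C. h ` K \<subseteq> K) \<longleftrightarrow> (\<forall>g\<in>carrier R. \<forall>x\<in>K. ract g x \<in> K)"
      using right_colinear_endos_all_iff[of "{}" K K] lact_stable_carrier[OF K] by (simp add: image_subset_iff)
    also have "\<dots> \<longleftrightarrow> ract_stable K"
      using K ract_all_iff[of K "\<lambda>y. y \<in> K"] by (simp add: ract_stable_def lact_stable_def)
    finally show ?thesis .
  qed
  then show ?thesis
    unfolding fully_invariant_right_coideal_def right_coideal_iff_lact_stable[OF P] by blast
qed

lemma fully_invariant_left_coideal_iff:
  assumes P: "projective_module (opposite A) (right_mod C)"
  shows "fully_invariant_left_coideal A C K \<longleftrightarrow> lact_stable K \<and> ract_stable K"
proof -
  have "(\<forall>h\<in>left_colinear_endos A C. h ` K \<subseteq> K) \<longleftrightarrow> lact_stable K" if K: "ract_stable K"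
  proof -
    have "(\<forall>h\<in>left_colinear_endos A C. h ` K \<subseteq> K) \<longleftrightarrow> (\<forall>f\<in>carrier L. \<forall>x\<in>K. lact f x \<in> K)"
      using left_colinear_endos_all_iff[of "{}" K K] ract_stable_carrier[OF K] by (simp add: image_subset_iff)
    also have "\<dots> \<longleftrightarrow> lact_stable K"
      using K lact_all_iff[of K "\<lambda>y. y \<in> K"] by (simp add: ract_stable_def lact_stable_def)
    finally show ?thesis .
  qed
  then show ?thesis
    unfolding fully_invariant_left_coideal_def left_coideal_iff_ract_stable[OF P] by blast
qed

lemma carrier_eq_internal_coproduct_iff:
  "carrier C = internal_coproduct C E X Y \<longleftrightarrow>
    (\<forall>h\<in>E. (\<forall>x\<in>X. h x = \<zero>\<^bsub>C\<^esub>) \<longrightarrow> (\<forall>c\<in>carrier C. h c \<in> Y))"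
  unfolding internal_coproduct_def by blast

text \<open>The annihilators in the left dual ring come from left linear maps that vanish on
  \<open>K\<close>. Such a map acts as zero on \<open>K\<close> because \<open>K\<close> is a left
  coideal, and projectivity of \<open>C\<close> on the right provides this.\<close>

lemma commuting_modules_left_dual:
  assumes qf: "quasi_frobenius A" and nz: "carrier C \<noteq> {\<zero>\<^bsub>C\<^esub>}"
    and P: "projective_module (opposite A) (right_mod C)"
  shows "commuting_modules L (left_dual_mod C) (opposite R) (right_dual_mod C)"
proof -
  have "\<exists>f\<in>carrier L. f \<noteq> \<zero>\<^bsub>L\<^esub> \<and> (\<forall>x\<in>K. lact f x = \<zero>\<^bsub>C\<^esub>)"
    if K: "ract_stable K" "K \<noteq> carrier C" for K
  proof -
    have sub: "submodule K A C"
      using K(1) unfolding left_coideal_iff_ract_stable[OF P, symmetric] left_coideal_def by blast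
    obtain f where f: "f \<in> mod_hom A C (regular A)" "\<And>x. x \<in> K \<Longrightarrow> f x = \<zero>\<^bsub>A\<^esub>"
      "\<exists>x\<in>carrier C. f x \<noteq> \<zero>\<^bsub>A\<^esub>"
      by (rule quasi_frobenius_cogenerates[OF CL.T.ring_axioms is_regular_regular _
            is_regular_right_mod_regular _ _ CL.left_module_axioms sub K(2)])
        (use qf in \<open>auto simp: quasi_frobenius_def right_artinian_def\<close>)
    have fl: "left_linear f" using f(1) by (simp add: left_linear_def)
    let ?f = "restrict f (carrier C)"
    have "?f \<in> carrier L" using fl by (simp add: left_dual_sel left_linear_restrict)
    moreover have "?f \<noteq> \<zero>\<^bsub>L\<^esub>"
      using f(3) unfolding left_dual_sel(3) by (metis restrict_apply')
    moreover have "lact ?f x = \<zero>\<^bsub>C\<^esub>" if "x \<in> K" for x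
      using lact_cong[OF fl, of ?f x] ract_stable_lact_eq_zero[OF P K(1) fl f(2) that]
        ract_stable_carrier[OF K(1)] that by auto
    ultimately show ?thesis by blast
  qed
  note ann = this
  show ?thesis
    by (intro commuting_modules.intro left_module_left_dual left_module_right_dual commuting_modules_axioms.intro)
      (simp_all add: nz lact_ract left_dual_sel(1) right_dual_sel(1) left_dual_faithful
        submodule_left_dual_iff submodule_right_dual_iff ann)
qed

lemma commuting_modules_right_dual:
  assumes qf: "quasi_frobenius A" and nz: "carrier C \<noteq> {\<zero>\<^bsub>C\<^esub>}" and P: "projective_module A C"
  shows "commuting_modules (opposite R) (right_dual_mod C) L (left_dual_mod C)"
proof -
  have "\<exists>g\<in>carrier R. g \<noteq> \<zero>\<^bsub>R\<^esub> \<and> (\<forall>x\<in>K. ract g x = \<zero>\<^bsub>C\<^esub>)"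
    if K: "lact_stable K" "K \<noteq> carrier C" for K
  proof -
    have co: "right_coideal A C K" using K(1) right_coideal_iff_lact_stable[OF P] by blast
    then have sub: "submodule K (opposite A) (right_mod C)" unfolding right_coideal_def by blast
    have ne: "K \<noteq> carrier (right_mod C)" using K(2) by simp
    \<comment> \<open>Over \<open>opposite A\<close> the two sides exchange their roles: the left
      regular module of \<open>A\<close> now supplies the annihilating element and the chain
      condition.\<close>
    have reg: "is_regular (opposite (opposite A)) (regular A)" by (simp add: is_regular_regular)
    obtain g where g: "g \<in> mod_hom (opposite A) (right_mod C) (right_mod (regular A))"
      "\<And>x. x \<in> K \<Longrightarrow> g x = \<zero>\<^bsub>opposite A\<^esub>" "\<exists>x\<in>carrier (right_mod C). g x \<noteq> \<zero>\<^bsub>opposite A\<^esub>"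
      by (rule quasi_frobenius_cogenerates[OF CR.T.ring_axioms is_regular_right_mod_regular _
            reg _ _ CR.left_module_axioms sub ne])
        (use qf in \<open>auto simp: quasi_frobenius_def left_artinian_def\<close>)
    have gl: "right_linear g" using g(1) by (simp add: right_linear_def)
    have g2: "\<And>x. x \<in> K \<Longrightarrow> g x = \<zero>\<^bsub>A\<^esub>" using g(2) by simp
    let ?g = "restrict g (carrier C)"
    have "?g \<in> carrier R" using gl by (simp add: right_dual_sel right_linear_restrict)
    moreover have "?g \<noteq> \<zero>\<^bsub>R\<^esub>"
      using g(3) unfolding right_dual_sel(3) right_mod_sel opposite_sel by (metis restrict_apply')
    moreover have "ract ?g x = \<zero>\<^bsub>C\<^esub>" if "x \<in> K" for x
      using ract_cong[OF gl, of ?g x] right_coideal_ract_eq_zero[OF co gl g2 that]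
        lact_stable_carrier[OF K(1)] that by auto
    ultimately show ?thesis by blast
  qed
  note ann = this
  show ?thesis
    by (intro commuting_modules.intro left_module_left_dual left_module_right_dual commuting_modules_axioms.intro)
      (simp_all add: nz lact_ract left_dual_sel(1) right_dual_sel(1) right_dual_faithful
        submodule_left_dual_iff submodule_right_dual_iff ann)
qed

end

theorem theorem5p25:
  fixes R :: "('r, 'k) ring_scheme"
    and A :: "('r, 'a, 'm) module_scheme"
    and C :: "('a, 'c, 'n) coring_scheme"
  assumes "cring R" and "\<one>\<^bsub>R\<^esub> \<noteq> \<zero>\<^bsub>R\<^esub>" and "unital_algebra R A"
    and "quasi_frobenius A"
    and "coring A C" and "carrier C \<noteq> {\<zero>\<^bsub>C\<^esub>}"
    and "projective_module A C"
    and "projective_module (opposite A) (right_mod C)"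
    and "right_artinian (right_dual A C)"
    and "left_artinian (left_dual A C)"
  shows "let props =
      [prime_ring (right_dual A C),
       prime_ring (left_dual A C),
       diprime_module (opposite (right_dual A C)) (right_dual_mod C),
       diprime_module (left_dual A C) (left_dual_mod C),
       prime_module (opposite (right_dual A C)) (right_dual_mod C),
       prime_module (left_dual A C) (left_dual_mod C),
       simple_artinian_ring (right_dual A C),
       simple_artinian_ring (left_dual A C),
       strongly_prime_module (opposite (right_dual A C)) (right_dual_mod C),
       strongly_prime_module (left_dual A C) (left_dual_mod C),
       right_fully_coprime A C,
       left_fully_coprime A C,
       \<forall>K. fully_invariant_right_coideal A C K \<longrightarrow> K = {\<zero>\<^bsub>C\<^esub>} \<or> K = carrier C,
       \<forall>K. fully_invariant_left_coideal A C K \<longrightarrow> K = {\<zero>\<^bsub>C\<^esub>} \<or> K = carrier C,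
       simple_bimodule (left_dual A C) (left_dual_mod C) (right_dual A C) (right_dual_mod C)]
    in \<forall>P\<in>set props. \<forall>Q\<in>set props. P \<longleftrightarrow> Q"
proof -
  interpret D: A_coring A C by (rule A_coring.intro) fact
  let ?R = "right_dual A C" and ?L = "left_dual A C"
  \<comment> \<open>In each instance the first ring is the one whose ring and module conditions are
    described.\<close>
  interpret l: commuting_modules ?L "left_dual_mod C" "opposite ?R" "right_dual_mod C"
    by (rule D.commuting_modules_left_dual) fact+
  interpret r: commuting_modules "opposite ?R" "right_dual_mod C" ?L "left_dual_mod C"
    by (rule D.commuting_modules_right_dual) fact+
  note stable = D.submodule_left_dual_iff D.submodule_right_dual_iff
  note fi = D.fully_invariant_right_coideal_iff[OF assms(7)] D.fully_invariant_left_coideal_iff[OF assms(8)]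
  have sub: "l.subbimodule K \<longleftrightarrow> D.lact_stable K \<and> D.ract_stable K"
    "r.subbimodule K \<longleftrightarrow> D.lact_stable K \<and> D.ract_stable K" for K
    unfolding l.subbimodule_def r.subbimodule_def stable by blast+
  \<comment> \<open>Subbimodules do not depend on the order of the two rings; this links the
    right-hand conditions with the left-hand ones.\<close>
  have rl: "r.simple \<longleftrightarrow> l.simple"
    by (simp add: l.simple_def r.simple_def sub)
  have inv: "(\<forall>K. fully_invariant_right_coideal A C K \<longrightarrow> K = {\<zero>\<^bsub>C\<^esub>} \<or> K = carrier C) \<longleftrightarrow> l.simple"
    "(\<forall>K. fully_invariant_left_coideal A C K \<longrightarrow> K = {\<zero>\<^bsub>C\<^esub>} \<or> K = carrier C) \<longleftrightarrow> l.simple"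
    by (simp_all add: fi l.simple_def sub)
  have bim: "simple_bimodule ?L (left_dual_mod C) ?R (right_dual_mod C) \<longleftrightarrow> l.simple"
    using assms(6) by (auto simp: simple_bimodule_def l.simple_def l.subbimodule_def)
  \<comment> \<open>The hands cross here: endomorphisms of the right comodule are actions of the
    right dual ring, which plays the part of \<open>U\<close> in the instance for the left dual
    ring.\<close>
  have cop: "right_fully_coprime A C \<longleftrightarrow> l.fully_coprime"
  proof -
    have "carrier C = internal_coproduct C (right_colinear_endos A C) X Y \<longleftrightarrow>
        (\<forall>u\<in>carrier ?R. (\<forall>x\<in>X. D.ract u x = \<zero>\<^bsub>C\<^esub>) \<longrightarrow> (\<forall>c\<in>carrier C. D.ract u c \<in> Y))"
      if "D.lact_stable X" for X Y
      unfolding D.carrier_eq_internal_coproduct_iff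
      by (rule D.right_colinear_endos_all_iff[OF D.lact_stable_carrier[OF that] order_refl])
    then show ?thesis
      unfolding right_fully_coprime_def l.fully_coprime_def sub fi
      by (simp cong: conj_cong imp_cong)
  qed
  have cop': "left_fully_coprime A C \<longleftrightarrow> r.fully_coprime"
  proof -
    have "carrier C = internal_coproduct C (left_colinear_endos A C) X Y \<longleftrightarrow>
        (\<forall>u\<in>carrier ?L. (\<forall>x\<in>X. D.lact u x = \<zero>\<^bsub>C\<^esub>) \<longrightarrow> (\<forall>c\<in>carrier C. D.lact u c \<in> Y))"
      if "D.lact_stable X" for X Y
      unfolding D.carrier_eq_internal_coproduct_iff
      by (rule D.left_colinear_endos_all_iff[OF D.lact_stable_carrier[OF that] order_refl])
    then show ?thesis
      unfolding left_fully_coprime_def r.fully_coprime_def sub fi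
      by (simp cong: conj_cong imp_cong)
  qed
  have art: "left_artinian (opposite ?R)"
    using assms(9) by (simp add: left_artinian_opposite[OF D.ring_right_dual])
  note le = l.equivalent_conditions[OF assms(10)]
    and re = r.equivalent_conditions[OF art, unfolded rl prime_ring_opposite[OF D.ring_right_dual]
      simple_artinian_ring_opposite[OF D.ring_right_dual]]
  show ?thesis
    unfolding Let_def by (simp add: le re inv bim cop cop')
qed

end
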